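(* Let $\mathbb D$ be a small (unsorted) LNL doctrine such that $|\mathbb D|$ is subterminal and all $\mathbb D$-cones are discrete and finite, and let $\mathcal S$ be an LNL polycategory with a functor $\pi:\mathcal S\to|\mathbb D|$, regarded as a $\mathbb D$-sketch with no proto-extremal cones. Let $\widehat{\mathcal S}_{\mathbb D}$ be the free $\mathbb D$-category generated by $\mathcal S$, constructed as described in the context, whose objects are identified with the types of the sequent calculus described in the context. Then for each admissible list $\Phi$ of signed types, there is a surjection from the derivations of $\vdash\Phi$ in this sequent calculus to the hom-set $\widehat{\mathcal S}_{\mathbb D}(\Phi)$.
   Context: **Signed objects.** Given objects partitioned into linear and nonlinear ones, a signed object is an object $R$ with a sign, written $R^+$ or $R^-$; $K^\bullet$ is $K$ with its sign flipped. A finite list of signed objects is admissible if it contains at most one positive nonlinear object, and if it contains one then it contains no linear objects. A structural map $(K_1,\dots,K_m)\to(K_{\sigma 1},\dots,K_{\sigma n})$ is given by a function $\sigma:\{1,\dots,n\}\to\{1,\dots,m\}$ such that whenever $|\sigma^{-1}(j)|\ne 1$, $K_j$ is negative and nonlinear. **LNL polycategory** $\mathcal P$ (entries-only form): a set of objects partitioned into linear and nonlinear ones; for each admissible list $\Phi$ a set $\mathcal P(\Phi)$ of morphisms, with functorial actions $\mathcal P(\Psi)\to\mathcal P(\Phi)$ of structural maps $\Phi\to\Psi$; identities $1_R\in\mathcal P(R^-,R^+)$; and whenever $(\Phi,K)$ and $(K^\bullet,\Psi)$ are admissible, a composition $\circ_K:\mathcal P(K^\bullet,\Psi)\times\mathcal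 P(\Phi,K)\to\mathcal P(\Phi,\Psi)$, which is associative, unital, and equivariant for structural actions and for permutations swapping the two inputs. A functor consists of functions on linear objects, nonlinear objects and morphisms preserving all this structure. An LNL polycategory is subterminal if it has at most one linear and at most one nonlinear object and each hom-set has at most one element. **Cones.** An abstract cone is a small LNL polycategory $\mathcal C$ with a specified signed object $K$ (the vertex) such that $\mathcal C(\Phi)=\emptyset$ if $\Phi$ contains a copy of $K^\bullet$ or more than one copy of $K$, except that $\mathcal C(K^\bullet,K)=\{1_K\}$. Nonidentity morphisms containing $K$ are abstract projections; morphisms not containing $K$ are abstract transitions. The cone is discrete if it has no nonidentity abstract transitions. The reduct $\partial\mathcal C$ is obtained by removing the underlying object of $K$, its identity, and all abstract projections. For a finite signed list $\Psi$ of new (linear or nonlinear) objects with $(K^\bullet,\Psi)$ admissible, the expansion $\mathcal C_{/\Psi}$ is obtained from $\mathcal C$ by adding the new objects, a new morphism $\tilde f\in\mathcal C_{/\Psi}(\Phi,\Psi)$ for each abstract projection $f\in\mathcal C(\Phi,K)$, and a new morphism $\chi\in\mathcal C_{/\Psi}(K^\bullet,\Psi)$, with $\chi\circ_K f=\tilde f$ and $\tilde f\circ g=\widetilde{f\circ g}$ for abstract transitions $g$. The pre-expansion $\partial(\mathcal C_{/\Psi})$ omits $\chi$. **Doctrines and sketches.** An LNL doctrine $\mathbb D$ is an LNL polycategory $|\mathbb D|$ with a family of functors $G:\mathcal C\to|\mathbb D|$ whose domains are abstract cones, the $\mathbb D$-cones. It is small if $|\mathbb D|$ and the family are small. A $\mathbb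 D$-sketch is an LNL polycategory $\mathcal P$ over $|\mathbb D|$ with, for each $\mathbb D$-cone $G$, a set of lifts of $G$ to $\mathcal P$ called proto-extremal; morphisms are functors over $|\mathbb D|$ preserving proto-extremal lifts. Each $\mathcal C$, $\mathcal C_{/\Psi}$ and $\partial(\mathcal C_{/\Psi})$ (given an extension of $G$ to $\mathcal C_{/\Psi}\to|\mathbb D|$) is a sketch with $G$ (i.e. the inclusion of $\mathcal C$) as only proto-extremal cone, and $\partial\mathcal C$ is a sketch with none. For a cone $\mathcal C$ with vertex $K$, $\mathcal C_{\cong}$ is $\mathcal C$ with an added signed object $K'$ isomorphic to $K$ (mapped to $|\mathbb D|$ by collapsing $K'$ to $K$), with the two sections $\mathcal C\to\mathcal C_\cong$ (sending $K$ to $K$, resp. to $K'$) proto-extremal; $\mathcal C_{\cong}'$ has only the first section proto-extremal. **Construction of $\widehat{\mathcal S}_{\mathbb D}$.** (1) Put $\mathcal S_0=\mathcal S$. Given $\mathcal S_n$, let $\mathcal S_{n+1}$ be the pushout in $\mathbb D$-sketches of $\coprod\partial\mathcal C\to\coprod\mathcal C$ along $\coprod\partial\mathcal C\to\mathcal S_n$, the coproducts over all $\mathbb D$-cones $\mathcal C$ and all sketch morphisms $u:\partial\mathcal C\to\mathcal S_n$ that, when $n>0$, do not factor through $\mathcal S_{n-1}$. Let $\mathcal S_\omega=\operatorname{colim}_n\mathcal S_n$. (2) From $\mathcal S_\omega$, iterate countably many times the pushout along all inclusions $\partial(\mathcal C_{/\Psi})\to\mathcal C_{/\Psi}$ and their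 codiagonals $\mathcal C_{/\Psi}+_{\partial(\mathcal C_{/\Psi})}\mathcal C_{/\Psi}\to\mathcal C_{/\Psi}$, over all maps from their domains into the current stage, and take the colimit $\mathcal S_{\omega+\omega}$. (3) Push out once along all maps $\mathcal C_\cong'\to\mathcal C_\cong$, giving $\widehat{\mathcal S}_{\mathbb D}=\mathcal S_{\omega+\omega+1}$. **Types.** For each $\mathbb D$-cone $\mathcal C$, fix an ordering $\{r_1^{\tau_1},\dots,r_n^{\tau_n}\}$ of the (finitely many) objects of $\partial\mathcal C$, where $r_i$ has class $\tau_i\in\{\mathrm L,\mathrm{NL}\}$ (linear, nonlinear); let $r^\epsilon$ be its vertex, of class $\tau_{\mathcal C}$. Types of class $\tau$ (judgments $R\;\mathsf{type}^\tau$) are inductively generated by: (a) every object of $\mathcal S$ of class $\tau$; (b) if $\mathcal C$ is a $\mathbb D$-cone whose reduct $\partial\mathcal C$ has objects ordered as $\{r_1^{\tau_1},\dots,r_n^{\tau_n}\}$ and whose vertex $r^\epsilon$ has class $\tau_{\mathcal C}$, and $R_i\;\mathsf{type}^{\tau_i}$ for $i=1,\dots,n$, then the formal expression $\bigodot_{\mathcal C}[R_1,\dots,R_n]$ is a type of class $\tau_{\mathcal C}$. Types of class $\tau$ are in bijection with objects of $\widehat{\mathcal S}_{\mathbb D}$ of class $\tau$: objects of $\mathcal S$ correspond to their images, and $\bigodot_{\mathcal C}[R_1,\dots,R_n]$ to the vertex adjoined for the map $\partial\mathcal C\to\mathcal S_m$ sending $r_i$ to (the object corresponding to) $R_i$.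 **Sequents and rules.** Sequents are $\vdash\Phi$ with $\Phi$ an admissible list of signed types. The rules are: - Identity: $\vdash R^-,R^+$ for every type $R$. - Cut: from $\vdash\Phi,K$ and $\vdash K^\bullet,\Psi$ infer $\vdash\Phi,\Psi$. - Structural: from $\vdash\Psi$ and a structural map $\sigma:\Phi\to\Psi$ infer $\vdash\Phi$. - Generator: for each $f\in\mathcal S(\Phi)$, infer $\vdash\Phi$. - Noninvertible logical rule: for a $\mathbb D$-cone $\mathcal C$ whose reduct $\partial\mathcal C$ has objects ordered as $\{r_1^{\tau_1},\dots,r_n^{\tau_n}\}$ and whose vertex is $r^\epsilon$ of class $\tau_{\mathcal C}$, types $R_i\;\mathsf{type}^{\tau_i}$, and an abstract projection $f\in\mathcal C(r_{i_1}^{\epsilon_1},\dots,r_{i_\ell}^{\epsilon_\ell},r^\epsilon)$, infer $\vdash R_{i_1}^{\epsilon_1},\dots,R_{i_\ell}^{\epsilon_\ell},\bigodot_{\mathcal C}[R_1,\dots,R_n]^{\epsilon}$. - Invertible logical rule: for a $\mathbb D$-cone $\mathcal C$ whose reduct $\partial\mathcal C$ has objects ordered as $\{r_1^{\tau_1},\dots,r_n^{\tau_n}\}$ and whose vertex is $r^\epsilon$ of class $\tau_{\mathcal C}$, types $R_i\;\mathsf{type}^{\tau_i}$ and $S_j\;\mathsf{type}^{\sigma_j}$ ($1\le j\le m$), and signs $\eta_j$ such that $|\mathbb D|(\tau_{\mathcal C}^{-\epsilon},\sigma_1^{\eta_1},\dots,\sigma_m^{\eta_m})\neq\emptyset$ (where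 a class also denotes the unique object of $|\mathbb D|$ of that class, and $-\epsilon$ is the opposite sign): from premises $\vdash R_{i_1}^{\epsilon_1},\dots,R_{i_\ell}^{\epsilon_\ell},S_1^{\eta_1},\dots,S_m^{\eta_m}$, one for each abstract projection $f\in\mathcal C(r_{i_1}^{\epsilon_1},\dots,r_{i_\ell}^{\epsilon_\ell},r^\epsilon)$, infer $\vdash\bigodot_{\mathcal C}[R_1,\dots,R_n]^{-\epsilon},S_1^{\eta_1},\dots,S_m^{\eta_m}$.
   Formalization: Cone conditions and rule premises are taken up to structural maps; "finite" also asks that each cone morphism be a unique structural image of an identity or listed projection, since the claim fails for a projection in C(A⁻,A⁻,K⁺) fixed by the swap. *)

theory Defs
  imports Main "HOL-Library.Infinite_Typeclass"
begin

section \<open>Signed objects and structural maps\<close>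

datatype kind = Linear | Nonlinear
datatype sign = Pos | Neg

type_synonym 'o signed = "'o \<times> sign"

fun flip :: "sign \<Rightarrow> sign" where
  "flip Pos = Neg"
| "flip Neg = Pos"

definition dual :: "'o signed \<Rightarrow> 'o signed" where
  "dual K = (fst K, flip (snd K))"

definition smap :: "('o \<Rightarrow> 'o2) \<Rightarrow> 'o signed list \<Rightarrow> 'o2 signed list" where
  "smap h = map (map_prod h id)"

definition pos_nonlinear :: "('o \<Rightarrow> kind) \<Rightarrow> 'o signed \<Rightarrow> bool" where
  "pos_nonlinear c K \<longleftrightarrow> c (fst K) = Nonlinear \<and> snd K = Pos"

definition neg_nonlinear :: "('o \<Rightarrow> kind) \<Rightarrow> 'o signed \<Rightarrow> bool" where
  "neg_nonlinear c K \<longleftrightarrow> c (fst K) = Nonlinear \<and> snd K = Neg"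

definition admissible :: "('o \<Rightarrow> kind) \<Rightarrow> 'o signed list \<Rightarrow> bool" where
  "admissible c \<Phi> \<longleftrightarrow>
     length (filter (pos_nonlinear c) \<Phi>) \<le> 1 \<and>
     ((\<exists>K\<in>set \<Phi>. pos_nonlinear c K) \<longrightarrow> (\<forall>K\<in>set \<Phi>. c (fst K) \<noteq> Linear))"

text \<open>A structural map is the list of values of its function (counting from 0). Its
  target is determined by its source: \<open>\<sigma> : \<Phi> \<rightarrow> pull \<Phi> \<sigma>\<close>.\<close>

definition pull :: "'a list \<Rightarrow> nat list \<Rightarrow> 'a list" where
  "pull xs \<sigma> = map (nth xs) \<sigma>"

definition structural :: "('o \<Rightarrow> kind) \<Rightarrow> 'o signed list \<Rightarrow> nat list \<Rightarrow> bool" where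
  "structural c \<Phi> \<sigma> \<longleftrightarrow>
     (\<forall>j\<in>set \<sigma>. j < length \<Phi>) \<and>
     (\<forall>j<length \<Phi>. count_list \<sigma> j \<noteq> 1 \<longrightarrow> neg_nonlinear c (\<Phi> ! j))"


section \<open>LNL polycategories\<close>

text \<open>Hom-sets of different lists need not be disjoint, so all operations take the lists
  involved as arguments: \<open>act P \<Phi> \<sigma> : P(pull \<Phi> \<sigma>) \<rightarrow> P(\<Phi>)\<close>, and \<open>cmp P \<Phi> K \<Psi> g f\<close> is
  the composite of \<open>g \<in> P(dual K, \<Psi>)\<close> and \<open>f \<in> P(\<Phi>, K)\<close>.\<close>

record ('o, 'm) lnl =
  Ob :: "'o set"
  cl :: "'o \<Rightarrow> kind"
  Hom :: "'o signed list \<Rightarrow> 'm set"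
  act :: "'o signed list \<Rightarrow> nat list \<Rightarrow> 'm \<Rightarrow> 'm"
  idn :: "'o \<Rightarrow> 'm"
  cmp :: "'o signed list \<Rightarrow> 'o signed \<Rightarrow> 'o signed list \<Rightarrow> 'm \<Rightarrow> 'm \<Rightarrow> 'm"

definition valid :: "('o, 'm) lnl \<Rightarrow> 'o signed list \<Rightarrow> bool" where
  "valid P \<Phi> \<longleftrightarrow> fst ` set \<Phi> \<subseteq> Ob P \<and> admissible (cl P) \<Phi>"

text \<open>The axioms are stated up to a family \<open>E\<close> of congruences, so that the same list of
  axioms also serves to define presentations by generators and relations; LNL polycategories
  are the case where \<open>E\<close> is equality.

  The last three axioms express equivariance of composition for structural maps acting on
  \<open>(\<Phi>, K)\<close>, according to whether \<open>K\<close> is hit once, never, or twice; every structural map is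
  obtained from these and permutations. Equivariance in the other argument follows by the
  swap axiom, and so do the unit laws for negative \<open>K\<close> and associativity for two compositions
  at different entries of the same morphism.\<close>

definition lnl_upto :: "('o signed list \<Rightarrow> 'm \<Rightarrow> 'm \<Rightarrow> bool) \<Rightarrow> ('o, 'm) lnl \<Rightarrow> bool" where
  "lnl_upto E P \<longleftrightarrow>
    (\<forall>\<Phi>. equivp (E \<Phi>)) \<and>
    (\<forall>\<Phi>. \<forall>x\<in>Hom P \<Phi>. valid P \<Phi>) \<and>
    \<comment> \<open>operations\<close>
    (\<forall>\<Phi> \<sigma>. \<forall>x\<in>Hom P (pull \<Phi> \<sigma>). valid P \<Phi> \<longrightarrow> structural (cl P) \<Phi> \<sigma> \<longrightarrow>
       act P \<Phi> \<sigma> x \<in> Hom P \<Phi>) \<and>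
    (\<forall>\<Phi> \<sigma>. \<forall>x\<in>Hom P (pull \<Phi> \<sigma>). \<forall>y\<in>Hom P (pull \<Phi> \<sigma>).
       valid P \<Phi> \<longrightarrow> structural (cl P) \<Phi> \<sigma> \<longrightarrow> E (pull \<Phi> \<sigma>) x y \<longrightarrow>
       E \<Phi> (act P \<Phi> \<sigma> x) (act P \<Phi> \<sigma> y)) \<and>
    (\<forall>R\<in>Ob P. idn P R \<in> Hom P [(R, Neg), (R, Pos)]) \<and>
    (\<forall>\<Phi> K \<Psi>. \<forall>f\<in>Hom P (\<Phi> @ [K]). \<forall>g\<in>Hom P (dual K # \<Psi>).
       cmp P \<Phi> K \<Psi> g f \<in> Hom P (\<Phi> @ \<Psi>)) \<and>
    (\<forall>\<Phi> K \<Psi>. \<forall>f\<in>Hom P (\<Phi> @ [K]). \<forall>f'\<in>Hom P (\<Phi> @ [K]).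
       \<forall>g\<in>Hom P (dual K # \<Psi>). \<forall>g'\<in>Hom P (dual K # \<Psi>).
       E (\<Phi> @ [K]) f f' \<longrightarrow> E (dual K # \<Psi>) g g' \<longrightarrow>
       E (\<Phi> @ \<Psi>) (cmp P \<Phi> K \<Psi> g f) (cmp P \<Phi> K \<Psi> g' f')) \<and>
    \<comment> \<open>functoriality of the structural action\<close>
    (\<forall>\<Phi>. \<forall>x\<in>Hom P \<Phi>. E \<Phi> (act P \<Phi> [0..<length \<Phi>] x) x) \<and>
    (\<forall>\<Phi> \<sigma> \<tau>. \<forall>x\<in>Hom P (pull (pull \<Phi> \<sigma>) \<tau>).
       valid P \<Phi> \<longrightarrow> structural (cl P) \<Phi> \<sigma> \<longrightarrow> structural (cl P) (pull \<Phi> \<sigma>) \<tau> \<longrightarrow>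
       E \<Phi> (act P \<Phi> \<sigma> (act P (pull \<Phi> \<sigma>) \<tau> x)) (act P \<Phi> (pull \<sigma> \<tau>) x)) \<and>
    \<comment> \<open>units\<close>
    (\<forall>\<Phi> R. \<forall>f\<in>Hom P (\<Phi> @ [(R, Pos)]).
       E (\<Phi> @ [(R, Pos)]) (cmp P \<Phi> (R, Pos) [(R, Pos)] (idn P R) f) f) \<and>
    (\<forall>\<Psi> R. \<forall>g\<in>Hom P ((R, Neg) # \<Psi>).
       E ((R, Neg) # \<Psi>) (cmp P [(R, Neg)] (R, Pos) \<Psi> g (idn P R)) g) \<and>
    \<comment> \<open>associativity\<close>
    (\<forall>\<Phi> K \<Psi> L \<Theta>. \<forall>f\<in>Hom P (\<Phi> @ [K]). \<forall>g\<in>Hom P (dual K # \<Psi> @ [L]). \<forall>h\<in>Hom P (dual L # \<Theta>).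
       E (\<Phi> @ \<Psi> @ \<Theta>)
         (cmp P (\<Phi> @ \<Psi>) L \<Theta> h (cmp P \<Phi> K (\<Psi> @ [L]) g f))
         (cmp P \<Phi> K (\<Psi> @ \<Theta>) (cmp P (dual K # \<Psi>) L \<Theta> h g) f)) \<and>
    \<comment> \<open>swapping the two inputs\<close>
    (\<forall>\<Phi> K \<Psi>. \<forall>f\<in>Hom P (\<Phi> @ [K]). \<forall>g\<in>Hom P (dual K # \<Psi>).
       let n = length \<Phi>; m = length \<Psi> in
       E (\<Phi> @ \<Psi>) (cmp P \<Phi> K \<Psi> g f)
         (act P (\<Phi> @ \<Psi>) ([n..<n+m] @ [0..<n])
            (cmp P \<Psi> (dual K) \<Phi>
               (act P (K # \<Phi>) ([1..<Suc n] @ [0]) f)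
               (act P (\<Psi> @ [dual K]) (m # [0..<m]) g)))) \<and>
    \<comment> \<open>structural maps\<close>
    (\<forall>\<Phi> \<sigma> K \<Psi>. \<forall>f\<in>Hom P (pull \<Phi> \<sigma> @ [K]). \<forall>g\<in>Hom P (dual K # \<Psi>).
       let n = length \<Phi>; m = length \<Psi> in
       valid P (\<Phi> @ [K]) \<longrightarrow> structural (cl P) \<Phi> \<sigma> \<longrightarrow>
       E (\<Phi> @ \<Psi>)
         (cmp P \<Phi> K \<Psi> g (act P (\<Phi> @ [K]) (\<sigma> @ [n]) f))
         (act P (\<Phi> @ \<Psi>) (\<sigma> @ [n..<n+m]) (cmp P (pull \<Phi> \<sigma>) K \<Psi> g f))) \<and>
    (\<forall>\<Phi> K \<Psi>. \<forall>f\<in>Hom P \<Phi>. \<forall>g\<in>Hom P (dual K # \<Psi>).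
       let n = length \<Phi> in
       valid P (\<Phi> @ [K]) \<longrightarrow> neg_nonlinear (cl P) K \<longrightarrow>
       E (\<Phi> @ \<Psi>)
         (cmp P \<Phi> K \<Psi> g (act P (\<Phi> @ [K]) [0..<n] f))
         (act P (\<Phi> @ \<Psi>) [0..<n] f)) \<and>
    (\<forall>\<Phi> K \<Psi>. \<forall>f\<in>Hom P (\<Phi> @ [K, K]). \<forall>g\<in>Hom P (dual K # \<Psi>).
       let n = length \<Phi>; m = length \<Psi> in
       neg_nonlinear (cl P) K \<longrightarrow>
       E (\<Phi> @ \<Psi>)
         (cmp P \<Phi> K \<Psi> g (act P (\<Phi> @ [K]) ([0..<n] @ [n, n]) f))
         (act P (\<Phi> @ \<Psi>) ([0..<n] @ [n..<n+m] @ [n..<n+m])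
            (cmp P (\<Phi> @ \<Psi>) K \<Psi> g
               (act P (\<Phi> @ \<Psi> @ [K]) ([0..<n] @ [n+m] @ [n..<n+m])
                  (cmp P (\<Phi> @ [K]) K \<Psi> g f)))))"

definition lnl :: "('o, 'm) lnl \<Rightarrow> bool" where
  "lnl P \<longleftrightarrow> lnl_upto (\<lambda>_. (=)) P"

definition subterminal :: "('o, 'm) lnl \<Rightarrow> bool" where
  "subterminal P \<longleftrightarrow>
     (\<forall>A\<in>Ob P. \<forall>B\<in>Ob P. cl P A = cl P B \<longrightarrow> A = B) \<and>
     (\<forall>\<Phi>. \<forall>x\<in>Hom P \<Phi>. \<forall>y\<in>Hom P \<Phi>. x = y)"


section \<open>Functors\<close>

text \<open>Functors are extensional (undefined off their domain), so that equality of functors is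
  equality in HOL.\<close>

record ('o, 'm, 'o2, 'm2) fctr =
  fob :: "'o \<Rightarrow> 'o2"
  fmor :: "'o signed list \<Rightarrow> 'm \<Rightarrow> 'm2"

definition is_functor ::
  "('o, 'm) lnl \<Rightarrow> ('o2, 'm2) lnl \<Rightarrow> ('o, 'm, 'o2, 'm2) fctr \<Rightarrow> bool" where
  "is_functor P Q F \<longleftrightarrow>
    (\<forall>R\<in>Ob P. fob F R \<in> Ob Q \<and> cl Q (fob F R) = cl P R) \<and>
    (\<forall>\<Phi>. \<forall>x\<in>Hom P \<Phi>. fmor F \<Phi> x \<in> Hom Q (smap (fob F) \<Phi>)) \<and>
    (\<forall>\<Phi> \<sigma>. \<forall>x\<in>Hom P (pull \<Phi> \<sigma>). valid P \<Phi> \<longrightarrow> structural (cl P) \<Phi> \<sigma> \<longrightarrow>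
       fmor F \<Phi> (act P \<Phi> \<sigma> x) = act Q (smap (fob F) \<Phi>) \<sigma> (fmor F (pull \<Phi> \<sigma>) x)) \<and>
    (\<forall>R\<in>Ob P. fmor F [(R, Neg), (R, Pos)] (idn P R) = idn Q (fob F R)) \<and>
    (\<forall>\<Phi> K \<Psi>. \<forall>f\<in>Hom P (\<Phi> @ [K]). \<forall>g\<in>Hom P (dual K # \<Psi>).
       fmor F (\<Phi> @ \<Psi>) (cmp P \<Phi> K \<Psi> g f) =
       cmp Q (smap (fob F) \<Phi>) (map_prod (fob F) id K) (smap (fob F) \<Psi>)
         (fmor F (dual K # \<Psi>) g) (fmor F (\<Phi> @ [K]) f)) \<and>
    (\<forall>R. R \<notin> Ob P \<longrightarrow> fob F R = undefined) \<and>
    (\<forall>\<Phi> x. x \<notin> Hom P \<Phi> \<longrightarrow> fmor F \<Phi> x = undefined)"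

text \<open>\<open>mk_fctr P h k\<close> is the pair of maps \<open>(h, k)\<close> cut down to \<open>P\<close>; \<open>fcomp P G F\<close> is the
  composite \<open>G \<circ> F\<close>, where \<open>P\<close> is the domain of \<open>F\<close>.\<close>

definition mk_fctr ::
  "('o, 'm) lnl \<Rightarrow> ('o \<Rightarrow> 'o2) \<Rightarrow> ('o signed list \<Rightarrow> 'm \<Rightarrow> 'm2) \<Rightarrow> ('o, 'm, 'o2, 'm2) fctr" where
  "mk_fctr P h k =
     \<lparr>fob = (\<lambda>R. if R \<in> Ob P then h R else undefined),
      fmor = (\<lambda>\<Phi> x. if x \<in> Hom P \<Phi> then k \<Phi> x else undefined)\<rparr>"

definition fcomp ::
  "('o, 'm) lnl \<Rightarrow> ('o2, 'm2, 'o3, 'm3) fctr \<Rightarrow> ('o, 'm, 'o2, 'm2) fctr \<Rightarrow> ('o, 'm, 'o3, 'm3) fctr"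
  where
  "fcomp P G F =
     mk_fctr P (\<lambda>R. fob G (fob F R)) (\<lambda>\<Phi> x. fmor G (smap (fob F) \<Phi>) (fmor F \<Phi> x))"

definition fincl :: "('o, 'm) lnl \<Rightarrow> ('o, 'm, 'o, 'm) fctr" where
  "fincl P = mk_fctr P (\<lambda>R. R) (\<lambda>_ x. x)"


section \<open>LNL polycategories presented by generators and relations\<close>

text \<open>\<open>gen g \<Xi>\<close> says that \<open>g\<close> is a generating morphism in the hom-set of \<open>\<Xi>\<close>. Terms are
  identified by the least congruence that contains the relations and satisfies the axioms of
  an LNL polycategory.\<close>

datatype ('o, 'g) tm =
    TGen 'g
  | TId 'o
  | TAct "'o signed list" "nat list" "('o, 'g) tm"
  | TCmp "'o signed list" "'o signed" "'o signed list" "('o, 'g) tm" "('o, 'g) tm"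

inductive wt ::
  "'o set \<Rightarrow> ('o \<Rightarrow> kind) \<Rightarrow> ('g \<Rightarrow> 'o signed list \<Rightarrow> bool) \<Rightarrow> 'o signed list \<Rightarrow> ('o, 'g) tm \<Rightarrow> bool"
  for O' c gen where
  "gen g \<Xi> \<Longrightarrow> fst ` set \<Xi> \<subseteq> O' \<Longrightarrow> admissible c \<Xi> \<Longrightarrow> wt O' c gen \<Xi> (TGen g)"
| "R \<in> O' \<Longrightarrow> wt O' c gen [(R, Neg), (R, Pos)] (TId R)"
| "wt O' c gen (pull \<Phi> \<sigma>) t \<Longrightarrow> fst ` set \<Phi> \<subseteq> O' \<Longrightarrow> admissible c \<Phi> \<Longrightarrow> structural c \<Phi> \<sigma> \<Longrightarrow>
   wt O' c gen \<Phi> (TAct \<Phi> \<sigma> t)"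
| "wt O' c gen (\<Phi> @ [K]) f \<Longrightarrow> wt O' c gen (dual K # \<Psi>) g \<Longrightarrow>
   wt O' c gen (\<Phi> @ \<Psi>) (TCmp \<Phi> K \<Psi> g f)"

definition term_alg ::
  "'o set \<Rightarrow> ('o \<Rightarrow> kind) \<Rightarrow> ('g \<Rightarrow> 'o signed list \<Rightarrow> bool) \<Rightarrow> ('o, ('o, 'g) tm) lnl" where
  "term_alg O' c gen =
     \<lparr>Ob = O', cl = c, Hom = (\<lambda>\<Phi>. {t. wt O' c gen \<Phi> t}), act = TAct, idn = TId, cmp = TCmp\<rparr>"

definition tm_eq ::
  "'o set \<Rightarrow> ('o \<Rightarrow> kind) \<Rightarrow> ('g \<Rightarrow> 'o signed list \<Rightarrow> bool) \<Rightarrow>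
   ('o signed list \<Rightarrow> ('o, 'g) tm \<Rightarrow> ('o, 'g) tm \<Rightarrow> bool) \<Rightarrow>
   'o signed list \<Rightarrow> ('o, 'g) tm \<Rightarrow> ('o, 'g) tm \<Rightarrow> bool" where
  "tm_eq O' c gen rel \<Phi> s t \<longleftrightarrow>
     (\<forall>E. lnl_upto E (term_alg O' c gen) \<and> (\<forall>\<Xi> a b. rel \<Xi> a b \<longrightarrow> E \<Xi> a b) \<longrightarrow> E \<Phi> s t)"

definition tm_class ::
  "'o set \<Rightarrow> ('o \<Rightarrow> kind) \<Rightarrow> ('g \<Rightarrow> 'o signed list \<Rightarrow> bool) \<Rightarrow>
   ('o signed list \<Rightarrow> ('o, 'g) tm \<Rightarrow> ('o, 'g) tm \<Rightarrow> bool) \<Rightarrow>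
   'o signed list \<Rightarrow> ('o, 'g) tm \<Rightarrow> ('o, 'g) tm set" where
  "tm_class O' c gen rel \<Phi> t = {s. wt O' c gen \<Phi> s \<and> tm_eq O' c gen rel \<Phi> t s}"

definition presented ::
  "'o set \<Rightarrow> ('o \<Rightarrow> kind) \<Rightarrow> ('g \<Rightarrow> 'o signed list \<Rightarrow> bool) \<Rightarrow>
   ('o signed list \<Rightarrow> ('o, 'g) tm \<Rightarrow> ('o, 'g) tm \<Rightarrow> bool) \<Rightarrow> ('o, ('o, 'g) tm set) lnl" where
  "presented O' c gen rel =
     (let q = tm_class O' c gen rel; rep = (\<lambda>X. SOME t. t \<in> X) in
     \<lparr>Ob = O', cl = c,
      Hom = (\<lambda>\<Phi>. {q \<Phi> t |t. wt O' c gen \<Phi> t}),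
      act = (\<lambda>\<Phi> \<sigma> X. q \<Phi> (TAct \<Phi> \<sigma> (rep X))),
      idn = (\<lambda>R. q [(R, Neg), (R, Pos)] (TId R)),
      cmp = (\<lambda>\<Phi> K \<Psi> Y X. q (\<Phi> @ \<Psi>) (TCmp \<Phi> K \<Psi> (rep Y) (rep X)))\<rparr>)"


section \<open>Abstract cones\<close>

text \<open>In the definition of an abstract cone, "morphism" has to be understood up to the
  structural action, since structural maps act on the identity of the vertex as well as on
  every other morphism. For instance the image of \<open>1\<^sub>K\<close> in \<open>C(K, dual K)\<close> cannot be
  avoided, and a nonlinear object (possibly \<open>K\<close> or \<open>dual K\<close> itself) can be weakened into any
  list without positive nonlinear object. A morphism is called reduced if it is not a
  weakening.\<close>

definition reduced :: "('o, 'm) lnl \<Rightarrow> 'o signed list \<Rightarrow> 'm \<Rightarrow> bool" where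
  "reduced C \<Phi> x \<longleftrightarrow> x \<in> Hom C \<Phi> \<and>
     (\<forall>\<sigma>. \<forall>y\<in>Hom C (pull \<Phi> \<sigma>). structural (cl C) \<Phi> \<sigma> \<longrightarrow> x = act C \<Phi> \<sigma> y \<longrightarrow>
        set \<sigma> = {..<length \<Phi>})"

definition permuted_idn :: "('o, 'm) lnl \<Rightarrow> 'o \<Rightarrow> 'o signed list \<Rightarrow> 'm \<Rightarrow> bool" where
  "permuted_idn C R \<Phi> x \<longleftrightarrow>
     \<Phi> = [(R, Neg), (R, Pos)] \<and> x = idn C R \<or>
     \<Phi> = [(R, Pos), (R, Neg)] \<and> x = act C \<Phi> [1, 0] (idn C R)"

text \<open>The last clause of \<open>abstract_cone\<close> is also part of the requirement that there are no
  morphisms with two copies of \<open>K\<close>: it excludes composites of two projections, which would be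
  such morphisms, but which need not be reduced.\<close>

definition abstract_cone :: "('o, 'm) lnl \<Rightarrow> 'o signed \<Rightarrow> bool" where
  "abstract_cone C K \<longleftrightarrow> lnl C \<and> fst K \<in> Ob C \<and>
     (\<forall>\<Phi> x. reduced C \<Phi> x \<longrightarrow> dual K \<in> set \<Phi> \<longrightarrow> permuted_idn C (fst K) \<Phi> x) \<and>
     (\<forall>\<Phi> x. reduced C \<Phi> x \<longrightarrow> count_list \<Phi> K \<le> 1) \<and>
     \<not> (\<exists>\<Phi> L \<Psi> f g. fst L \<noteq> fst K \<and> K \<in> set \<Phi> \<and> K \<in> set \<Psi> \<and>
          reduced C (\<Phi> @ [L]) f \<and> reduced C (dual L # \<Psi>) g)"

definition abstract_projection ::
  "('o, 'm) lnl \<Rightarrow> 'o signed \<Rightarrow> 'o signed list \<Rightarrow> 'm \<Rightarrow> bool" where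
  "abstract_projection C K \<Phi> f \<longleftrightarrow> fst K \<notin> fst ` set \<Phi> \<and> f \<in> Hom C (\<Phi> @ [K])"

definition discrete_cone :: "('o, 'm) lnl \<Rightarrow> 'o signed \<Rightarrow> bool" where
  "discrete_cone C K \<longleftrightarrow>
     (\<forall>\<Phi> x. reduced C \<Phi> x \<longrightarrow> fst K \<notin> fst ` set \<Phi> \<longrightarrow> (\<exists>R\<in>Ob C. permuted_idn C R \<Phi> x))"

text \<open>A finite discrete cone has finitely many objects and, up to structural maps, finitely
  many abstract projections; every morphism is the image of an identity or of one of these
  projections under a unique structural map. Without uniqueness (for example for a single
  projection \<open>f \<in> C(A\<^sup>-, A\<^sup>-, K\<^sup>+)\<close> invariant under the swap, whose universal
  lift is a symmetric square) the universal property of a vertex would refer only to families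
  of morphisms with the same invariance, which the premises of a sequent rule cannot express.\<close>

definition projection_basis ::
  "('o, 'm) lnl \<Rightarrow> 'o signed \<Rightarrow> ('o signed list \<times> 'm) list \<Rightarrow> bool" where
  "projection_basis C K ps \<longleftrightarrow> distinct ps \<and>
     (\<forall>(\<Phi>, f)\<in>set ps. abstract_projection C K \<Phi> f) \<and>
     (\<forall>\<Xi>. \<forall>x\<in>Hom C \<Xi>. \<exists>!(\<Psi>, g, \<sigma>).
        (\<Psi>, g) \<in> {([(R, Neg), (R, Pos)], idn C R) |R. R \<in> Ob C} \<union>
                  {(\<Phi> @ [K], f) |\<Phi> f. (\<Phi>, f) \<in> set ps} \<and>
        structural (cl C) \<Xi> \<sigma> \<and> pull \<Xi> \<sigma> = \<Psi> \<and> act C \<Xi> \<sigma> g = x)"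

definition finite_cone :: "('o, 'm) lnl \<Rightarrow> 'o signed \<Rightarrow> bool" where
  "finite_cone C K \<longleftrightarrow> finite (Ob C) \<and> (\<exists>ps. projection_basis C K ps)"

definition reduct :: "('o, 'm) lnl \<Rightarrow> 'o signed \<Rightarrow> ('o, 'm) lnl" where
  "reduct C K = C\<lparr>Ob := Ob C - {fst K},
                  Hom := (\<lambda>\<Phi>. if fst K \<in> fst ` set \<Phi> then {} else Hom C \<Phi>)\<rparr>"

subsection \<open>Expansions\<close>

text \<open>The list of new objects is given by their classes and signs; the new objects are the
  \<open>Inr j\<close>. \<open>expansion C K \<psi> X\<close> has a copy of the new morphism \<open>\<chi>\<close> for every element of \<open>X\<close>.
  Hence \<open>X = {0}\<close> gives the expansion, \<open>X = {}\<close> the pre-expansion, and \<open>X = {0, 1}\<close> the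
  pushout of the expansion with itself over the pre-expansion.\<close>

type_synonym shape = "(kind \<times> sign) list"

datatype ('r, 'p) egen = Mor "'r signed list" 'p | Til "'r signed list" 'p | Chi nat

type_synonym ('r, 'p) etm = "('r + nat, ('r, 'p) egen) tm"

definition exp_cl :: "('r, 'p) lnl \<Rightarrow> shape \<Rightarrow> 'r + nat \<Rightarrow> kind" where
  "exp_cl C \<psi> = case_sum (cl C) (\<lambda>j. fst (\<psi> ! j))"

definition exp_Ob :: "('r, 'p) lnl \<Rightarrow> shape \<Rightarrow> ('r + nat) set" where
  "exp_Ob C \<psi> = Inl ` Ob C \<union> Inr ` {..<length \<psi>}"

definition new :: "shape \<Rightarrow> ('r + nat) signed list" where
  "new \<psi> = map (\<lambda>j. (Inr j, snd (\<psi> ! j))) [0..<length \<psi>]"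

abbreviation old :: "'r signed list \<Rightarrow> ('r + nat) signed list" where
  "old \<equiv> smap Inl"

definition exp_gen ::
  "('r, 'p) lnl \<Rightarrow> 'r signed \<Rightarrow> shape \<Rightarrow> nat set \<Rightarrow> ('r, 'p) egen \<Rightarrow> ('r + nat) signed list \<Rightarrow> bool"
  where
  "exp_gen C K \<psi> X g \<Xi> \<longleftrightarrow>
     (case g of
        Mor \<Phi> f \<Rightarrow> f \<in> Hom C \<Phi> \<and> \<Xi> = old \<Phi>
      | Til \<Phi> f \<Rightarrow> abstract_projection C K \<Phi> f \<and> \<Xi> = old \<Phi> @ new \<psi>
      | Chi i \<Rightarrow> i \<in> X \<and> \<Xi> = old [dual K] @ new \<psi>)"

text \<open>Besides functoriality of the inclusion of \<open>C\<close> and the two families of equations for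
  \<open>\<chi>\<close> and for transitions, the new morphisms are required to be compatible with structural
  maps. This is implied by the equation for \<open>\<chi>\<close> if there is one, but has to be stated for
  the pre-expansion.\<close>

inductive exp_rel ::
  "('r, 'p) lnl \<Rightarrow> 'r signed \<Rightarrow> shape \<Rightarrow> nat set \<Rightarrow>
   ('r + nat) signed list \<Rightarrow> ('r, 'p) etm \<Rightarrow> ('r, 'p) etm \<Rightarrow> bool"
  for C K \<psi> X where
  incl_act: "valid C \<Phi> \<Longrightarrow> structural (cl C) \<Phi> \<sigma> \<Longrightarrow> x \<in> Hom C (pull \<Phi> \<sigma>) \<Longrightarrow>
    exp_rel C K \<psi> X (old \<Phi>)
      (TGen (Mor \<Phi> (act C \<Phi> \<sigma> x)))
      (TAct (old \<Phi>) \<sigma> (TGen (Mor (pull \<Phi> \<sigma>) x)))"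
| incl_idn: "R \<in> Ob C \<Longrightarrow>
    exp_rel C K \<psi> X [(Inl R, Neg), (Inl R, Pos)]
      (TGen (Mor [(R, Neg), (R, Pos)] (idn C R)))
      (TId (Inl R))"
| incl_cmp: "f \<in> Hom C (\<Phi> @ [L]) \<Longrightarrow> g \<in> Hom C (dual L # \<Psi>) \<Longrightarrow>
    exp_rel C K \<psi> X (old (\<Phi> @ \<Psi>))
      (TGen (Mor (\<Phi> @ \<Psi>) (cmp C \<Phi> L \<Psi> g f)))
      (TCmp (old \<Phi>) (map_prod Inl id L) (old \<Psi>)
         (TGen (Mor (dual L # \<Psi>) g)) (TGen (Mor (\<Phi> @ [L]) f)))"
| chi: "i \<in> X \<Longrightarrow> abstract_projection C K \<Phi> f \<Longrightarrow>
    exp_rel C K \<psi> X (old \<Phi> @ new \<psi>)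
      (TCmp (old \<Phi>) (map_prod Inl id K) (new \<psi>) (TGen (Chi i)) (TGen (Mor (\<Phi> @ [K]) f)))
      (TGen (Til \<Phi> f))"
| til_trans: "abstract_projection C K (dual L # \<Phi>) f \<Longrightarrow>
    g \<in> Hom C (\<Theta> @ [L]) \<Longrightarrow> fst K \<notin> fst ` set (\<Theta> @ [L]) \<Longrightarrow>
    exp_rel C K \<psi> X (old \<Theta> @ old \<Phi> @ new \<psi>)
      (TCmp (old \<Theta>) (map_prod Inl id L) (old \<Phi> @ new \<psi>)
         (TGen (Til (dual L # \<Phi>) f)) (TGen (Mor (\<Theta> @ [L]) g)))
      (TGen (Til (\<Theta> @ \<Phi>) (cmp C \<Theta> L (\<Phi> @ [K]) f g)))"
| til_act: "abstract_projection C K (pull \<Phi> \<sigma>) f \<Longrightarrow>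
    valid C (\<Phi> @ [K]) \<Longrightarrow> structural (cl C) \<Phi> \<sigma> \<Longrightarrow> fst K \<notin> fst ` set \<Phi> \<Longrightarrow>
    exp_rel C K \<psi> X (old \<Phi> @ new \<psi>)
      (TGen (Til \<Phi> (act C (\<Phi> @ [K]) (\<sigma> @ [length \<Phi>]) f)))
      (TAct (old \<Phi> @ new \<psi>) (\<sigma> @ [length \<Phi>..<length \<Phi> + length \<psi>]) (TGen (Til (pull \<Phi> \<sigma>) f)))"
| til_weak: "f \<in> Hom C \<Phi> \<Longrightarrow> neg_nonlinear (cl C) K \<Longrightarrow>
    valid C (\<Phi> @ [K]) \<Longrightarrow> fst K \<notin> fst ` set \<Phi> \<Longrightarrow>
    exp_rel C K \<psi> X (old \<Phi> @ new \<psi>)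
      (TGen (Til \<Phi> (act C (\<Phi> @ [K]) [0..<length \<Phi>] f)))
      (TAct (old \<Phi> @ new \<psi>) [0..<length \<Phi>] (TGen (Mor \<Phi> f)))"

definition expansion ::
  "('r, 'p) lnl \<Rightarrow> 'r signed \<Rightarrow> shape \<Rightarrow> nat set \<Rightarrow> ('r + nat, ('r, 'p) etm set) lnl" where
  "expansion C K \<psi> X =
     presented (exp_Ob C \<psi>) (exp_cl C \<psi>) (exp_gen C K \<psi> X) (exp_rel C K \<psi> X)"

definition exp_class ::
  "('r, 'p) lnl \<Rightarrow> 'r signed \<Rightarrow> shape \<Rightarrow> nat set \<Rightarrow>
   ('r + nat) signed list \<Rightarrow> ('r, 'p) etm \<Rightarrow> ('r, 'p) etm set" where
  "exp_class C K \<psi> X =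
     tm_class (exp_Ob C \<psi>) (exp_cl C \<psi>) (exp_gen C K \<psi> X) (exp_rel C K \<psi> X)"

definition exp_incl ::
  "('r, 'p) lnl \<Rightarrow> 'r signed \<Rightarrow> shape \<Rightarrow> nat set \<Rightarrow>
   ('r, 'p, 'r + nat, ('r, 'p) etm set) fctr" where
  "exp_incl C K \<psi> X = mk_fctr C Inl (\<lambda>\<Phi> f. exp_class C K \<psi> X (old \<Phi>) (TGen (Mor \<Phi> f)))"

text \<open>The functor to the expansion that sends every copy of \<open>\<chi>\<close> to \<open>\<chi>\<close>: the inclusion of the
  pre-expansion if \<open>X = {}\<close>, and the codiagonal if \<open>X = {0, 1}\<close>.\<close>

definition merge_chi ::
  "('r, 'p) lnl \<Rightarrow> 'r signed \<Rightarrow> shape \<Rightarrow> nat set \<Rightarrow>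
   ('r + nat, ('r, 'p) etm set, 'r + nat, ('r, 'p) etm set) fctr" where
  "merge_chi C K \<psi> X =
     mk_fctr (expansion C K \<psi> X) (\<lambda>R. R)
       (\<lambda>\<Xi> x. exp_class C K \<psi> {0} \<Xi>
          (map_tm id (\<lambda>g. case g of Chi i \<Rightarrow> Chi 0 | _ \<Rightarrow> g) (SOME t. t \<in> x)))"

subsection \<open>Adjoining an isomorphic vertex\<close>

text \<open>\<open>None\<close> is the new object \<open>K'\<close>. Since \<open>K'\<close> is isomorphic to \<open>K\<close>, collapsing \<open>K'\<close> to \<open>K\<close>
  is bijective on hom-sets.\<close>

definition collapse :: "'r signed \<Rightarrow> 'r option \<Rightarrow> 'r" where
  "collapse K = case_option (fst K) (\<lambda>r. r)"

definition iso_cone :: "('r, 'p) lnl \<Rightarrow> 'r signed \<Rightarrow> ('r option, 'p) lnl" where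
  "iso_cone C K =
     (let q = collapse K in
     \<lparr>Ob = insert None (Some ` Ob C),
      cl = cl C \<circ> q,
      Hom = (\<lambda>\<Phi>. if fst ` set \<Phi> \<subseteq> insert None (Some ` Ob C) then Hom C (smap q \<Phi>) else {}),
      act = (\<lambda>\<Phi>. act C (smap q \<Phi>)),
      idn = idn C \<circ> q,
      cmp = (\<lambda>\<Phi> L \<Psi>. cmp C (smap q \<Phi>) (map_prod q id L) (smap q \<Psi>))\<rparr>)"

definition iso_collapse :: "('r, 'p) lnl \<Rightarrow> 'r signed \<Rightarrow> ('r option, 'p, 'r, 'p) fctr" where
  "iso_collapse C K = mk_fctr (iso_cone C K) (collapse K) (\<lambda>_ x. x)"

definition section1 :: "('r, 'p) lnl \<Rightarrow> ('r, 'p, 'r option, 'p) fctr" where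
  "section1 C = mk_fctr C Some (\<lambda>_ x. x)"

definition section2 :: "('r, 'p) lnl \<Rightarrow> 'r signed \<Rightarrow> ('r, 'p, 'r option, 'p) fctr" where
  "section2 C K = mk_fctr C (\<lambda>r. if r = fst K then None else Some r) (\<lambda>_ x. x)"


section \<open>Doctrines and sketches\<close>

record ('d, 'e, 'c, 'r, 'p) doctrine =
  base :: "('d, 'e) lnl"
  cones :: "'c set"
  cone :: "'c \<Rightarrow> ('r, 'p) lnl"
  vtx :: "'c \<Rightarrow> 'r signed"
  cfun :: "'c \<Rightarrow> ('r, 'p, 'd, 'e) fctr"

definition lnl_doctrine :: "('d, 'e, 'c, 'r, 'p) doctrine \<Rightarrow> bool" where
  "lnl_doctrine D \<longleftrightarrow> lnl (base D) \<and>
     (\<forall>c\<in>cones D. abstract_cone (cone D c) (vtx D c) \<and> is_functor (cone D c) (base D) (cfun D c))"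

record ('o, 'm, 'd, 'e, 'c, 'r, 'p) sketch =
  poly :: "('o, 'm) lnl"
  over :: "('o, 'm, 'd, 'e) fctr"
  pext :: "'c \<Rightarrow> ('r, 'p, 'o, 'm) fctr set"

definition is_sketch ::
  "('d, 'e, 'c, 'r, 'p) doctrine \<Rightarrow> ('o, 'm, 'd, 'e, 'c, 'r, 'p) sketch \<Rightarrow> bool" where
  "is_sketch D P \<longleftrightarrow> lnl (poly P) \<and> is_functor (poly P) (base D) (over P) \<and>
     (\<forall>c\<in>cones D. \<forall>L\<in>pext P c.
        is_functor (cone D c) (poly P) L \<and> fcomp (cone D c) (over P) L = cfun D c)"

definition sketch_mor ::
  "('d, 'e, 'c, 'r, 'p) doctrine \<Rightarrow> ('o, 'm, 'd, 'e, 'c, 'r, 'p) sketch \<Rightarrow>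
   ('o2, 'm2, 'd, 'e, 'c, 'r, 'p) sketch \<Rightarrow> ('o, 'm, 'o2, 'm2) fctr \<Rightarrow> bool" where
  "sketch_mor D P Q F \<longleftrightarrow> is_functor (poly P) (poly Q) F \<and>
     fcomp (poly P) (over Q) F = over P \<and>
     (\<forall>c\<in>cones D. \<forall>L\<in>pext P c. fcomp (cone D c) F L \<in> pext Q c)"

definition plain_sketch ::
  "('o, 'm) lnl \<Rightarrow> ('o, 'm, 'd, 'e) fctr \<Rightarrow> ('o, 'm, 'd, 'e, 'c, 'r, 'p) sketch" where
  "plain_sketch P \<pi> = \<lparr>poly = P, over = \<pi>, pext = (\<lambda>_. {})\<rparr>"

definition cone_sketch ::
  "('d, 'e, 'c, 'r, 'p) doctrine \<Rightarrow> 'c \<Rightarrow> ('r, 'p, 'd, 'e, 'c, 'r, 'p) sketch" where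
  "cone_sketch D c =
     \<lparr>poly = cone D c, over = cfun D c, pext = (\<lambda>_. {})(c := {fincl (cone D c)})\<rparr>"

abbreviation cone_reduct :: "('d, 'e, 'c, 'r, 'p) doctrine \<Rightarrow> 'c \<Rightarrow> ('r, 'p) lnl" where
  "cone_reduct D c \<equiv> reduct (cone D c) (vtx D c)"

definition reduct_sketch ::
  "('d, 'e, 'c, 'r, 'p) doctrine \<Rightarrow> 'c \<Rightarrow> ('r, 'p, 'd, 'e, 'c, 'r, 'p) sketch" where
  "reduct_sketch D c =
     plain_sketch (cone_reduct D c) (fcomp (cone_reduct D c) (cfun D c) (fincl (cone_reduct D c)))"

text \<open>\<open>E\<close> is the extension of the given \<open>\<bbbD>\<close>-cone to the expansion.\<close>

definition exp_sketch ::
  "('d, 'e, 'c, 'r, 'p) doctrine \<Rightarrow> 'c \<Rightarrow> shape \<Rightarrow> ('r + nat, ('r, 'p) etm set, 'd, 'e) fctr \<Rightarrow>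
   nat set \<Rightarrow> ('r + nat, ('r, 'p) etm set, 'd, 'e, 'c, 'r, 'p) sketch" where
  "exp_sketch D c \<psi> E X =
     (let C = cone D c; K = vtx D c in
     \<lparr>poly = expansion C K \<psi> X,
      over = fcomp (expansion C K \<psi> X) E (merge_chi C K \<psi> X),
      pext = (\<lambda>_. {})(c := {exp_incl C K \<psi> X})\<rparr>)"

definition iso_sketch ::
  "('d, 'e, 'c, 'r, 'p) doctrine \<Rightarrow> 'c \<Rightarrow> ('r option, 'p, 'd, 'e, 'c, 'r, 'p) sketch" where
  "iso_sketch D c =
     (let C = cone D c; K = vtx D c in
     \<lparr>poly = iso_cone C K,
      over = fcomp (iso_cone C K) (cfun D c) (iso_collapse C K),
      pext = (\<lambda>_. {})(c := {section1 C, section2 C K})\<rparr>)"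

definition iso_sketch' ::
  "('d, 'e, 'c, 'r, 'p) doctrine \<Rightarrow> 'c \<Rightarrow> ('r option, 'p, 'd, 'e, 'c, 'r, 'p) sketch" where
  "iso_sketch' D c = (iso_sketch D c)\<lparr>pext := (\<lambda>_. {})(c := {section1 (cone D c)})\<rparr>"


section \<open>Pushouts and sequential colimits of sketches\<close>

text \<open>\<open>is_pushout D I A B j a S S' inc att\<close>: \<open>S'\<close> is the pushout of \<open>\<Coprod> j\<^sub>i : \<Coprod> A\<^sub>i \<rightarrow> \<Coprod> B\<^sub>i\<close>
  along \<open>\<Coprod> A\<^sub>i \<rightarrow> S\<close>, the map with components \<open>a\<^sub>i\<close>, where \<open>i\<close> ranges over \<open>I\<close>; the universal
  properties of the coproducts and of the pushout are combined.

  The universal property is tested against sketches on the same types \<open>'o\<close> and \<open>'m\<close> as \<open>S'\<close>.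
  These types play the role of a universe containing the sketches involved: their carriers
  are arbitrary subsets of the types, and any pushout that can be realized in these types
  satisfies the definition. (Results about it need infinite types \<open>'o\<close> and \<open>'m\<close>, so that there
  are enough test sketches.)\<close>

definition is_pushout ::
  "('d, 'e, 'c, 'r, 'p) doctrine \<Rightarrow> 'i set \<Rightarrow>
   ('i \<Rightarrow> ('a, 'a2, 'd, 'e, 'c, 'r, 'p) sketch) \<Rightarrow> ('i \<Rightarrow> ('b, 'b2, 'd, 'e, 'c, 'r, 'p) sketch) \<Rightarrow>
   ('i \<Rightarrow> ('a, 'a2, 'b, 'b2) fctr) \<Rightarrow> ('i \<Rightarrow> ('a, 'a2, 'o, 'm) fctr) \<Rightarrow>
   ('o, 'm, 'd, 'e, 'c, 'r, 'p) sketch \<Rightarrow> ('o, 'm, 'd, 'e, 'c, 'r, 'p) sketch \<Rightarrow>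
   ('o, 'm, 'o, 'm) fctr \<Rightarrow> ('i \<Rightarrow> ('b, 'b2, 'o, 'm) fctr) \<Rightarrow> bool" where
  "is_pushout D I A B j a S S' inc att \<longleftrightarrow>
     is_sketch D S' \<and> sketch_mor D S S' inc \<and>
     (\<forall>i\<in>I. sketch_mor D (B i) S' (att i) \<and>
        fcomp (poly (A i)) (att i) (j i) = fcomp (poly (A i)) inc (a i)) \<and>
     (\<forall>(T :: ('o, 'm, 'd, 'e, 'c, 'r, 'p) sketch) h k.
        is_sketch D T \<and> sketch_mor D S T h \<and>
        (\<forall>i\<in>I. sketch_mor D (B i) T (k i) \<and>
           fcomp (poly (A i)) (k i) (j i) = fcomp (poly (A i)) h (a i)) \<longrightarrow>
        (\<exists>!H. sketch_mor D S' T H \<and> fcomp (poly S) H inc = h \<and>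
           (\<forall>i\<in>I. fcomp (poly (B i)) H (att i) = k i)))"

definition is_seq_colimit ::
  "('d, 'e, 'c, 'r, 'p) doctrine \<Rightarrow>
   (nat \<Rightarrow> ('o, 'm, 'd, 'e, 'c, 'r, 'p) sketch) \<Rightarrow> (nat \<Rightarrow> ('o, 'm, 'o, 'm) fctr) \<Rightarrow>
   ('o, 'm, 'd, 'e, 'c, 'r, 'p) sketch \<Rightarrow> (nat \<Rightarrow> ('o, 'm, 'o, 'm) fctr) \<Rightarrow> bool" where
  "is_seq_colimit D S inc S' leg \<longleftrightarrow>
     is_sketch D S' \<and>
     (\<forall>n. sketch_mor D (S n) S' (leg n) \<and> fcomp (poly (S n)) (leg (Suc n)) (inc n) = leg n) \<and>
     (\<forall>(T :: ('o, 'm, 'd, 'e, 'c, 'r, 'p) sketch) h.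
        is_sketch D T \<and>
        (\<forall>n. sketch_mor D (S n) T (h n) \<and> fcomp (poly (S n)) (h (Suc n)) (inc n) = h n) \<longrightarrow>
        (\<exists>!H. sketch_mor D S' T H \<and> (\<forall>n. fcomp (poly (S n)) H (leg n) = h n)))"


section \<open>The construction of the free category of a doctrine\<close>

type_synonym ('r, 'p, 'd, 'e, 'c, 'o, 'm) exp_cell =
  "'c \<times> shape \<times> ('r + nat, ('r, 'p) etm set, 'd, 'e) fctr \<times> nat set \<times>
   ('r + nat, ('r, 'p) etm set, 'o, 'm) fctr"

text \<open>The stages \<open>stg1 n\<close> are \<open>\<S>\<^sub>n\<close>, with colimit \<open>lim1 = \<S>\<^sub>\<omega>\<close>; the stages \<open>stg2 k\<close> are
  \<open>\<S>\<^sub>\<omega>\<^sub>+\<^sub>k\<close>, with colimit \<open>lim2\<close>; and \<open>fin\<close> is the result. The \<open>att\<close> fields are the maps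
  from the adjoined cells into the next stage.\<close>

record ('o, 'm, 'd, 'e, 'c, 'r, 'p) tower =
  stg1 :: "nat \<Rightarrow> ('o, 'm, 'd, 'e, 'c, 'r, 'p) sketch"
  inc1 :: "nat \<Rightarrow> ('o, 'm, 'o, 'm) fctr"
  att1 :: "nat \<Rightarrow> 'c \<times> ('r, 'p, 'o, 'm) fctr \<Rightarrow> ('r, 'p, 'o, 'm) fctr"
  lim1 :: "('o, 'm, 'd, 'e, 'c, 'r, 'p) sketch"
  leg1 :: "nat \<Rightarrow> ('o, 'm, 'o, 'm) fctr"
  stg2 :: "nat \<Rightarrow> ('o, 'm, 'd, 'e, 'c, 'r, 'p) sketch"
  inc2 :: "nat \<Rightarrow> ('o, 'm, 'o, 'm) fctr"
  att2 :: "nat \<Rightarrow> ('r, 'p, 'd, 'e, 'c, 'o, 'm) exp_cell \<Rightarrow>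
             ('r + nat, ('r, 'p) etm set, 'o, 'm) fctr"
  lim2 :: "('o, 'm, 'd, 'e, 'c, 'r, 'p) sketch"
  leg2 :: "nat \<Rightarrow> ('o, 'm, 'o, 'm) fctr"
  fin :: "('o, 'm, 'd, 'e, 'c, 'r, 'p) sketch"
  inc3 :: "('o, 'm, 'o, 'm) fctr"
  att3 :: "'c \<times> ('r option, 'p, 'o, 'm) fctr \<Rightarrow> ('r option, 'p, 'o, 'm) fctr"

definition cells1 ::
  "('d, 'e, 'c, 'r, 'p) doctrine \<Rightarrow> ('o, 'm, 'd, 'e, 'c, 'r, 'p) tower \<Rightarrow> nat \<Rightarrow>
   ('c \<times> ('r, 'p, 'o, 'm) fctr) set" where
  "cells1 D X n =
     {(c, u). c \<in> cones D \<and> sketch_mor D (reduct_sketch D c) (stg1 X n) u \<and>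
        (0 < n \<longrightarrow> \<not> (\<exists>w. sketch_mor D (reduct_sketch D c) (stg1 X (n - 1)) w \<and>
                         u = fcomp (cone_reduct D c) (inc1 X (n - 1)) w))}"

definition cells2 ::
  "('d, 'e, 'c, 'r, 'p) doctrine \<Rightarrow> ('o, 'm, 'd, 'e, 'c, 'r, 'p) sketch \<Rightarrow>
   ('r, 'p, 'd, 'e, 'c, 'o, 'm) exp_cell set" where
  "cells2 D S =
     {(c, \<psi>, E, X, u). c \<in> cones D \<and>
        admissible (exp_cl (cone D c) \<psi>) (old [dual (vtx D c)] @ new \<psi>) \<and>
        is_functor (expansion (cone D c) (vtx D c) \<psi> {0}) (base D) E \<and>
        fcomp (cone D c) E (exp_incl (cone D c) (vtx D c) \<psi> {0}) = cfun D c \<and>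
        (X = {} \<or> X = {0, 1}) \<and>
        sketch_mor D (exp_sketch D c \<psi> E X) S u}"

definition cells3 ::
  "('d, 'e, 'c, 'r, 'p) doctrine \<Rightarrow> ('o, 'm, 'd, 'e, 'c, 'r, 'p) sketch \<Rightarrow>
   ('c \<times> ('r option, 'p, 'o, 'm) fctr) set" where
  "cells3 D S = {(c, u). c \<in> cones D \<and> sketch_mor D (iso_sketch' D c) S u}"

definition free_construction ::
  "('d, 'e, 'c, 'r, 'p) doctrine \<Rightarrow> ('o, 'm, 'd, 'e, 'c, 'r, 'p) sketch \<Rightarrow>
   ('o, 'm, 'd, 'e, 'c, 'r, 'p) tower \<Rightarrow> bool" where
  "free_construction D S X \<longleftrightarrow>
     stg1 X 0 = S \<and>
     (\<forall>n. is_pushout D (cells1 D X n)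
            (\<lambda>(c, u). reduct_sketch D c) (\<lambda>(c, u). cone_sketch D c)
            (\<lambda>(c, u). fincl (cone_reduct D c)) (\<lambda>(c, u). u)
            (stg1 X n) (stg1 X (Suc n)) (inc1 X n) (att1 X n)) \<and>
     is_seq_colimit D (stg1 X) (inc1 X) (lim1 X) (leg1 X) \<and>
     stg2 X 0 = lim1 X \<and>
     (\<forall>k. is_pushout D (cells2 D (stg2 X k))
            (\<lambda>(c, \<psi>, E, Y, u). exp_sketch D c \<psi> E Y) (\<lambda>(c, \<psi>, E, Y, u). exp_sketch D c \<psi> E {0})
            (\<lambda>(c, \<psi>, E, Y, u). merge_chi (cone D c) (vtx D c) \<psi> Y) (\<lambda>(c, \<psi>, E, Y, u). u)
            (stg2 X k) (stg2 X (Suc k)) (inc2 X k) (att2 X k)) \<and>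
     is_seq_colimit D (stg2 X) (inc2 X) (lim2 X) (leg2 X) \<and>
     is_pushout D (cells3 D (lim2 X))
            (\<lambda>(c, u). iso_sketch' D c) (\<lambda>(c, u). iso_sketch D c)
            (\<lambda>(c, u). fincl (iso_cone (cone D c) (vtx D c))) (\<lambda>(c, u). u)
            (lim2 X) (fin X) (inc3 X) (att3 X)"


section \<open>Types\<close>

text \<open>\<open>ord c\<close> is the chosen ordering of the objects of the reduct of the cone \<open>c\<close>.\<close>

datatype ('o, 'c) ty = Base 'o | Vtx 'c "('o, 'c) ty list"

fun ty_class :: "('d, 'e, 'c, 'r, 'p) doctrine \<Rightarrow> ('o, 'm) lnl \<Rightarrow> ('o, 'c) ty \<Rightarrow> kind" where
  "ty_class D S (Base A) = cl S A"
| "ty_class D S (Vtx c Rs) = cl (cone D c) (fst (vtx D c))"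

inductive is_type ::
  "('d, 'e, 'c, 'r, 'p) doctrine \<Rightarrow> ('c \<Rightarrow> 'r list) \<Rightarrow> ('o, 'm) lnl \<Rightarrow> ('o, 'c) ty \<Rightarrow> kind \<Rightarrow> bool"
  for D ord S where
  "A \<in> Ob S \<Longrightarrow> is_type D ord S (Base A) (cl S A)"
| "c \<in> cones D \<Longrightarrow> length Rs = length (ord c) \<Longrightarrow>
   (\<And>i. i < length Rs \<Longrightarrow> is_type D ord S (Rs ! i) (cl (cone D c) (ord c ! i))) \<Longrightarrow>
   is_type D ord S (Vtx c Rs) (cl (cone D c) (fst (vtx D c)))"

definition signed_types ::
  "('d, 'e, 'c, 'r, 'p) doctrine \<Rightarrow> ('c \<Rightarrow> 'r list) \<Rightarrow> ('o, 'm) lnl \<Rightarrow>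
   ('o, 'c) ty signed list \<Rightarrow> bool" where
  "signed_types D ord S \<Phi> \<longleftrightarrow> (\<forall>K\<in>set \<Phi>. is_type D ord S (fst K) (ty_class D S (fst K)))"

definition sequent ::
  "('d, 'e, 'c, 'r, 'p) doctrine \<Rightarrow> ('c \<Rightarrow> 'r list) \<Rightarrow> ('o, 'm) lnl \<Rightarrow>
   ('o, 'c) ty signed list \<Rightarrow> bool" where
  "sequent D ord S \<Phi> \<longleftrightarrow> signed_types D ord S \<Phi> \<and> admissible (ty_class D S) \<Phi>"

text \<open>The identification of types with objects of the free category: a compound type denotes
  the vertex adjoined, at the stage \<open>n\<close> where this happens, for the map \<open>u\<close> from the reduct
  that sends the objects of the reduct to the objects denoted by the component types.\<close>

definition to_fin :: "('o, 'm, 'd, 'e, 'c, 'r, 'p) tower \<Rightarrow> nat \<Rightarrow> 'o \<Rightarrow> 'o" where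
  "to_fin X n A = fob (inc3 X) (fob (leg2 X 0) (fob (leg1 X n) A))"

primrec ty_obj ::
  "('d, 'e, 'c, 'r, 'p) doctrine \<Rightarrow> ('c \<Rightarrow> 'r list) \<Rightarrow> ('o, 'm, 'd, 'e, 'c, 'r, 'p) tower \<Rightarrow>
   ('o, 'c) ty \<Rightarrow> 'o" where
  "ty_obj D ord X (Base A) = to_fin X 0 A"
| "ty_obj D ord X (Vtx c Rs) =
     (let (n, u) = (SOME (n, u). (c, u) \<in> cells1 D X n \<and>
                      map (\<lambda>r. to_fin X n (fob u r)) (ord c) = map (ty_obj D ord X) Rs)
      in to_fin X (Suc n) (fob (att1 X n (c, u)) (fst (vtx D c))))"


section \<open>The sequent calculus\<close>

text \<open>\<open>prj c\<close> lists the abstract projections of the cone \<open>c\<close>, up to structural maps, in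
  the form \<open>(\<Phi>, f)\<close> with \<open>f \<in> C(\<Phi>, K)\<close>; the premises of the invertible rule are ordered
  accordingly.\<close>

datatype ('o, 'm, 'c, 'r, 'p) deriv =
    DId "('o, 'c) ty"
  | DCut "('o, 'c) ty signed list" "('o, 'c) ty signed" "('o, 'c) ty signed list"
      "('o, 'm, 'c, 'r, 'p) deriv" "('o, 'm, 'c, 'r, 'p) deriv"
  | DStr "('o, 'c) ty signed list" "nat list" "('o, 'm, 'c, 'r, 'p) deriv"
  | DGen "'o signed list" 'm
  | DNoninv 'c "('o, 'c) ty list" "'r signed list" 'p
  | DInv 'c "('o, 'c) ty list" "('o, 'c) ty signed list" "('o, 'm, 'c, 'r, 'p) deriv list"

definition inst ::
  "('c \<Rightarrow> 'r list) \<Rightarrow> 'c \<Rightarrow> ('o, 'c) ty list \<Rightarrow> 'r signed list \<Rightarrow> ('o, 'c) ty signed list" where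
  "inst ord c Rs = smap (\<lambda>r. the (map_of (zip (ord c) Rs) r))"

definition base_obj :: "('d, 'e, 'c, 'r, 'p) doctrine \<Rightarrow> kind \<Rightarrow> 'd" where
  "base_obj D \<tau> = (THE A. A \<in> Ob (base D) \<and> cl (base D) A = \<tau>)"

inductive derives ::
  "('d, 'e, 'c, 'r, 'p) doctrine \<Rightarrow> ('c \<Rightarrow> 'r list) \<Rightarrow> ('c \<Rightarrow> ('r signed list \<times> 'p) list) \<Rightarrow>
   ('o, 'm) lnl \<Rightarrow> ('o, 'm, 'c, 'r, 'p) deriv \<Rightarrow> ('o, 'c) ty signed list \<Rightarrow> bool"
  for D ord prj S where
  identity: "is_type D ord S R \<tau> \<Longrightarrow>
    derives D ord prj S (DId R) [(R, Neg), (R, Pos)]"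
| cut: "derives D ord prj S d (\<Phi> @ [K]) \<Longrightarrow> derives D ord prj S d' (dual K # \<Psi>) \<Longrightarrow>
    derives D ord prj S (DCut \<Phi> K \<Psi> d d') (\<Phi> @ \<Psi>)"
| structural: "derives D ord prj S d (pull \<Phi> \<sigma>) \<Longrightarrow> sequent D ord S \<Phi> \<Longrightarrow>
    structural (ty_class D S) \<Phi> \<sigma> \<Longrightarrow>
    derives D ord prj S (DStr \<Phi> \<sigma> d) \<Phi>"
| generator: "f \<in> Hom S \<Phi> \<Longrightarrow>
    derives D ord prj S (DGen \<Phi> f) (smap Base \<Phi>)"
| noninvertible: "is_type D ord S (Vtx c Rs) \<tau> \<Longrightarrow> (\<Phi>, f) \<in> set (prj c) \<Longrightarrow>
    derives D ord prj S (DNoninv c Rs \<Phi> f) (inst ord c Rs \<Phi> @ [(Vtx c Rs, snd (vtx D c))])"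
| invertible: "is_type D ord S (Vtx c Rs) \<tau> \<Longrightarrow>
    sequent D ord S ((Vtx c Rs, flip (snd (vtx D c))) # \<Psi>) \<Longrightarrow>
    Hom (base D) (smap (\<lambda>R. base_obj D (ty_class D S R))
                    ((Vtx c Rs, flip (snd (vtx D c))) # \<Psi>)) \<noteq> {} \<Longrightarrow>
    length ds = length (prj c) \<Longrightarrow>
    (\<And>i. i < length ds \<Longrightarrow>
       derives D ord prj S (ds ! i) (inst ord c Rs (fst (prj c ! i)) @ \<Psi>)) \<Longrightarrow>
    derives D ord prj S (DInv c Rs \<Psi> ds) ((Vtx c Rs, flip (snd (vtx D c))) # \<Psi>)"

end

theory Submission
  imports Defs "HOL-Library.Nat_Bijection"
begin

text \<open>
  A sub-sketch containing the images of the legs of a pushout or of a sequential colimit is the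
  whole of it, so its morphisms are generated from those of the legs under identities, structural
  actions and composition. Its objects are detected by testing against thin sketches with two
  copies of every object of the base. Hence the pushouts along \<open>\<partial>\<C> \<rightarrow> \<C>\<close> adjoin precisely the
  vertices, the later pushouts change only the morphisms, and types correspond to objects.

  Surjectivity: the morphisms of \<open>\<S>\<^sub>\<omega>\<close> are generated by those of \<open>\<S>\<close> and by abstract
  projections, and each stage after it adds the universal morphisms \<open>\<chi>\<close>. All of these are conclusions
  of the generator and logical rules, and the operations are cut and the structural rule. So it
  suffices to assign to derivations the morphisms they denote at a finite stage, as a partial
  function hitting every morphism; derivations without a denotation may go anywhere, provided that
  the hom-set is inhabited.

  Inhabitation is an induction on derivations. For the invertible rule one needs a functor out of
  the pre-expansion with prescribed values on the morphisms \<open>\<chi> \<circ> f\<close>. In a finite discrete cone every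
  projection is uniquely a structural action on a basic one, so such functors are
  given by values on the basic projections, which the premises supply.
\<close>

text \<open>The tower is known only through universal properties, tested against sketches on the
  same HOL types, so no explicit model of a pushout can be consulted. Sub-sketches of a colimit live
  on these types automatically. The thin test sketches have at most four objects, one for each pair
  of a class and a boolean, and an infinite type has room for them; their hom-sets have at most one
  element. The obstacle that shapes the second half is equality of morphisms: nothing is known about
  which morphisms of one stage are identified in the next. Denotations must nevertheless be well
  defined, so a derivation denotes a morphism of a definite stage, and moving to the next stage
  leaves a trace in the derivation. An instance of the invertible rule denotes one morphism because
  the attaching map of a cell is determined by three things: the object at the vertex, the new
  objects, and the values at the basic projections. The first two are read off the conclusion and
  the last is what the premises denote. This rests on uniqueness of normal forms inside a cone, the
  only place where equality of morphisms is decided.\<close>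

lemma lnl_uptoI:
  assumes "\<And>\<Phi>. equivp (E \<Phi>)"
    and "\<And>\<Phi> x. x \<in> Hom P \<Phi> \<Longrightarrow> valid P \<Phi>"
    and "\<And>\<Phi> \<sigma> x. x \<in> Hom P (pull \<Phi> \<sigma>) \<Longrightarrow> valid P \<Phi> \<Longrightarrow> structural (cl P) \<Phi> \<sigma> \<Longrightarrow> act P \<Phi> \<sigma> x \<in> Hom P \<Phi>"
    and "\<And>\<Phi> \<sigma> x y. x \<in> Hom P (pull \<Phi> \<sigma>) \<Longrightarrow> y \<in> Hom P (pull \<Phi> \<sigma>) \<Longrightarrow> valid P \<Phi> \<Longrightarrow> structural (cl P) \<Phi> \<sigma> \<Longrightarrow>
           E (pull \<Phi> \<sigma>) x y \<Longrightarrow> E \<Phi> (act P \<Phi> \<sigma> x) (act P \<Phi> \<sigma> y)"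
    and "\<And>R. R \<in> Ob P \<Longrightarrow> idn P R \<in> Hom P [(R, Neg), (R, Pos)]"
    and "\<And>\<Phi> K \<Psi> f g. f \<in> Hom P (\<Phi> @ [K]) \<Longrightarrow> g \<in> Hom P (dual K # \<Psi>) \<Longrightarrow> cmp P \<Phi> K \<Psi> g f \<in> Hom P (\<Phi> @ \<Psi>)"
    and "\<And>\<Phi> K \<Psi> f f' g g'. f \<in> Hom P (\<Phi> @ [K]) \<Longrightarrow> f' \<in> Hom P (\<Phi> @ [K]) \<Longrightarrow>
           g \<in> Hom P (dual K # \<Psi>) \<Longrightarrow> g' \<in> Hom P (dual K # \<Psi>) \<Longrightarrow> E (\<Phi> @ [K]) f f' \<Longrightarrow> E (dual K # \<Psi>) g g' \<Longrightarrow>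
           E (\<Phi> @ \<Psi>) (cmp P \<Phi> K \<Psi> g f) (cmp P \<Phi> K \<Psi> g' f')"
    and "\<And>\<Phi> x. x \<in> Hom P \<Phi> \<Longrightarrow> E \<Phi> (act P \<Phi> [0..<length \<Phi>] x) x"
    and "\<And>\<Phi> \<sigma> \<tau> x. x \<in> Hom P (pull (pull \<Phi> \<sigma>) \<tau>) \<Longrightarrow> valid P \<Phi> \<Longrightarrow> structural (cl P) \<Phi> \<sigma> \<Longrightarrow>
       structural (cl P) (pull \<Phi> \<sigma>) \<tau> \<Longrightarrow>
       E \<Phi> (act P \<Phi> \<sigma> (act P (pull \<Phi> \<sigma>) \<tau> x)) (act P \<Phi> (pull \<sigma> \<tau>) x)"
    and "\<And>\<Phi> R f. f \<in> Hom P (\<Phi> @ [(R, Pos)]) \<Longrightarrow> E (\<Phi> @ [(R, Pos)]) (cmp P \<Phi> (R, Pos) [(R, Pos)] (idn P R) f) f"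
    and "\<And>\<Psi> R g. g \<in> Hom P ((R, Neg) # \<Psi>) \<Longrightarrow> E ((R, Neg) # \<Psi>) (cmp P [(R, Neg)] (R, Pos) \<Psi> g (idn P R)) g"
    and "\<And>\<Phi> K \<Psi> L \<Theta> f g h. f \<in> Hom P (\<Phi> @ [K]) \<Longrightarrow> g \<in> Hom P (dual K # \<Psi> @ [L]) \<Longrightarrow> h \<in> Hom P (dual L # \<Theta>) \<Longrightarrow>
       E (\<Phi> @ \<Psi> @ \<Theta>) (cmp P (\<Phi> @ \<Psi>) L \<Theta> h (cmp P \<Phi> K (\<Psi> @ [L]) g f))
       (cmp P \<Phi> K (\<Psi> @ \<Theta>) (cmp P (dual K # \<Psi>) L \<Theta> h g) f)"
    and "\<And>\<Phi> K \<Psi> f g. f \<in> Hom P (\<Phi> @ [K]) \<Longrightarrow> g \<in> Hom P (dual K # \<Psi>) \<Longrightarrow>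
       E (\<Phi> @ \<Psi>) (cmp P \<Phi> K \<Psi> g f)
         (act P (\<Phi> @ \<Psi>) ([length \<Phi>..<length \<Phi>+length \<Psi>] @ [0..<length \<Phi>])
            (cmp P \<Psi> (dual K) \<Phi>
               (act P (K # \<Phi>) ([1..<Suc (length \<Phi>)] @ [0]) f)
               (act P (\<Psi> @ [dual K]) (length \<Psi> # [0..<length \<Psi>]) g)))"
    and "\<And>\<Phi> \<sigma> K \<Psi> f g. f \<in> Hom P (pull \<Phi> \<sigma> @ [K]) \<Longrightarrow> g \<in> Hom P (dual K # \<Psi>) \<Longrightarrow>
       valid P (\<Phi> @ [K]) \<Longrightarrow> structural (cl P) \<Phi> \<sigma> \<Longrightarrow>
         E (\<Phi> @ \<Psi>) (cmp P \<Phi> K \<Psi> g (act P (\<Phi> @ [K]) (\<sigma> @ [length \<Phi>]) f))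
         (act P (\<Phi> @ \<Psi>) (\<sigma> @ [length \<Phi>..<length \<Phi>+length \<Psi>]) (cmp P (pull \<Phi> \<sigma>) K \<Psi> g f))"
    and "\<And>\<Phi> K \<Psi> f g. f \<in> Hom P \<Phi> \<Longrightarrow> g \<in> Hom P (dual K # \<Psi>) \<Longrightarrow>
       valid P (\<Phi> @ [K]) \<Longrightarrow> neg_nonlinear (cl P) K \<Longrightarrow>
         E (\<Phi> @ \<Psi>) (cmp P \<Phi> K \<Psi> g (act P (\<Phi> @ [K]) [0..<length \<Phi>] f)) (act P (\<Phi> @ \<Psi>) [0..<length \<Phi>] f)"
    and "\<And>\<Phi> K \<Psi> f g. f \<in> Hom P (\<Phi> @ [K, K]) \<Longrightarrow> g \<in> Hom P (dual K # \<Psi>) \<Longrightarrow> neg_nonlinear (cl P) K \<Longrightarrow>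
         E (\<Phi> @ \<Psi>) (cmp P \<Phi> K \<Psi> g (act P (\<Phi> @ [K]) ([0..<length \<Phi>] @ [length \<Phi>, length \<Phi>]) f))
         (act P (\<Phi> @ \<Psi>) ([0..<length \<Phi>] @ [length \<Phi>..<length \<Phi>+length \<Psi>] @ [length \<Phi>..<length \<Phi>+length \<Psi>])
            (cmp P (\<Phi> @ \<Psi>) K \<Psi> g
               (act P (\<Phi> @ \<Psi> @ [K]) ([0..<length \<Phi>] @ [length \<Phi>+length \<Psi>] @ [length \<Phi>..<length \<Phi>+length \<Psi>])
                  (cmp P (\<Phi> @ [K]) K \<Psi> g f))))"
  shows "lnl_upto E P"
  unfolding lnl_upto_def Let_def
  by (intro conjI allI ballI impI; (rule assms, assumption+ | rule assms))

lemma lnl_uptoD: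
  assumes "lnl_upto E P"
  shows upto_equivp: "equivp (E \<Phi>)"
    and upto_valid: "x \<in> Hom P \<Phi> \<Longrightarrow> valid P \<Phi>"
    and upto_act: "x \<in> Hom P (pull \<Phi> \<sigma>) \<Longrightarrow> valid P \<Phi> \<Longrightarrow> structural (cl P) \<Phi> \<sigma> \<Longrightarrow> act P \<Phi> \<sigma> x \<in> Hom P \<Phi>"
    and upto_act_cong: "x \<in> Hom P (pull \<Phi> \<sigma>) \<Longrightarrow> y \<in> Hom P (pull \<Phi> \<sigma>) \<Longrightarrow> valid P \<Phi> \<Longrightarrow> structural (cl P) \<Phi> \<sigma> \<Longrightarrow>
           E (pull \<Phi> \<sigma>) x y \<Longrightarrow> E \<Phi> (act P \<Phi> \<sigma> x) (act P \<Phi> \<sigma> y)"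
    and upto_idn: "R \<in> Ob P \<Longrightarrow> idn P R \<in> Hom P [(R, Neg), (R, Pos)]"
    and upto_cmp: "f \<in> Hom P (\<Phi> @ [K]) \<Longrightarrow> g \<in> Hom P (dual K # \<Psi>) \<Longrightarrow> cmp P \<Phi> K \<Psi> g f \<in> Hom P (\<Phi> @ \<Psi>)"
    and upto_cmp_cong: "f \<in> Hom P (\<Phi> @ [K]) \<Longrightarrow> f' \<in> Hom P (\<Phi> @ [K]) \<Longrightarrow>
           g \<in> Hom P (dual K # \<Psi>) \<Longrightarrow> g' \<in> Hom P (dual K # \<Psi>) \<Longrightarrow> E (\<Phi> @ [K]) f f' \<Longrightarrow> E (dual K # \<Psi>) g g' \<Longrightarrow>
           E (\<Phi> @ \<Psi>) (cmp P \<Phi> K \<Psi> g f) (cmp P \<Phi> K \<Psi> g' f')"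
    and upto_act_id: "x \<in> Hom P \<Phi> \<Longrightarrow> E \<Phi> (act P \<Phi> [0..<length \<Phi>] x) x"
    and upto_act_act: "x \<in> Hom P (pull (pull \<Phi> \<sigma>) \<tau>) \<Longrightarrow> valid P \<Phi> \<Longrightarrow> structural (cl P) \<Phi> \<sigma> \<Longrightarrow>
       structural (cl P) (pull \<Phi> \<sigma>) \<tau> \<Longrightarrow>
       E \<Phi> (act P \<Phi> \<sigma> (act P (pull \<Phi> \<sigma>) \<tau> x)) (act P \<Phi> (pull \<sigma> \<tau>) x)"
    and upto_unit_pos: "f \<in> Hom P (\<Phi> @ [(R, Pos)]) \<Longrightarrow> E (\<Phi> @ [(R, Pos)]) (cmp P \<Phi> (R, Pos) [(R, Pos)] (idn P R) f) f"
    and upto_unit_neg: "g \<in> Hom P ((R, Neg) # \<Psi>) \<Longrightarrow> E ((R, Neg) # \<Psi>) (cmp P [(R, Neg)] (R, Pos) \<Psi> g (idn P R)) g"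
    and upto_assoc: "f \<in> Hom P (\<Phi> @ [K]) \<Longrightarrow> g \<in> Hom P (dual K # \<Psi> @ [L]) \<Longrightarrow> h \<in> Hom P (dual L # \<Theta>) \<Longrightarrow>
       E (\<Phi> @ \<Psi> @ \<Theta>) (cmp P (\<Phi> @ \<Psi>) L \<Theta> h (cmp P \<Phi> K (\<Psi> @ [L]) g f))
       (cmp P \<Phi> K (\<Psi> @ \<Theta>) (cmp P (dual K # \<Psi>) L \<Theta> h g) f)"
    and upto_swap: "f \<in> Hom P (\<Phi> @ [K]) \<Longrightarrow> g \<in> Hom P (dual K # \<Psi>) \<Longrightarrow>
       E (\<Phi> @ \<Psi>) (cmp P \<Phi> K \<Psi> g f)
         (act P (\<Phi> @ \<Psi>) ([length \<Phi>..<length \<Phi>+length \<Psi>] @ [0..<length \<Phi>])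
            (cmp P \<Psi> (dual K) \<Phi>
               (act P (K # \<Phi>) ([1..<Suc (length \<Phi>)] @ [0]) f)
               (act P (\<Psi> @ [dual K]) (length \<Psi> # [0..<length \<Psi>]) g)))"
    and upto_str: "f \<in> Hom P (pull \<Phi> \<sigma> @ [K]) \<Longrightarrow> g \<in> Hom P (dual K # \<Psi>) \<Longrightarrow>
       valid P (\<Phi> @ [K]) \<Longrightarrow> structural (cl P) \<Phi> \<sigma> \<Longrightarrow>
         E (\<Phi> @ \<Psi>) (cmp P \<Phi> K \<Psi> g (act P (\<Phi> @ [K]) (\<sigma> @ [length \<Phi>]) f))
         (act P (\<Phi> @ \<Psi>) (\<sigma> @ [length \<Phi>..<length \<Phi>+length \<Psi>]) (cmp P (pull \<Phi> \<sigma>) K \<Psi> g f))"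
    and upto_weak: "f \<in> Hom P \<Phi> \<Longrightarrow> g \<in> Hom P (dual K # \<Psi>) \<Longrightarrow>
       valid P (\<Phi> @ [K]) \<Longrightarrow> neg_nonlinear (cl P) K \<Longrightarrow>
         E (\<Phi> @ \<Psi>) (cmp P \<Phi> K \<Psi> g (act P (\<Phi> @ [K]) [0..<length \<Phi>] f)) (act P (\<Phi> @ \<Psi>) [0..<length \<Phi>] f)"
    and upto_contr: "f \<in> Hom P (\<Phi> @ [K, K]) \<Longrightarrow> g \<in> Hom P (dual K # \<Psi>) \<Longrightarrow> neg_nonlinear (cl P) K \<Longrightarrow>
         E (\<Phi> @ \<Psi>) (cmp P \<Phi> K \<Psi> g (act P (\<Phi> @ [K]) ([0..<length \<Phi>] @ [length \<Phi>, length \<Phi>]) f))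
         (act P (\<Phi> @ \<Psi>) ([0..<length \<Phi>] @ [length \<Phi>..<length \<Phi>+length \<Psi>] @ [length \<Phi>..<length \<Phi>+length \<Psi>])
            (cmp P (\<Phi> @ \<Psi>) K \<Psi> g
               (act P (\<Phi> @ \<Psi> @ [K]) ([0..<length \<Phi>] @ [length \<Phi>+length \<Psi>] @ [length \<Phi>..<length \<Phi>+length \<Psi>])
                  (cmp P (\<Phi> @ [K]) K \<Psi> g f))))"
proof -
  note A0 = assms[unfolded lnl_upto_def Let_def]
  note A1 = A0[THEN conjunct2]
  note A2 = A1[THEN conjunct2]
  note A3 = A2[THEN conjunct2]
  note A4 = A3[THEN conjunct2]
  note A5 = A4[THEN conjunct2]
  note A6 = A5[THEN conjunct2]
  note A7 = A6[THEN conjunct2]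
  note A8 = A7[THEN conjunct2]
  note A9 = A8[THEN conjunct2]
  note A10 = A9[THEN conjunct2]
  note A11 = A10[THEN conjunct2]
  note A12 = A11[THEN conjunct2]
  note A13 = A12[THEN conjunct2]
  note A14 = A13[THEN conjunct2]
  note A15 = A14[THEN conjunct2]
  note B0 = A0[THEN conjunct1, rule_format]
  note B1 = A1[THEN conjunct1, rule_format]
  note B2 = A2[THEN conjunct1, rule_format]
  note B3 = A3[THEN conjunct1, rule_format]
  note B4 = A4[THEN conjunct1, rule_format]
  note B5 = A5[THEN conjunct1, rule_format]
  note B6 = A6[THEN conjunct1, rule_format]
  note B7 = A7[THEN conjunct1, rule_format]
  note B8 = A8[THEN conjunct1, rule_format]
  note B9 = A9[THEN conjunct1, rule_format]
  note B10 = A10[THEN conjunct1, rule_format]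
  note B11 = A11[THEN conjunct1, rule_format]
  note B12 = A12[THEN conjunct1, rule_format]
  note B13 = A13[THEN conjunct1, rule_format]
  note B14 = A14[THEN conjunct1, rule_format]
  note B15 = A15[rule_format]
  show "equivp (E \<Phi>)"
    by (rule B0)
  show "x \<in> Hom P \<Phi> \<Longrightarrow> valid P \<Phi>"
    by (rule B1)
  show "x \<in> Hom P (pull \<Phi> \<sigma>) \<Longrightarrow> valid P \<Phi> \<Longrightarrow> structural (cl P) \<Phi> \<sigma> \<Longrightarrow> act P \<Phi> \<sigma> x \<in> Hom P \<Phi>"
    by (rule B2)
  show "x \<in> Hom P (pull \<Phi> \<sigma>) \<Longrightarrow> y \<in> Hom P (pull \<Phi> \<sigma>) \<Longrightarrow> valid P \<Phi> \<Longrightarrow> structural (cl P) \<Phi> \<sigma> \<Longrightarrow>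
           E (pull \<Phi> \<sigma>) x y \<Longrightarrow> E \<Phi> (act P \<Phi> \<sigma> x) (act P \<Phi> \<sigma> y)"
    by (rule B3)
  show "R \<in> Ob P \<Longrightarrow> idn P R \<in> Hom P [(R, Neg), (R, Pos)]"
    by (rule B4)
  show "f \<in> Hom P (\<Phi> @ [K]) \<Longrightarrow> g \<in> Hom P (dual K # \<Psi>) \<Longrightarrow> cmp P \<Phi> K \<Psi> g f \<in> Hom P (\<Phi> @ \<Psi>)"
    by (rule B5)
  show "f \<in> Hom P (\<Phi> @ [K]) \<Longrightarrow> f' \<in> Hom P (\<Phi> @ [K]) \<Longrightarrow>
           g \<in> Hom P (dual K # \<Psi>) \<Longrightarrow> g' \<in> Hom P (dual K # \<Psi>) \<Longrightarrow> E (\<Phi> @ [K]) f f' \<Longrightarrow> E (dual K # \<Psi>) g g' \<Longrightarrow>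
           E (\<Phi> @ \<Psi>) (cmp P \<Phi> K \<Psi> g f) (cmp P \<Phi> K \<Psi> g' f')"
    by (rule B6)
  show "x \<in> Hom P \<Phi> \<Longrightarrow> E \<Phi> (act P \<Phi> [0..<length \<Phi>] x) x"
    by (rule B7)
  show "x \<in> Hom P (pull (pull \<Phi> \<sigma>) \<tau>) \<Longrightarrow> valid P \<Phi> \<Longrightarrow> structural (cl P) \<Phi> \<sigma> \<Longrightarrow>
       structural (cl P) (pull \<Phi> \<sigma>) \<tau> \<Longrightarrow>
       E \<Phi> (act P \<Phi> \<sigma> (act P (pull \<Phi> \<sigma>) \<tau> x)) (act P \<Phi> (pull \<sigma> \<tau>) x)"
    by (rule B8)
  show "f \<in> Hom P (\<Phi> @ [(R, Pos)]) \<Longrightarrow> E (\<Phi> @ [(R, Pos)]) (cmp P \<Phi> (R, Pos) [(R, Pos)] (idn P R) f) f"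
    by (rule B9)
  show "g \<in> Hom P ((R, Neg) # \<Psi>) \<Longrightarrow> E ((R, Neg) # \<Psi>) (cmp P [(R, Neg)] (R, Pos) \<Psi> g (idn P R)) g"
    by (rule B10)
  show "f \<in> Hom P (\<Phi> @ [K]) \<Longrightarrow> g \<in> Hom P (dual K # \<Psi> @ [L]) \<Longrightarrow> h \<in> Hom P (dual L # \<Theta>) \<Longrightarrow>
       E (\<Phi> @ \<Psi> @ \<Theta>) (cmp P (\<Phi> @ \<Psi>) L \<Theta> h (cmp P \<Phi> K (\<Psi> @ [L]) g f))
       (cmp P \<Phi> K (\<Psi> @ \<Theta>) (cmp P (dual K # \<Psi>) L \<Theta> h g) f)"
    by (rule B11)
  show "f \<in> Hom P (\<Phi> @ [K]) \<Longrightarrow> g \<in> Hom P (dual K # \<Psi>) \<Longrightarrow>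
       E (\<Phi> @ \<Psi>) (cmp P \<Phi> K \<Psi> g f)
         (act P (\<Phi> @ \<Psi>) ([length \<Phi>..<length \<Phi>+length \<Psi>] @ [0..<length \<Phi>])
            (cmp P \<Psi> (dual K) \<Phi>
               (act P (K # \<Phi>) ([1..<Suc (length \<Phi>)] @ [0]) f)
               (act P (\<Psi> @ [dual K]) (length \<Psi> # [0..<length \<Psi>]) g)))"
    by (rule B12)
  show "f \<in> Hom P (pull \<Phi> \<sigma> @ [K]) \<Longrightarrow> g \<in> Hom P (dual K # \<Psi>) \<Longrightarrow>
       valid P (\<Phi> @ [K]) \<Longrightarrow> structural (cl P) \<Phi> \<sigma> \<Longrightarrow>
         E (\<Phi> @ \<Psi>) (cmp P \<Phi> K \<Psi> g (act P (\<Phi> @ [K]) (\<sigma> @ [length \<Phi>]) f))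
         (act P (\<Phi> @ \<Psi>) (\<sigma> @ [length \<Phi>..<length \<Phi>+length \<Psi>]) (cmp P (pull \<Phi> \<sigma>) K \<Psi> g f))"
    by (rule B13)
  show "f \<in> Hom P \<Phi> \<Longrightarrow> g \<in> Hom P (dual K # \<Psi>) \<Longrightarrow>
       valid P (\<Phi> @ [K]) \<Longrightarrow> neg_nonlinear (cl P) K \<Longrightarrow>
         E (\<Phi> @ \<Psi>) (cmp P \<Phi> K \<Psi> g (act P (\<Phi> @ [K]) [0..<length \<Phi>] f)) (act P (\<Phi> @ \<Psi>) [0..<length \<Phi>] f)"
    by (rule B14)
  show "f \<in> Hom P (\<Phi> @ [K, K]) \<Longrightarrow> g \<in> Hom P (dual K # \<Psi>) \<Longrightarrow> neg_nonlinear (cl P) K \<Longrightarrow>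
         E (\<Phi> @ \<Psi>) (cmp P \<Phi> K \<Psi> g (act P (\<Phi> @ [K]) ([0..<length \<Phi>] @ [length \<Phi>, length \<Phi>]) f))
         (act P (\<Phi> @ \<Psi>) ([0..<length \<Phi>] @ [length \<Phi>..<length \<Phi>+length \<Psi>] @ [length \<Phi>..<length \<Phi>+length \<Psi>])
            (cmp P (\<Phi> @ \<Psi>) K \<Psi> g
               (act P (\<Phi> @ \<Psi> @ [K]) ([0..<length \<Phi>] @ [length \<Phi>+length \<Psi>] @ [length \<Phi>..<length \<Phi>+length \<Psi>])
                  (cmp P (\<Phi> @ [K]) K \<Psi> g f))))"
    by (rule B15)
qed

lemma lnlD:
  assumes "lnl P"
  shows lnl_valid: "x \<in> Hom P \<Phi> \<Longrightarrow> valid P \<Phi>"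
    and lnl_act: "x \<in> Hom P (pull \<Phi> \<sigma>) \<Longrightarrow> valid P \<Phi> \<Longrightarrow> structural (cl P) \<Phi> \<sigma> \<Longrightarrow> act P \<Phi> \<sigma> x \<in> Hom P \<Phi>"
    and lnl_idn: "R \<in> Ob P \<Longrightarrow> idn P R \<in> Hom P [(R, Neg), (R, Pos)]"
    and lnl_cmp: "f \<in> Hom P (\<Phi> @ [K]) \<Longrightarrow> g \<in> Hom P (dual K # \<Psi>) \<Longrightarrow> cmp P \<Phi> K \<Psi> g f \<in> Hom P (\<Phi> @ \<Psi>)"
    and lnl_act_id: "x \<in> Hom P \<Phi> \<Longrightarrow> act P \<Phi> [0..<length \<Phi>] x = x"
    and lnl_act_act: "x \<in> Hom P (pull (pull \<Phi> \<sigma>) \<tau>) \<Longrightarrow> valid P \<Phi> \<Longrightarrow> structural (cl P) \<Phi> \<sigma> \<Longrightarrow>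
       structural (cl P) (pull \<Phi> \<sigma>) \<tau> \<Longrightarrow>
       act P \<Phi> \<sigma> (act P (pull \<Phi> \<sigma>) \<tau> x) = act P \<Phi> (pull \<sigma> \<tau>) x"
    and lnl_unit_pos: "f \<in> Hom P (\<Phi> @ [(R, Pos)]) \<Longrightarrow> cmp P \<Phi> (R, Pos) [(R, Pos)] (idn P R) f = f"
    and lnl_unit_neg: "g \<in> Hom P ((R, Neg) # \<Psi>) \<Longrightarrow> cmp P [(R, Neg)] (R, Pos) \<Psi> g (idn P R) = g"
    and lnl_assoc: "f \<in> Hom P (\<Phi> @ [K]) \<Longrightarrow> g \<in> Hom P (dual K # \<Psi> @ [L]) \<Longrightarrow> h \<in> Hom P (dual L # \<Theta>) \<Longrightarrow>
       cmp P (\<Phi> @ \<Psi>) L \<Theta> h (cmp P \<Phi> K (\<Psi> @ [L]) g f) =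
       cmp P \<Phi> K (\<Psi> @ \<Theta>) (cmp P (dual K # \<Psi>) L \<Theta> h g) f"
    and lnl_swap: "f \<in> Hom P (\<Phi> @ [K]) \<Longrightarrow> g \<in> Hom P (dual K # \<Psi>) \<Longrightarrow>
       cmp P \<Phi> K \<Psi> g f =
         act P (\<Phi> @ \<Psi>) ([length \<Phi>..<length \<Phi>+length \<Psi>] @ [0..<length \<Phi>])
            (cmp P \<Psi> (dual K) \<Phi>
               (act P (K # \<Phi>) ([1..<Suc (length \<Phi>)] @ [0]) f)
               (act P (\<Psi> @ [dual K]) (length \<Psi> # [0..<length \<Psi>]) g))"
    and lnl_str: "f \<in> Hom P (pull \<Phi> \<sigma> @ [K]) \<Longrightarrow> g \<in> Hom P (dual K # \<Psi>) \<Longrightarrow>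
       valid P (\<Phi> @ [K]) \<Longrightarrow> structural (cl P) \<Phi> \<sigma> \<Longrightarrow>
         cmp P \<Phi> K \<Psi> g (act P (\<Phi> @ [K]) (\<sigma> @ [length \<Phi>]) f) =
         act P (\<Phi> @ \<Psi>) (\<sigma> @ [length \<Phi>..<length \<Phi>+length \<Psi>]) (cmp P (pull \<Phi> \<sigma>) K \<Psi> g f)"
    and lnl_weak: "f \<in> Hom P \<Phi> \<Longrightarrow> g \<in> Hom P (dual K # \<Psi>) \<Longrightarrow>
       valid P (\<Phi> @ [K]) \<Longrightarrow> neg_nonlinear (cl P) K \<Longrightarrow>
         cmp P \<Phi> K \<Psi> g (act P (\<Phi> @ [K]) [0..<length \<Phi>] f) = act P (\<Phi> @ \<Psi>) [0..<length \<Phi>] f"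
    and lnl_contr: "f \<in> Hom P (\<Phi> @ [K, K]) \<Longrightarrow> g \<in> Hom P (dual K # \<Psi>) \<Longrightarrow> neg_nonlinear (cl P) K \<Longrightarrow>
         cmp P \<Phi> K \<Psi> g (act P (\<Phi> @ [K]) ([0..<length \<Phi>] @ [length \<Phi>, length \<Phi>]) f) =
         act P (\<Phi> @ \<Psi>) ([0..<length \<Phi>] @ [length \<Phi>..<length \<Phi>+length \<Psi>] @ [length \<Phi>..<length \<Phi>+length \<Psi>])
            (cmp P (\<Phi> @ \<Psi>) K \<Psi> g
               (act P (\<Phi> @ \<Psi> @ [K]) ([0..<length \<Phi>] @ [length \<Phi>+length \<Psi>] @ [length \<Phi>..<length \<Phi>+length \<Psi>])
                  (cmp P (\<Phi> @ [K]) K \<Psi> g f)))"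
proof -
  note * = assms[unfolded lnl_def]
  show "x \<in> Hom P \<Phi> \<Longrightarrow> valid P \<Phi>"
    by (rule upto_valid[OF *])
  show "x \<in> Hom P (pull \<Phi> \<sigma>) \<Longrightarrow> valid P \<Phi> \<Longrightarrow> structural (cl P) \<Phi> \<sigma> \<Longrightarrow> act P \<Phi> \<sigma> x \<in> Hom P \<Phi>"
    by (rule upto_act[OF *])
  show "R \<in> Ob P \<Longrightarrow> idn P R \<in> Hom P [(R, Neg), (R, Pos)]"
    by (rule upto_idn[OF *])
  show "f \<in> Hom P (\<Phi> @ [K]) \<Longrightarrow> g \<in> Hom P (dual K # \<Psi>) \<Longrightarrow> cmp P \<Phi> K \<Psi> g f \<in> Hom P (\<Phi> @ \<Psi>)"
    by (rule upto_cmp[OF *])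
  show "x \<in> Hom P \<Phi> \<Longrightarrow> act P \<Phi> [0..<length \<Phi>] x = x"
    by (rule upto_act_id[OF *])
  show "x \<in> Hom P (pull (pull \<Phi> \<sigma>) \<tau>) \<Longrightarrow> valid P \<Phi> \<Longrightarrow> structural (cl P) \<Phi> \<sigma> \<Longrightarrow>
       structural (cl P) (pull \<Phi> \<sigma>) \<tau> \<Longrightarrow>
       act P \<Phi> \<sigma> (act P (pull \<Phi> \<sigma>) \<tau> x) = act P \<Phi> (pull \<sigma> \<tau>) x"
    by (rule upto_act_act[OF *])
  show "f \<in> Hom P (\<Phi> @ [(R, Pos)]) \<Longrightarrow> cmp P \<Phi> (R, Pos) [(R, Pos)] (idn P R) f = f"
    by (rule upto_unit_pos[OF *])
  show "g \<in> Hom P ((R, Neg) # \<Psi>) \<Longrightarrow> cmp P [(R, Neg)] (R, Pos) \<Psi> g (idn P R) = g"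
    by (rule upto_unit_neg[OF *])
  show "f \<in> Hom P (\<Phi> @ [K]) \<Longrightarrow> g \<in> Hom P (dual K # \<Psi> @ [L]) \<Longrightarrow> h \<in> Hom P (dual L # \<Theta>) \<Longrightarrow>
       cmp P (\<Phi> @ \<Psi>) L \<Theta> h (cmp P \<Phi> K (\<Psi> @ [L]) g f) =
       cmp P \<Phi> K (\<Psi> @ \<Theta>) (cmp P (dual K # \<Psi>) L \<Theta> h g) f"
    by (rule upto_assoc[OF *])
  show "f \<in> Hom P (\<Phi> @ [K]) \<Longrightarrow> g \<in> Hom P (dual K # \<Psi>) \<Longrightarrow>
       cmp P \<Phi> K \<Psi> g f =
         act P (\<Phi> @ \<Psi>) ([length \<Phi>..<length \<Phi>+length \<Psi>] @ [0..<length \<Phi>])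
            (cmp P \<Psi> (dual K) \<Phi>
               (act P (K # \<Phi>) ([1..<Suc (length \<Phi>)] @ [0]) f)
               (act P (\<Psi> @ [dual K]) (length \<Psi> # [0..<length \<Psi>]) g))"
    by (rule upto_swap[OF *])
  show "f \<in> Hom P (pull \<Phi> \<sigma> @ [K]) \<Longrightarrow> g \<in> Hom P (dual K # \<Psi>) \<Longrightarrow>
       valid P (\<Phi> @ [K]) \<Longrightarrow> structural (cl P) \<Phi> \<sigma> \<Longrightarrow>
         cmp P \<Phi> K \<Psi> g (act P (\<Phi> @ [K]) (\<sigma> @ [length \<Phi>]) f) =
         act P (\<Phi> @ \<Psi>) (\<sigma> @ [length \<Phi>..<length \<Phi>+length \<Psi>]) (cmp P (pull \<Phi> \<sigma>) K \<Psi> g f)"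
    by (rule upto_str[OF *])
  show "f \<in> Hom P \<Phi> \<Longrightarrow> g \<in> Hom P (dual K # \<Psi>) \<Longrightarrow>
       valid P (\<Phi> @ [K]) \<Longrightarrow> neg_nonlinear (cl P) K \<Longrightarrow>
         cmp P \<Phi> K \<Psi> g (act P (\<Phi> @ [K]) [0..<length \<Phi>] f) = act P (\<Phi> @ \<Psi>) [0..<length \<Phi>] f"
    by (rule upto_weak[OF *])
  show "f \<in> Hom P (\<Phi> @ [K, K]) \<Longrightarrow> g \<in> Hom P (dual K # \<Psi>) \<Longrightarrow> neg_nonlinear (cl P) K \<Longrightarrow>
         cmp P \<Phi> K \<Psi> g (act P (\<Phi> @ [K]) ([0..<length \<Phi>] @ [length \<Phi>, length \<Phi>]) f) =
         act P (\<Phi> @ \<Psi>) ([0..<length \<Phi>] @ [length \<Phi>..<length \<Phi>+length \<Psi>] @ [length \<Phi>..<length \<Phi>+length \<Psi>])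
            (cmp P (\<Phi> @ \<Psi>) K \<Psi> g
               (act P (\<Phi> @ \<Psi> @ [K]) ([0..<length \<Phi>] @ [length \<Phi>+length \<Psi>] @ [length \<Phi>..<length \<Phi>+length \<Psi>])
                  (cmp P (\<Phi> @ [K]) K \<Psi> g f)))"
    by (rule upto_contr[OF *])
qed

section \<open>Signed lists, functors and admissibility\<close>

lemma smap_simps [simp]:
  "smap h [] = []" "smap h (K # \<Phi>) = map_prod h id K # smap h \<Phi>"
  "smap h (\<Phi> @ \<Psi>) = smap h \<Phi> @ smap h \<Psi>" "length (smap h \<Phi>) = length \<Phi>"
  "smap h \<Phi> = [] \<longleftrightarrow> \<Phi> = []"
  by (auto simp: smap_def)

lemma smap_smap: "smap g (smap h \<Phi>) = smap (\<lambda>R. g (h R)) \<Phi>"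
  by (induction \<Phi>) auto

lemma smap_cong: "(\<And>R. R \<in> fst ` set \<Phi> \<Longrightarrow> g R = h R) \<Longrightarrow> smap g \<Phi> = smap h \<Phi>"
  by (induction \<Phi>) (auto simp: map_prod_def split: prod.splits)

lemma smap_ident [simp]: "smap (\<lambda>R. R) \<Phi> = \<Phi>"
  by (induction \<Phi>) auto

lemma smap_idI: "(\<And>R. R \<in> fst ` set \<Phi> \<Longrightarrow> h R = R) \<Longrightarrow> smap h \<Phi> = \<Phi>"
  using smap_cong[of \<Phi> h "\<lambda>R. R"] by simp

lemma fst_set_smap: "fst ` set (smap h \<Phi>) = h ` fst ` set \<Phi>"
  by (induction \<Phi>) auto

lemma pull_smap: "\<forall>j\<in>set \<sigma>. j < length \<Phi> \<Longrightarrow> pull (smap h \<Phi>) \<sigma> = smap h (pull \<Phi> \<sigma>)"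
  by (auto simp: pull_def smap_def)

lemma pull_smap_structural: "structural c \<Phi> \<sigma> \<Longrightarrow> pull (smap h \<Phi>) \<sigma> = smap h (pull \<Phi> \<sigma>)"
  by (rule pull_smap) (auto simp: structural_def)

lemma dual_map_prod: "dual (map_prod h id K) = map_prod h id (dual K)"
  by (cases K) (auto simp: dual_def)

lemma fst_dual [simp]: "fst (dual K) = fst K" and snd_dual [simp]: "snd (dual K) = flip (snd K)"
  by (auto simp: dual_def)

lemma admissible_smap:
  assumes "\<And>R. R \<in> fst ` set \<Phi> \<Longrightarrow> c' (h R) = c R"
  shows "admissible c' (smap h \<Phi>) = admissible c \<Phi>"
proof -
  have "filter (pos_nonlinear c') (smap h \<Phi>) = smap h (filter (pos_nonlinear c) \<Phi>)"
    using assms by (induction \<Phi>) (auto simp: pos_nonlinear_def)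
  moreover have "(\<exists>K\<in>set (smap h \<Phi>). pos_nonlinear c' K) = (\<exists>K\<in>set \<Phi>. pos_nonlinear c K)"
    using assms by (auto simp: pos_nonlinear_def smap_def)
  moreover have "(\<forall>K\<in>set (smap h \<Phi>). c' (fst K) \<noteq> Linear) = (\<forall>K\<in>set \<Phi>. c (fst K) \<noteq> Linear)"
    using assms by (auto simp: smap_def)
  ultimately show ?thesis by (simp add: admissible_def)
qed

lemma structural_smap:
  assumes "\<And>R. R \<in> fst ` set \<Phi> \<Longrightarrow> c' (h R) = c R"
  shows "structural c' (smap h \<Phi>) \<sigma> = structural c \<Phi> \<sigma>"
proof -
  have "neg_nonlinear c' (smap h \<Phi> ! j) = neg_nonlinear c (\<Phi> ! j)" if "j < length \<Phi>" for j
    using that assms[of "fst (\<Phi> ! j)"] by (auto simp: smap_def neg_nonlinear_def)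
  then show ?thesis by (auto simp: structural_def)
qed

lemma functorD:
  assumes "is_functor P Q F"
  shows functor_ob: "R \<in> Ob P \<Longrightarrow> fob F R \<in> Ob Q"
    and functor_cl: "R \<in> Ob P \<Longrightarrow> cl Q (fob F R) = cl P R"
    and functor_hom: "x \<in> Hom P \<Phi> \<Longrightarrow> fmor F \<Phi> x \<in> Hom Q (smap (fob F) \<Phi>)"
    and functor_act: "x \<in> Hom P (pull \<Phi> \<sigma>) \<Longrightarrow> valid P \<Phi> \<Longrightarrow> structural (cl P) \<Phi> \<sigma> \<Longrightarrow>
       fmor F \<Phi> (act P \<Phi> \<sigma> x) = act Q (smap (fob F) \<Phi>) \<sigma> (fmor F (pull \<Phi> \<sigma>) x)"
    and functor_idn: "R \<in> Ob P \<Longrightarrow> fmor F [(R, Neg), (R, Pos)] (idn P R) = idn Q (fob F R)"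
    and functor_cmp: "f \<in> Hom P (\<Phi> @ [K]) \<Longrightarrow> g \<in> Hom P (dual K # \<Psi>) \<Longrightarrow>
       fmor F (\<Phi> @ \<Psi>) (cmp P \<Phi> K \<Psi> g f) =
       cmp Q (smap (fob F) \<Phi>) (map_prod (fob F) id K) (smap (fob F) \<Psi>)
         (fmor F (dual K # \<Psi>) g) (fmor F (\<Phi> @ [K]) f)"
    and functor_ob_undef: "R \<notin> Ob P \<Longrightarrow> fob F R = undefined"
    and functor_mor_undef: "x \<notin> Hom P \<Phi> \<Longrightarrow> fmor F \<Phi> x = undefined"
  using assms unfolding is_functor_def by blast+

lemma functorI:
  assumes "\<And>R. R \<in> Ob P \<Longrightarrow> fob F R \<in> Ob Q"
    and "\<And>R. R \<in> Ob P \<Longrightarrow> cl Q (fob F R) = cl P R"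
    and "\<And>\<Phi> x. x \<in> Hom P \<Phi> \<Longrightarrow> fmor F \<Phi> x \<in> Hom Q (smap (fob F) \<Phi>)"
    and "\<And>\<Phi> \<sigma> x. x \<in> Hom P (pull \<Phi> \<sigma>) \<Longrightarrow> valid P \<Phi> \<Longrightarrow> structural (cl P) \<Phi> \<sigma> \<Longrightarrow>
       fmor F \<Phi> (act P \<Phi> \<sigma> x) = act Q (smap (fob F) \<Phi>) \<sigma> (fmor F (pull \<Phi> \<sigma>) x)"
    and "\<And>R. R \<in> Ob P \<Longrightarrow> fmor F [(R, Neg), (R, Pos)] (idn P R) = idn Q (fob F R)"
    and "\<And>\<Phi> K \<Psi> f g. f \<in> Hom P (\<Phi> @ [K]) \<Longrightarrow> g \<in> Hom P (dual K # \<Psi>) \<Longrightarrow>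
       fmor F (\<Phi> @ \<Psi>) (cmp P \<Phi> K \<Psi> g f) =
       cmp Q (smap (fob F) \<Phi>) (map_prod (fob F) id K) (smap (fob F) \<Psi>)
         (fmor F (dual K # \<Psi>) g) (fmor F (\<Phi> @ [K]) f)"
    and "\<And>R. R \<notin> Ob P \<Longrightarrow> fob F R = undefined"
    and "\<And>\<Phi> x. x \<notin> Hom P \<Phi> \<Longrightarrow> fmor F \<Phi> x = undefined"
  shows "is_functor P Q F"
  using assms unfolding is_functor_def by blast

lemma functor_valid:
  assumes "is_functor P Q F" and "valid P \<Phi>"
  shows "valid Q (smap (fob F) \<Phi>)"
proof -
  have "\<And>R. R \<in> fst ` set \<Phi> \<Longrightarrow> R \<in> Ob P" using assms(2) by (auto simp: valid_def)
  moreover from this have "admissible (cl Q) (smap (fob F) \<Phi>) = admissible (cl P) \<Phi>"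
    by (intro admissible_smap) (use functor_cl[OF assms(1)] in blast)
  ultimately show ?thesis
    using assms functor_ob[OF assms(1)] by (auto simp: valid_def fst_set_smap)
qed

lemma functor_structural:
  assumes "is_functor P Q F" and "valid P \<Phi>"
  shows "structural (cl Q) (smap (fob F) \<Phi>) \<sigma> = structural (cl P) \<Phi> \<sigma>"
  by (rule structural_smap) (use assms functor_cl[OF assms(1)] in \<open>auto simp: valid_def\<close>)

text \<open>Functors are undefined off their domain, so agreement on the carrier gives equality in
  HOL. The codomains may differ, since the record of a functor does not mention them.\<close>

lemma functor_eqI:
  assumes "is_functor P Q F" "is_functor P Q' G"
    and "\<And>R. R \<in> Ob P \<Longrightarrow> fob F R = fob G R" "\<And>\<Phi> x. x \<in> Hom P \<Phi> \<Longrightarrow> fmor F \<Phi> x = fmor G \<Phi> x"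
  shows "F = G"
proof -
  have "fob F = fob G"
    using assms(3) functor_ob_undef[OF assms(1)] functor_ob_undef[OF assms(2)] by (metis ext)
  moreover have "fmor F = fmor G"
    using assms(4) functor_mor_undef[OF assms(1)] functor_mor_undef[OF assms(2)] by (metis ext)
  ultimately show ?thesis by simp
qed

lemma mk_fctr_simps:
  "R \<in> Ob P \<Longrightarrow> fob (mk_fctr P h k) R = h R"
  "x \<in> Hom P \<Phi> \<Longrightarrow> fmor (mk_fctr P h k) \<Phi> x = k \<Phi> x"
  "R \<notin> Ob P \<Longrightarrow> fob (mk_fctr P h k) R = undefined"
  "x \<notin> Hom P \<Phi> \<Longrightarrow> fmor (mk_fctr P h k) \<Phi> x = undefined"
  by (auto simp: mk_fctr_def)

lemma fcomp_simps:
  "R \<in> Ob P \<Longrightarrow> fob (fcomp P G F) R = fob G (fob F R)"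
  "x \<in> Hom P \<Phi> \<Longrightarrow> fmor (fcomp P G F) \<Phi> x = fmor G (smap (fob F) \<Phi>) (fmor F \<Phi> x)"
  by (auto simp: fcomp_def mk_fctr_simps)

lemma fincl_simps:
  "R \<in> Ob P \<Longrightarrow> fob (fincl P) R = R" "x \<in> Hom P \<Phi> \<Longrightarrow> fmor (fincl P) \<Phi> x = x"
  by (auto simp: fincl_def mk_fctr_simps)

lemma mk_fctr_eqI:
  assumes "\<And>R. R \<in> Ob P \<Longrightarrow> h R = h' R" "\<And>\<Phi> x. x \<in> Hom P \<Phi> \<Longrightarrow> k \<Phi> x = k' \<Phi> x"
  shows "mk_fctr P h k = mk_fctr P h' k'"
  using assms by (auto simp: mk_fctr_def fun_eq_iff)

lemma fcomp_eqI:
  assumes "\<And>R. R \<in> Ob P \<Longrightarrow> fob G (fob F R) = fob G' (fob F' R)"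
    and "\<And>\<Phi> x. x \<in> Hom P \<Phi> \<Longrightarrow>
          fmor G (smap (fob F) \<Phi>) (fmor F \<Phi> x) = fmor G' (smap (fob F') \<Phi>) (fmor F' \<Phi> x)"
  shows "fcomp P G F = fcomp P G' F'"
  unfolding fcomp_def by (rule mk_fctr_eqI) (use assms in auto)

lemma fcomp_eq_functorI:
  assumes "is_functor P Q H"
    and "\<And>R. R \<in> Ob P \<Longrightarrow> fob G (fob F R) = fob H R"
    and "\<And>\<Phi> x. x \<in> Hom P \<Phi> \<Longrightarrow> fmor G (smap (fob F) \<Phi>) (fmor F \<Phi> x) = fmor H \<Phi> x"
  shows "fcomp P G F = H"
proof -
  have "fob (fcomp P G F) R = fob H R" for R
    using functor_ob_undef[OF assms(1)] assms(2) by (cases "R \<in> Ob P") (auto simp: fcomp_def mk_fctr_simps)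
  moreover have "fmor (fcomp P G F) \<Phi> x = fmor H \<Phi> x" for \<Phi> x
    using functor_mor_undef[OF assms(1)] assms(3) by (cases "x \<in> Hom P \<Phi>") (auto simp: fcomp_def mk_fctr_simps)
  ultimately show ?thesis by (simp add: fun_eq_iff)
qed

lemma smap_fctr_cong:
  assumes "valid P \<Phi>" "\<And>R. R \<in> Ob P \<Longrightarrow> g R = h R"
  shows "smap g \<Phi> = smap h \<Phi>"
  by (rule smap_cong) (use assms in \<open>auto simp: valid_def\<close>)

lemma valid_append_dual:
  assumes "valid P (\<Phi> @ [K])" "valid P (dual K # \<Psi>)"
  shows "fst ` set (\<Phi> @ \<Psi>) \<subseteq> Ob P"
  using assms by (auto simp: valid_def)

text \<open>If the class of \<open>K\<close> is nonlinear, exactly one of \<open>K\<close> and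
  \<open>dual K\<close> is positive nonlinear; it takes the single slot of its list, whose remaining
  entries are then neither linear nor positive nonlinear. If the class is linear, neither list can
  contain a positive nonlinear object.\<close>

lemma admissible_cut:
  assumes "admissible c (\<Phi> @ [K])" "admissible c (dual K # \<Psi>)"
  shows "admissible c (\<Phi> @ \<Psi>)"
proof (cases "c (fst K) = Nonlinear")
  case True
  show ?thesis
  proof (cases "snd K")
    case Pos
    with True have K: "pos_nonlinear c K" "\<not> pos_nonlinear c (dual K)"
      by (auto simp: pos_nonlinear_def)
    with assms have 1: "\<forall>K\<in>set \<Phi>. c (fst K) \<noteq> Linear" "\<forall>K\<in>set \<Phi>. \<not> pos_nonlinear c K"
      by (auto simp: admissible_def filter_empty_conv)
    with K assms show ?thesis by (auto simp: admissible_def)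
  next
    case Neg
    with True have K: "pos_nonlinear c (dual K)" "\<not> pos_nonlinear c K"
      by (auto simp: pos_nonlinear_def)
    with assms have 1: "\<forall>K\<in>set \<Psi>. c (fst K) \<noteq> Linear" "\<forall>K\<in>set \<Psi>. \<not> pos_nonlinear c K"
      by (auto simp: admissible_def filter_empty_conv)
    with K assms show ?thesis by (auto simp: admissible_def)
  qed
next
  case False
  then have "c (fst K) = Linear" by (cases "c (fst K)") auto
  then have "\<And>L. L \<in> set \<Phi> \<union> set \<Psi> \<Longrightarrow> \<not> pos_nonlinear c L"
    using assms by (auto simp: admissible_def)
  then have "filter (pos_nonlinear c) (\<Phi> @ \<Psi>) = []" "\<not> (\<exists>K\<in>set (\<Phi> @ \<Psi>). pos_nonlinear c K)"
    by (auto simp: filter_empty_conv)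
  then show ?thesis unfolding admissible_def by simp
qed

section \<open>Colimits of sketches are generated by their legs\<close>

text \<open>An induction principle on morphisms: a colimit or a presented polycategory is exhausted
  by every closed predicate that contains its generators. \<open>M\<close> takes the list as an
  argument because hom-sets of different lists may overlap.\<close>

definition op_closed :: "('o, 'm) lnl \<Rightarrow> ('o signed list \<Rightarrow> 'm \<Rightarrow> bool) \<Rightarrow> bool" where
  "op_closed P M \<longleftrightarrow>
    (\<forall>R\<in>Ob P. M [(R, Neg), (R, Pos)] (idn P R)) \<and>
    (\<forall>\<Phi> \<sigma>. \<forall>x\<in>Hom P (pull \<Phi> \<sigma>). M (pull \<Phi> \<sigma>) x \<longrightarrow> valid P \<Phi> \<longrightarrow> structural (cl P) \<Phi> \<sigma> \<longrightarrow>
       M \<Phi> (act P \<Phi> \<sigma> x)) \<and>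
    (\<forall>\<Phi> K \<Psi>. \<forall>f\<in>Hom P (\<Phi> @ [K]). \<forall>g\<in>Hom P (dual K # \<Psi>). M (\<Phi> @ [K]) f \<longrightarrow> M (dual K # \<Psi>) g \<longrightarrow>
       M (\<Phi> @ \<Psi>) (cmp P \<Phi> K \<Psi> g f))"

lemma op_closedI:
  assumes "\<And>R. R \<in> Ob P \<Longrightarrow> M [(R, Neg), (R, Pos)] (idn P R)"
    and "\<And>\<Phi> \<sigma> x. x \<in> Hom P (pull \<Phi> \<sigma>) \<Longrightarrow> M (pull \<Phi> \<sigma>) x \<Longrightarrow> valid P \<Phi> \<Longrightarrow> structural (cl P) \<Phi> \<sigma> \<Longrightarrow>
       M \<Phi> (act P \<Phi> \<sigma> x)"
    and "\<And>\<Phi> K \<Psi> f g. f \<in> Hom P (\<Phi> @ [K]) \<Longrightarrow> g \<in> Hom P (dual K # \<Psi>) \<Longrightarrow> M (\<Phi> @ [K]) f \<Longrightarrow>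
       M (dual K # \<Psi>) g \<Longrightarrow> M (\<Phi> @ \<Psi>) (cmp P \<Phi> K \<Psi> g f)"
  shows "op_closed P M"
  using assms unfolding op_closed_def by blast

lemma op_closedD:
  assumes "op_closed P M"
  shows op_closed_idn: "R \<in> Ob P \<Longrightarrow> M [(R, Neg), (R, Pos)] (idn P R)"
    and op_closed_act: "x \<in> Hom P (pull \<Phi> \<sigma>) \<Longrightarrow> M (pull \<Phi> \<sigma>) x \<Longrightarrow> valid P \<Phi> \<Longrightarrow> structural (cl P) \<Phi> \<sigma> \<Longrightarrow>
       M \<Phi> (act P \<Phi> \<sigma> x)"
    and op_closed_cmp: "f \<in> Hom P (\<Phi> @ [K]) \<Longrightarrow> g \<in> Hom P (dual K # \<Psi>) \<Longrightarrow> M (\<Phi> @ [K]) f \<Longrightarrow>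
       M (dual K # \<Psi>) g \<Longrightarrow> M (\<Phi> @ \<Psi>) (cmp P \<Phi> K \<Psi> g f)"
  using assms unfolding op_closed_def by blast+

text \<open>The part of the axioms of an LNL polycategory that is immediate for presented ones.\<close>

definition lnl_ops :: "('o, 'm) lnl \<Rightarrow> bool" where
  "lnl_ops P \<longleftrightarrow> (\<forall>\<Phi>. \<forall>x\<in>Hom P \<Phi>. valid P \<Phi>) \<and> op_closed P (\<lambda>\<Phi> x. x \<in> Hom P \<Phi>)"

lemma lnl_opsD:
  assumes "lnl_ops P"
  shows lnl_ops_valid: "x \<in> Hom P \<Phi> \<Longrightarrow> valid P \<Phi>"
    and lnl_ops_idn: "R \<in> Ob P \<Longrightarrow> idn P R \<in> Hom P [(R, Neg), (R, Pos)]"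
    and lnl_ops_act: "x \<in> Hom P (pull \<Phi> \<sigma>) \<Longrightarrow> valid P \<Phi> \<Longrightarrow> structural (cl P) \<Phi> \<sigma> \<Longrightarrow> act P \<Phi> \<sigma> x \<in> Hom P \<Phi>"
    and lnl_ops_cmp: "f \<in> Hom P (\<Phi> @ [K]) \<Longrightarrow> g \<in> Hom P (dual K # \<Psi>) \<Longrightarrow> cmp P \<Phi> K \<Psi> g f \<in> Hom P (\<Phi> @ \<Psi>)"
  using assms unfolding lnl_ops_def op_closed_def by blast+

lemma lnl_lnl_ops: "lnl P \<Longrightarrow> lnl_ops P"
  unfolding lnl_ops_def by (auto intro!: op_closedI intro: lnlD)

text \<open>The typing half of \<open>is_functor\<close>. It is what is established for the
  inclusions and codiagonals of expansions, and it suffices for composing into a thin polycategory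
  and for following objects and generators.\<close>

definition carries :: "('o, 'm) lnl \<Rightarrow> ('o2, 'm2) lnl \<Rightarrow> ('o, 'm, 'o2, 'm2) fctr \<Rightarrow> bool" where
  "carries P Q F \<longleftrightarrow>
    (\<forall>R\<in>Ob P. fob F R \<in> Ob Q \<and> cl Q (fob F R) = cl P R) \<and>
    (\<forall>\<Phi>. \<forall>x\<in>Hom P \<Phi>. fmor F \<Phi> x \<in> Hom Q (smap (fob F) \<Phi>))"

lemma carriesD:
  assumes "carries P Q F"
  shows carries_ob: "R \<in> Ob P \<Longrightarrow> fob F R \<in> Ob Q"
    and carries_cl: "R \<in> Ob P \<Longrightarrow> cl Q (fob F R) = cl P R"
    and carries_hom: "x \<in> Hom P \<Phi> \<Longrightarrow> fmor F \<Phi> x \<in> Hom Q (smap (fob F) \<Phi>)"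
  using assms unfolding carries_def by blast+

lemma functor_carries: "is_functor P Q F \<Longrightarrow> carries P Q F"
  unfolding carries_def by (auto intro: functorD)

text \<open>A functor turns operations of \<open>P\<close> into operations of \<open>Q\<close>.
  Hence a closed predicate on a colimit can be checked along a leg on generators of the domain of
  that leg.\<close>

lemma op_closed_preimage:
  assumes F: "is_functor P Q F" and M: "op_closed Q M"
  shows "op_closed P (\<lambda>\<Phi> x. M (smap (fob F) \<Phi>) (fmor F \<Phi> x))"
proof (rule op_closedI)
  show "M (smap (fob F) [(R, Neg), (R, Pos)]) (fmor F [(R, Neg), (R, Pos)] (idn P R))" if "R \<in> Ob P" for R
    using op_closed_idn[OF M functor_ob[OF F that]] functor_idn[OF F that] by simp
  show "M (smap (fob F) \<Phi>) (fmor F \<Phi> (act P \<Phi> \<sigma> x))"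
    if "x \<in> Hom P (pull \<Phi> \<sigma>)" "M (smap (fob F) (pull \<Phi> \<sigma>)) (fmor F (pull \<Phi> \<sigma>) x)" "valid P \<Phi>"
      "structural (cl P) \<Phi> \<sigma>" for \<Phi> \<sigma> x
    using that functor_hom[OF F that(1)] functor_valid[OF F] functor_structural[OF F]
    by (simp add: functor_act[OF F] op_closed_act[OF M] flip: pull_smap_structural)
  show "M (smap (fob F) (\<Phi> @ \<Psi>)) (fmor F (\<Phi> @ \<Psi>) (cmp P \<Phi> K \<Psi> g f))"
    if "f \<in> Hom P (\<Phi> @ [K])" "g \<in> Hom P (dual K # \<Psi>)" "M (smap (fob F) (\<Phi> @ [K])) (fmor F (\<Phi> @ [K]) f)"
      "M (smap (fob F) (dual K # \<Psi>)) (fmor F (dual K # \<Psi>) g)" for \<Phi> K \<Psi> f g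
    using that functor_hom[OF F that(1)] functor_hom[OF F that(2)]
    by (auto simp: functor_cmp[OF F] dual_map_prod[symmetric] intro: op_closed_cmp[OF M])
qed

text \<open>Combined with a generation lemma this gives uniqueness of a functor from its values at
  generators. Agreement on objects comes first, since otherwise the operations would be compared at
  different lists.\<close>

lemma op_closed_equalizer:
  assumes "is_functor P Q F" "is_functor P Q G" "\<And>R. R \<in> Ob P \<Longrightarrow> fob F R = fob G R" "lnl_ops P"
  shows "op_closed P (\<lambda>\<Phi> x. fmor F \<Phi> x = fmor G \<Phi> x)"
proof (rule op_closedI)
  note c = smap_fctr_cong[OF _ assms(3)]
  note F = functorD[OF assms(1)] and G = functorD[OF assms(2)]
  show "fmor F [(R, Neg), (R, Pos)] (idn P R) = fmor G [(R, Neg), (R, Pos)] (idn P R)" if "R \<in> Ob P" for R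
    using that F(5) G(5) assms(3) by metis
  show "fmor F \<Phi> (act P \<Phi> \<sigma> x) = fmor G \<Phi> (act P \<Phi> \<sigma> x)"
    if "x \<in> Hom P (pull \<Phi> \<sigma>)" "fmor F (pull \<Phi> \<sigma>) x = fmor G (pull \<Phi> \<sigma>) x" "valid P \<Phi>"
      "structural (cl P) \<Phi> \<sigma>" for \<Phi> \<sigma> x
    using that F(4)[OF that(1,3,4)] G(4)[OF that(1,3,4)] c[OF that(3)] by simp
  show "fmor F (\<Phi> @ \<Psi>) (cmp P \<Phi> K \<Psi> g f) = fmor G (\<Phi> @ \<Psi>) (cmp P \<Phi> K \<Psi> g f)"
    if "f \<in> Hom P (\<Phi> @ [K])" "g \<in> Hom P (dual K # \<Psi>)" "fmor F (\<Phi> @ [K]) f = fmor G (\<Phi> @ [K]) f"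
      "fmor F (dual K # \<Psi>) g = fmor G (dual K # \<Psi>) g" for \<Phi> K \<Psi> f g
    using that F(6)[OF that(1,2)] G(6)[OF that(1,2)] c[OF lnl_ops_valid[OF assms(4) that(1)]]
      c[OF lnl_ops_valid[OF assms(4) that(2)]] by (simp add: map_prod_def split: prod.splits)
qed

lemma functor_fcomp:
  assumes F: "is_functor P Q F" and G: "is_functor Q R G" and P: "lnl_ops P"
  shows "is_functor P R (fcomp P G F)"
proof -
  note s = fcomp_simps
  note F' = functorD[OF F] and G' = functorD[OF G] and P' = lnl_opsD[OF P]
  have m: "smap (fob (fcomp P G F)) \<Phi> = smap (fob G) (smap (fob F) \<Phi>)" if "valid P \<Phi>" for \<Phi>
    unfolding smap_smap by (rule smap_fctr_cong[OF that]) (simp add: s)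
  show ?thesis
  proof (rule functorI)
    fix \<Phi> \<sigma> x assume a: "x \<in> Hom P (pull \<Phi> \<sigma>)" "valid P \<Phi>" "structural (cl P) \<Phi> \<sigma>"
    then have "fmor G (smap (fob F) \<Phi>) (act Q (smap (fob F) \<Phi>) \<sigma> (fmor F (pull \<Phi> \<sigma>) x)) =
      act R (smap (fob G) (smap (fob F) \<Phi>)) \<sigma> (fmor G (pull (smap (fob F) \<Phi>) \<sigma>) (fmor F (pull \<Phi> \<sigma>) x))"
      by (intro G') (use a F'(3)[OF a(1)] functor_valid[OF F] functor_structural[OF F] in
          \<open>auto simp: pull_smap_structural\<close>)
    then show "fmor (fcomp P G F) \<Phi> (act P \<Phi> \<sigma> x) =
      act R (smap (fob (fcomp P G F)) \<Phi>) \<sigma> (fmor (fcomp P G F) (pull \<Phi> \<sigma>) x)"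
      using a by (simp add: s P' F' m pull_smap_structural)
  next
    fix \<Phi> K \<Psi> f g assume a: "f \<in> Hom P (\<Phi> @ [K])" "g \<in> Hom P (dual K # \<Psi>)"
    let ?s = "smap (fob F)" and ?K = "map_prod (fob F) id K"
    have b: "fmor F (\<Phi> @ [K]) f \<in> Hom Q (?s \<Phi> @ [?K])" "fmor F (dual K # \<Psi>) g \<in> Hom Q (dual ?K # ?s \<Psi>)"
      using F'(3)[OF a(1)] F'(3)[OF a(2)] by (simp_all add: dual_map_prod)
    have K: "fst K \<in> Ob P" using P'(1)[OF a(1)] by (auto simp: valid_def)
    have K': "map_prod (fob (fcomp P G F)) id K = map_prod (fob G) id ?K"
      using K by (cases K) (simp add: s)
    have v: "smap (fob (fcomp P G F)) \<Phi> = smap (fob G) (?s \<Phi>)" "smap (fob (fcomp P G F)) \<Psi> = smap (fob G) (?s \<Psi>)"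
      using m[OF P'(1)[OF a(1)]] m[OF P'(1)[OF a(2)]] by auto
    show "fmor (fcomp P G F) (\<Phi> @ \<Psi>) (cmp P \<Phi> K \<Psi> g f) =
       cmp R (smap (fob (fcomp P G F)) \<Phi>) (map_prod (fob (fcomp P G F)) id K) (smap (fob (fcomp P G F)) \<Psi>)
         (fmor (fcomp P G F) (dual K # \<Psi>) g) (fmor (fcomp P G F) (\<Phi> @ [K]) f)"
      using a b G'(6)[OF b] K'
      by (simp add: s P' F' v dual_map_prod)
  next
    fix S assume "S \<in> Ob P"
    then show "fmor (fcomp P G F) [(S, Neg), (S, Pos)] (idn P S) = idn R (fob (fcomp P G F) S)"
      using G'(5)[OF F'(1)] by (simp add: s P' F')
  next
    fix \<Phi> x assume "x \<in> Hom P \<Phi>"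
    then show "fmor (fcomp P G F) \<Phi> x \<in> Hom R (smap (fob (fcomp P G F)) \<Phi>)"
      using m[OF P'(1)] F' G' by (simp add: s)
  qed (auto simp: s F' G' fcomp_def mk_fctr_simps)
qed

section \<open>Sub-polycategories and sub-sketches\<close>

definition sub_lnl :: "('o, 'm) lnl \<Rightarrow> 'o set \<Rightarrow> ('o signed list \<Rightarrow> 'm \<Rightarrow> bool) \<Rightarrow> ('o, 'm) lnl" where
  "sub_lnl P O' M = P\<lparr>Ob := O', Hom := \<lambda>\<Phi>. {x \<in> Hom P \<Phi>. fst ` set \<Phi> \<subseteq> O' \<and> M \<Phi> x}\<rparr>"

lemma sub_lnl_simps [simp]:
  "Ob (sub_lnl P O' M) = O'" "cl (sub_lnl P O' M) = cl P"
  "Hom (sub_lnl P O' M) \<Phi> = {x \<in> Hom P \<Phi>. fst ` set \<Phi> \<subseteq> O' \<and> M \<Phi> x}"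
  "act (sub_lnl P O' M) = act P" "idn (sub_lnl P O' M) = idn P" "cmp (sub_lnl P O' M) = cmp P"
  by (auto simp: sub_lnl_def)

lemma valid_sub_lnl: "O' \<subseteq> Ob P \<Longrightarrow> valid (sub_lnl P O' M) \<Phi> \<longleftrightarrow> valid P \<Phi> \<and> fst ` set \<Phi> \<subseteq> O'"
  by (auto simp: valid_def)

lemma set_pull: "structural c \<Phi> \<sigma> \<Longrightarrow> set (pull \<Phi> \<sigma>) \<subseteq> set \<Phi>"
  by (auto simp: pull_def structural_def)

text \<open>The operations are unchanged and the laws are equations, so these restrict from
  \<open>P\<close>; what has to be checked is closure of the smaller hom-sets.\<close>

lemma lnl_sub_lnl:
  assumes P: "lnl P" and M: "op_closed P M" and O': "O' \<subseteq> Ob P"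
  shows "lnl (sub_lnl P O' M)"
  unfolding lnl_def
proof (rule lnl_uptoI, simp_all only: sub_lnl_simps valid_sub_lnl[OF O'] mem_Collect_eq, goal_cases)
  case 1 show ?case by (rule identity_equivp)
next
  case 2 then show ?case using lnl_valid[OF P] by blast
next
  case (3 \<Phi> \<sigma> x) then show ?case
    using lnl_act[OF P, of x \<Phi> \<sigma>] op_closed_act[OF M, of x \<Phi> \<sigma>] by simp
next
  case 4 then show ?case using lnl_idn[OF P] op_closed_idn[OF M] O' by auto
next
  case 5 then show ?case using lnl_cmp[OF P] op_closed_cmp[OF M] by auto
next
  case 6 then show ?case using lnl_act_id[OF P] by auto
next
  case 7 then show ?case using lnl_act_act[OF P] by auto
next
  case 8 then show ?case using lnl_unit_pos[OF P] by auto
next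
  case 9 then show ?case using lnl_unit_neg[OF P] by auto
next
  case 10 then show ?case using lnl_assoc[OF P] by auto
next
  case 11 then show ?case using lnl_swap[OF P] by auto
next
  case 12 then show ?case using lnl_str[OF P] by auto
next
  case 13 then show ?case using lnl_weak[OF P] by auto
next
  case 14 then show ?case using lnl_contr[OF P] by auto
qed

lemma functor_sub_lnlD:
  assumes "is_functor P (sub_lnl Q O' M) F" "O' \<subseteq> Ob Q"
  shows "is_functor P Q F"
  using assms unfolding is_functor_def by (simp add: subset_iff)

lemma functor_sub_lnlI:
  assumes "is_functor P Q F" "\<And>\<Phi> x. x \<in> Hom P \<Phi> \<Longrightarrow> valid P \<Phi>"
    "\<And>R. R \<in> Ob P \<Longrightarrow> fob F R \<in> O'" "\<And>\<Phi> x. x \<in> Hom P \<Phi> \<Longrightarrow> M (smap (fob F) \<Phi>) (fmor F \<Phi> x)"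
  shows "is_functor P (sub_lnl Q O' M) F"
proof -
  have "fst ` set (smap (fob F) \<Phi>) \<subseteq> O'" if "x \<in> Hom P \<Phi>" for \<Phi> x
    unfolding fst_set_smap using assms(2)[OF that] assms(3) by (auto simp: valid_def)
  with assms show ?thesis unfolding is_functor_def by simp
qed

definition lands :: "('o, 'm) lnl \<Rightarrow> ('o2 set) \<Rightarrow> ('o2 signed list \<Rightarrow> 'm2 \<Rightarrow> bool) \<Rightarrow> ('o, 'm, 'o2, 'm2) fctr \<Rightarrow> bool" where
  "lands P O' M F \<longleftrightarrow> (\<forall>R\<in>Ob P. fob F R \<in> O') \<and> (\<forall>\<Phi>. \<forall>x\<in>Hom P \<Phi>. M (smap (fob F) \<Phi>) (fmor F \<Phi> x))"

text \<open>The proto-extremal lifts are cut down by \<open>PE\<close> along with objects and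
  morphisms, so that a single argument describes all three in a colimit.\<close>

definition sub_sketch where
  "sub_sketch P O' M PE = \<lparr>poly = sub_lnl (poly P) O' M,
     over = fcomp (sub_lnl (poly P) O' M) (over P) (fincl (sub_lnl (poly P) O' M)),
     pext = (\<lambda>c. {L \<in> pext P c. PE c L})\<rparr>"

lemma functor_fincl: "lnl P \<Longrightarrow> O' \<subseteq> Ob P \<Longrightarrow> op_closed P M \<Longrightarrow> is_functor (sub_lnl P O' M) P (fincl (sub_lnl P O' M))"
proof -
  assume a: "lnl P" "O' \<subseteq> Ob P" "op_closed P M"
  then have l: "lnl_ops (sub_lnl P O' M)" by (intro lnl_lnl_ops lnl_sub_lnl)
  have s: "smap (fob (fincl (sub_lnl P O' M))) \<Phi> = \<Phi>" if "fst ` set \<Phi> \<subseteq> O'" for \<Phi>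
    by (rule smap_idI) (use that in \<open>auto simp: fincl_simps\<close>)
  show ?thesis
  proof (rule functorI)
    show "fmor (fincl (sub_lnl P O' M)) \<Phi> x \<in> Hom P (smap (fob (fincl (sub_lnl P O' M))) \<Phi>)"
      if "x \<in> Hom (sub_lnl P O' M) \<Phi>" for \<Phi> x
      using that by (auto simp: s fincl_simps)
    show "fmor (fincl (sub_lnl P O' M)) \<Phi> (act (sub_lnl P O' M) \<Phi> \<sigma> x) =
       act P (smap (fob (fincl (sub_lnl P O' M))) \<Phi>) \<sigma> (fmor (fincl (sub_lnl P O' M)) (pull \<Phi> \<sigma>) x)"
      if "x \<in> Hom (sub_lnl P O' M) (pull \<Phi> \<sigma>)" "valid (sub_lnl P O' M) \<Phi>"
        "structural (cl (sub_lnl P O' M)) \<Phi> \<sigma>" for \<Phi> \<sigma> x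
      using lnl_ops_act[OF l that] that by (simp add: fincl_simps s valid_def)
    show "fmor (fincl (sub_lnl P O' M)) (\<Phi> @ \<Psi>) (cmp (sub_lnl P O' M) \<Phi> K \<Psi> g f) =
       cmp P (smap (fob (fincl (sub_lnl P O' M))) \<Phi>) (map_prod (fob (fincl (sub_lnl P O' M))) id K)
         (smap (fob (fincl (sub_lnl P O' M))) \<Psi>)
         (fmor (fincl (sub_lnl P O' M)) (dual K # \<Psi>) g) (fmor (fincl (sub_lnl P O' M)) (\<Phi> @ [K]) f)"
      if "f \<in> Hom (sub_lnl P O' M) (\<Phi> @ [K])" "g \<in> Hom (sub_lnl P O' M) (dual K # \<Psi>)" for \<Phi> K \<Psi> f g
      using lnl_ops_cmp[OF l that] that by (cases K) (simp add: fincl_simps s)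
    show "fmor (fincl (sub_lnl P O' M)) [(R, Neg), (R, Pos)] (idn (sub_lnl P O' M) R) =
        idn P (fob (fincl (sub_lnl P O' M)) R)" if "R \<in> Ob (sub_lnl P O' M)" for R
      using lnl_ops_idn[OF l that] that by (simp add: fincl_simps)
  qed (use a in \<open>auto simp: fincl_def mk_fctr_simps\<close>)
qed

lemma sub_lnl_all: "lnl P \<Longrightarrow> sub_lnl P (Ob P) (\<lambda>_ _. True) = P"
proof -
  assume P: "lnl P"
  have "Hom (sub_lnl P (Ob P) (\<lambda>_ _. True)) = Hom P"
    by (rule ext) (use lnl_valid[OF P] in \<open>auto simp: valid_def\<close>)
  then show ?thesis by (intro lnl.equality) auto
qed

lemma functor_fincl_self: "lnl P \<Longrightarrow> is_functor P P (fincl P)"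
  using functor_fincl[of P "Ob P" "\<lambda>_ _. True"] sub_lnl_all[of P] by (auto simp: op_closed_def)

lemma fcomp_fincl: "is_functor P Q F \<Longrightarrow> (\<And>\<Phi> x. x \<in> Hom P \<Phi> \<Longrightarrow> valid P \<Phi>) \<Longrightarrow> fcomp P F (fincl P) = F"
  by (rule fcomp_eq_functorI, assumption)
    (auto simp: fincl_simps smap_fctr_cong[of P _ "fob (fincl P)" "\<lambda>R. R", OF _ fincl_simps(1)])

lemma fincl_fcomp: "is_functor P Q F \<Longrightarrow> fcomp P (fincl Q) F = F"
  by (rule fcomp_eq_functorI, assumption) (auto simp: fincl_simps functorD)

lemma sketch_morD:
  assumes "sketch_mor D P Q F"
  shows sketch_mor_functor: "is_functor (poly P) (poly Q) F"
    and sketch_mor_over: "fcomp (poly P) (over Q) F = over P"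
    and sketch_mor_pext: "c \<in> cones D \<Longrightarrow> L \<in> pext P c \<Longrightarrow> fcomp (cone D c) F L \<in> pext Q c"
  using assms unfolding sketch_mor_def by auto

lemma is_sketchD:
  assumes "is_sketch D P"
  shows sketch_lnl: "lnl (poly P)"
    and sketch_over: "is_functor (poly P) (base D) (over P)"
    and sketch_pext: "c \<in> cones D \<Longrightarrow> L \<in> pext P c \<Longrightarrow> is_functor (cone D c) (poly P) L"
    and sketch_pext_over: "c \<in> cones D \<Longrightarrow> L \<in> pext P c \<Longrightarrow> fcomp (cone D c) (over P) L = cfun D c"
  using assms unfolding is_sketch_def by auto

lemma sub_sketch_simps [simp]:
  "poly (sub_sketch P O' M PE) = sub_lnl (poly P) O' M"
  "over (sub_sketch P O' M PE) = fcomp (sub_lnl (poly P) O' M) (over P) (fincl (sub_lnl (poly P) O' M))"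
  "pext (sub_sketch P O' M PE) c = {L \<in> pext P c. PE c L}"
  by (auto simp: sub_sketch_def)

locale subsketch =
  fixes D :: "('d, 'e, 'c, 'r, 'p) doctrine" and P :: "('o, 'm, 'd, 'e, 'c, 'r, 'p) sketch" and O' M PE
  assumes D: "lnl_doctrine D" and P: "is_sketch D P"
    and O': "O' \<subseteq> Ob (poly P)" and M: "op_closed (poly P) M"
    and PE: "\<And>c L. c \<in> cones D \<Longrightarrow> L \<in> pext P c \<Longrightarrow> PE c L \<Longrightarrow> lands (cone D c) O' M L"
begin

abbreviation "T \<equiv> sub_sketch P O' M PE"

lemma over_sub:
  "R \<in> O' \<Longrightarrow> fob (over T) R = fob (over P) R"
  "x \<in> Hom (poly T) \<Phi> \<Longrightarrow> fmor (over T) \<Phi> x = fmor (over P) \<Phi> x"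
  by (auto simp: fcomp_simps fincl_simps smap_cong[of \<Phi> "fob (fincl (sub_lnl (poly P) O' M))" "\<lambda>R. R"] subset_iff)

lemma cone_lnl: "c \<in> cones D \<Longrightarrow> lnl (cone D c)"
  using D by (auto simp: lnl_doctrine_def abstract_cone_def)

lemma fcomp_over_sub:
  assumes "is_functor Q (poly T) F"
  shows "fcomp Q (over T) F = fcomp Q (over P) F"
proof (rule fcomp_eqI)
  show "fob (over T) (fob F R) = fob (over P) (fob F R)" if "R \<in> Ob Q" for R
    using functor_ob[OF assms that] by (intro over_sub) simp
  show "fmor (over T) (smap (fob F) \<Phi>) (fmor F \<Phi> x) = fmor (over P) (smap (fob F) \<Phi>) (fmor F \<Phi> x)"
    if "x \<in> Hom Q \<Phi>" for \<Phi> x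
    by (rule over_sub(2)[OF functor_hom[OF assms that]])
qed

lemma is_sketch_sub: "is_sketch D T"
  unfolding is_sketch_def
proof (intro conjI ballI)
  show "lnl (poly T)" using lnl_sub_lnl[OF sketch_lnl[OF P] M O'] by simp
  then show "is_functor (poly T) (base D) (over T)"
    using functor_fincl[OF sketch_lnl[OF P] O' M] functor_fcomp lnl_lnl_ops sketch_over[OF P]
    by (metis sub_sketch_simps(1,2))
  fix c L assume c: "c \<in> cones D" "L \<in> pext T c"
  then have L: "L \<in> pext P c" "PE c L" by auto
  show F: "is_functor (cone D c) (poly T) L"
    using PE[OF c(1) L] sketch_pext[OF P c(1) L(1)] cone_lnl[OF c(1)]
    by (auto intro!: functor_sub_lnlI intro: lnl_valid simp: lands_def)
  show "fcomp (cone D c) (over T) L = cfun D c"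
    unfolding fcomp_over_sub[OF F] by (rule sketch_pext_over[OF P c(1) L(1)])
qed

lemma sketch_mor_subI:
  assumes F: "sketch_mor D Q P F" and v: "lnl_ops (poly Q)"
    and "lands (poly Q) O' M F" and pe: "\<And>c L. c \<in> cones D \<Longrightarrow> L \<in> pext Q c \<Longrightarrow> PE c (fcomp (cone D c) F L)"
  shows "sketch_mor D Q T F"
proof -
  have F': "is_functor (poly Q) (poly T) F"
    using assms sketch_mor_functor[OF F] by (auto intro!: functor_sub_lnlI lnl_ops_valid[OF v] simp: lands_def)
  show ?thesis
    unfolding sketch_mor_def fcomp_over_sub[OF F']
    using F' sketch_morD[OF F] pe by auto
qed

text \<open>\<open>T\<close> has the operations of \<open>P\<close>, so a morphism from
  \<open>P\<close> to \<open>T\<close> is literally also an endomorphism of \<open>P\<close>. Once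
  uniqueness forces that endomorphism to be the identity, everything in \<open>P\<close> lies in
  \<open>T\<close>.\<close>

lemma sub_full:
  assumes H: "sketch_mor D P T H" and "sketch_mor D P P H \<Longrightarrow> H = fincl (poly P)"
  shows "Ob (poly P) \<subseteq> O'" "\<And>\<Phi> x. x \<in> Hom (poly P) \<Phi> \<Longrightarrow> M \<Phi> x"
    "\<And>c L. c \<in> cones D \<Longrightarrow> L \<in> pext P c \<Longrightarrow> PE c L"
proof -
  have F': "is_functor (poly P) (poly T) H" using sketch_mor_functor[OF H] .
  have "sketch_mor D P P H"
    unfolding sketch_mor_def
    using functor_sub_lnlD[OF _ O', of "poly P" M H] sketch_morD[OF H] O' fcomp_over_sub[OF F'] by auto
  then have eq: "H = fincl (poly P)" using assms by blast
  show "Ob (poly P) \<subseteq> O'" using functor_ob[OF F'] unfolding eq by (auto simp: fincl_simps)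
  show "M \<Phi> x" if "x \<in> Hom (poly P) \<Phi>" for \<Phi> x
  proof -
    have "smap (fob H) \<Phi> = \<Phi>"
      using smap_fctr_cong[OF lnl_valid[OF sketch_lnl[OF P] that], of "fob H" "\<lambda>R. R"]
      unfolding eq by (simp add: fincl_simps)
    then show ?thesis
      using functor_hom[OF F' that] that unfolding eq by (simp add: fincl_simps)
  qed
  show "PE c L" if "c \<in> cones D" "L \<in> pext P c" for c L
    using sketch_mor_pext[OF H that] fincl_fcomp[OF sketch_pext[OF P that]] unfolding eq by simp
qed

end

lemma sketch_mor_fincl: "is_sketch D P \<Longrightarrow> sketch_mor D P P (fincl (poly P))"
  unfolding sketch_mor_def
  by (auto simp: functor_fincl_self is_sketchD fincl_fcomp[OF sketch_pext]
      intro!: fcomp_fincl[OF sketch_over] lnl_valid[of "poly P"])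

lemma pushoutD:
  fixes S' T :: "('o, 'm, 'd, 'e, 'c, 'r, 'p) sketch"
  assumes "is_pushout D I A B j a S S' inc att"
  shows pushout_sketch: "is_sketch D S'" and pushout_inc: "sketch_mor D S S' inc"
    and pushout_att: "i \<in> I \<Longrightarrow> sketch_mor D (B i) S' (att i)"
    and pushout_comm: "i \<in> I \<Longrightarrow> fcomp (poly (A i)) (att i) (j i) = fcomp (poly (A i)) inc (a i)"
    and pushout_ex1: "is_sketch D T \<Longrightarrow> sketch_mor D S T h \<Longrightarrow> (\<And>i. i \<in> I \<Longrightarrow> sketch_mor D (B i) T (k i)) \<Longrightarrow>
      (\<And>i. i \<in> I \<Longrightarrow> fcomp (poly (A i)) (k i) (j i) = fcomp (poly (A i)) h (a i)) \<Longrightarrow>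
      \<exists>!H. sketch_mor D S' T H \<and> fcomp (poly S) H inc = h \<and> (\<forall>i\<in>I. fcomp (poly (B i)) H (att i) = k i)"
proof -
  note * = assms[unfolded is_pushout_def]
  show "is_sketch D S'" "sketch_mor D S S' inc" using * by simp_all
  show "sketch_mor D (B i) S' (att i)" if "i \<in> I"
    using *[THEN conjunct2, THEN conjunct2, THEN conjunct1] that by simp
  show "fcomp (poly (A i)) (att i) (j i) = fcomp (poly (A i)) inc (a i)" if "i \<in> I"
    using *[THEN conjunct2, THEN conjunct2, THEN conjunct1] that by simp
  show "\<exists>!H. sketch_mor D S' T H \<and> fcomp (poly S) H inc = h \<and> (\<forall>i\<in>I. fcomp (poly (B i)) H (att i) = k i)"
    if "is_sketch D T" "sketch_mor D S T h" "\<And>i. i \<in> I \<Longrightarrow> sketch_mor D (B i) T (k i)"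
      "\<And>i. i \<in> I \<Longrightarrow> fcomp (poly (A i)) (k i) (j i) = fcomp (poly (A i)) h (a i)"
    by (rule *[THEN conjunct2, THEN conjunct2, THEN conjunct2, rule_format]) (use that in simp)
qed

lemma seq_colimitD:
  fixes S' T :: "('o, 'm, 'd, 'e, 'c, 'r, 'p) sketch"
  assumes "is_seq_colimit D S inc S' leg"
  shows seq_colimit_sketch: "is_sketch D S'" and seq_colimit_leg: "sketch_mor D (S n) S' (leg n)"
    and seq_colimit_comm: "fcomp (poly (S n)) (leg (Suc n)) (inc n) = leg n"
    and seq_colimit_ex1: "is_sketch D T \<Longrightarrow> (\<And>n. sketch_mor D (S n) T (h n)) \<Longrightarrow>
      (\<And>n. fcomp (poly (S n)) (h (Suc n)) (inc n) = h n) \<Longrightarrow>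
      \<exists>!H. sketch_mor D S' T H \<and> (\<forall>n. fcomp (poly (S n)) H (leg n) = h n)"
proof -
  note * = assms[unfolded is_seq_colimit_def]
  show "is_sketch D S'" using * by simp
  show "sketch_mor D (S n) S' (leg n)" "fcomp (poly (S n)) (leg (Suc n)) (inc n) = leg n"
    using *[THEN conjunct2, THEN conjunct1] by simp_all
  show "\<exists>!H. sketch_mor D S' T H \<and> (\<forall>n. fcomp (poly (S n)) H (leg n) = h n)"
    if "is_sketch D T" "\<And>n. sketch_mor D (S n) T (h n)"
      "\<And>n. fcomp (poly (S n)) (h (Suc n)) (inc n) = h n"
    by (rule *[THEN conjunct2, THEN conjunct2, rule_format]) (use that in simp)
qed

text \<open>The legs factor through \<open>T\<close>. The induced morphism \<open>H\<close> into
  \<open>T\<close>, read as a morphism into \<open>P\<close>, and the identity of \<open>P\<close>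
  both extend the legs, so the uniqueness clause of the pushout identifies them.\<close>

lemma (in subsketch) pushout_sub:
  assumes po: "is_pushout D I A B j a S P inc att"
    and v: "lnl_ops (poly S)" "\<And>i. i \<in> I \<Longrightarrow> lnl_ops (poly (B i))"
    and inc: "lands (poly S) O' M inc" and att: "\<And>i. i \<in> I \<Longrightarrow> lands (poly (B i)) O' M (att i)"
    and "\<And>c L. c \<in> cones D \<Longrightarrow> L \<in> pext S c \<Longrightarrow> PE c (fcomp (cone D c) inc L)"
    and "\<And>i c L. i \<in> I \<Longrightarrow> c \<in> cones D \<Longrightarrow> L \<in> pext (B i) c \<Longrightarrow> PE c (fcomp (cone D c) (att i) L)"
  shows "Ob (poly P) \<subseteq> O'" "\<And>\<Phi> x. x \<in> Hom (poly P) \<Phi> \<Longrightarrow> M \<Phi> x"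
    "\<And>c L. c \<in> cones D \<Longrightarrow> L \<in> pext P c \<Longrightarrow> PE c L"
proof -
  have i: "sketch_mor D S T inc"
    using sketch_mor_subI[OF pushout_inc[OF po] v(1) inc] assms by blast
  have k: "sketch_mor D (B i) T (att i)" if "i \<in> I" for i
    using sketch_mor_subI[OF pushout_att[OF po that] v(2)[OF that] att[OF that]] that assms by blast
  obtain H where H: "sketch_mor D P T H" "fcomp (poly S) H inc = inc"
    "\<forall>i\<in>I. fcomp (poly (B i)) H (att i) = att i"
    using pushout_ex1[OF po is_sketch_sub i k pushout_comm[OF po]] by auto
  have "H = fincl (poly P)" if "sketch_mor D P P H"
  proof -
    have "fcomp (poly S) (fincl (poly P)) inc = inc"
      by (rule fincl_fcomp[OF sketch_mor_functor[OF pushout_inc[OF po]]])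
    moreover have "\<forall>i\<in>I. fcomp (poly (B i)) (fincl (poly P)) (att i) = att i"
      using fincl_fcomp[OF sketch_mor_functor[OF pushout_att[OF po]]] by blast
    ultimately show ?thesis
      using pushout_ex1[OF po local.P pushout_inc[OF po] pushout_att[OF po] pushout_comm[OF po]]
        H that sketch_mor_fincl[OF local.P] by blast
  qed
  from sub_full[OF H(1) this] show "Ob (poly P) \<subseteq> O'" "\<And>\<Phi> x. x \<in> Hom (poly P) \<Phi> \<Longrightarrow> M \<Phi> x"
    "\<And>c L. c \<in> cones D \<Longrightarrow> L \<in> pext P c \<Longrightarrow> PE c L" by blast+
qed

lemma (in subsketch) seq_colimit_sub:
  assumes co: "is_seq_colimit D S inc P leg"
    and v: "\<And>n. lnl_ops (poly (S n))"
    and leg: "\<And>n. lands (poly (S n)) O' M (leg n)"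
    and "\<And>n c L. c \<in> cones D \<Longrightarrow> L \<in> pext (S n) c \<Longrightarrow> PE c (fcomp (cone D c) (leg n) L)"
  shows "Ob (poly P) \<subseteq> O'" "\<And>\<Phi> x. x \<in> Hom (poly P) \<Phi> \<Longrightarrow> M \<Phi> x"
    "\<And>c L. c \<in> cones D \<Longrightarrow> L \<in> pext P c \<Longrightarrow> PE c L"
proof -
  have k: "sketch_mor D (S n) T (leg n)" for n
    using sketch_mor_subI[OF seq_colimit_leg[OF co] v leg] assms by blast
  obtain H where H: "sketch_mor D P T H" "\<forall>n. fcomp (poly (S n)) H (leg n) = leg n"
    using seq_colimit_ex1[OF co is_sketch_sub k seq_colimit_comm[OF co]] by auto
  have "H = fincl (poly P)" if "sketch_mor D P P H"
  proof -
    have "\<forall>n. fcomp (poly (S n)) (fincl (poly P)) (leg n) = leg n"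
      using fincl_fcomp[OF sketch_mor_functor[OF seq_colimit_leg[OF co]]] by blast
    then show ?thesis
      using seq_colimit_ex1[OF co local.P seq_colimit_leg[OF co] seq_colimit_comm[OF co]]
        H that sketch_mor_fincl[OF local.P] by blast
  qed
  from sub_full[OF H(1) this] show "Ob (poly P) \<subseteq> O'" "\<And>\<Phi> x. x \<in> Hom (poly P) \<Phi> \<Longrightarrow> M \<Phi> x"
    "\<And>c L. c \<in> cones D \<Longrightarrow> L \<in> pext P c \<Longrightarrow> PE c L" by blast+
qed

section \<open>Objects of pushouts and sequential colimits\<close>

text \<open>The two sides of each functor equation lie in the same hom-set of \<open>Q\<close>,
  which has at most one element.\<close>

lemma functor_to_thin:
  assumes F: "carries P Q F" and P: "lnl_ops P" and Q: "lnl_ops Q"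
    and thin: "\<And>\<Phi> x y. x \<in> Hom Q \<Phi> \<Longrightarrow> y \<in> Hom Q \<Phi> \<Longrightarrow> x = y"
    and "\<And>R. R \<notin> Ob P \<Longrightarrow> fob F R = undefined" "\<And>\<Phi> x. x \<notin> Hom P \<Phi> \<Longrightarrow> fmor F \<Phi> x = undefined"
  shows "is_functor P Q F"
proof -
  note P' = lnl_opsD[OF P] and Q' = lnl_opsD[OF Q] and F' = carriesD[OF F]
  have v: "valid Q (smap (fob F) \<Phi>)" if "valid P \<Phi>" for \<Phi>
  proof -
    have "\<And>R. R \<in> fst ` set \<Phi> \<Longrightarrow> R \<in> Ob P" using that by (auto simp: valid_def)
    moreover from this have "admissible (cl Q) (smap (fob F) \<Phi>) = admissible (cl P) \<Phi>"
      by (intro admissible_smap) (use F' in blast)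
    ultimately show ?thesis
      using that F' by (auto simp: valid_def fst_set_smap)
  qed
  have s: "structural (cl Q) (smap (fob F) \<Phi>) \<sigma> = structural (cl P) \<Phi> \<sigma>" if "valid P \<Phi>" for \<Phi> \<sigma>
    by (rule structural_smap) (use that F' in \<open>auto simp: valid_def\<close>)
  show ?thesis
  proof (rule functorI)
    fix \<Phi> \<sigma> x assume a: "x \<in> Hom P (pull \<Phi> \<sigma>)" "valid P \<Phi>" "structural (cl P) \<Phi> \<sigma>"
    show "fmor F \<Phi> (act P \<Phi> \<sigma> x) = act Q (smap (fob F) \<Phi>) \<sigma> (fmor F (pull \<Phi> \<sigma>) x)"
      by (rule thin[OF F'(3)[OF P'(3)[OF a]] Q'(3)])
        (use a v s F'(3)[OF a(1)] in \<open>auto simp: pull_smap_structural\<close>)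
  next
    fix R assume a: "R \<in> Ob P"
    show "fmor F [(R, Neg), (R, Pos)] (idn P R) = idn Q (fob F R)"
      using F'(3)[OF P'(2)[OF a]] by (intro thin[OF F'(3)[OF P'(2)[OF a]]]) (use Q'(2)[OF F'(1)[OF a]] in simp)
  next
    fix \<Phi> K \<Psi> f g assume a: "f \<in> Hom P (\<Phi> @ [K])" "g \<in> Hom P (dual K # \<Psi>)"
    have "cmp Q (smap (fob F) \<Phi>) (map_prod (fob F) id K) (smap (fob F) \<Psi>) (fmor F (dual K # \<Psi>) g)
        (fmor F (\<Phi> @ [K]) f) \<in> Hom Q (smap (fob F) \<Phi> @ smap (fob F) \<Psi>)"
      by (rule Q'(4)) (use F'(3)[OF a(1)] F'(3)[OF a(2)] in \<open>simp_all add: dual_map_prod\<close>)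
    then show "fmor F (\<Phi> @ \<Psi>) (cmp P \<Phi> K \<Psi> g f) =
       cmp Q (smap (fob F) \<Phi>) (map_prod (fob F) id K) (smap (fob F) \<Psi>)
         (fmor F (dual K # \<Psi>) g) (fmor F (\<Phi> @ [K]) f)"
      by (intro thin[OF F'(3)[OF P'(4)[OF a]]]) simp
  qed (use assms F' in auto)
qed

text \<open>Makes compatibility with the projections to the base automatic throughout: over a
  subterminal base it is enough that both composites are functors.\<close>

lemma subterminal_functor_eq:
  assumes "subterminal Q" "is_functor P Q F" "is_functor P Q G" "\<And>\<Phi> x. x \<in> Hom P \<Phi> \<Longrightarrow> valid P \<Phi>"
  shows "F = G"
proof (rule functor_eqI[OF assms(2,3)])
  show ob: "fob F R = fob G R" if "R \<in> Ob P" for R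
    using assms(1) functorD(1,2)[OF assms(2) that] functorD(1,2)[OF assms(3) that]
    unfolding subterminal_def by metis
  show "fmor F \<Phi> x = fmor G \<Phi> x" if "x \<in> Hom P \<Phi>" for \<Phi> x
    using functor_hom[OF assms(2) that] functor_hom[OF assms(3) that]
      smap_fctr_cong[OF assms(4)[OF that], of "fob F" "fob G"] ob assms(1)
    unfolding subterminal_def by metis
qed

section \<open>Thin test sketches over a subterminal base\<close>

locale subterminal_doctrine =
  fixes D :: "('d, 'e, 'c, 'r, 'p) doctrine"
  assumes D: "lnl_doctrine D" and sub: "subterminal (base D)"
begin

lemma base_obj:
  assumes "R \<in> Ob (base D)" shows "base_obj D (cl (base D) R) = R"
  unfolding base_obj_def by (rule the_equality) (use assms sub in \<open>auto simp: subterminal_def\<close>)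

lemma base_thin: "x \<in> Hom (base D) \<Phi> \<Longrightarrow> y \<in> Hom (base D) \<Phi> \<Longrightarrow> x = y"
  using sub by (auto simp: subterminal_def)

lemma base_lnl: "lnl (base D)"
  using D by (simp add: lnl_doctrine_def)

lemma cone_lnl: "c \<in> cones D \<Longrightarrow> lnl (cone D c)"
  using D by (auto simp: lnl_doctrine_def abstract_cone_def)

lemma cfun_functor: "c \<in> cones D \<Longrightarrow> is_functor (cone D c) (base D) (cfun D c)"
  using D by (auto simp: lnl_doctrine_def)

text \<open>A sketch morphism into this thin test sketch amounts to a predicate on the objects, so
  universal properties restricted to it describe the objects of a colimit.\<close>

definition chaos_poly :: "(kind \<times> bool \<Rightarrow> 'o) \<Rightarrow> ('o, 'm) lnl" where
  "chaos_poly \<iota> =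
     (let \<kappa> = (\<lambda>R. fst (inv \<iota> R)); O' = \<iota> ` (cl (base D) ` Ob (base D) \<times> UNIV) in
      \<lparr>Ob = O', cl = \<kappa>,
       Hom = (\<lambda>\<Phi>. {x. x = undefined \<and> fst ` set \<Phi> \<subseteq> O' \<and> admissible \<kappa> \<Phi> \<and>
                Hom (base D) (smap (\<lambda>R. base_obj D (\<kappa> R)) \<Phi>) \<noteq> {}}),
       act = (\<lambda>_ _ _. undefined), idn = (\<lambda>_. undefined), cmp = (\<lambda>_ _ _ _ _. undefined)\<rparr>)"

definition chaos_over :: "(kind \<times> bool \<Rightarrow> 'o) \<Rightarrow> ('o, 'm, 'd, 'e) fctr" where
  "chaos_over \<iota> = mk_fctr (chaos_poly \<iota>) (\<lambda>R. base_obj D (fst (inv \<iota> R)))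
     (\<lambda>\<Phi> _. SOME x. x \<in> Hom (base D) (smap (\<lambda>R. base_obj D (fst (inv \<iota> R))) \<Phi>))"

text \<open>All lifts of a cone are declared proto-extremal, so preserving proto-extremal lifts is
  no restriction on a map into this sketch over the base.\<close>

definition chaos :: "(kind \<times> bool \<Rightarrow> 'o) \<Rightarrow> ('o, 'm, 'd, 'e, 'c, 'r, 'p) sketch" where
  "chaos \<iota> = \<lparr>poly = chaos_poly \<iota>, over = chaos_over \<iota>,
     pext = (\<lambda>c. {L. is_functor (cone D c) (chaos_poly \<iota>) L \<and>
                     fcomp (cone D c) (chaos_over \<iota>) L = cfun D c})\<rparr>"

lemma chaos_simps [simp]:
  "Ob (chaos_poly \<iota>) = \<iota> ` (cl (base D) ` Ob (base D) \<times> UNIV)"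
  "cl (chaos_poly \<iota>) = (\<lambda>R. fst (inv \<iota> R))"
  "act (chaos_poly \<iota>) \<Phi> \<sigma> x = undefined" "idn (chaos_poly \<iota>) R = undefined"
  "cmp (chaos_poly \<iota>) \<Phi> K \<Psi> f g = undefined"
  by (simp_all add: chaos_poly_def Let_def)

lemma chaos_Hom:
  "x \<in> Hom (chaos_poly \<iota> :: ('o, 'm) lnl) \<Phi> \<longleftrightarrow>
     x = undefined \<and> valid (chaos_poly \<iota> :: ('o, 'm) lnl) \<Phi> \<and>
     Hom (base D) (smap (\<lambda>R. base_obj D (fst (inv \<iota> R))) \<Phi>) \<noteq> {}"
  by (simp add: chaos_poly_def Let_def valid_def)

context
  fixes \<iota> :: "kind \<times> bool \<Rightarrow> 'o"
  assumes inj: "inj \<iota>"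
begin

lemma chaos_base_obj:
  assumes "R \<in> Ob (chaos_poly \<iota> :: ('o, 'm) lnl)"
  shows "base_obj D (fst (inv \<iota> R)) \<in> Ob (base D)"
    "cl (base D) (base_obj D (fst (inv \<iota> R))) = fst (inv \<iota> R)"
  using assms base_obj inj by auto

lemma chaos_valid:
  assumes "valid (chaos_poly \<iota> :: ('o, 'm) lnl) \<Phi>"
  shows "valid (base D) (smap (\<lambda>R. base_obj D (fst (inv \<iota> R))) \<Phi>)"
    "structural (cl (base D)) (smap (\<lambda>R. base_obj D (fst (inv \<iota> R))) \<Phi>) \<sigma> \<longleftrightarrow>
       structural (cl (chaos_poly \<iota> :: ('o, 'm) lnl)) \<Phi> \<sigma>"
proof -
  have R: "\<And>R. R \<in> fst ` set \<Phi> \<Longrightarrow> R \<in> Ob (chaos_poly \<iota> :: ('o, 'm) lnl)" using assms unfolding valid_def by blast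
  have "admissible (cl (base D)) (smap (\<lambda>R. base_obj D (fst (inv \<iota> R))) \<Phi>) = admissible (cl (chaos_poly \<iota> :: ('o, 'm) lnl)) \<Phi>"
    by (intro admissible_smap) (use chaos_base_obj[OF R] in auto)
  then show "valid (base D) (smap (\<lambda>R. base_obj D (fst (inv \<iota> R))) \<Phi>)"
    unfolding valid_def fst_set_smap using assms chaos_base_obj(1)[OF R] unfolding valid_def by blast
  show "structural (cl (base D)) (smap (\<lambda>R. base_obj D (fst (inv \<iota> R))) \<Phi>) \<sigma> \<longleftrightarrow>
       structural (cl (chaos_poly \<iota> :: ('o, 'm) lnl)) \<Phi> \<sigma>"
    by (intro structural_smap) (use chaos_base_obj[OF R] in auto)
qed

lemma chaos_lnl_ops: "lnl_ops (chaos_poly \<iota> :: ('o, 'm) lnl)"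
  unfolding lnl_ops_def
proof (intro conjI allI ballI op_closedI)
  let ?P = "chaos_poly \<iota> :: ('o, 'm) lnl" and ?b = "\<lambda>R. base_obj D (fst (inv \<iota> R))"
  show "valid ?P \<Phi>" if "x \<in> Hom ?P \<Phi>" for \<Phi> x using that by (simp add: chaos_Hom)
  show "idn ?P R \<in> Hom ?P [(R, Neg), (R, Pos)]" if R: "R \<in> Ob ?P" for R
    using lnl_idn[OF base_lnl chaos_base_obj(1)[OF R]] lnl_valid[OF base_lnl lnl_idn[OF base_lnl chaos_base_obj(1)[OF R]]] R
     chaos_base_obj(2)[OF R]
    by (auto simp: chaos_Hom valid_def admissible_def pos_nonlinear_def)
  show "act ?P \<Phi> \<sigma> x \<in> Hom ?P \<Phi>"
    if "x \<in> Hom ?P (pull \<Phi> \<sigma>)" "valid ?P \<Phi>" "structural (cl ?P) \<Phi> \<sigma>" for \<Phi> \<sigma> x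
    using that lnl_act[OF base_lnl _ chaos_valid(1)[OF that(2)], of _ \<sigma>] chaos_valid(2)[OF that(2)]
    by (fastforce simp: chaos_Hom pull_smap_structural)
  show "cmp ?P \<Phi> K \<Psi> g f \<in> Hom ?P (\<Phi> @ \<Psi>)"
    if a: "f \<in> Hom ?P (\<Phi> @ [K])" "g \<in> Hom ?P (dual K # \<Psi>)" for \<Phi> K \<Psi> f g
  proof -
    obtain f' g' where "f' \<in> Hom (base D) (smap ?b (\<Phi> @ [K]))" "g' \<in> Hom (base D) (smap ?b (dual K # \<Psi>))"
      using a unfolding chaos_Hom by blast
    then have "cmp (base D) (smap ?b \<Phi>) (map_prod ?b id K) (smap ?b \<Psi>) g' f' \<in>
        Hom (base D) (smap ?b \<Phi> @ smap ?b \<Psi>)"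
      by (intro lnl_cmp[OF base_lnl]) (simp_all add: dual_map_prod)
    moreover from a have v: "valid ?P (\<Phi> @ [K])" "valid ?P (dual K # \<Psi>)" unfolding chaos_Hom by blast+
    have "admissible (cl ?P) (\<Phi> @ \<Psi>)"
      by (rule admissible_cut[of _ _ K]) (use v in \<open>simp_all add: valid_def\<close>)
    then have "valid ?P (\<Phi> @ \<Psi>)"
      using valid_append_dual[OF v] by (simp add: valid_def)
    ultimately show ?thesis by (auto simp: chaos_Hom)
  qed
qed

lemma chaos_lnl: "lnl (chaos_poly \<iota> :: ('o, 'm) lnl)"
proof -
  note ops = lnl_opsD[OF chaos_lnl_ops[where 'm='m]]
  show ?thesis
    unfolding lnl_def
  proof (rule lnl_uptoI, goal_cases)
    case 1 show ?case by (rule identity_equivp)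
  next
    case 2 then show ?case by (rule ops)
  next
    case 3 then show ?case by (rule ops)
  next
    case 5 then show ?case by (rule ops)
  next
    case 6 then show ?case by (rule ops)
  qed (simp_all add: chaos_Hom)
qed

lemma chaos_over: "is_functor (chaos_poly \<iota>) (base D) (chaos_over \<iota> :: ('o, 'm, 'd, 'e) fctr)"
  (is "is_functor _ _ ?F")
proof (rule functor_to_thin[OF _ chaos_lnl_ops lnl_lnl_ops[OF base_lnl] base_thin])
  have "fmor (?F) \<Phi> x \<in> Hom (base D) (smap (fob ?F) \<Phi>)"
    if x: "x \<in> Hom (chaos_poly \<iota> :: ('o, 'm) lnl) \<Phi>" for \<Phi> x
  proof -
    have "smap (fob ?F) \<Phi> = smap (\<lambda>R. base_obj D (fst (inv \<iota> R))) \<Phi>"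
      by (rule smap_fctr_cong[OF lnl_valid[OF chaos_lnl x]]) (simp add: chaos_over_def mk_fctr_simps)
    moreover have "fmor (?F) \<Phi> x =
        (SOME y. y \<in> Hom (base D) (smap (\<lambda>R. base_obj D (fst (inv \<iota> R))) \<Phi>))"
      using x by (simp add: chaos_over_def mk_fctr_simps)
    moreover have "\<exists>y. y \<in> Hom (base D) (smap (\<lambda>R. base_obj D (fst (inv \<iota> R))) \<Phi>)"
      using x unfolding chaos_Hom by blast
    note someI_ex[OF this]
    ultimately show ?thesis by simp
  qed
  then show "carries (chaos_poly \<iota>) (base D) ?F"
    unfolding carries_def using chaos_base_obj by (auto simp: chaos_over_def mk_fctr_simps)
qed (auto simp: chaos_over_def mk_fctr_simps)

lemma chaos_sketch: "is_sketch D (chaos \<iota>)"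
  unfolding is_sketch_def using chaos_lnl chaos_over by (auto simp: chaos_def)

text \<open>The classifying map of the predicate \<open>p\<close>: an object goes to the copy of its
  class marked by its truth value, and all morphisms go to the single value
  \<open>undefined\<close>.\<close>

definition tmap :: "('a, 'b) lnl \<Rightarrow> ('a \<Rightarrow> bool) \<Rightarrow> ('a, 'b, 'o, 'm) fctr" where
  "tmap P p = mk_fctr P (\<lambda>R. \<iota> (cl P R, p R)) (\<lambda>_ _. undefined)"

text \<open>\<open>Q\<close> and \<open>F\<close> supply a functor from \<open>P\<close> to the
  base. The cells attached in a pushout are not assumed to be sketches, but they map to one, namely
  the pushout.\<close>

lemma sketch_mor_chaos:
  fixes p :: "'a \<Rightarrow> bool"
  assumes Q: "is_sketch D Q" and F: "sketch_mor D P Q F" and P: "lnl_ops (poly P)"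
    and pc: "\<And>c L. c \<in> cones D \<Longrightarrow> L \<in> pext P c \<Longrightarrow> carries (cone D c) (poly P) L"
  shows "sketch_mor D P (chaos \<iota>) (tmap (poly P) p :: ('a, 'b, 'o, 'm) fctr)"
proof -
  let ?P = "poly P" and ?F = "tmap (poly P) p :: ('a, 'b, 'o, 'm) fctr"
  note F' = sketch_mor_functor[OF F]
  have oF: "is_functor ?P (base D) (over P)"
    using functor_fcomp[OF F' sketch_over[OF Q] P] sketch_mor_over[OF F] by simp
  have cR: "cl ?P R \<in> cl (base D) ` Ob (base D)" if "R \<in> Ob ?P" for R
    using functorD(1,2)[OF oF that] by (metis imageI)
  have bR: "base_obj D (cl ?P R) = fob (over P) R" if "R \<in> Ob ?P" for R
    using base_obj[OF functor_ob[OF oF that]] functor_cl[OF oF that] by simp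
  have tob: "fob ?F R = \<iota> (cl ?P R, p R)" if "R \<in> Ob ?P" for R
    using that by (simp add: tmap_def mk_fctr_simps)
  have tobO: "fob ?F R \<in> Ob (chaos_poly \<iota> :: ('o, 'm) lnl)" if "R \<in> Ob ?P" for R
    unfolding tob[OF that] using cR[OF that] by simp
  have v: "valid (chaos_poly \<iota> :: ('o, 'm) lnl) (smap (fob ?F) \<Phi>)" if "valid ?P \<Phi>" for \<Phi>
  proof -
    have R: "\<And>R. R \<in> fst ` set \<Phi> \<Longrightarrow> R \<in> Ob ?P" using that by (auto simp: valid_def)
    then have "admissible (cl (chaos_poly \<iota> :: ('o, 'm) lnl)) (smap (fob ?F) \<Phi>) = admissible (cl ?P) \<Phi>"
      by (intro admissible_smap) (use tob inj in auto)
    moreover have "fob ?F ` fst ` set \<Phi> \<subseteq> Ob (chaos_poly \<iota> :: ('o, 'm) lnl)" using R tobO by blast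
    ultimately show ?thesis using that unfolding valid_def fst_set_smap by blast
  qed
  have ca: "carries ?P (chaos_poly \<iota>) ?F"
    unfolding carries_def
  proof (intro conjI ballI allI)
    fix \<Phi> x assume x: "x \<in> Hom ?P \<Phi>"
    have "smap (\<lambda>R. base_obj D (fst (inv \<iota> R))) (smap (fob ?F) \<Phi>) = smap (fob (over P)) \<Phi>"
      unfolding smap_smap
      by (rule smap_fctr_cong[OF lnl_ops_valid[OF P x]]) (use tob bR inj in simp)
    then show "fmor ?F \<Phi> x \<in> Hom (chaos_poly \<iota>) (smap (fob ?F) \<Phi>)"
      using x v[OF lnl_ops_valid[OF P x]] functor_hom[OF oF x]
      by (auto simp: chaos_Hom tmap_def mk_fctr_simps)
  qed (use tob cR inj in auto)
  have thin: "x = y" if "x \<in> Hom (chaos_poly \<iota> :: ('o, 'm) lnl) \<Phi>" "y \<in> Hom (chaos_poly \<iota> :: ('o, 'm) lnl) \<Phi>" for x y \<Phi>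
    using that by (simp add: chaos_Hom)
  have Fu: "is_functor ?P (chaos_poly \<iota>) ?F"
    by (rule functor_to_thin[OF ca P chaos_lnl_ops thin]) (auto simp: tmap_def mk_fctr_simps)
  show ?thesis
    unfolding sketch_mor_def
  proof (intro conjI ballI)
    show "is_functor (poly P) (poly (chaos \<iota>)) ?F" using Fu by (simp add: chaos_def)
    show "fcomp (poly P) (over (chaos \<iota>)) ?F = over P"
      using subterminal_functor_eq[OF sub functor_fcomp[OF Fu chaos_over P] oF lnl_ops_valid[OF P]]
      by (simp add: chaos_def)
    fix c L assume c: "c \<in> cones D" "L \<in> pext P c"
    let ?C = "cone D c"
    have C: "lnl_ops ?C" using cone_lnl[OF c(1)] by (rule lnl_lnl_ops)
    note L = carriesD[OF pc[OF c]]
    have ca': "carries ?C (chaos_poly \<iota>) (fcomp ?C ?F L)"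
      unfolding carries_def
    proof (intro conjI ballI allI)
      fix \<Phi> x assume x: "x \<in> Hom ?C \<Phi>"
      have "smap (fob (fcomp ?C ?F L)) \<Phi> = smap (fob ?F) (smap (fob L) \<Phi>)"
        unfolding smap_smap by (rule smap_fctr_cong[OF lnl_ops_valid[OF C x]]) (simp add: fcomp_simps)
      then show "fmor (fcomp ?C ?F L) \<Phi> x \<in> Hom (chaos_poly \<iota>) (smap (fob (fcomp ?C ?F L)) \<Phi>)"
        using carries_hom[OF ca L(3)[OF x]] x by (simp add: fcomp_simps)
    qed (use L carries_ob[OF ca] carries_cl[OF ca] in \<open>simp_all only: fcomp_simps\<close>)
    have Fu': "is_functor ?C (chaos_poly \<iota>) (fcomp ?C ?F L)"
      by (rule functor_to_thin[OF ca' C chaos_lnl_ops thin]) (auto simp: fcomp_def mk_fctr_simps)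
    moreover have "fcomp ?C (chaos_over \<iota>) (fcomp ?C ?F L) = cfun D c"
      using subterminal_functor_eq[OF sub functor_fcomp[OF Fu' chaos_over C] cfun_functor[OF c(1)] lnl_ops_valid[OF C]] .
    ultimately show "fcomp ?C ?F L \<in> pext (chaos \<iota>) c" by (simp add: chaos_def)
  qed
qed

end

text \<open>Here the infinitude of the object type enters: a test sketch has to live on that type
  and needs two objects for each class.\<close>

lemma ex_inj_bool: "\<exists>\<iota> :: kind \<times> bool \<Rightarrow> 'o::infinite. inj \<iota>"
proof -
  have "finite (UNIV :: kind set)"
    by (rule finite_subset[of _ "{Linear, Nonlinear}"]) (use kind.exhaust in auto)
  then have "finite (UNIV :: (kind \<times> bool) set)" by (simp add: finite_prod)
  then obtain f :: "kind \<times> bool \<Rightarrow> nat" where f: "inj f"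
    using finite_imp_inj_to_nat_seg by metis
  obtain g :: "nat \<Rightarrow> 'o" where g: "inj g"
    using infinite_countable_subset[OF infinite_UNIV] by blast
  from inj_compose[OF g f] show ?thesis by blast
qed

text \<open>Compatible predicates on the pieces amount to compatible maps into \<open>chaos\<close>.
  The induced map out of the pushout, decoded through \<open>inv \<iota>\<close>, is the glued
  predicate. Injectivity and newness of objects follow by choosing the predicate well.\<close>

lemma pushout_pred:
  fixes S S' :: "('o::infinite, 'm, 'd, 'e, 'c, 'r, 'p) sketch"
  assumes po: "is_pushout D I A B j a S S' inc att" and S: "is_sketch D S"
    and B: "\<And>i. i \<in> I \<Longrightarrow> lnl_ops (poly (B i))"
      "\<And>i c L. i \<in> I \<Longrightarrow> c \<in> cones D \<Longrightarrow> L \<in> pext (B i) c \<Longrightarrow> carries (cone D c) (poly (B i)) L"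
    and j: "\<And>i. i \<in> I \<Longrightarrow> carries (poly (A i)) (poly (B i)) (j i)"
    and a: "\<And>i. i \<in> I \<Longrightarrow> carries (poly (A i)) (poly S) (a i)"
    and p: "\<And>i r. i \<in> I \<Longrightarrow> r \<in> Ob (poly (A i)) \<Longrightarrow> pB i (fob (j i) r) \<longleftrightarrow> pS (fob (a i) r)"
  shows "\<exists>Q. (\<forall>R\<in>Ob (poly S). Q (fob inc R) \<longleftrightarrow> pS R) \<and>
             (\<forall>i\<in>I. \<forall>r\<in>Ob (poly (B i)). Q (fob (att i) r) \<longleftrightarrow> pB i r)"
proof -
  obtain \<iota> :: "kind \<times> bool \<Rightarrow> 'o" where inj: "inj \<iota>" using ex_inj_bool by blast
  let ?T = "chaos \<iota> :: ('o, 'm, 'd, 'e, 'c, 'r, 'p) sketch"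
  let ?t = "tmap \<iota> (poly S) pS :: ('o, 'm, 'o, 'm) fctr"
    and ?k = "\<lambda>i. tmap \<iota> (poly (B i)) (pB i) :: (_, _, 'o, 'm) fctr"
  note S' = pushout_sketch[OF po]
  have t: "sketch_mor D S ?T ?t"
    by (rule sketch_mor_chaos[OF inj S' pushout_inc[OF po] lnl_lnl_ops[OF sketch_lnl[OF S]]])
      (auto intro: functor_carries sketch_pext[OF S])
  have k: "sketch_mor D (B i) ?T (?k i)" if "i \<in> I" for i
    by (rule sketch_mor_chaos[OF inj S' pushout_att[OF po that] B(1)[OF that]]) (use B(2) that in auto)
  have "fcomp (poly (A i)) (?k i) (j i) = fcomp (poly (A i)) ?t (a i)" if i: "i \<in> I" for i
    using p[OF i] carriesD[OF j[OF i]] carriesD[OF a[OF i]]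
    by (intro fcomp_eqI) (simp_all add: tmap_def[OF inj] mk_fctr_simps)
  from ex1_implies_ex[OF pushout_ex1[OF po chaos_sketch[OF inj] t k this]]
  obtain H where H: "fcomp (poly S) H inc = ?t" "\<And>i. i \<in> I \<Longrightarrow> fcomp (poly (B i)) H (att i) = ?k i"
    by auto
  have tm: "snd (inv \<iota> (fob (tmap \<iota> P p :: (_, _, 'o, 'm) fctr) R)) = p R" if "R \<in> Ob P" for P :: "('x, 'y) lnl" and p R
    using that inj by (simp add: tmap_def[OF inj] mk_fctr_simps)
  have "snd (inv \<iota> (fob H (fob inc R))) \<longleftrightarrow> pS R" if "R \<in> Ob (poly S)" for R
    using tm[OF that, of pS] that unfolding H(1)[symmetric] by (simp add: fcomp_simps)
  moreover have "snd (inv \<iota> (fob H (fob (att i) r))) \<longleftrightarrow> pB i r" if "i \<in> I" "r \<in> Ob (poly (B i))" for i r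
    using tm[OF that(2), of "pB i"] that unfolding H(2)[OF that(1), symmetric] by (simp add: fcomp_simps)
  ultimately show ?thesis by (intro exI[of _ "\<lambda>R. snd (inv \<iota> (fob H R))"]) auto
qed

lemma seq_colimit_pred:
  fixes S' :: "('o::infinite, 'm, 'd, 'e, 'c, 'r, 'p) sketch"
  assumes co: "is_seq_colimit D S inc S' leg" and S: "\<And>n. is_sketch D (S n)"
    and inc: "\<And>n. carries (poly (S n)) (poly (S (Suc n))) (inc n)"
    and p: "\<And>n R. R \<in> Ob (poly (S n)) \<Longrightarrow> p (Suc n) (fob (inc n) R) \<longleftrightarrow> p n R"
  shows "\<exists>Q. \<forall>n. \<forall>R\<in>Ob (poly (S n)). Q (fob (leg n) R) \<longleftrightarrow> p n R"
proof -
  obtain \<iota> :: "kind \<times> bool \<Rightarrow> 'o" where inj: "inj \<iota>" using ex_inj_bool by blast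
  let ?T = "chaos \<iota> :: ('o, 'm, 'd, 'e, 'c, 'r, 'p) sketch"
  let ?k = "\<lambda>n. tmap \<iota> (poly (S n)) (p n) :: ('o, 'm, 'o, 'm) fctr"
  have k: "sketch_mor D (S n) ?T (?k n)" for n
    by (rule sketch_mor_chaos[OF inj seq_colimit_sketch[OF co] seq_colimit_leg[OF co]
          lnl_lnl_ops[OF sketch_lnl[OF S]]])
      (auto intro: functor_carries sketch_pext[OF S])
  have "fcomp (poly (S n)) (?k (Suc n)) (inc n) = ?k n" for n
    by (rule fcomp_eq_functorI[OF sketch_mor_functor[OF k]])
      (use p carriesD[OF inc[of n]] in \<open>auto simp: tmap_def[OF inj] mk_fctr_simps\<close>)
  from ex1_implies_ex[OF seq_colimit_ex1[OF co chaos_sketch[OF inj] k this]]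
  obtain H where H: "\<And>n. fcomp (poly (S n)) H (leg n) = ?k n"
    by auto
  have tm: "snd (inv \<iota> (fob (tmap \<iota> P p :: (_, _, 'o, 'm) fctr) R)) = p R" if "R \<in> Ob P" for P :: "('x, 'y) lnl" and p R
    using that inj by (simp add: tmap_def[OF inj] mk_fctr_simps)
  have "snd (inv \<iota> (fob H (fob (leg n) R))) \<longleftrightarrow> p n R" if "R \<in> Ob (poly (S n))" for R n
    using tm[OF that, of "p n"] that unfolding H[symmetric] by (simp add: fcomp_simps)
  then show ?thesis by (intro exI[of _ "\<lambda>R. snd (inv \<iota> (fob H R))"]) auto
qed

end

section \<open>Presented polycategories\<close>

lemma term_alg_simps [simp]:
  "Ob (term_alg O' c gen) = O'" "cl (term_alg O' c gen) = c" "Hom (term_alg O' c gen) \<Phi> = {t. wt O' c gen \<Phi> t}"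
  "act (term_alg O' c gen) = TAct" "idn (term_alg O' c gen) = TId" "cmp (term_alg O' c gen) = TCmp"
  by (simp_all add: term_alg_def)

lemma wt_valid: "wt O' c gen \<Phi> t \<Longrightarrow> fst ` set \<Phi> \<subseteq> O' \<and> admissible c \<Phi>"
proof (induction rule: wt.induct)
  case (4 \<Phi> K f \<Psi> g)
  then have "admissible c (\<Phi> @ [K])" "admissible c (dual K # \<Psi>)" by blast+
  with 4 show ?case using admissible_cut[of c \<Phi> K \<Psi>] by (simp add: image_Un)
next
  case (2 R) then show ?case by (simp add: admissible_def pos_nonlinear_def)
qed blast+

primrec ev :: "('o2, 'm) lnl \<Rightarrow> ('o \<Rightarrow> 'o2) \<Rightarrow> ('g \<Rightarrow> 'm) \<Rightarrow> ('o, 'g) tm \<Rightarrow> 'm" where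
  "ev Q h \<gamma> (TGen g) = \<gamma> g"
| "ev Q h \<gamma> (TId R) = idn Q (h R)"
| "ev Q h \<gamma> (TAct \<Phi> \<sigma> t) = act Q (smap h \<Phi>) \<sigma> (ev Q h \<gamma> t)"
| "ev Q h \<gamma> (TCmp \<Phi> K \<Psi> g f) = cmp Q (smap h \<Phi>) (map_prod h id K) (smap h \<Psi>) (ev Q h \<gamma> g) (ev Q h \<gamma> f)"

locale presentation =
  fixes O' :: "'o set" and c :: "'o \<Rightarrow> kind" and gen :: "'g \<Rightarrow> 'o signed list \<Rightarrow> bool"
    and rel :: "'o signed list \<Rightarrow> ('o, 'g) tm \<Rightarrow> ('o, 'g) tm \<Rightarrow> bool"
begin

abbreviation "P \<equiv> presented O' c gen rel"
abbreviation "cls \<equiv> tm_class O' c gen rel"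
abbreviation "wtt \<equiv> wt O' c gen"
abbreviation "eqv \<equiv> tm_eq O' c gen rel"

lemma presented_simps [simp]:
  "Ob P = O'" "cl P = c" "Hom P \<Phi> = {cls \<Phi> t |t. wtt \<Phi> t}" "idn P R = cls [(R, Neg), (R, Pos)] (TId R)"
  by (simp_all add: presented_def Let_def)

lemma eqv_rel: "rel \<Phi> s t \<Longrightarrow> eqv \<Phi> s t"
  by (auto simp: tm_eq_def)

lemma eqv_refl [simp]: "eqv \<Phi> t t"
  unfolding tm_eq_def lnl_upto_def by (auto intro: equivp_reflp)

lemma eqv_sym: "eqv \<Phi> s t \<Longrightarrow> eqv \<Phi> t s"
  unfolding tm_eq_def
proof (intro allI impI)
  fix E assume a: "\<forall>E. lnl_upto E (term_alg O' c gen) \<and> (\<forall>\<Xi> a b. rel \<Xi> a b \<longrightarrow> E \<Xi> a b) \<longrightarrow> E \<Phi> s t"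
    and E: "lnl_upto E (term_alg O' c gen) \<and> (\<forall>\<Xi> a b. rel \<Xi> a b \<longrightarrow> E \<Xi> a b)"
  from E have "equivp (E \<Phi>)" by (simp add: lnl_upto_def)
  with a E show "E \<Phi> t s" using equivp_symp by metis
qed

lemma eqv_trans: "eqv \<Phi> s t \<Longrightarrow> eqv \<Phi> t u \<Longrightarrow> eqv \<Phi> s u"
  unfolding tm_eq_def
proof (intro allI impI)
  fix E assume a: "\<forall>E. lnl_upto E (term_alg O' c gen) \<and> (\<forall>\<Xi> a b. rel \<Xi> a b \<longrightarrow> E \<Xi> a b) \<longrightarrow> E \<Phi> s t"
    "\<forall>E. lnl_upto E (term_alg O' c gen) \<and> (\<forall>\<Xi> a b. rel \<Xi> a b \<longrightarrow> E \<Xi> a b) \<longrightarrow> E \<Phi> t u"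
    and E: "lnl_upto E (term_alg O' c gen) \<and> (\<forall>\<Xi> a b. rel \<Xi> a b \<longrightarrow> E \<Xi> a b)"
  from E have "equivp (E \<Phi>)" by (simp add: lnl_upto_def)
  with a E show "E \<Phi> s u" using equivp_transp by metis
qed

lemma eqv_act:
  assumes "wtt (pull \<Phi> \<sigma>) s" "wtt (pull \<Phi> \<sigma>) t" "valid P \<Phi>" "structural c \<Phi> \<sigma>" "eqv (pull \<Phi> \<sigma>) s t"
  shows "eqv \<Phi> (TAct \<Phi> \<sigma> s) (TAct \<Phi> \<sigma> t)"
  unfolding tm_eq_def
proof (intro allI impI)
  fix E assume E: "lnl_upto E (term_alg O' c gen) \<and> (\<forall>\<Xi> a b. rel \<Xi> a b \<longrightarrow> E \<Xi> a b)"
  have "E (pull \<Phi> \<sigma>) s t" using assms(5) E unfolding tm_eq_def by blast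
  then show "E \<Phi> (TAct \<Phi> \<sigma> s) (TAct \<Phi> \<sigma> t)"
    using upto_act_cong[OF E[THEN conjunct1], of s \<Phi> \<sigma> t] assms by (simp add: valid_def)
qed

lemma eqv_cmp:
  assumes "wtt (\<Phi> @ [K]) f" "wtt (\<Phi> @ [K]) f'" "wtt (dual K # \<Psi>) g" "wtt (dual K # \<Psi>) g'"
    "eqv (\<Phi> @ [K]) f f'" "eqv (dual K # \<Psi>) g g'"
  shows "eqv (\<Phi> @ \<Psi>) (TCmp \<Phi> K \<Psi> g f) (TCmp \<Phi> K \<Psi> g' f')"
  unfolding tm_eq_def
proof (intro allI impI)
  fix E assume E: "lnl_upto E (term_alg O' c gen) \<and> (\<forall>\<Xi> a b. rel \<Xi> a b \<longrightarrow> E \<Xi> a b)"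
  have "E (\<Phi> @ [K]) f f'" "E (dual K # \<Psi>) g g'" using assms(5,6) E unfolding tm_eq_def by blast+
  then show "E (\<Phi> @ \<Psi>) (TCmp \<Phi> K \<Psi> g f) (TCmp \<Phi> K \<Psi> g' f')"
    using upto_cmp_cong[OF E[THEN conjunct1], of f \<Phi> K f' g \<Psi> g'] assms by simp
qed

lemma cls_eq: "eqv \<Phi> s t \<Longrightarrow> cls \<Phi> s = cls \<Phi> t"
  unfolding tm_class_def using eqv_sym eqv_trans by blast

text \<open>The operations of \<open>presented\<close> use a chosen representative of a class. This
  controls the choice up to congruence, so that the computation rules for \<open>act\<close> and
  \<open>cmp\<close> can remove it.\<close>

lemma rep:
  assumes "wtt \<Phi> t"
  shows "wtt \<Phi> (SOME s. s \<in> cls \<Phi> t)" "eqv \<Phi> t (SOME s. s \<in> cls \<Phi> t)"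
proof -
  have "t \<in> cls \<Phi> t" using assms by (simp add: tm_class_def)
  then have "(SOME s. s \<in> cls \<Phi> t) \<in> cls \<Phi> t" by (rule someI)
  then show "wtt \<Phi> (SOME s. s \<in> cls \<Phi> t)" "eqv \<Phi> t (SOME s. s \<in> cls \<Phi> t)"
    by (simp_all add: tm_class_def)
qed

lemma presented_act:
  assumes "wtt (pull \<Phi> \<sigma>) t" "valid P \<Phi>" "structural c \<Phi> \<sigma>"
  shows "act P \<Phi> \<sigma> (cls (pull \<Phi> \<sigma>) t) = cls \<Phi> (TAct \<Phi> \<sigma> t)"
  using rep[OF assms(1)] assms
  by (auto simp: presented_def Let_def intro!: cls_eq intro: eqv_act eqv_sym)

lemma presented_cmp:
  assumes "wtt (\<Phi> @ [K]) f" "wtt (dual K # \<Psi>) g"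
  shows "cmp P \<Phi> K \<Psi> (cls (dual K # \<Psi>) g) (cls (\<Phi> @ [K]) f) = cls (\<Phi> @ \<Psi>) (TCmp \<Phi> K \<Psi> g f)"
  using rep[OF assms(1)] rep[OF assms(2)] assms
  by (auto simp: presented_def Let_def intro!: cls_eq intro: eqv_cmp eqv_sym)

lemma wt_act: "wtt (pull \<Phi> \<sigma>) t \<Longrightarrow> valid P \<Phi> \<Longrightarrow> structural c \<Phi> \<sigma> \<Longrightarrow> wtt \<Phi> (TAct \<Phi> \<sigma> t)"
  by (auto simp: valid_def intro: wt.intros)

lemma presented_lnl_ops: "lnl_ops P"
  unfolding lnl_ops_def
proof (intro conjI allI ballI op_closedI)
  show "valid P \<Phi>" if "x \<in> Hom P \<Phi>" for \<Phi> x
    using that wt_valid by (fastforce simp: valid_def)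
  show "idn P R \<in> Hom P [(R, Neg), (R, Pos)]" if "R \<in> Ob P" for R
    using that by (auto intro: wt.intros)
  show "act P \<Phi> \<sigma> x \<in> Hom P \<Phi>" if "x \<in> Hom P (pull \<Phi> \<sigma>)" "valid P \<Phi>" "structural (cl P) \<Phi> \<sigma>" for \<Phi> \<sigma> x
  proof -
    from that obtain t where "x = cls (pull \<Phi> \<sigma>) t" "wtt (pull \<Phi> \<sigma>) t" by auto
    then show ?thesis using presented_act wt_act that by auto
  qed
  show "cmp P \<Phi> K \<Psi> g f \<in> Hom P (\<Phi> @ \<Psi>)" if "f \<in> Hom P (\<Phi> @ [K])" "g \<in> Hom P (dual K # \<Psi>)" for \<Phi> K \<Psi> f g
  proof -
    from that obtain s t where "f = cls (\<Phi> @ [K]) s" "wtt (\<Phi> @ [K]) s" "g = cls (dual K # \<Psi>) t" "wtt (dual K # \<Psi>) t"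
      by auto
    then show ?thesis using presented_cmp by (auto intro: wt.intros)
  qed
qed

lemma presented_generated:
  assumes M: "op_closed P M"
    and gen: "\<And>g \<Xi>. gen g \<Xi> \<Longrightarrow> fst ` set \<Xi> \<subseteq> O' \<Longrightarrow> admissible c \<Xi> \<Longrightarrow> M \<Xi> (cls \<Xi> (TGen g))"
    and x: "x \<in> Hom P \<Phi>"
  shows "M \<Phi> x"
proof -
  have "M \<Phi> (cls \<Phi> t)" if "wtt \<Phi> t" for \<Phi> t
    using that
  proof induction
    case (1 g \<Xi>) then show ?case by (rule gen)
  next
    case (2 R) then show ?case using op_closed_idn[OF M, of R] by simp
  next
    case (3 \<Phi> \<sigma> t)
    then show ?case
      using op_closed_act[OF M, of "cls (pull \<Phi> \<sigma>) t" \<Phi> \<sigma>] presented_act[of \<Phi> \<sigma> t]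
      by (auto simp: valid_def)
  next
    case (4 \<Phi> K f \<Psi> g)
    then show ?case
      using op_closed_cmp[OF M, of "cls (\<Phi> @ [K]) f" \<Phi> K "cls (dual K # \<Psi>) g" \<Psi>] presented_cmp[of \<Phi> K f \<Psi> g]
      by auto
  qed
  then show ?thesis using x by auto
qed

context
  fixes Q :: "('o2, 'm) lnl" and h \<gamma>
  assumes Q: "lnl Q" and h: "\<And>R. R \<in> O' \<Longrightarrow> h R \<in> Ob Q \<and> cl Q (h R) = c R"
    and \<gamma>: "\<And>g \<Xi>. gen g \<Xi> \<Longrightarrow> fst ` set \<Xi> \<subseteq> O' \<Longrightarrow> admissible c \<Xi> \<Longrightarrow> \<gamma> g \<in> Hom Q (smap h \<Xi>)"
    and rel: "\<And>\<Xi> s t. rel \<Xi> s t \<Longrightarrow> ev Q h \<gamma> s = ev Q h \<gamma> t"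
begin

lemma ev_valid:
  assumes "fst ` set \<Phi> \<subseteq> O'" "admissible c \<Phi>"
  shows "valid Q (smap h \<Phi>)"
proof -
  have "admissible (cl Q) (smap h \<Phi>) = admissible c \<Phi>"
    by (intro admissible_smap) (use assms h in auto)
  moreover have "h ` fst ` set \<Phi> \<subseteq> Ob Q" using assms h by blast
  ultimately show ?thesis using assms by (simp add: valid_def fst_set_smap)
qed

lemma ev_structural: "fst ` set \<Phi> \<subseteq> O' \<Longrightarrow> structural (cl Q) (smap h \<Phi>) \<sigma> = structural c \<Phi> \<sigma>"
  by (intro structural_smap) (use h in auto)

lemma ev_Hom: "wtt \<Phi> t \<Longrightarrow> ev Q h \<gamma> t \<in> Hom Q (smap h \<Phi>)"
proof (induction rule: wt.induct)
  case (3 \<Phi> \<sigma> t)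
  then show ?case
    using lnl_act[OF Q _ ev_valid ev_structural[THEN iffD2]] by (simp add: pull_smap_structural)
next
  case (4 \<Phi> K f \<Psi> g)
  then show ?case using lnl_cmp[OF Q] by (simp add: dual_map_prod)
qed (use \<gamma> h lnl_idn[OF Q] in auto)

text \<open>The kernel of evaluation is a family of congruences satisfying the axioms, because
  \<open>Q\<close> satisfies them. As \<open>tm_eq\<close> is contained in every such family that
  contains the relations, congruent terms have equal values.\<close>

lemma ev_lnl_upto: "lnl_upto (\<lambda>_ s t. ev Q h \<gamma> s = ev Q h \<gamma> t) (term_alg O' c gen)"
proof (rule lnl_uptoI; (simp only: term_alg_simps mem_Collect_eq)?)
  note H = ev_Hom
  show "equivp (\<lambda>s t. ev Q h \<gamma> s = ev Q h \<gamma> t)" by (auto intro!: equivpI reflpI sympI transpI)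
  show "valid (term_alg O' c gen) \<Phi>" if "wtt \<Phi> x" for \<Phi> x
    using wt_valid[OF that] by (simp add: valid_def)
  show "wtt \<Phi> (TAct \<Phi> \<sigma> x)" if "wtt (pull \<Phi> \<sigma>) x" "valid (term_alg O' c gen) \<Phi>" "structural c \<Phi> \<sigma>" for \<Phi> \<sigma> x
    using that by (auto simp: valid_def intro: wt.intros)
  show "wtt [(R, Neg), (R, Pos)] (TId R)" if "R \<in> O'" for R
    using that by (rule wt.intros)
  show "wtt (\<Phi> @ \<Psi>) (TCmp \<Phi> K \<Psi> g f)" if "wtt (\<Phi> @ [K]) f" "wtt (dual K # \<Psi>) g" for \<Phi> K \<Psi> f g
    using that by (rule wt.intros)
  show "ev Q h \<gamma> (TAct \<Phi> [0..<length \<Phi>] x) = ev Q h \<gamma> x" if "wtt \<Phi> x" for \<Phi> x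
    using lnl_act_id[OF Q H[OF that]] by simp
  show "ev Q h \<gamma> (TAct \<Phi> \<sigma> (TAct (pull \<Phi> \<sigma>) \<tau> x)) = ev Q h \<gamma> (TAct \<Phi> (pull \<sigma> \<tau>) x)"
    if "wtt (pull (pull \<Phi> \<sigma>) \<tau>) x" "valid (term_alg O' c gen) \<Phi>" "structural c \<Phi> \<sigma>" "structural c (pull \<Phi> \<sigma>) \<tau>"
    for \<Phi> \<sigma> \<tau> x
  proof -
    have *: "structural (cl Q) (smap h (pull \<Phi> \<sigma>)) \<tau>"
      using ev_structural[of "pull \<Phi> \<sigma>"] that set_pull[OF that(3)] by (auto simp: valid_def)
    show ?thesis
      using H[OF that(1)] that * ev_valid[of \<Phi>] ev_structural[of \<Phi>]
        lnl_act_act[OF Q, of "ev Q h \<gamma> x" "smap h \<Phi>" \<sigma> \<tau>]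
      by (simp add: pull_smap_structural valid_def)
  qed
  show "ev Q h \<gamma> (TCmp \<Phi> (R, Pos) [(R, Pos)] (TId R) f) = ev Q h \<gamma> f" if "wtt (\<Phi> @ [(R, Pos)]) f" for \<Phi> R f
    using lnl_unit_pos[OF Q] H[OF that] by simp
  show "ev Q h \<gamma> (TCmp [(R, Neg)] (R, Pos) \<Psi> g (TId R)) = ev Q h \<gamma> g" if "wtt ((R, Neg) # \<Psi>) g" for \<Psi> R g
    using lnl_unit_neg[OF Q] H[OF that] by simp
  show "ev Q h \<gamma> (TCmp (\<Phi> @ \<Psi>) L \<Theta> hh (TCmp \<Phi> K (\<Psi> @ [L]) g f)) =
       ev Q h \<gamma> (TCmp \<Phi> K (\<Psi> @ \<Theta>) (TCmp (dual K # \<Psi>) L \<Theta> hh g) f)"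
    if "wtt (\<Phi> @ [K]) f" "wtt (dual K # \<Psi> @ [L]) g" "wtt (dual L # \<Theta>) hh" for \<Phi> K \<Psi> L \<Theta> f g hh
    using lnl_assoc[OF Q, of "ev Q h \<gamma> f" "smap h \<Phi>" "map_prod h id K" "ev Q h \<gamma> g" "smap h \<Psi>" "map_prod h id L"]
      H[OF that(1)] H[OF that(2)] H[OF that(3)] by (simp add: dual_map_prod)
  show "ev Q h \<gamma> (TCmp \<Phi> K \<Psi> g f) =
         ev Q h \<gamma> (TAct (\<Phi> @ \<Psi>) ([length \<Phi>..<length \<Phi>+length \<Psi>] @ [0..<length \<Phi>])
            (TCmp \<Psi> (dual K) \<Phi>
               (TAct (K # \<Phi>) ([1..<Suc (length \<Phi>)] @ [0]) f)
               (TAct (\<Psi> @ [dual K]) (length \<Psi> # [0..<length \<Psi>]) g)))"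
    if "wtt (\<Phi> @ [K]) f" "wtt (dual K # \<Psi>) g" for \<Phi> K \<Psi> f g
    using lnl_swap[OF Q, of "ev Q h \<gamma> f" "smap h \<Phi>" "map_prod h id K" "ev Q h \<gamma> g" "smap h \<Psi>"]
      H[OF that(1)] H[OF that(2)] by (simp add: dual_map_prod)
  show "ev Q h \<gamma> (TCmp \<Phi> K \<Psi> g (TAct (\<Phi> @ [K]) (\<sigma> @ [length \<Phi>]) f)) =
         ev Q h \<gamma> (TAct (\<Phi> @ \<Psi>) (\<sigma> @ [length \<Phi>..<length \<Phi>+length \<Psi>]) (TCmp (pull \<Phi> \<sigma>) K \<Psi> g f))"
    if "wtt (pull \<Phi> \<sigma> @ [K]) f" "wtt (dual K # \<Psi>) g" "valid (term_alg O' c gen) (\<Phi> @ [K])" "structural c \<Phi> \<sigma>"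
    for \<Phi> \<sigma> K \<Psi> f g
    using lnl_str[OF Q, of "ev Q h \<gamma> f" "smap h \<Phi>" \<sigma> "map_prod h id K" "ev Q h \<gamma> g" "smap h \<Psi>"]
      H[OF that(1)] H[OF that(2)] that ev_valid[of "\<Phi> @ [K]"] ev_structural[of \<Phi>]
    by (simp add: dual_map_prod pull_smap_structural valid_def)
  have n: "neg_nonlinear (cl Q) (map_prod h id K)" if "neg_nonlinear c K" "fst K \<in> O'" for K
    using that h by (simp add: neg_nonlinear_def)
  show "ev Q h \<gamma> (TCmp \<Phi> K \<Psi> g (TAct (\<Phi> @ [K]) [0..<length \<Phi>] f)) = ev Q h \<gamma> (TAct (\<Phi> @ \<Psi>) [0..<length \<Phi>] f)"
    if "wtt \<Phi> f" "wtt (dual K # \<Psi>) g" "valid (term_alg O' c gen) (\<Phi> @ [K])" "neg_nonlinear c K" for \<Phi> K \<Psi> f g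
    using lnl_weak[OF Q, of "ev Q h \<gamma> f" "smap h \<Phi>" "ev Q h \<gamma> g" "map_prod h id K" "smap h \<Psi>"]
      H[OF that(1)] H[OF that(2)] that ev_valid[of "\<Phi> @ [K]"] n[of K]
    by (simp add: dual_map_prod valid_def)
  show "ev Q h \<gamma> (TCmp \<Phi> K \<Psi> g (TAct (\<Phi> @ [K]) ([0..<length \<Phi>] @ [length \<Phi>, length \<Phi>]) f)) =
         ev Q h \<gamma> (TAct (\<Phi> @ \<Psi>) ([0..<length \<Phi>] @ [length \<Phi>..<length \<Phi>+length \<Psi>] @ [length \<Phi>..<length \<Phi>+length \<Psi>])
            (TCmp (\<Phi> @ \<Psi>) K \<Psi> g
               (TAct (\<Phi> @ \<Psi> @ [K]) ([0..<length \<Phi>] @ [length \<Phi>+length \<Psi>] @ [length \<Phi>..<length \<Phi>+length \<Psi>])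
                  (TCmp (\<Phi> @ [K]) K \<Psi> g f))))"
    if "wtt (\<Phi> @ [K, K]) f" "wtt (dual K # \<Psi>) g" "neg_nonlinear c K" for \<Phi> K \<Psi> f g
    using lnl_contr[OF Q, of "ev Q h \<gamma> f" "smap h \<Phi>" "map_prod h id K" "ev Q h \<gamma> g" "smap h \<Psi>"]
      H[OF that(1)] H[OF that(2)] that wt_valid[OF that(1)] n[of K]
    by (simp add: dual_map_prod)
qed auto

lemma ev_eqv: "eqv \<Phi> s t \<Longrightarrow> ev Q h \<gamma> s = ev Q h \<gamma> t"
  using ev_lnl_upto rel unfolding tm_eq_def by blast

text \<open>The universal property of a presentation: an assignment on generators that respects the
  relations extends to terms by evaluation and descends to classes by \<open>ev_eqv\<close>.\<close>

lemma presented_functor: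
  "\<exists>F. is_functor P Q F \<and> (\<forall>R\<in>O'. fob F R = h R) \<and> (\<forall>\<Phi> t. wtt \<Phi> t \<longrightarrow> fmor F \<Phi> (cls \<Phi> t) = ev Q h \<gamma> t)"
proof -
  define F where "F = mk_fctr P h (\<lambda>\<Phi> x. ev Q h \<gamma> (SOME t. t \<in> x))"
  have ob: "fob F R = h R" if "R \<in> O'" for R
    using that by (simp add: F_def mk_fctr_simps)
  have mor: "fmor F \<Phi> (cls \<Phi> t) = ev Q h \<gamma> t" if "wtt \<Phi> t" for \<Phi> t
  proof -
    have "cls \<Phi> t \<in> Hom P \<Phi>" using that by auto
    then show ?thesis
      using ev_eqv[OF rep(2)[OF that]] unfolding F_def by (simp only: mk_fctr_simps)
  qed
  have s: "smap (fob F) \<Phi> = smap h \<Phi>" if "fst ` set \<Phi> \<subseteq> O'" for \<Phi>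
    by (rule smap_cong) (use that ob in auto)
  have "is_functor P Q F"
  proof (rule functorI)
    show "fob F R \<in> Ob Q" "cl Q (fob F R) = cl P R" if "R \<in> Ob P" for R
      using that ob h by auto
    show "fmor F \<Phi> x \<in> Hom Q (smap (fob F) \<Phi>)" if "x \<in> Hom P \<Phi>" for \<Phi> x
    proof -
      from that obtain t where "x = cls \<Phi> t" "wtt \<Phi> t" by auto
      then show ?thesis using mor s ev_Hom wt_valid[OF \<open>wtt \<Phi> t\<close>] by simp
    qed
    show "fmor F \<Phi> (act P \<Phi> \<sigma> x) = act Q (smap (fob F) \<Phi>) \<sigma> (fmor F (pull \<Phi> \<sigma>) x)"
      if x: "x \<in> Hom P (pull \<Phi> \<sigma>)" and a: "valid P \<Phi>" "structural (cl P) \<Phi> \<sigma>" for \<Phi> \<sigma> x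
    proof -
      obtain t where t: "x = cls (pull \<Phi> \<sigma>) t" "wtt (pull \<Phi> \<sigma>) t" using x by auto
      have "wtt \<Phi> (TAct \<Phi> \<sigma> t)" using wt_act t a by auto
      then show ?thesis
        using presented_act[OF t(2)] a mor[of \<Phi>] mor[OF t(2)] s[of \<Phi>] unfolding t(1) by (simp add: valid_def)
    qed
    show "fmor F [(R, Neg), (R, Pos)] (idn P R) = idn Q (fob F R)" if "R \<in> Ob P" for R
      using mor[OF wt.intros(2)[of R]] ob[of R] that by simp
    show "fmor F (\<Phi> @ \<Psi>) (cmp P \<Phi> K \<Psi> g f) =
       cmp Q (smap (fob F) \<Phi>) (map_prod (fob F) id K) (smap (fob F) \<Psi>)
         (fmor F (dual K # \<Psi>) g) (fmor F (\<Phi> @ [K]) f)"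
      if "f \<in> Hom P (\<Phi> @ [K])" "g \<in> Hom P (dual K # \<Psi>)" for \<Phi> K \<Psi> f g
    proof -
      from that obtain t u where t: "f = cls (\<Phi> @ [K]) t" "wtt (\<Phi> @ [K]) t"
        and u: "g = cls (dual K # \<Psi>) u" "wtt (dual K # \<Psi>) u" by auto
      have "map_prod (fob F) id K = map_prod h id K"
        using ob wt_valid[OF t(2)] by (cases K) auto
      then show ?thesis
        using presented_cmp[OF t(2) u(2)] mor[OF wt.intros(4)[OF t(2) u(2)]] mor[OF t(2)] mor[OF u(2)]
          wt_valid[OF t(2)] wt_valid[OF u(2)] s[of \<Phi>] s[of \<Psi>]
        unfolding t(1) u(1) by simp
    qed
  qed (auto simp: F_def mk_fctr_def)
  then show ?thesis using ob mor by blast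
qed

end

end

section \<open>Structural maps\<close>

lemma pull_simps [simp]:
  "pull xs [] = []" "pull xs (j # \<sigma>) = xs ! j # pull xs \<sigma>" "pull xs (\<sigma> @ \<tau>) = pull xs \<sigma> @ pull xs \<tau>"
  "length (pull xs \<sigma>) = length \<sigma>"
  by (simp_all add: pull_def)

lemma pull_upt: "n + m \<le> length xs \<Longrightarrow> pull xs [n..<n + m] = take m (drop n xs)"
  by (intro nth_equalityI) (auto simp: pull_def)

lemma pull_append_left: "\<forall>j\<in>set \<sigma>. j < length \<Phi> \<Longrightarrow> pull (\<Phi> @ \<Psi>) \<sigma> = pull \<Phi> \<sigma>"
  by (auto simp: pull_def nth_append)

lemma pull_append_upt [simp]: "pull (\<Phi> @ \<Psi>) [length \<Phi>..<length \<Phi> + length \<Psi>] = \<Psi>"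
  by (simp add: pull_upt)

lemma pull_id [simp]: "pull \<Phi> [0..<length \<Phi>] = \<Phi>"
  using pull_upt[of 0 "length \<Phi>" \<Phi>] by simp

lemma pull_append_id [simp]: "pull (\<Phi> @ \<Psi>) [0..<length \<Phi>] = \<Phi>"
  by (subst pull_append_left) auto

lemma pull_upt_left: "\<forall>j\<in>set \<sigma>. j < n \<Longrightarrow> pull [0..<n] \<sigma> = \<sigma>"
  by (auto simp: pull_def intro: nth_equalityI map_idI)

lemma structural_lt: "structural c \<Phi> \<sigma> \<Longrightarrow> j \<in> set \<sigma> \<Longrightarrow> j < length \<Phi>"
  by (auto simp: structural_def)

lemma count_list_upt: "count_list [n..<m] j = (if n \<le> j \<and> j < m then 1 else 0)"
proof (cases "n \<le> j \<and> j < m")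
  case True
  then have "[n..<m] = [n..<j] @ j # [Suc j..<m]"
    by (metis upt_add_eq_append[of n j "m - j"] upt_conv_Cons le_add_diff_inverse less_or_eq_imp_le)
  then show ?thesis using True by (auto simp: count_list_0_iff)
qed (auto simp: count_list_0_iff)

lemma structural_append_iff:
  assumes "\<forall>j\<in>set \<sigma>. j < length \<Phi>"
  shows "structural c (\<Phi> @ \<Psi>) (\<sigma> @ [length \<Phi>..<length \<Phi> + length \<Psi>]) = structural c \<Phi> \<sigma>"
proof -
  have 1: "count_list (\<sigma> @ [length \<Phi>..<length \<Phi> + length \<Psi>]) j = (if j < length \<Phi> then count_list \<sigma> j else 1)"
    if "j < length \<Phi> + length \<Psi>" for j
  proof -
    have "count_list \<sigma> j = 0" if "\<not> j < length \<Phi>" using that assms by (auto simp: count_list_0_iff)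
    then show ?thesis using that by (auto simp: count_list_upt)
  qed
  show ?thesis
    using assms 1 unfolding structural_def by (force simp: nth_append)
qed

text \<open>The entries of \<open>\<Psi>\<close> are not hit at all, which their being negative
  nonlinear permits: this is weakening by \<open>\<Psi>\<close>.\<close>

lemma structural_append_weak:
  assumes "\<forall>K\<in>set \<Psi>. neg_nonlinear c K" "\<forall>j\<in>set \<sigma>. j < length \<Phi>"
  shows "structural c (\<Phi> @ \<Psi>) \<sigma> = structural c \<Phi> \<sigma>"
proof
  assume *: "structural c (\<Phi> @ \<Psi>) \<sigma>"
  show "structural c \<Phi> \<sigma>"
    unfolding structural_def
  proof (intro conjI allI impI)
    fix j assume j: "j < length \<Phi>" "count_list \<sigma> j \<noteq> 1"
    then have "neg_nonlinear c ((\<Phi> @ \<Psi>) ! j)" using * by (auto simp: structural_def)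
    then show "neg_nonlinear c (\<Phi> ! j)" using j by (simp add: nth_append)
  qed (use assms in auto)
next
  assume *: "structural c \<Phi> \<sigma>"
  have "neg_nonlinear c ((\<Phi> @ \<Psi>) ! j)" if "j < length (\<Phi> @ \<Psi>)" "count_list \<sigma> j \<noteq> 1" for j
    using that * assms by (cases "j < length \<Phi>") (auto simp: nth_append structural_def)
  then show "structural c (\<Phi> @ \<Psi>) \<sigma>" using assms unfolding structural_def by auto
qed

lemma structural_id: "structural c \<Phi> [0..<length \<Phi>]"
  by (auto simp: structural_def count_list_upt)

text \<open>\<open>p\<close> is the only position at which \<open>\<sigma>\<close> has this value,
  so its occurrences in the composite correspond to the occurrences of \<open>p\<close> in
  \<open>\<tau>\<close>.\<close>

lemma count_list_pull:
  assumes "count_list \<sigma> (\<sigma> ! p) = 1" "p < length \<sigma>" "\<forall>i\<in>set \<tau>. i < length \<sigma>"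
  shows "count_list (pull \<sigma> \<tau>) (\<sigma> ! p) = count_list \<tau> p"
proof -
  have "i = p" if "i < length \<sigma>" "\<sigma> ! i = \<sigma> ! p" for i
  proof (rule ccontr)
    assume "i \<noteq> p"
    then have "card {i, p} = 2" by simp
    moreover have "{i, p} \<subseteq> {q. q < length \<sigma> \<and> \<sigma> ! p = \<sigma> ! q}" using that assms by auto
    moreover have "count_list \<sigma> (\<sigma> ! p) = card {q. q < length \<sigma> \<and> \<sigma> ! p = \<sigma> ! q}"
      by (simp add: count_list_eq_length_filter length_filter_conv_card)
    ultimately show False
      using assms(1) card_mono[of "{q. q < length \<sigma> \<and> \<sigma> ! p = \<sigma> ! q}" "{i, p}"] by simp
  qed
  then show ?thesis using assms(2,3) by (induction \<tau>) auto
qed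

text \<open>If \<open>\<sigma>\<close> takes the value \<open>j\<close> exactly once, the
  multiplicity of \<open>j\<close> in the composite is that of its unique position in
  \<open>\<tau>\<close>. Otherwise \<open>\<sigma>\<close> already requires the entry at
  \<open>j\<close> to be negative nonlinear.\<close>

lemma structural_pull:
  assumes "structural c \<Phi> \<sigma>" "structural c (pull \<Phi> \<sigma>) \<tau>"
  shows "structural c \<Phi> (pull \<sigma> \<tau>)"
proof -
  have \<tau>: "i < length \<sigma>" if "i \<in> set \<tau>" for i
    using that structural_lt[OF assms(2)] by simp
  have "neg_nonlinear c (\<Phi> ! j)" if j: "j < length \<Phi>" "count_list (pull \<sigma> \<tau>) j \<noteq> 1" for j
  proof (cases "count_list \<sigma> j = 1")
    case True
    then have "j \<in> set \<sigma>" by (metis count_notin zero_neq_one)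
    then obtain p where p: "p < length \<sigma>" "\<sigma> ! p = j" by (auto simp: in_set_conv_nth)
    then have "count_list \<tau> p \<noteq> 1" using j count_list_pull[of \<sigma> p \<tau>] True \<tau> by auto
    then have "neg_nonlinear c (pull \<Phi> \<sigma> ! p)" using assms(2) p by (auto simp: structural_def)
    then show ?thesis using p by (simp add: pull_def)
  qed (use assms(1) j in \<open>auto simp: structural_def\<close>)
  moreover have "j < length \<Phi>" if "j \<in> set (pull \<sigma> \<tau>)" for j
    using that \<tau> structural_lt[OF assms(1)] by (auto simp: pull_def)
  ultimately show ?thesis by (auto simp: structural_def)
qed

lemma pull_pull: "\<forall>i\<in>set \<tau>. i < length \<sigma> \<Longrightarrow> pull (pull \<Phi> \<sigma>) \<tau> = pull \<Phi> (pull \<sigma> \<tau>)"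
  by (auto simp: pull_def)

text \<open>\<open>dual K\<close> takes the single slot for a positive nonlinear object and excludes
  linear ones, which leaves only negative nonlinear entries in \<open>\<Psi>\<close>.\<close>

lemma neg_nonlinear_cut:
  assumes "admissible c (dual K # \<Psi>)" "neg_nonlinear c K" "L \<in> set \<Psi>"
  shows "neg_nonlinear c L"
proof -
  have d: "pos_nonlinear c (dual K)" using assms(2) by (auto simp: pos_nonlinear_def neg_nonlinear_def)
  with assms(1) have "filter (pos_nonlinear c) \<Psi> = []" "\<forall>L\<in>set \<Psi>. c (fst L) \<noteq> Linear"
    by (auto simp: admissible_def)
  then have "\<not> pos_nonlinear c L" "c (fst L) \<noteq> Linear"
    using assms(3) by (auto simp: filter_empty_conv)
  then show ?thesis
    by (cases "c (fst L)"; cases "snd L") (auto simp: neg_nonlinear_def pos_nonlinear_def)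
qed

text \<open>The two values of \<open>\<sigma>\<close> differ, as they select entries of opposite
  sign, so the last entry is hit at most once. If it is hit, the other value selects an entry dual
  to it; if not, the last entry must be negative nonlinear.\<close>

lemma structural_idn_cases:
  assumes "structural c (\<Theta> @ [L]) \<sigma>" "pull (\<Theta> @ [L]) \<sigma> = [(R, Neg), (R, Pos)]"
  obtains (hit) a where "a < length \<Theta>" "\<Theta> ! a = dual L" "fst L = R" "structural c \<Theta> [a]"
      "\<sigma> = (if snd L = Pos then [a, length \<Theta>] else [length \<Theta>, a])"
  | (miss) "neg_nonlinear c L" "structural c \<Theta> \<sigma>" "\<forall>j\<in>set \<sigma>. j < length \<Theta>"
proof -
  let ?n = "length \<Theta>"
  obtain a b where \<sigma>: "\<sigma> = [a, b]" and ab: "(\<Theta> @ [L]) ! a = (R, Neg)" "(\<Theta> @ [L]) ! b = (R, Pos)"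
    using assms(2) by (cases \<sigma>; cases "tl \<sigma>") (auto simp: pull_def)
  have lt: "a \<le> ?n" "b \<le> ?n" using assms(1) \<sigma> by (auto simp: structural_def)
  have neq: "a \<noteq> b" using ab by auto
  have nn: "neg_nonlinear c ((\<Theta> @ [L]) ! j)" if "j \<le> ?n" "count_list \<sigma> j \<noteq> 1" for j
    using assms(1) that by (auto simp: structural_def)
  show thesis
  proof (cases "?n \<in> set \<sigma>")
    case False
    then have j: "\<forall>j\<in>set \<sigma>. j < ?n" using lt \<sigma> by auto
    have L: "neg_nonlinear c L" using nn[of ?n] False by (simp add: count_notin)
    show ?thesis using miss[OF L _ j] structural_append_weak[of "[L]" c \<sigma> \<Theta>] assms(1) L j by simp
  next
    case True
    define d where "d = (if a = ?n then b else a)"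
    have d: "d < ?n" "(\<Theta> @ [L]) ! d = \<Theta> ! d" using lt neq True \<sigma> by (auto simp: d_def nth_append)
    have "structural c \<Theta> [d]"
      unfolding structural_def
    proof (intro conjI allI impI)
      fix j assume j: "j < ?n" "count_list [d] j \<noteq> 1"
      then have "count_list \<sigma> j \<noteq> 1" using True lt neq \<sigma> by (auto simp: d_def split: if_splits)
      then show "neg_nonlinear c (\<Theta> ! j)" using nn[of j] j by (simp add: nth_append)
    qed (use d in auto)
    moreover have "\<Theta> ! d = dual L" "fst L = R" "\<sigma> = (if snd L = Pos then [d, ?n] else [?n, d])"
      using True lt neq \<sigma> ab d by (auto simp: d_def dual_def nth_append split: if_splits)
    ultimately show ?thesis using hit[of d] d by blast
  qed
qed

text \<open>Cutting against a relabelled identity is a relabelling, by a unit law. For positive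
  \<open>L\<close> the unit axiom applies directly; for negative \<open>L\<close> the identity
  stands on the wrong side and is first turned around by the swap axiom.\<close>

lemma cmp_structural_hit:
  assumes P: "lnl P" and f: "f \<in> Hom P (dual L # \<Psi>)" and v: "valid P (\<Theta> @ [L])"
    and a: "a < length \<Theta>" "\<Theta> ! a = dual L" "structural (cl P) \<Theta> [a]"
  shows "cmp P \<Theta> L \<Psi> f (act P (\<Theta> @ [L]) (if snd L = Pos then [a, length \<Theta>] else [length \<Theta>, a]) (idn P (fst L))) =
     act P (\<Theta> @ \<Psi>) (a # [length \<Theta>..<length \<Theta> + length \<Psi>]) f"
proof (cases "snd L")
  case Pos
  then obtain R where L: "L = (R, Pos)" by (cases L) auto
  have R: "R \<in> Ob P" using v L by (auto simp: valid_def)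
  have p: "pull \<Theta> [a] = [(R, Neg)]" using a L by (simp add: dual_def)
  have "cmp P \<Theta> L \<Psi> f (act P (\<Theta> @ [L]) ([a] @ [length \<Theta>]) (idn P R)) =
     act P (\<Theta> @ \<Psi>) ([a] @ [length \<Theta>..<length \<Theta> + length \<Psi>]) (cmp P (pull \<Theta> [a]) L \<Psi> f (idn P R))"
    by (rule lnl_str[OF P]) (use p lnl_idn[OF P R] f v a L in auto)
  then show ?thesis using lnl_unit_neg[OF P, of f R \<Psi>] f p L by (simp add: dual_def)
next
  case Neg
  then obtain R where L: "L = (R, Neg)" by (cases L) auto
  have R: "R \<in> Ob P" using v L by (auto simp: valid_def)
  let ?n = "length \<Theta>" and ?m = "length \<Psi>" and ?N = "[(R, Neg), (R, Pos)]" and ?M = "[(R, Pos), (R, Neg)]"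
  have p: "pull \<Theta> [a] = [(R, Pos)]" using a L by (simp add: dual_def)
  have i: "idn P R \<in> Hom P ?N" by (rule lnl_idn[OF P R])
  have sN: "structural (cl P) ?N [1, 0]" "structural (cl P) ?M [1, 0]"
    by (auto simp: structural_def less_Suc_eq)
  have v2: "valid P ?N" using lnl_valid[OF P i] .
  have vM: "valid P ?M" using v2 by (auto simp: valid_def admissible_def)
  \<comment> \<open>The identity with its entries exchanged, so that the entry to be composed along,
    here the negative one, comes last.\<close>
  define s where "s = act P ?M [1, 0] (idn P R)"
  have s: "s \<in> Hom P ?M" unfolding s_def by (rule lnl_act[OF P _ vM sN(2)]) (use i in simp)
  have ss: "act P ?N [1, 0] s = idn P R"
  proof -
    have "act P ?N [1, 0] s = act P ?N (pull [1, 0] [1, 0]) (idn P R)"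
      unfolding s_def using lnl_act_act[OF P, of "idn P R" ?N "[1,0]" "[1,0]"] i v2 sN by simp
    then show ?thesis using lnl_act_id[OF P i] by (simp add: upt_rec)
  qed
  have fL: "f \<in> Hom P ((R, Pos) # \<Psi>)" using f L by (simp add: dual_def)
  have vf: "valid P ((R, Pos) # \<Psi>)" by (rule lnl_valid[OF P fL])
  have vf': "valid P (\<Psi> @ [(R, Pos)])" using vf by (auto simp: valid_def admissible_def)
  have pf: "pull (\<Psi> @ [(R, Pos)]) (?m # [0..<?m]) = (R, Pos) # \<Psi>"
    "pull ((R, Pos) # \<Psi>) ([1..<1 + ?m] @ [0]) = \<Psi> @ [(R, Pos)]"
    using pull_append_upt[of "[(R, Pos)]" \<Psi>] by simp_all
  have cnt: "count_list (?m # [0..<?m]) j = 1" if "j < Suc ?m" for j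
    using that by (auto simp: count_list_upt)
  have cnt2: "count_list ([1..<1 + ?m] @ [0]) j = 1" if "j < Suc ?m" for j
    using that by (auto simp: count_list_upt)
  have st1: "structural (cl P) (\<Psi> @ [(R, Pos)]) (?m # [0..<?m])"
    using cnt by (auto simp: structural_def)
  have st2: "structural (cl P) ((R, Pos) # \<Psi>) ([1..<1 + ?m] @ [0])"
    unfolding structural_def using cnt2 by (auto simp del: One_nat_def)
  have f': "act P (\<Psi> @ [(R, Pos)]) (?m # [0..<?m]) f \<in> Hom P (\<Psi> @ [(R, Pos)])"
    by (rule lnl_act[OF P _ vf' st1]) (use pf fL in simp)
  \<comment> \<open>Swapping moves the identity to the side on which the positive unit axiom
    applies; the outer permutation then cancels the one acting on \<open>f\<close>.\<close>
  have "cmp P [(R, Pos)] (R, Neg) \<Psi> f s =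
    act P ([(R, Pos)] @ \<Psi>) ([length [(R, Pos)]..<length [(R, Pos)] + ?m] @ [0..<length [(R, Pos)]])
      (cmp P \<Psi> (dual (R, Neg)) [(R, Pos)]
         (act P ((R, Neg) # [(R, Pos)]) ([1..<Suc (length [(R, Pos)])] @ [0]) s)
         (act P (\<Psi> @ [dual (R, Neg)]) (?m # [0..<?m]) f))"
    by (rule lnl_swap[OF P]) (use s fL in \<open>simp_all add: dual_def\<close>)
  also have "\<dots> = act P ((R, Pos) # \<Psi>) ([1..<1 + ?m] @ [0]) (act P (\<Psi> @ [(R, Pos)]) (?m # [0..<?m]) f)"
    using ss lnl_unit_pos[OF P f'] by (simp add: dual_def upt_rec)
  also have "\<dots> = act P ((R, Pos) # \<Psi>) (pull ([1..<1 + ?m] @ [0]) (?m # [0..<?m])) f"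
    using lnl_act_act[OF P, of f "(R, Pos) # \<Psi>" "[1..<1 + ?m] @ [0]" "?m # [0..<?m]"] pf fL vf st1 st2 by simp
  also have "pull ([1..<1 + ?m] @ [0]) (?m # [0..<?m]) = [0..<length ((R, Pos) # \<Psi>)]"
  proof -
    have "pull ([1..<1 + ?m] @ [0]) [0..<?m] = [1..<1 + ?m]"
      using pull_append_id[of "[1..<1 + ?m]" "[0]"] unfolding length_upt add_diff_cancel_left' .
    then show ?thesis by (simp add: nth_append upt_conv_Cons del: upt_Suc)
  qed
  also have "act P ((R, Pos) # \<Psi>) [0..<length ((R, Pos) # \<Psi>)] f = f"
    by (rule lnl_act_id[OF P fL])
  finally have sf: "cmp P [(R, Pos)] (R, Neg) \<Psi> f s = f" .
  have st3: "structural (cl P) (\<Theta> @ [L]) ([a] @ [?n])"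
    using structural_append_iff[of "[a]" \<Theta> "cl P" "[L]"] a by simp
  have "act P (\<Theta> @ [L]) ([a] @ [?n]) s = act P (\<Theta> @ [L]) (pull ([a] @ [?n]) [1, 0]) (idn P R)"
    unfolding s_def using lnl_act_act[OF P, of "idn P R" "\<Theta> @ [L]" "[a] @ [?n]" "[1, 0]"] i v st3 sN L a
    by (simp add: nth_append dual_def)
  moreover have "cmp P \<Theta> L \<Psi> f (act P (\<Theta> @ [L]) ([a] @ [?n]) s) =
     act P (\<Theta> @ \<Psi>) ([a] @ [?n..<?n + ?m]) (cmp P (pull \<Theta> [a]) L \<Psi> f s)"
    by (rule lnl_str[OF P]) (use p s f v a L in auto)
  ultimately show ?thesis using sf p L by (simp add: dual_def)
qed

text \<open>\<open>L\<close> is present only by weakening, so the weakening axiom discards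
  \<open>f\<close>. For this the action of \<open>\<sigma>\<close> is split into its action within
  \<open>\<Theta>\<close> and the weakening from \<open>\<Theta>\<close> to the longer list.\<close>

lemma cmp_structural_miss:
  assumes P: "lnl P" and f: "f \<in> Hom P (dual L # \<Psi>)" and v: "valid P (\<Theta> @ [L])"
    and L: "neg_nonlinear (cl P) L" and \<sigma>: "structural (cl P) \<Theta> \<sigma>" and g: "g \<in> Hom P (pull \<Theta> \<sigma>)"
  shows "cmp P \<Theta> L \<Psi> f (act P (\<Theta> @ [L]) \<sigma> g) = act P (\<Theta> @ \<Psi>) \<sigma> g"
proof -
  have lt: "\<forall>j\<in>set \<sigma>. j < length \<Theta>" using structural_lt[OF \<sigma>] by blast
  have v\<Theta>: "valid P \<Theta>"
    using v by (auto simp: valid_def admissible_def split: if_splits)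
  have vf: "valid P (dual L # \<Psi>)" by (rule lnl_valid[OF P f])
  have v\<Psi>: "valid P (\<Theta> @ \<Psi>)"
    using valid_append_dual[OF v vf] v vf admissible_cut[of "cl P" \<Theta> L \<Psi>] by (simp add: valid_def)
  have \<Psi>: "\<forall>K\<in>set \<Psi>. neg_nonlinear (cl P) K"
    using neg_nonlinear_cut[of "cl P" L \<Psi>] vf L by (auto simp: valid_def)
  have *: "act P (\<Theta> @ \<Xi>) \<sigma> g = act P (\<Theta> @ \<Xi>) [0..<length \<Theta>] (act P \<Theta> \<sigma> g)"
    if "\<forall>K\<in>set \<Xi>. neg_nonlinear (cl P) K" "valid P (\<Theta> @ \<Xi>)" for \<Xi>
    using lnl_act_act[OF P, of g "\<Theta> @ \<Xi>" "[0..<length \<Theta>]" \<sigma>] g that lt \<sigma>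
      structural_append_weak[of \<Xi> "cl P" "[0..<length \<Theta>]" \<Theta>] structural_id[of "cl P" \<Theta>]
    by (simp add: pull_upt_left)
  have "act P \<Theta> \<sigma> g \<in> Hom P \<Theta>" by (rule lnl_act[OF P g v\<Theta> \<sigma>])
  from lnl_weak[OF P this f v L] show ?thesis using *[of "[L]"] *[OF \<Psi> v\<Psi>] v L by simp
qed

section \<open>Functors out of finite discrete cones and their expansions\<close>

lemma smap_nth: "j < length \<Phi> \<Longrightarrow> smap h \<Phi> ! j = map_prod h id (\<Phi> ! j)"
  by (simp add: smap_def)

lemma reduct_simps [simp]:
  "Ob (reduct C K) = Ob C - {fst K}" "cl (reduct C K) = cl C"
  "Hom (reduct C K) \<Phi> = (if fst K \<in> fst ` set \<Phi> then {} else Hom C \<Phi>)"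
  "act (reduct C K) = act C" "idn (reduct C K) = idn C" "cmp (reduct C K) = cmp C"
  by (simp_all add: reduct_def)

lemma reduct_sub_lnl: "lnl C \<Longrightarrow> reduct C K = sub_lnl C (Ob C - {fst K}) (\<lambda>_ _. True)"
proof -
  assume C: "lnl C"
  have "Hom (reduct C K) = Hom (sub_lnl C (Ob C - {fst K}) (\<lambda>_ _. True))"
  proof (intro ext set_eqI)
    show "x \<in> Hom (reduct C K) \<Phi> \<longleftrightarrow> x \<in> Hom (sub_lnl C (Ob C - {fst K}) (\<lambda>_ _. True)) \<Phi>" for \<Phi> x
      using lnl_valid[OF C, of x \<Phi>] by (auto simp: valid_def subset_Diff_insert)
  qed
  then show ?thesis by (intro lnl.equality) auto
qed

lemma lnl_ops_reduct: "lnl C \<Longrightarrow> lnl_ops (reduct C K)"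
  by (simp add: reduct_sub_lnl lnl_lnl_ops lnl_sub_lnl op_closed_def)

lemma functor_fincl_reduct: "lnl C \<Longrightarrow> is_functor (reduct C K) C (fincl (reduct C K))"
  unfolding reduct_sub_lnl by (rule functor_fincl) (auto simp: op_closed_def)

lemma valid_two: "valid P [(R, Neg), (R, Pos)] \<longleftrightarrow> R \<in> Ob P"
  by (auto simp: valid_def admissible_def pos_nonlinear_def)

section \<open>Normal forms in a cone and functors out of its reduct\<close>

locale cone_basis =
  fixes C :: "('r, 'p) lnl" and K :: "'r signed" and ps :: "('r signed list \<times> 'p) list"
  assumes C: "lnl C" and basis: "projection_basis C K ps"
begin

text \<open>The uniqueness clause of \<open>projection_basis\<close> as a predicate:
  \<open>x\<close> is obtained from the basic morphism \<open>g\<close>, an identity or a listed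
  projection, by the structural map \<open>\<sigma>\<close>.\<close>

definition nf :: "'r signed list \<Rightarrow> 'r signed list \<Rightarrow> 'p \<Rightarrow> nat list \<Rightarrow> 'p \<Rightarrow> bool" where
  "nf \<Xi> \<Psi> g \<sigma> x \<longleftrightarrow>
     (\<Psi>, g) \<in> {([(R, Neg), (R, Pos)], idn C R) |R. R \<in> Ob C} \<union> {(\<Phi> @ [K], f) |\<Phi> f. (\<Phi>, f) \<in> set ps} \<and>
     structural (cl C) \<Xi> \<sigma> \<and> pull \<Xi> \<sigma> = \<Psi> \<and> act C \<Xi> \<sigma> g = x"

lemma nf_ex1: "x \<in> Hom C \<Xi> \<Longrightarrow> \<exists>!(\<Psi>, g, \<sigma>). nf \<Xi> \<Psi> g \<sigma> x"
  unfolding nf_def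
  by (rule basis[unfolded projection_basis_def, THEN conjunct2, THEN conjunct2, THEN spec, THEN bspec])

lemma nf_unique:
  assumes "x \<in> Hom C \<Xi>" "nf \<Xi> \<Psi> g \<sigma> x" "nf \<Xi> \<Psi>' g' \<sigma>' x"
  shows "\<Psi> = \<Psi>'" "g = g'" "\<sigma> = \<sigma>'"
  using nf_ex1[OF assms(1)] assms(2,3) by auto

lemma ps_proj: "(\<Phi>, f) \<in> set ps \<Longrightarrow> fst K \<notin> fst ` set \<Phi> \<and> f \<in> Hom C (\<Phi> @ [K])"
  using basis unfolding projection_basis_def abstract_projection_def by blast

lemma nf_idnI:
  assumes "R \<in> Ob C" "structural (cl C) \<Xi> \<sigma>" "pull \<Xi> \<sigma> = [(R, Neg), (R, Pos)]"
  shows "nf \<Xi> [(R, Neg), (R, Pos)] (idn C R) \<sigma> (act C \<Xi> \<sigma> (idn C R))"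
  using assms unfolding nf_def by blast

lemma act_idn_Hom:
  assumes "valid C \<Xi>" "structural (cl C) \<Xi> \<sigma>" "pull \<Xi> \<sigma> = [(R, Neg), (R, Pos)]"
  shows "act C \<Xi> \<sigma> (idn C R) \<in> Hom C \<Xi>" "R \<in> Ob C"
proof -
  have "(R, Neg) \<in> set \<Xi>" using set_pull[OF assms(2)] assms(3) by auto
  then show "R \<in> Ob C" using assms(1) by (force simp: valid_def)
  then show "act C \<Xi> \<sigma> (idn C R) \<in> Hom C \<Xi>"
    using lnl_act[OF C _ assms(1,2)] lnl_idn[OF C] assms(3) by metis
qed

lemma act_idn_unique:
  assumes "valid C \<Xi>" "structural (cl C) \<Xi> \<sigma>" "pull \<Xi> \<sigma> = [(R, Neg), (R, Pos)]"
    "structural (cl C) \<Xi> \<sigma>'" "pull \<Xi> \<sigma>' = [(R', Neg), (R', Pos)]"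
    "act C \<Xi> \<sigma> (idn C R) = act C \<Xi> \<sigma>' (idn C R')"
  shows "R = R'" "\<sigma> = \<sigma>'"
  using nf_unique[OF act_idn_Hom(1)[OF assms(1-3)] nf_idnI[OF act_idn_Hom(2)[OF assms(1-3)] assms(2,3)]]
    nf_idnI[OF act_idn_Hom(2)[OF assms(1,4,5)] assms(4,5)] assms(6) by auto

text \<open>A listed projection has the vertex among its entries, and all entries of the pulled back
  list occur in \<open>\<Xi>\<close>. Hence the normal form of a morphism avoiding the vertex comes
  from an identity.\<close>

lemma transition_nf:
  assumes x: "x \<in> Hom C \<Xi>" and K: "fst K \<notin> fst ` set \<Xi>"
  obtains R \<sigma> where "R \<in> Ob C" "structural (cl C) \<Xi> \<sigma>" "pull \<Xi> \<sigma> = [(R, Neg), (R, Pos)]"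
    "x = act C \<Xi> \<sigma> (idn C R)"
proof -
  obtain \<Psi> g \<sigma> where n: "nf \<Xi> \<Psi> g \<sigma> x" using nf_ex1[OF x] by auto
  have "K \<notin> set \<Psi>" using set_pull[of "cl C" \<Xi> \<sigma>] n K unfolding nf_def by auto
  then obtain R where "\<Psi> = [(R, Neg), (R, Pos)]" "g = idn C R" "R \<in> Ob C"
    using n unfolding nf_def by auto
  with n show thesis using that[of R \<sigma>] unfolding nf_def by simp
qed

text \<open>All morphisms of the reduct are structural images of identities, so the values on
  objects decide everything. Requiring only equal \<open>act\<close> and \<open>idn\<close> in the
  codomains lets functors into stages with provably equal indices be compared.\<close>

lemma transition_functor_eq:
  assumes F: "is_functor (reduct C K) Q F" and G: "is_functor (reduct C K) Q' G"
    and QQ: "act Q = act Q'" "idn Q = idn Q'"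
    and ob: "\<And>r. r \<in> Ob (reduct C K) \<Longrightarrow> fob F r = fob G r"
  shows "F = G"
proof (rule functor_eqI[OF F G ob])
  fix \<Phi> x assume x: "x \<in> Hom (reduct C K) \<Phi>"
  then have x': "x \<in> Hom C \<Phi>" "fst K \<notin> fst ` set \<Phi>" by (auto split: if_splits)
  then obtain R \<sigma> where n: "R \<in> Ob C" "structural (cl C) \<Phi> \<sigma>" "pull \<Phi> \<sigma> = [(R, Neg), (R, Pos)]"
    "x = act C \<Phi> \<sigma> (idn C R)" by (rule transition_nf)
  have v: "valid (reduct C K) \<Phi>" by (rule lnl_ops_valid[OF lnl_ops_reduct[OF C] x])
  have "(R, Neg) \<in> set \<Phi>" using set_pull[OF n(2)] n(3) by auto
  then have R: "R \<in> Ob (reduct C K)" using v by (force simp: valid_def)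
  have i: "idn C R \<in> Hom (reduct C K) (pull \<Phi> \<sigma>)"
    using lnl_ops_idn[OF lnl_ops_reduct[OF C, of K] R] n(3) by simp
  show "fmor F \<Phi> x = fmor G \<Phi> x"
    using functor_act[OF F i v] functor_act[OF G i v] functor_idn[OF F R] functor_idn[OF G R] n ob[OF R]
      smap_fctr_cong[OF v ob] QQ by simp
qed

context
  fixes Q :: "('o, 'm) lnl" and h :: "'r \<Rightarrow> 'o"
  assumes Q: "lnl Q" and h: "\<And>r. r \<in> Ob C - {fst K} \<Longrightarrow> h r \<in> Ob Q \<and> cl Q (h r) = cl C r"
begin

lemma h_valid:
  assumes "valid C \<Xi>" "fst K \<notin> fst ` set \<Xi>"
  shows "valid Q (smap h \<Xi>)"
proof -
  have R: "\<And>R. R \<in> fst ` set \<Xi> \<Longrightarrow> R \<in> Ob C - {fst K}" using assms unfolding valid_def by blast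
  have "admissible (cl Q) (smap h \<Xi>) = admissible (cl C) \<Xi>"
    by (intro admissible_smap) (use R h in blast)
  moreover have "h ` fst ` set \<Xi> \<subseteq> Ob Q" using R h by blast
  ultimately show ?thesis using assms by (simp add: valid_def fst_set_smap)
qed

lemma h_structural:
  assumes "valid C \<Xi>" "fst K \<notin> fst ` set \<Xi>"
  shows "structural (cl Q) (smap h \<Xi>) \<sigma> = structural (cl C) \<Xi> \<sigma>"
proof (intro structural_smap)
  fix R assume "R \<in> fst ` set \<Xi>"
  then have "R \<in> Ob C - {fst K}" using assms unfolding valid_def by blast
  then show "cl Q (h R) = cl C R" using h by blast
qed

text \<open>The value forced by functoriality: the same relabelling of the identity at the image
  object. Uniqueness of normal forms makes the description definite.\<close>

definition tr :: "'r signed list \<Rightarrow> 'p \<Rightarrow> 'm" where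
  "tr \<Xi> x = (THE z. \<exists>R \<sigma>. structural (cl C) \<Xi> \<sigma> \<and> pull \<Xi> \<sigma> = [(R, Neg), (R, Pos)] \<and>
     x = act C \<Xi> \<sigma> (idn C R) \<and> z = act Q (smap h \<Xi>) \<sigma> (idn Q (h R)))"

lemma tr_act_idn:
  assumes "valid C \<Xi>" "structural (cl C) \<Xi> \<sigma>" "pull \<Xi> \<sigma> = [(R, Neg), (R, Pos)]"
  shows "tr \<Xi> (act C \<Xi> \<sigma> (idn C R)) = act Q (smap h \<Xi>) \<sigma> (idn Q (h R))"
  unfolding tr_def
proof (rule the_equality, goal_cases)
  case 1 then show ?case using assms by blast
next
  case (2 z) then show ?case using act_idn_unique[OF assms] by metis
qed

lemma h_act_idn_Hom:
  assumes "valid C \<Xi>" "fst K \<notin> fst ` set \<Xi>" "structural (cl C) \<Xi> \<sigma>" "pull \<Xi> \<sigma> = [(R, Neg), (R, Pos)]"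
  shows "h R \<in> Ob Q" "idn Q (h R) \<in> Hom Q (pull (smap h \<Xi>) \<sigma>)"
    "act Q (smap h \<Xi>) \<sigma> (idn Q (h R)) \<in> Hom Q (smap h \<Xi>)"
proof -
  have "(R, Neg) \<in> set \<Xi>" using set_pull[OF assms(3)] assms(4) by auto
  then have "R \<in> fst ` set \<Xi>" by force
  then have "R \<in> Ob C - {fst K}" using assms(1,2) unfolding valid_def by blast
  then show hR: "h R \<in> Ob Q" using h by blast
  show i: "idn Q (h R) \<in> Hom Q (pull (smap h \<Xi>) \<sigma>)"
    using lnl_idn[OF Q hR] assms(4) by (simp add: pull_smap_structural[OF assms(3)])
  show "act Q (smap h \<Xi>) \<sigma> (idn Q (h R)) \<in> Hom Q (smap h \<Xi>)"
    by (rule lnl_act[OF Q i]) (use assms h_valid h_structural in auto)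
qed

lemma tr_Hom:
  assumes x: "x \<in> Hom C \<Xi>" and K: "fst K \<notin> fst ` set \<Xi>"
  shows "tr \<Xi> x \<in> Hom Q (smap h \<Xi>)"
  using transition_nf[OF assms] tr_act_idn[OF lnl_valid[OF C x]] h_act_idn_Hom[OF lnl_valid[OF C x] K] by metis

lemma tr_act:
  assumes x: "x \<in> Hom C (pull \<Xi> \<tau>)" and K: "fst K \<notin> fst ` set (pull \<Xi> \<tau>)" "fst K \<notin> fst ` set \<Xi>"
    and v: "valid C \<Xi>" and \<tau>: "structural (cl C) \<Xi> \<tau>"
  shows "tr \<Xi> (act C \<Xi> \<tau> x) = act Q (smap h \<Xi>) \<tau> (tr (pull \<Xi> \<tau>) x)"
proof -
  obtain R \<sigma> where n: "R \<in> Ob C" "structural (cl C) (pull \<Xi> \<tau>) \<sigma>" "pull (pull \<Xi> \<tau>) \<sigma> = [(R, Neg), (R, Pos)]"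
    "x = act C (pull \<Xi> \<tau>) \<sigma> (idn C R)" by (rule transition_nf[OF x K(1)])
  note v' = lnl_valid[OF C x]
  have \<sigma>: "\<forall>i\<in>set \<sigma>. i < length \<tau>" using structural_lt[OF n(2)] by simp
  have st: "structural (cl C) \<Xi> (pull \<tau> \<sigma>)" by (rule structural_pull[OF \<tau> n(2)])
  have pp: "pull \<Xi> (pull \<tau> \<sigma>) = [(R, Neg), (R, Pos)]" using n(3) pull_pull[OF \<sigma>] by metis
  have "act C \<Xi> \<tau> x = act C \<Xi> (pull \<tau> \<sigma>) (idn C R)"
    unfolding n(4) by (rule lnl_act_act[OF C _ v \<tau> n(2)]) (use n lnl_idn[OF C] in simp)
  then have "tr \<Xi> (act C \<Xi> \<tau> x) = act Q (smap h \<Xi>) (pull \<tau> \<sigma>) (idn Q (h R))"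
    using tr_act_idn[OF v st pp] by simp
  also have "\<dots> = act Q (smap h \<Xi>) \<tau> (act Q (pull (smap h \<Xi>) \<tau>) \<sigma> (idn Q (h R)))"
    using h_act_idn_Hom(2)[OF v' K(1) n(2,3)] h_valid[OF v K(2)] h_structural[OF v K(2)] h_structural[OF v' K(1)] \<tau> n(2)
    by (intro lnl_act_act[OF Q, symmetric]) (simp_all add: pull_smap_structural)
  also have "\<dots> = act Q (smap h \<Xi>) \<tau> (tr (pull \<Xi> \<tau>) x)"
    unfolding n(4) using tr_act_idn[OF v' n(2,3)] by (simp add: pull_smap_structural[OF \<tau>])
  finally show ?thesis .
qed

text \<open>As \<open>f\<close> is a relabelled identity, the composite is either a relabelling of
  \<open>g\<close> or an identity weakened by \<open>\<Psi>\<close>, according to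
  \<open>structural_idn_cases\<close>. The same computation holds in \<open>Q\<close>, with the same
  structural maps.\<close>

lemma tr_cmp:
  assumes f: "f \<in> Hom C (\<Phi> @ [L])" "fst K \<notin> fst ` set (\<Phi> @ [L])"
    and g: "g \<in> Hom C (dual L # \<Psi>)" "fst K \<notin> fst ` set (dual L # \<Psi>)"
  shows "tr (\<Phi> @ \<Psi>) (cmp C \<Phi> L \<Psi> g f) =
    cmp Q (smap h \<Phi>) (map_prod h id L) (smap h \<Psi>) (tr (dual L # \<Psi>) g) (tr (\<Phi> @ [L]) f)"
proof -
  let ?hL = "map_prod h id L"
  obtain R \<sigma> where n: "R \<in> Ob C" "structural (cl C) (\<Phi> @ [L]) \<sigma>" "pull (\<Phi> @ [L]) \<sigma> = [(R, Neg), (R, Pos)]"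
    "f = act C (\<Phi> @ [L]) \<sigma> (idn C R)" by (rule transition_nf[OF f])
  note vf = lnl_valid[OF C f(1)] and vg = lnl_valid[OF C g(1)]
  have vfg: "valid C (\<Phi> @ \<Psi>)"
    using lnl_valid[OF C lnl_cmp[OF C f(1) g(1)]] .
  have K: "fst K \<notin> fst ` set (\<Phi> @ \<Psi>)" using f g by auto
  have v\<Phi>: "valid C \<Phi>" using vf by (auto simp: valid_def admissible_def split: if_splits)
  have hg: "tr (dual L # \<Psi>) g \<in> Hom Q (dual ?hL # smap h \<Psi>)" using tr_Hom[OF g] by (simp add: dual_map_prod)
  have vQ: "valid Q (smap h \<Phi> @ [?hL])" using h_valid[OF vf f(2)] by simp
  have trf: "tr (\<Phi> @ [L]) f = act Q (smap h \<Phi> @ [?hL]) \<sigma> (idn Q (h R))"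
    unfolding n(4) using tr_act_idn[OF vf n(2,3)] by simp
  from n(2,3) show ?thesis
  proof (cases rule: structural_idn_cases)
    case (hit a)
    have pl: "pull (\<Phi> @ \<Psi>) (a # [length \<Phi>..<length \<Phi> + length \<Psi>]) = dual L # \<Psi>"
      using hit by (simp add: nth_append)
    have st: "structural (cl C) (\<Phi> @ \<Psi>) (a # [length \<Phi>..<length \<Phi> + length \<Psi>])"
      using structural_append_iff[of "[a]" \<Phi> "cl C" \<Psi>] hit by simp
    have "cmp C \<Phi> L \<Psi> g f = act C (\<Phi> @ \<Psi>) (a # [length \<Phi>..<length \<Phi> + length \<Psi>]) g"
      using cmp_structural_hit[OF C g(1) vf hit(1,2,4)] n(4) hit by simp
    moreover have "cmp Q (smap h \<Phi>) ?hL (smap h \<Psi>) (tr (dual L # \<Psi>) g) (tr (\<Phi> @ [L]) f) =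
      act Q (smap h \<Phi> @ smap h \<Psi>) (a # [length \<Phi>..<length \<Phi> + length \<Psi>]) (tr (dual L # \<Psi>) g)"
      unfolding trf hit
      using cmp_structural_hit[OF Q hg vQ, of a] hit h_structural[OF v\<Phi>] f(2) 
      by (simp add: dual_map_prod smap_nth cong: if_cong)
    moreover have "tr (\<Phi> @ \<Psi>) (act C (\<Phi> @ \<Psi>) (a # [length \<Phi>..<length \<Phi> + length \<Psi>]) g) =
       act Q (smap h \<Phi> @ smap h \<Psi>) (a # [length \<Phi>..<length \<Phi> + length \<Psi>]) (tr (dual L # \<Psi>) g)"
      using tr_act[of g "\<Phi> @ \<Psi>", OF _ _ K vfg st] g unfolding pl by simp
    ultimately show ?thesis by simp
  next
    case miss
    have pl: "pull \<Phi> \<sigma> = [(R, Neg), (R, Pos)]" using n(3) pull_append_left[OF miss(3)] by simp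
    have nQ: "neg_nonlinear (cl Q) ?hL" using miss h[of "fst L"] vf f(2) by (auto simp: neg_nonlinear_def valid_def)
    have "cmp C \<Phi> L \<Psi> g f = act C (\<Phi> @ \<Psi>) \<sigma> (idn C R)"
      unfolding n(4) by (rule cmp_structural_miss[OF C g(1) vf miss(1,2)]) (use pl lnl_idn[OF C n(1)] in simp)
    moreover have "cmp Q (smap h \<Phi>) ?hL (smap h \<Psi>) (tr (dual L # \<Psi>) g) (tr (\<Phi> @ [L]) f) =
      act Q (smap h \<Phi> @ smap h \<Psi>) \<sigma> (idn Q (h R))"
      unfolding trf
      by (rule cmp_structural_miss[OF Q hg vQ nQ]) (use miss h_structural[OF v\<Phi>] f(2) h_act_idn_Hom(2)[OF v\<Phi> _ miss(2) pl] in auto)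
    moreover have "\<forall>M\<in>set \<Psi>. neg_nonlinear (cl C) M"
      using neg_nonlinear_cut[of "cl C" L \<Psi>] vg miss by (auto simp: valid_def)
    then have "structural (cl C) (\<Phi> @ \<Psi>) \<sigma>" using structural_append_weak miss by blast
    then have "tr (\<Phi> @ \<Psi>) (act C (\<Phi> @ \<Psi>) \<sigma> (idn C R)) = act Q (smap h (\<Phi> @ \<Psi>)) \<sigma> (idn Q (h R))"
      by (intro tr_act_idn[OF vfg]) (use pl pull_append_left[OF miss(3)] in auto)
    ultimately show ?thesis by simp
  qed
qed

text \<open>Given a basis, the reduct is free on its objects, its morphisms being relabelled
  identities. Hence every class-preserving assignment of objects extends.\<close>

lemma reduct_functor: "\<exists>F. is_functor (reduct C K) Q F \<and> (\<forall>r\<in>Ob (reduct C K). fob F r = h r)"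
proof -
  let ?R = "reduct C K"
  define F where "F = mk_fctr ?R h tr"
  note R = lnl_opsD[OF lnl_ops_reduct[OF C, of K]]
  have ob: "fob F r = h r" if "r \<in> Ob ?R" for r using that by (simp add: F_def mk_fctr_simps)
  have mor: "fmor F \<Phi> x = tr \<Phi> x" if "x \<in> Hom ?R \<Phi>" for \<Phi> x using that by (simp add: F_def mk_fctr_simps)
  have s: "smap (fob F) \<Phi> = smap h \<Phi>" if "valid ?R \<Phi>" for \<Phi> by (rule smap_fctr_cong[OF that ob])
  have Hd: "x \<in> Hom C \<Phi> \<and> fst K \<notin> fst ` set \<Phi>" if "x \<in> Hom ?R \<Phi>" for \<Phi> x using that by (auto split: if_splits)
  have "is_functor ?R Q F"
  proof (rule functorI)
    show "fmor F \<Phi> x \<in> Hom Q (smap (fob F) \<Phi>)" if "x \<in> Hom ?R \<Phi>" for \<Phi> x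
      using tr_Hom Hd[OF that] mor[OF that] s[OF R(1)[OF that]] by simp
    show "fmor F \<Phi> (act ?R \<Phi> \<sigma> x) = act Q (smap (fob F) \<Phi>) \<sigma> (fmor F (pull \<Phi> \<sigma>) x)"
      if a: "x \<in> Hom ?R (pull \<Phi> \<sigma>)" "valid ?R \<Phi>" "structural (cl ?R) \<Phi> \<sigma>" for \<Phi> \<sigma> x
      using mor[OF R(3)[OF a]] mor[OF a(1)] s[OF a(2)] tr_act[of x \<Phi> \<sigma>] Hd[OF a(1)] Hd[OF R(3)[OF a]] a
        by (auto simp: valid_def)
    show "fmor F [(r, Neg), (r, Pos)] (idn ?R r) = idn Q (fob F r)" if r: "r \<in> Ob ?R" for r
    proof -
      have rC: "r \<in> Ob C" using r by simp
      have "idn C r = act C [(r, Neg), (r, Pos)] [0..<2] (idn C r)"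
        using lnl_act_id[OF C lnl_idn[OF C rC]] by (simp add: numeral_2_eq_2)
      moreover have "tr [(r, Neg), (r, Pos)] (act C [(r, Neg), (r, Pos)] [0..<2] (idn C r)) =
        act Q (smap h [(r, Neg), (r, Pos)]) [0..<2] (idn Q (h r))"
        using structural_id[of "cl C" "[(r, Neg), (r, Pos)]"] pull_id[of "[(r, Neg), (r, Pos)]"] rC
        by (intro tr_act_idn) (simp_all add: numeral_2_eq_2 valid_two)
      moreover have "\<dots> = idn Q (h r)"
        using lnl_act_id[OF Q lnl_idn[OF Q, of "h r"]] h[of r] r by (simp add: numeral_2_eq_2)
      ultimately show ?thesis using mor[OF R(2)[OF r]] ob[OF r] by simp
    qed
    show "fmor F (\<Phi> @ \<Psi>) (cmp ?R \<Phi> L \<Psi> g f) =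
       cmp Q (smap (fob F) \<Phi>) (map_prod (fob F) id L) (smap (fob F) \<Psi>)
         (fmor F (dual L # \<Psi>) g) (fmor F (\<Phi> @ [L]) f)"
      if a: "f \<in> Hom ?R (\<Phi> @ [L])" "g \<in> Hom ?R (dual L # \<Psi>)" for \<Phi> L \<Psi> f g
    proof -
      have "map_prod (fob F) id L = map_prod h id L"
        using ob[of "fst L"] R(1)[OF a(1)] by (cases L) (auto simp: valid_def)
      then show ?thesis
        using mor[OF R(4)[OF a]] mor[OF a(1)] mor[OF a(2)] s[OF R(1)[OF a(1)]] s[OF R(1)[OF a(2)]]
          tr_cmp[of f \<Phi> L g \<Psi>] Hd[OF a(1)] Hd[OF a(2)] by simp
    qed
  qed (use ob h in \<open>auto simp: F_def mk_fctr_def\<close>)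
  then show ?thesis using ob by blast
qed

end

end

section \<open>Expansions and the renaming of their generators\<close>

lemma map_tm_id:
  "map_tm id k (TGen g) = TGen (k g)" "map_tm id k (TId R) = TId R"
  "map_tm id k (TAct \<Phi> \<sigma> t) = TAct \<Phi> \<sigma> (map_tm id k t)"
  "map_tm id k (TCmp \<Phi> K \<Psi> s t) = TCmp \<Phi> K \<Psi> (map_tm id k s) (map_tm id k t)"
  by (simp_all only: tm.map id_apply prod.map_id prod.map_id0 list.map_id)

text \<open>A congruence on the terms over the target generators, pulled back along a well-typed
  renaming \<open>k\<close>, is one on the terms over the source generators. As \<open>tm_eq\<close>
  quantifies over all congruences, it is thereby transported along renamings.\<close>

lemma lnl_upto_map:
  assumes E: "lnl_upto E (term_alg O' c gen')"
    and wt: "\<And>\<Phi> t. wt O' c gen \<Phi> t \<Longrightarrow> wt O' c gen' \<Phi> (map_tm id k t)"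
  shows "lnl_upto (\<lambda>\<Phi> s t. E \<Phi> (map_tm id k s) (map_tm id k t)) (term_alg O' c gen)"
proof (rule lnl_uptoI; (simp only: term_alg_simps mem_Collect_eq map_tm_id)?)
  note m = term_alg_simps mem_Collect_eq
  note W = wt
  show "equivp (\<lambda>s t. E \<Phi> (map_tm id k s) (map_tm id k t))" for \<Phi>
    by (intro equivpI reflpI sympI transpI)
      (blast intro: equivp_reflp[OF upto_equivp[OF E]] equivp_symp[OF upto_equivp[OF E]]
        equivp_transp[OF upto_equivp[OF E]])+
  show "valid (term_alg O' c gen) \<Phi>" if "wt O' c gen \<Phi> x" for \<Phi> x
    using wt_valid[OF that] by (simp add: valid_def)
  show "wt O' c gen \<Phi> (TAct \<Phi> \<sigma> x)"
    if "wt O' c gen (pull \<Phi> \<sigma>) x" "valid (term_alg O' c gen) \<Phi>" "structural c \<Phi> \<sigma>" for \<Phi> \<sigma> x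
    using that by (auto simp: valid_def intro: wt.intros)
  show "E \<Phi> (TAct \<Phi> \<sigma> (map_tm id k x)) (TAct \<Phi> \<sigma> (map_tm id k y))"
    if "wt O' c gen (pull \<Phi> \<sigma>) x" "wt O' c gen (pull \<Phi> \<sigma>) y" "valid (term_alg O' c gen) \<Phi>" "structural c \<Phi> \<sigma>"
      "E (pull \<Phi> \<sigma>) (map_tm id k x) (map_tm id k y)" for \<Phi> \<sigma> x y
    by (rule upto_act_cong[OF E, unfolded m]) (use that W in \<open>simp_all add: valid_def\<close>)
  show "wt O' c gen [(R, Neg), (R, Pos)] (TId R)" if "R \<in> O'" for R
    using that by (rule wt.intros)
  show "wt O' c gen (\<Phi> @ \<Psi>) (TCmp \<Phi> K \<Psi> g f)" if "wt O' c gen (\<Phi> @ [K]) f" "wt O' c gen (dual K # \<Psi>) g" for \<Phi> K \<Psi> f g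
    using that by (rule wt.intros)
  show "E (\<Phi> @ \<Psi>) (TCmp \<Phi> K \<Psi> (map_tm id k g) (map_tm id k f)) (TCmp \<Phi> K \<Psi> (map_tm id k g') (map_tm id k f'))"
    if "wt O' c gen (\<Phi> @ [K]) f" "wt O' c gen (\<Phi> @ [K]) f'" "wt O' c gen (dual K # \<Psi>) g" "wt O' c gen (dual K # \<Psi>) g'"
      "E (\<Phi> @ [K]) (map_tm id k f) (map_tm id k f')" "E (dual K # \<Psi>) (map_tm id k g) (map_tm id k g')" for \<Phi> K \<Psi> f f' g g'
    by (rule upto_cmp_cong[OF E, unfolded m]) (use that W in simp_all)
  show "E \<Phi> (TAct \<Phi> [0..<length \<Phi>] (map_tm id k x)) (map_tm id k x)" if "wt O' c gen \<Phi> x" for \<Phi> x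
    by (rule upto_act_id[OF E, unfolded m]) (use that W in simp_all)
  show "E \<Phi> (TAct \<Phi> \<sigma> (TAct (pull \<Phi> \<sigma>) \<tau> (map_tm id k x))) (TAct \<Phi> (pull \<sigma> \<tau>) (map_tm id k x))"
    if "wt O' c gen (pull (pull \<Phi> \<sigma>) \<tau>) x" "valid (term_alg O' c gen) \<Phi>" "structural c \<Phi> \<sigma>" "structural c (pull \<Phi> \<sigma>) \<tau>"
    for \<Phi> \<sigma> \<tau> x
    by (rule upto_act_act[OF E, unfolded m]) (use that W in \<open>simp_all add: valid_def\<close>)
  show "E (\<Phi> @ [(R, Pos)]) (TCmp \<Phi> (R, Pos) [(R, Pos)] (TId R) (map_tm id k f)) (map_tm id k f)"
    if "wt O' c gen (\<Phi> @ [(R, Pos)]) f" for \<Phi> R f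
    by (rule upto_unit_pos[OF E, unfolded m]) (use that W in simp_all)
  show "E ((R, Neg) # \<Psi>) (TCmp [(R, Neg)] (R, Pos) \<Psi> (map_tm id k g) (TId R)) (map_tm id k g)"
    if "wt O' c gen ((R, Neg) # \<Psi>) g" for \<Psi> R g
    by (rule upto_unit_neg[OF E, unfolded m]) (use that W in simp_all)
  show "E (\<Phi> @ \<Psi> @ \<Theta>) (TCmp (\<Phi> @ \<Psi>) L \<Theta> (map_tm id k h) (TCmp \<Phi> K (\<Psi> @ [L]) (map_tm id k g) (map_tm id k f)))
       (TCmp \<Phi> K (\<Psi> @ \<Theta>) (TCmp (dual K # \<Psi>) L \<Theta> (map_tm id k h) (map_tm id k g)) (map_tm id k f))"
    if "wt O' c gen (\<Phi> @ [K]) f" "wt O' c gen (dual K # \<Psi> @ [L]) g" "wt O' c gen (dual L # \<Theta>) h" for \<Phi> K \<Psi> L \<Theta> f g h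
    by (rule upto_assoc[OF E, unfolded m]) (use that W in simp_all)
  show "E (\<Phi> @ \<Psi>) (TCmp \<Phi> K \<Psi> (map_tm id k g) (map_tm id k f))
         (TAct (\<Phi> @ \<Psi>) ([length \<Phi>..<length \<Phi>+length \<Psi>] @ [0..<length \<Phi>])
            (TCmp \<Psi> (dual K) \<Phi>
               (TAct (K # \<Phi>) ([1..<Suc (length \<Phi>)] @ [0]) (map_tm id k f))
               (TAct (\<Psi> @ [dual K]) (length \<Psi> # [0..<length \<Psi>]) (map_tm id k g))))"
    if "wt O' c gen (\<Phi> @ [K]) f" "wt O' c gen (dual K # \<Psi>) g" for \<Phi> K \<Psi> f g
    by (rule upto_swap[OF E, unfolded m]) (use that W in simp_all)
  show "E (\<Phi> @ \<Psi>) (TCmp \<Phi> K \<Psi> (map_tm id k g) (TAct (\<Phi> @ [K]) (\<sigma> @ [length \<Phi>]) (map_tm id k f)))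
         (TAct (\<Phi> @ \<Psi>) (\<sigma> @ [length \<Phi>..<length \<Phi>+length \<Psi>]) (TCmp (pull \<Phi> \<sigma>) K \<Psi> (map_tm id k g) (map_tm id k f)))"
    if "wt O' c gen (pull \<Phi> \<sigma> @ [K]) f" "wt O' c gen (dual K # \<Psi>) g" "valid (term_alg O' c gen) (\<Phi> @ [K])" "structural c \<Phi> \<sigma>"
    for \<Phi> \<sigma> K \<Psi> f g
    by (rule upto_str[OF E, unfolded m]) (use that W in \<open>simp_all add: valid_def\<close>)
  show "E (\<Phi> @ \<Psi>) (TCmp \<Phi> K \<Psi> (map_tm id k g) (TAct (\<Phi> @ [K]) [0..<length \<Phi>] (map_tm id k f)))
      (TAct (\<Phi> @ \<Psi>) [0..<length \<Phi>] (map_tm id k f))"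
    if "wt O' c gen \<Phi> f" "wt O' c gen (dual K # \<Psi>) g" "valid (term_alg O' c gen) (\<Phi> @ [K])" "neg_nonlinear c K" for \<Phi> K \<Psi> f g
    by (rule upto_weak[OF E, unfolded m]) (use that W in \<open>simp_all add: valid_def\<close>)
  show "E (\<Phi> @ \<Psi>) (TCmp \<Phi> K \<Psi> (map_tm id k g) (TAct (\<Phi> @ [K]) ([0..<length \<Phi>] @ [length \<Phi>, length \<Phi>]) (map_tm id k f)))
         (TAct (\<Phi> @ \<Psi>) ([0..<length \<Phi>] @ [length \<Phi>..<length \<Phi>+length \<Psi>] @ [length \<Phi>..<length \<Phi>+length \<Psi>])
            (TCmp (\<Phi> @ \<Psi>) K \<Psi> (map_tm id k g)
               (TAct (\<Phi> @ \<Psi> @ [K]) ([0..<length \<Phi>] @ [length \<Phi>+length \<Psi>] @ [length \<Phi>..<length \<Phi>+length \<Psi>])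
                  (TCmp (\<Phi> @ [K]) K \<Psi> (map_tm id k g) (map_tm id k f)))))"
    if "wt O' c gen (\<Phi> @ [K, K]) f" "wt O' c gen (dual K # \<Psi>) g" "neg_nonlinear c K" for \<Phi> K \<Psi> f g
    by (rule upto_contr[OF E, unfolded m]) (use that W in simp_all)
qed

abbreviation merge_gen :: "('r, 'p) egen \<Rightarrow> ('r, 'p) egen" where
  "merge_gen \<equiv> (\<lambda>g. case g of Chi i \<Rightarrow> Chi 0 | _ \<Rightarrow> g)"

locale expn =
  fixes C :: "('r, 'p) lnl" and K :: "'r signed" and \<psi> :: shape
  assumes C: "lnl C" and KC: "fst K \<in> Ob C"
    and adm: "admissible (exp_cl C \<psi>) (old [dual K] @ new \<psi>)"
begin

abbreviation "EC \<equiv> expansion C K \<psi>"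
abbreviation "ecls \<equiv> exp_class C K \<psi>"
abbreviation "ewt X \<equiv> wt (exp_Ob C \<psi>) (exp_cl C \<psi>) (exp_gen C K \<psi> X)"

lemma exp_simps:
  "Ob (EC X) = exp_Ob C \<psi>" "cl (EC X) = exp_cl C \<psi>" "Hom (EC X) \<Xi> = {ecls X \<Xi> t |t. ewt X \<Xi> t}"
  "lnl_ops (EC X)"
  unfolding expansion_def exp_class_def
  by (auto simp: presentation.presented_simps presentation.presented_lnl_ops)

lemma new_simps: "length (new \<psi>) = length \<psi>" "fst ` set (new \<psi>) = Inr ` {..<length \<psi>}"
  by (auto simp: new_def image_image)

lemma exp_admissible_old: "admissible (exp_cl C \<psi>) (old \<Phi>) = admissible (cl C) \<Phi>"
  by (rule admissible_smap) (simp add: exp_cl_def)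

lemma exp_admissible_til:
  assumes "valid C (\<Phi> @ [K])"
  shows "admissible (exp_cl C \<psi>) (old \<Phi> @ new \<psi>)"
proof (rule admissible_cut)
  show "admissible (exp_cl C \<psi>) (old \<Phi> @ [map_prod Inl id K])"
    using assms exp_admissible_old[of "\<Phi> @ [K]"] by (simp add: valid_def)
  show "admissible (exp_cl C \<psi>) (dual (map_prod Inl id K) # new \<psi>)"
    using adm by (simp add: dual_map_prod)
qed

lemma wt_Mor: "x \<in> Hom C \<Phi> \<Longrightarrow> ewt X (old \<Phi>) (TGen (Mor \<Phi> x))"
  using lnl_valid[OF C, of x \<Phi>]
  by (intro wt.intros(1)) (auto simp: exp_gen_def exp_Ob_def fst_set_smap valid_def exp_admissible_old)

lemma wt_Til: "abstract_projection C K \<Phi> f \<Longrightarrow> ewt X (old \<Phi> @ new \<psi>) (TGen (Til \<Phi> f))"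
  using lnl_valid[OF C, of f "\<Phi> @ [K]"] exp_admissible_til[of \<Phi>]
  by (intro wt.intros(1))
    (auto simp: exp_gen_def exp_Ob_def fst_set_smap valid_def image_Un abstract_projection_def new_simps)

lemma wt_Chi: "i \<in> X \<Longrightarrow> ewt X (old [dual K] @ new \<psi>) (TGen (Chi i))"
  using KC adm
  by (intro wt.intros(1)) (auto simp: exp_gen_def exp_Ob_def new_simps)

lemma exp_incl_simps:
  "R \<in> Ob C \<Longrightarrow> fob (exp_incl C K \<psi> X) R = Inl R"
  "f \<in> Hom C \<Phi> \<Longrightarrow> fmor (exp_incl C K \<psi> X) \<Phi> f = ecls X (old \<Phi>) (TGen (Mor \<Phi> f))"
  "valid C \<Phi> \<Longrightarrow> smap (fob (exp_incl C K \<psi> X)) \<Phi> = old \<Phi>"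
  by (auto simp: exp_incl_def mk_fctr_simps intro!: smap_fctr_cong)

lemma exp_incl_carries: "carries C (EC X) (exp_incl C K \<psi> X)"
  unfolding carries_def
proof (intro conjI ballI allI)
  show "fmor (exp_incl C K \<psi> X) \<Phi> x \<in> Hom (EC X) (smap (fob (exp_incl C K \<psi> X)) \<Phi>)" if "x \<in> Hom C \<Phi>" for \<Phi> x
    using exp_incl_simps(3)[OF lnl_valid[OF C that]] wt_Mor[OF that] that
    by (auto simp: exp_incl_simps exp_simps)
qed (auto simp: exp_incl_simps exp_simps exp_Ob_def exp_cl_def)

lemma wt_merge:
  assumes "ewt X \<Xi> t" shows "ewt {0} \<Xi> (map_tm id merge_gen t)"
  using assms
proof induction
  case (1 g \<Xi>)
  then have "exp_gen C K \<psi> {0} (merge_gen g) \<Xi>" by (cases g) (auto simp: exp_gen_def)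
  then show ?case using 1 unfolding map_tm_id by (intro wt.intros)
qed (unfold map_tm_id, (rule wt.intros, assumption+)+)

lemma rel_merge:
  assumes "exp_rel C K \<psi> X \<Xi> a b"
  shows "exp_rel C K \<psi> {0} \<Xi> (map_tm id merge_gen a) (map_tm id merge_gen b)"
  using assms
  by cases (simp_all only: map_tm_id egen.case, (blast intro: exp_rel.intros)+)

text \<open>\<open>merge_chi\<close> renames a chosen representative of a class. Renaming preserves
  the congruence, so the representative may be replaced by \<open>t\<close>.\<close>

lemma merge_cls:
  assumes "ewt X \<Xi> t"
  shows "fmor (merge_chi C K \<psi> X) \<Xi> (ecls X \<Xi> t) = ecls {0} \<Xi> (map_tm id merge_gen t)"
proof -
  interpret X: presentation "exp_Ob C \<psi>" "exp_cl C \<psi>" "exp_gen C K \<psi> X" "exp_rel C K \<psi> X" .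
  interpret Z: presentation "exp_Ob C \<psi>" "exp_cl C \<psi>" "exp_gen C K \<psi> {0}" "exp_rel C K \<psi> {0}" .
  define s where "s = (SOME s. s \<in> X.cls \<Xi> t)"
  have "X.eqv \<Xi> t s" unfolding s_def by (rule X.rep(2)[OF assms])
  have "Z.eqv \<Xi> (map_tm id merge_gen t) (map_tm id merge_gen s)"
    unfolding tm_eq_def
  proof (intro allI impI)
    fix E assume E: "lnl_upto E (term_alg (exp_Ob C \<psi>) (exp_cl C \<psi>) (exp_gen C K \<psi> {0})) \<and>
      (\<forall>\<Xi> a b. exp_rel C K \<psi> {0} \<Xi> a b \<longrightarrow> E \<Xi> a b)"
    note E' = lnl_upto_map[OF E[THEN conjunct1] wt_merge[where X=X]]
    show "E \<Xi> (map_tm id merge_gen t) (map_tm id merge_gen s)"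
      using \<open>X.eqv \<Xi> t s\<close>[unfolded tm_eq_def, THEN spec, THEN mp, OF conjI[OF E']] E rel_merge by simp
  qed
  moreover have "ecls X \<Xi> t \<in> Hom (EC X) \<Xi>" using assms by (auto simp: exp_simps)
  ultimately show ?thesis
    using Z.cls_eq unfolding merge_chi_def exp_class_def s_def by (simp only: mk_fctr_simps)
qed

lemma merge_ob: "R \<in> exp_Ob C \<psi> \<Longrightarrow> fob (merge_chi C K \<psi> X) R = R"
  by (simp add: merge_chi_def mk_fctr_simps exp_simps)

lemma merge_smap: "valid (EC X) \<Xi> \<Longrightarrow> smap (fob (merge_chi C K \<psi> X)) \<Xi> = \<Xi>"
  using smap_fctr_cong[of "EC X" \<Xi> "fob (merge_chi C K \<psi> X)" "\<lambda>R. R"] by (simp add: merge_ob exp_simps)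

lemma merge_carries: "carries (EC X) (EC {0}) (merge_chi C K \<psi> X)"
  unfolding carries_def
proof (intro conjI ballI allI)
  fix \<Xi> x assume x: "x \<in> Hom (EC X) \<Xi>"
  then obtain t where t: "x = ecls X \<Xi> t" "ewt X \<Xi> t" by (auto simp: exp_simps)
  show "fmor (merge_chi C K \<psi> X) \<Xi> x \<in> Hom (EC {0}) (smap (fob (merge_chi C K \<psi> X)) \<Xi>)"
    using merge_smap[OF lnl_ops_valid[OF exp_simps(4) x]] merge_cls[OF t(2)] wt_merge[OF t(2)] t(1)
    by (auto simp: exp_simps)
qed (auto simp: exp_simps merge_ob)

lemma exp_generated:
  assumes M: "op_closed (EC X) M"
    and "\<And>\<Phi> f. f \<in> Hom C \<Phi> \<Longrightarrow> M (old \<Phi>) (ecls X (old \<Phi>) (TGen (Mor \<Phi> f)))"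
    and "\<And>\<Phi> f. abstract_projection C K \<Phi> f \<Longrightarrow> M (old \<Phi> @ new \<psi>) (ecls X (old \<Phi> @ new \<psi>) (TGen (Til \<Phi> f)))"
    and "\<And>i. i \<in> X \<Longrightarrow> M (old [dual K] @ new \<psi>) (ecls X (old [dual K] @ new \<psi>) (TGen (Chi i)))"
    and x: "x \<in> Hom (EC X) \<Xi>"
  shows "M \<Xi> x"
proof (rule presentation.presented_generated[OF _ _ x[unfolded expansion_def]])
  show "op_closed (presented (exp_Ob C \<psi>) (exp_cl C \<psi>) (exp_gen C K \<psi> X) (exp_rel C K \<psi> X)) M"
    using M unfolding expansion_def .
  show "M \<Xi> (tm_class (exp_Ob C \<psi>) (exp_cl C \<psi>) (exp_gen C K \<psi> X) (exp_rel C K \<psi> X) \<Xi> (TGen g))"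
    if "exp_gen C K \<psi> X g \<Xi>" for g \<Xi>
    using that assms(2-4) unfolding exp_gen_def exp_class_def by (cases g) auto
qed

end

lemma valid_appendD:
  assumes "valid P (\<Phi> @ \<Psi>)" shows "valid P \<Phi>" "valid P \<Psi>"
  using assms by (auto simp: valid_def admissible_def split: if_splits)

text \<open>The vertex occurs once in a listed projection and once in \<open>\<Phi>\<close> followed
  by \<open>K\<close>, so a normal form by a projection keeps the last entry in place. An identity
  cannot hit that entry, since \<open>dual K\<close> is not in \<open>\<Phi>\<close>; in that case
  \<open>x\<close> is a transition weakened by the vertex.\<close>

lemma (in cone_basis) proj_nf:
  assumes x: "x \<in> Hom C (\<Phi> @ [K])" and K: "fst K \<notin> fst ` set \<Phi>"
  obtains (proj) f \<sigma> where "(pull \<Phi> \<sigma>, f) \<in> set ps" "structural (cl C) \<Phi> \<sigma>"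
      "x = act C (\<Phi> @ [K]) (\<sigma> @ [length \<Phi>]) f"
  | (weak) R \<sigma> where "structural (cl C) \<Phi> \<sigma>" "pull \<Phi> \<sigma> = [(R, Neg), (R, Pos)]" "neg_nonlinear (cl C) K"
      "x = act C (\<Phi> @ [K]) \<sigma> (idn C R)"
proof -
  let ?n = "length \<Phi>"
  obtain \<Psi> g \<sigma> where n: "nf (\<Phi> @ [K]) \<Psi> g \<sigma> x" using nf_ex1[OF x] by auto
  have st: "structural (cl C) (\<Phi> @ [K]) \<sigma>" and pl: "pull (\<Phi> @ [K]) \<sigma> = \<Psi>" and ac: "act C (\<Phi> @ [K]) \<sigma> g = x"
    using n by (auto simp: nf_def)
  from n consider R where "\<Psi> = [(R, Neg), (R, Pos)]" "g = idn C R" | \<Phi>' where "(\<Phi>', g) \<in> set ps" "\<Psi> = \<Phi>' @ [K]"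
    unfolding nf_def by blast
  then show thesis
  proof cases
    case (1 R)
    from st pl[unfolded 1] show ?thesis
    proof (cases rule: structural_idn_cases)
      case (hit a)
      then have "dual K \<in> set \<Phi>" by (metis nth_mem)
      then have "fst (dual K) \<in> fst ` set \<Phi>" by (rule imageI)
      then show ?thesis using K by simp
    next
      case miss
      then have "pull \<Phi> \<sigma> = [(R, Neg), (R, Pos)]" using pl 1 pull_append_left by metis
      then show ?thesis using weak miss ac 1 by blast
    qed
  next
    case (2 \<Phi>')
    have lt: "j \<le> ?n" if "j \<in> set \<sigma>" for j using structural_lt[OF st that] by simp
    obtain \<sigma>' j where \<sigma>: "\<sigma> = \<sigma>' @ [j]" using pl 2 by (cases \<sigma> rule: rev_cases) auto
    then have p: "pull (\<Phi> @ [K]) \<sigma>' = \<Phi>'" "(\<Phi> @ [K]) ! j = K" using pl 2 by auto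
    have j: "j = ?n"
    proof (rule ccontr)
      assume "j \<noteq> ?n"
      then have "j < ?n" using lt[of j] \<sigma> by simp
      then have "K \<in> set \<Phi>" using p(2) by (metis nth_append nth_mem)
      then show False using K by blast
    qed
    \<comment> \<open>Another occurrence of the index of the vertex would give the listed projection
      a second copy of it.\<close>
    have lt': "\<forall>i\<in>set \<sigma>'. i < ?n"
    proof (rule ccontr)
      assume "\<not> ?thesis"
      then have "?n \<in> set \<sigma>'" using lt \<sigma> by (metis Un_iff le_neq_implies_less set_append)
      then have "(\<Phi> @ [K]) ! ?n \<in> set (pull (\<Phi> @ [K]) \<sigma>')" unfolding pull_def set_map by (rule imageI)
      then have "K \<in> set \<Phi>'" using p by simp
      then show False using ps_proj[OF 2(1)] by blast
    qed
    then have "structural (cl C) \<Phi> \<sigma>'"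
      using structural_append_iff[OF lt', of "cl C" "[K]"] st \<sigma> j by simp
    then show ?thesis using proj[of \<sigma>' g] 2 p pull_append_left[OF lt', of "[K]"] ac \<sigma> j by simp
  qed
qed

section \<open>Functors out of the pre-expansion\<close>

locale cone_expn = cone_basis C K ps + expn C K \<psi>
  for C :: "('r, 'p) lnl" and K :: "'r signed" and ps :: "('r signed list \<times> 'p) list" and \<psi> :: shape
begin

context
  fixes Q :: "('o, 'm) lnl" and F :: "('r, 'p, 'o, 'm) fctr" and \<psi>' :: "'o signed list" and y :: "'r signed list \<Rightarrow> 'p \<Rightarrow> 'm"
  assumes Q: "lnl Q" and F: "is_functor C Q F"
    and v: "valid Q (dual (map_prod (fob F) id K) # \<psi>')"
    and y: "\<And>\<Phi> f. (\<Phi>, f) \<in> set ps \<Longrightarrow> y \<Phi> f \<in> Hom Q (smap (fob F) \<Phi> @ \<psi>')"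
begin

abbreviation (input) "h \<equiv> fob F"
abbreviation (input) "ext \<Phi> \<sigma> \<equiv> \<sigma> @ [length \<Phi>..<length \<Phi> + length \<psi>']"

text \<open>The graph of the only possible extension of \<open>y\<close> to all projections:
  compatibility with structural maps forces the first alternative, compatibility with weakening by
  the vertex the second. Starting from a relation keeps existence, uniqueness and the equations
  apart.\<close>

definition til :: "'r signed list \<Rightarrow> 'p \<Rightarrow> 'm \<Rightarrow> bool" where
  "til \<Phi> x z \<longleftrightarrow>
    (\<exists>f \<sigma>. (pull \<Phi> \<sigma>, f) \<in> set ps \<and> structural (cl C) \<Phi> \<sigma> \<and> x = act C (\<Phi> @ [K]) (\<sigma> @ [length \<Phi>]) f \<and>
       z = act Q (smap h \<Phi> @ \<psi>') (ext \<Phi> \<sigma>) (y (pull \<Phi> \<sigma>) f)) \<or>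
    (\<exists>R \<sigma>. structural (cl C) \<Phi> \<sigma> \<and> pull \<Phi> \<sigma> = [(R, Neg), (R, Pos)] \<and> neg_nonlinear (cl C) K \<and>
       x = act C (\<Phi> @ [K]) \<sigma> (idn C R) \<and> z = act Q (smap h \<Phi> @ \<psi>') \<sigma> (idn Q (h R)))"

lemma til_ex: "x \<in> Hom C (\<Phi> @ [K]) \<Longrightarrow> fst K \<notin> fst ` set \<Phi> \<Longrightarrow> \<exists>z. til \<Phi> x z"
  by (erule (1) proj_nf) (unfold til_def, blast+)

lemma structural_K: "structural (cl C) \<Phi> \<sigma> \<Longrightarrow> structural (cl C) (\<Phi> @ [K]) (\<sigma> @ [length \<Phi>])"
  using structural_append_iff[of \<sigma> \<Phi> "cl C" "[K]"] structural_lt by auto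

lemma structural_K_weak: "neg_nonlinear (cl C) K \<Longrightarrow> structural (cl C) \<Phi> \<sigma> \<Longrightarrow> structural (cl C) (\<Phi> @ [K]) \<sigma>"
  using structural_append_weak[of "[K]" "cl C" \<sigma> \<Phi>] structural_lt by auto

lemma pull_struct_left: "structural c \<Phi> \<sigma> \<Longrightarrow> pull (\<Phi> @ \<Psi>) \<sigma> = pull \<Phi> \<sigma>"
  by (rule pull_append_left) (auto simp: structural_lt)

text \<open>Normal forms are unique, and the two alternatives exclude each other: the index
  \<open>length \<Phi>\<close> of the vertex occurs in the structural map of the first but not in
  that of the second.\<close>

lemma til_unique:
  assumes va: "valid C (\<Phi> @ [K])" and "til \<Phi> x z" "til \<Phi> x z'"
  shows "z = z'"
proof -
  have nfp: "nf (\<Phi> @ [K]) (pull \<Phi> \<sigma> @ [K]) f (\<sigma> @ [length \<Phi>]) (act C (\<Phi> @ [K]) (\<sigma> @ [length \<Phi>]) f)"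
    if "(pull \<Phi> \<sigma>, f) \<in> set ps" "structural (cl C) \<Phi> \<sigma>" for \<sigma> f
    unfolding nf_def using that structural_K[OF that(2)] pull_struct_left[OF that(2)] by auto
  have Hp: "act C (\<Phi> @ [K]) (\<sigma> @ [length \<Phi>]) f \<in> Hom C (\<Phi> @ [K])"
    if "(pull \<Phi> \<sigma>, f) \<in> set ps" "structural (cl C) \<Phi> \<sigma>" for \<sigma> f
    using lnl_act[OF C _ va structural_K[OF that(2)]] ps_proj[OF that(1)] pull_struct_left[OF that(2)] by simp
  have nfi: "nf (\<Phi> @ [K]) [(R, Neg), (R, Pos)] (idn C R) \<sigma> (act C (\<Phi> @ [K]) \<sigma> (idn C R))"
    if "structural (cl C) \<Phi> \<sigma>" "pull \<Phi> \<sigma> = [(R, Neg), (R, Pos)]" "neg_nonlinear (cl C) K" for R \<sigma>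
    using that structural_K_weak[OF that(3,1)] pull_struct_left[OF that(1)] act_idn_Hom(2)[OF va, of \<sigma> R]
    by (intro nf_idnI) auto
  have Hi: "act C (\<Phi> @ [K]) \<sigma> (idn C R) \<in> Hom C (\<Phi> @ [K])"
    if "structural (cl C) \<Phi> \<sigma>" "pull \<Phi> \<sigma> = [(R, Neg), (R, Pos)]" "neg_nonlinear (cl C) K" for R \<sigma>
    using that structural_K_weak[OF that(3,1)] pull_struct_left[OF that(1)] by (intro act_idn_Hom(1)[OF va]) auto
  have clash: "\<sigma> @ [length \<Phi>] \<noteq> \<sigma>'" if "structural (cl C) \<Phi> \<sigma>'" for \<sigma> \<sigma>'
    using structural_lt[OF that, of "length \<Phi>"] by auto
  from assms(2) show ?thesis
    unfolding til_def
  proof (elim disjE exE conjE)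
    fix f \<sigma> assume a: "(pull \<Phi> \<sigma>, f) \<in> set ps" "structural (cl C) \<Phi> \<sigma>" "x = act C (\<Phi> @ [K]) (\<sigma> @ [length \<Phi>]) f"
      "z = act Q (smap h \<Phi> @ \<psi>') (ext \<Phi> \<sigma>) (y (pull \<Phi> \<sigma>) f)"
    note u = nf_unique[OF Hp[OF a(1,2)] nfp[OF a(1,2)], folded a(3)]
    from assms(3) show "z = z'"
      unfolding til_def
    proof (elim disjE exE conjE)
      fix f' \<sigma>' assume b: "(pull \<Phi> \<sigma>', f') \<in> set ps" "structural (cl C) \<Phi> \<sigma>'" "x = act C (\<Phi> @ [K]) (\<sigma>' @ [length \<Phi>]) f'"
        "z' = act Q (smap h \<Phi> @ \<psi>') (ext \<Phi> \<sigma>') (y (pull \<Phi> \<sigma>') f')"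
      show ?thesis using u(2,3)[OF nfp[OF b(1,2), folded b(3)]] a b by simp
    next
      fix R \<sigma>' assume b: "structural (cl C) \<Phi> \<sigma>'" "pull \<Phi> \<sigma>' = [(R, Neg), (R, Pos)]" "neg_nonlinear (cl C) K"
        "x = act C (\<Phi> @ [K]) \<sigma>' (idn C R)"
      show ?thesis using u(3)[OF nfi[OF b(1-3), folded b(4)]] clash[OF b(1)] by blast
    qed
  next
    fix R \<sigma> assume a: "structural (cl C) \<Phi> \<sigma>" "pull \<Phi> \<sigma> = [(R, Neg), (R, Pos)]" "neg_nonlinear (cl C) K"
      "x = act C (\<Phi> @ [K]) \<sigma> (idn C R)" "z = act Q (smap h \<Phi> @ \<psi>') \<sigma> (idn Q (h R))"
    note u = nf_unique[OF Hi[OF a(1-3)] nfi[OF a(1-3)], folded a(4)]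
    from assms(3) show "z = z'"
      unfolding til_def
    proof (elim disjE exE conjE)
      fix f' \<sigma>' assume b: "(pull \<Phi> \<sigma>', f') \<in> set ps" "structural (cl C) \<Phi> \<sigma>'" "x = act C (\<Phi> @ [K]) (\<sigma>' @ [length \<Phi>]) f'"
      show ?thesis using u(3)[OF nfp[OF b(1,2), folded b(3)]] clash[OF a(1), of \<sigma>'] by simp
    next
      fix R' \<sigma>' assume b: "structural (cl C) \<Phi> \<sigma>'" "pull \<Phi> \<sigma>' = [(R', Neg), (R', Pos)]" "neg_nonlinear (cl C) K"
        "x = act C (\<Phi> @ [K]) \<sigma>' (idn C R')" "z' = act Q (smap h \<Phi> @ \<psi>') \<sigma>' (idn Q (h R'))"
      show ?thesis using u(1,3)[OF nfi[OF b(1-3), folded b(4)]] a b by simp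
    qed
  qed
qed

lemma v_til:
  assumes "valid C (\<Phi> @ [K])" shows "valid Q (smap h \<Phi> @ \<psi>')"
proof -
  have 1: "valid Q (smap h \<Phi> @ [map_prod h id K])" using functor_valid[OF F assms] by simp
  show ?thesis
    using valid_append_dual[OF 1 v] admissible_cut[of "cl Q" "smap h \<Phi>" "map_prod h id K" \<psi>'] 1 v
    by (simp add: valid_def)
qed

lemma ext_structural:
  assumes "valid C \<Phi>" "structural (cl C) \<Phi> \<sigma>"
  shows "structural (cl Q) (smap h \<Phi> @ \<psi>') (ext \<Phi> \<sigma>)" "pull (smap h \<Phi> @ \<psi>') (ext \<Phi> \<sigma>) = smap h (pull \<Phi> \<sigma>) @ \<psi>'"
proof -
  have lt: "\<forall>j\<in>set \<sigma>. j < length (smap h \<Phi>)" using structural_lt[OF assms(2)] by simp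
  show "structural (cl Q) (smap h \<Phi> @ \<psi>') (ext \<Phi> \<sigma>)"
    using structural_append_iff[OF lt, of "cl Q" \<psi>'] functor_structural[OF F assms(1)] assms(2) by simp
  show "pull (smap h \<Phi> @ \<psi>') (ext \<Phi> \<sigma>) = smap h (pull \<Phi> \<sigma>) @ \<psi>'"
    using pull_append_left[OF lt] pull_smap_structural[OF assms(2)] pull_append_upt[of "smap h \<Phi>" \<psi>'] by simp
qed

lemma weak_structural:
  assumes "valid C \<Phi>" "structural (cl C) \<Phi> \<sigma>" "neg_nonlinear (cl C) K"
  shows "structural (cl Q) (smap h \<Phi> @ \<psi>') \<sigma>" "pull (smap h \<Phi> @ \<psi>') \<sigma> = smap h (pull \<Phi> \<sigma>)"
proof -
  have lt: "\<forall>j\<in>set \<sigma>. j < length (smap h \<Phi>)" using structural_lt[OF assms(2)] by simp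
  have "neg_nonlinear (cl Q) (map_prod h id K)"
    using assms(3) functor_cl[OF F KC] by (simp add: neg_nonlinear_def)
  then have "\<forall>L\<in>set \<psi>'. neg_nonlinear (cl Q) L"
    using v neg_nonlinear_cut unfolding valid_def by blast
  then show "structural (cl Q) (smap h \<Phi> @ \<psi>') \<sigma>"
    using structural_append_weak[OF _ lt, of \<psi>' "cl Q"] functor_structural[OF F assms(1)] assms(2) by simp
  show "pull (smap h \<Phi> @ \<psi>') \<sigma> = smap h (pull \<Phi> \<sigma>)"
    using pull_append_left[OF lt] pull_smap_structural[OF assms(2)] by simp
qed

lemma til_Hom:
  assumes va: "valid C (\<Phi> @ [K])" and t: "til \<Phi> x z"
  shows "z \<in> Hom Q (smap h \<Phi> @ \<psi>')"
  using t unfolding til_def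
proof (elim disjE exE conjE)
  note v\<Phi> = valid_appendD(1)[OF va]
  fix f \<sigma> assume a: "(pull \<Phi> \<sigma>, f) \<in> set ps" "structural (cl C) \<Phi> \<sigma>"
    "z = act Q (smap h \<Phi> @ \<psi>') (ext \<Phi> \<sigma>) (y (pull \<Phi> \<sigma>) f)"
  show ?thesis unfolding a(3)
    by (rule lnl_act[OF Q _ v_til[OF va] ext_structural(1)[OF v\<Phi> a(2)]])
      (use ext_structural(2)[OF v\<Phi> a(2)] y[OF a(1)] in simp)
next
  note v\<Phi> = valid_appendD(1)[OF va]
  fix R \<sigma> assume a: "structural (cl C) \<Phi> \<sigma>" "pull \<Phi> \<sigma> = [(R, Neg), (R, Pos)]" "neg_nonlinear (cl C) K"
    "z = act Q (smap h \<Phi> @ \<psi>') \<sigma> (idn Q (h R))"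
  have "R \<in> Ob C" by (rule act_idn_Hom(2)[OF v\<Phi> a(1,2)])
  then show ?thesis unfolding a(4)
    by (intro lnl_act[OF Q _ v_til[OF va] weak_structural(1)[OF v\<Phi> a(1,3)]])
      (use weak_structural(2)[OF v\<Phi> a(1,3)] a(2) lnl_idn[OF Q functor_ob[OF F]] in simp)
qed

text \<open>The map \<open>\<tau>\<close> composes with the structural map of the normal form, both
  in \<open>C\<close> and in \<open>Q\<close>. This lemma and the next two verify the relations that
  the pre-expansion imposes on its new morphisms.\<close>

lemma til_act:
  assumes t: "til (pull \<Phi> \<tau>) x z" and va: "valid C (\<Phi> @ [K])" and \<tau>: "structural (cl C) \<Phi> \<tau>"
    and va': "valid C (pull \<Phi> \<tau> @ [K])"
  shows "til \<Phi> (act C (\<Phi> @ [K]) (\<tau> @ [length \<Phi>]) x) (act Q (smap h \<Phi> @ \<psi>') (ext \<Phi> \<tau>) z)"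
proof -
  note v\<Phi> = valid_appendD(1)[OF va] and v\<tau> = valid_appendD(1)[OF va']
  have pl: "pull (\<Phi> @ [K]) (\<tau> @ [length \<Phi>]) = pull \<Phi> \<tau> @ [K]" using pull_struct_left[OF \<tau>] by simp
  have nK: "(pull \<Phi> \<tau> @ [K]) ! length \<tau> = K" by (simp add: nth_append)
  have upt: "pull (ext \<Phi> \<tau>) [length \<tau>..<length \<tau> + length \<psi>'] = [length \<Phi>..<length \<Phi> + length \<psi>']"
    using pull_append_upt[of \<tau> "[length \<Phi>..<length \<Phi> + length \<psi>']"] by simp
  have lt: "\<forall>j\<in>set \<sigma>. j < length \<tau>" if "structural (cl C) (pull \<Phi> \<tau>) \<sigma>" for \<sigma>
    using structural_lt[OF that] by simp
  note E = ext_structural[OF v\<Phi> \<tau>]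
  from t show ?thesis
    unfolding til_def[of "pull \<Phi> \<tau>"]
  proof (elim disjE exE conjE)
    fix f \<sigma> assume a: "(pull (pull \<Phi> \<tau>) \<sigma>, f) \<in> set ps" "structural (cl C) (pull \<Phi> \<tau>) \<sigma>"
      "x = act C (pull \<Phi> \<tau> @ [K]) (\<sigma> @ [length (pull \<Phi> \<tau>)]) f"
      "z = act Q (smap h (pull \<Phi> \<tau>) @ \<psi>') (ext (pull \<Phi> \<tau>) \<sigma>) (y (pull (pull \<Phi> \<tau>) \<sigma>) f)"
    have pp: "pull (pull \<Phi> \<tau>) \<sigma> = pull \<Phi> (pull \<tau> \<sigma>)" by (rule pull_pull[OF lt[OF a(2)]])
    have st: "structural (cl C) \<Phi> (pull \<tau> \<sigma>)" by (rule structural_pull[OF \<tau> a(2)])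
    have f: "f \<in> Hom C (pull (pull \<Phi> \<tau>) \<sigma> @ [K])" using ps_proj[OF a(1)] by blast
    have "act C (\<Phi> @ [K]) (\<tau> @ [length \<Phi>]) x = act C (\<Phi> @ [K]) (pull \<tau> \<sigma> @ [length \<Phi>]) f"
      unfolding a(3)
      using lnl_act_act[OF C, of f "\<Phi> @ [K]" "\<tau> @ [length \<Phi>]" "\<sigma> @ [length \<tau>]"] f va structural_K[OF \<tau>]
        structural_K[OF a(2)] pl nK pull_struct_left[OF a(2)] pull_append_left[OF lt[OF a(2)], of "[length \<Phi>]"]
      by simp
    moreover have "act Q (smap h \<Phi> @ \<psi>') (ext \<Phi> \<tau>) z =
        act Q (smap h \<Phi> @ \<psi>') (ext \<Phi> (pull \<tau> \<sigma>)) (y (pull (pull \<Phi> \<tau>) \<sigma>) f)"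
      unfolding a(4)
      using lnl_act_act[OF Q, of "y (pull (pull \<Phi> \<tau>) \<sigma>) f" "smap h \<Phi> @ \<psi>'" "ext \<Phi> \<tau>" "ext (pull \<Phi> \<tau>) \<sigma>"]
        y[OF a(1)] v_til[OF va] E ext_structural[OF v\<tau> a(2)]
        pull_append_left[OF lt[OF a(2)], of "[length \<Phi>..<length \<Phi> + length \<psi>']"] upt by simp
    ultimately show ?thesis unfolding til_def using a(1) st pp by metis
  next
    fix R \<sigma> assume a: "structural (cl C) (pull \<Phi> \<tau>) \<sigma>" "pull (pull \<Phi> \<tau>) \<sigma> = [(R, Neg), (R, Pos)]" "neg_nonlinear (cl C) K"
      "x = act C (pull \<Phi> \<tau> @ [K]) \<sigma> (idn C R)" "z = act Q (smap h (pull \<Phi> \<tau>) @ \<psi>') \<sigma> (idn Q (h R))"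
    have R: "R \<in> Ob C" by (rule act_idn_Hom(2)[OF v\<tau> a(1,2)])
    have pp: "pull (pull \<Phi> \<tau>) \<sigma> = pull \<Phi> (pull \<tau> \<sigma>)" by (rule pull_pull[OF lt[OF a(1)]])
    have st: "structural (cl C) \<Phi> (pull \<tau> \<sigma>)" by (rule structural_pull[OF \<tau> a(1)])
    have "act C (\<Phi> @ [K]) (\<tau> @ [length \<Phi>]) x = act C (\<Phi> @ [K]) (pull \<tau> \<sigma>) (idn C R)"
      unfolding a(4)
      using lnl_act_act[OF C, of "idn C R" "\<Phi> @ [K]" "\<tau> @ [length \<Phi>]" \<sigma>] lnl_idn[OF C R] va structural_K[OF \<tau>]
        structural_K_weak[OF a(3,1)] pl pull_struct_left[OF a(1)] a(2) pull_append_left[OF lt[OF a(1)], of "[length \<Phi>]"]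
      by simp
    moreover have "act Q (smap h \<Phi> @ \<psi>') (ext \<Phi> \<tau>) z = act Q (smap h \<Phi> @ \<psi>') (pull \<tau> \<sigma>) (idn Q (h R))"
      unfolding a(5)
      using lnl_act_act[OF Q, of "idn Q (h R)" "smap h \<Phi> @ \<psi>'" "ext \<Phi> \<tau>" \<sigma>] lnl_idn[OF Q functor_ob[OF F R]]
        v_til[OF va] E weak_structural[OF v\<tau> a(1,3)] a(2) 
        pull_append_left[OF lt[OF a(1)], of "[length \<Phi>..<length \<Phi> + length \<psi>']"] by simp
    ultimately show ?thesis unfolding til_def using a(2,3) st pp by metis
  qed
qed

lemma til_weak:
  assumes f: "f \<in> Hom C \<Phi>" and K: "fst K \<notin> fst ` set \<Phi>" "neg_nonlinear (cl C) K" and va: "valid C (\<Phi> @ [K])"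
  shows "til \<Phi> (act C (\<Phi> @ [K]) [0..<length \<Phi>] f) (act Q (smap h \<Phi> @ \<psi>') [0..<length \<Phi>] (fmor F \<Phi> f))"
proof -
  obtain R \<sigma> where n: "R \<in> Ob C" "structural (cl C) \<Phi> \<sigma>" "pull \<Phi> \<sigma> = [(R, Neg), (R, Pos)]"
    "f = act C \<Phi> \<sigma> (idn C R)" by (rule transition_nf[OF f K(1)])
  note v\<Phi> = valid_appendD(1)[OF va]
  have lt: "\<forall>j\<in>set \<sigma>. j < length \<Phi>" using structural_lt[OF n(2)] by blast
  have i: "idn C R \<in> Hom C (pull \<Phi> \<sigma>)" using lnl_idn[OF C n(1)] n(3) by simp
  have "act C (\<Phi> @ [K]) [0..<length \<Phi>] f = act C (\<Phi> @ [K]) \<sigma> (idn C R)"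
    unfolding n(4)
    using lnl_act_act[OF C, of "idn C R" "\<Phi> @ [K]" "[0..<length \<Phi>]" \<sigma>] i va
      structural_K_weak[OF K(2) structural_id] n(2) pull_upt_left[OF lt] by simp
  moreover have "fmor F \<Phi> f = act Q (smap h \<Phi>) \<sigma> (idn Q (h R))"
    unfolding n(4) using functor_act[OF F i v\<Phi> n(2)] functor_idn[OF F n(1)] n(3) by simp
  then have "act Q (smap h \<Phi> @ \<psi>') [0..<length \<Phi>] (fmor F \<Phi> f) = act Q (smap h \<Phi> @ \<psi>') \<sigma> (idn Q (h R))"
    using lnl_act_act[OF Q, of "idn Q (h R)" "smap h \<Phi> @ \<psi>'" "[0..<length \<Phi>]" \<sigma>] lnl_idn[OF Q functor_ob[OF F n(1)]]
      v_til[OF va] weak_structural[OF v\<Phi> structural_id K(2)] n(2,3) functor_structural[OF F v\<Phi>]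
      pull_upt_left[OF lt] by (simp add: pull_smap_structural[OF n(2)])
  ultimately show ?thesis unfolding til_def using n K by metis
qed

text \<open>The transition \<open>g\<close> is a relabelled identity, so the composite is a
  relabelling of \<open>x\<close>, covered by \<open>til_act\<close>, or a weakened identity,
  covered by the second alternative of \<open>til\<close>.\<close>

lemma til_trans:
  assumes t: "til (dual L # \<Phi>) x z" and x: "x \<in> Hom C (dual L # \<Phi> @ [K])" 
    and g: "g \<in> Hom C (\<Theta> @ [L])" "fst K \<notin> fst ` set (\<Theta> @ [L])" and K\<Phi>: "fst K \<notin> fst ` set \<Phi>"
  shows "til (\<Theta> @ \<Phi>) (cmp C \<Theta> L (\<Phi> @ [K]) x g)
    (cmp Q (smap h \<Theta>) (map_prod h id L) (smap h \<Phi> @ \<psi>') z (fmor F (\<Theta> @ [L]) g))"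
proof -
  let ?hL = "map_prod h id L"
  obtain R \<sigma> where n: "R \<in> Ob C" "structural (cl C) (\<Theta> @ [L]) \<sigma>" "pull (\<Theta> @ [L]) \<sigma> = [(R, Neg), (R, Pos)]"
    "g = act C (\<Theta> @ [L]) \<sigma> (idn C R)" by (rule transition_nf[OF g])
  note vg = lnl_valid[OF C g(1)] and vx = lnl_valid[OF C x]
  note v\<Theta> = valid_appendD(1)[OF vg]
  have vc: "valid C ((\<Theta> @ \<Phi>) @ [K])" using lnl_valid[OF C lnl_cmp[OF C g(1) x]] by simp
  have vQ: "valid Q (smap h \<Theta> @ [?hL])" using functor_valid[OF F vg] by simp
  have z: "z \<in> Hom Q (dual ?hL # smap h \<Phi> @ \<psi>')" using til_Hom[OF _ t] vx by (simp add: dual_map_prod)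
  have i: "idn C R \<in> Hom C (pull (\<Theta> @ [L]) \<sigma>)" using lnl_idn[OF C n(1)] n(3) by simp
  have Fg: "fmor F (\<Theta> @ [L]) g = act Q (smap h \<Theta> @ [?hL]) \<sigma> (idn Q (h R))"
    unfolding n(4) using functor_act[OF F i vg n(2)] functor_idn[OF F n(1)] n(3) by simp
  let ?n = "length \<Theta>" and ?m = "length \<Phi>" and ?l = "length \<psi>'"
  from n(2,3) show ?thesis
  proof (cases rule: structural_idn_cases)
    case (hit a)
    let ?\<tau> = "a # [?n..<?n + ?m]"
    have pl: "pull (\<Theta> @ \<Phi>) ?\<tau> = dual L # \<Phi>" using hit by (simp add: nth_append)
    have st: "structural (cl C) (\<Theta> @ \<Phi>) ?\<tau>"
      using structural_append_iff[of "[a]" \<Theta> "cl C" \<Phi>] hit by simp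
    have "cmp C \<Theta> L (\<Phi> @ [K]) x g = act C (\<Theta> @ \<Phi> @ [K]) (a # [?n..<?n + length (\<Phi> @ [K])]) x"
      using cmp_structural_hit[OF C x vg hit(1,2,4)] n(4) hit by simp
    moreover have "cmp Q (smap h \<Theta>) ?hL (smap h \<Phi> @ \<psi>') z (fmor F (\<Theta> @ [L]) g) =
      act Q (smap h \<Theta> @ smap h \<Phi> @ \<psi>') (a # [?n..<?n + length (smap h \<Phi> @ \<psi>')]) z"
      unfolding Fg hit
      using cmp_structural_hit[OF Q z vQ, of a] hit functor_structural[OF F v\<Theta>]
      by (simp add: dual_map_prod smap_nth cong: if_cong)
    moreover have "a # [?n..<?n + length (\<Phi> @ [K])] = ?\<tau> @ [length (\<Theta> @ \<Phi>)]" by simp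
    moreover have "a # [?n..<?n + length (smap h \<Phi> @ \<psi>')] = ext (\<Theta> @ \<Phi>) ?\<tau>"
      using upt_add_eq_append[of ?n "?n + ?m" ?l] by (simp add: add.assoc)
    moreover have "til (\<Theta> @ \<Phi>) (act C ((\<Theta> @ \<Phi>) @ [K]) (?\<tau> @ [length (\<Theta> @ \<Phi>)]) x)
      (act Q (smap h (\<Theta> @ \<Phi>) @ \<psi>') (ext (\<Theta> @ \<Phi>) ?\<tau>) z)"
      by (rule til_act[OF _ vc st]) (use pl t vx in simp_all)
    ultimately show ?thesis by simp
  next
    case miss
    have pl: "pull \<Theta> \<sigma> = [(R, Neg), (R, Pos)]" using n(3) pull_append_left[OF miss(3)] by simp
    have LC: "fst L \<in> Ob C" using vg by (auto simp: valid_def)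
    have nQ: "neg_nonlinear (cl Q) ?hL" using miss functor_cl[OF F LC] by (auto simp: neg_nonlinear_def)
    have nn: "\<forall>M\<in>set (\<Phi> @ [K]). neg_nonlinear (cl C) M"
      using neg_nonlinear_cut[of "cl C" L "\<Phi> @ [K]"] vx miss by (auto simp: valid_def)
    have "cmp C \<Theta> L (\<Phi> @ [K]) x g = act C (\<Theta> @ \<Phi> @ [K]) \<sigma> (idn C R)"
      unfolding n(4) by (rule cmp_structural_miss[OF C x vg miss(1,2)]) (use pl lnl_idn[OF C n(1)] in simp)
    moreover have "cmp Q (smap h \<Theta>) ?hL (smap h \<Phi> @ \<psi>') z (fmor F (\<Theta> @ [L]) g) =
      act Q (smap h \<Theta> @ smap h \<Phi> @ \<psi>') \<sigma> (idn Q (h R))"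
      unfolding Fg
      by (rule cmp_structural_miss[OF Q z vQ nQ])
        (use miss functor_structural[OF F v\<Theta>] lnl_idn[OF Q functor_ob[OF F n(1)]] pl in
          \<open>auto simp: pull_smap_structural[OF miss(2)]\<close>)
    moreover have "structural (cl C) (\<Theta> @ \<Phi>) \<sigma>" using structural_append_weak[of \<Phi> "cl C" \<sigma> \<Theta>] miss nn by simp
    moreover have "pull (\<Theta> @ \<Phi>) \<sigma> = [(R, Neg), (R, Pos)]" using pl pull_append_left[OF miss(3)] by simp
    ultimately show ?thesis using nn unfolding til_def by auto
  qed
qed

text \<open>Over a functor on the cone, the pre-expansion is free on the listed projections: the
  values \<open>y\<close> may be prescribed at will within their hom-sets. In this form the premises
  of the invertible rule are used; \<open>sh\<close> says that the entries of \<open>\<psi>'\<close>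
  have the classes and signs of the new objects.\<close>

lemma exp_functor_ex:
  assumes sh: "\<psi> = map (map_prod (cl Q) id) \<psi>'"
  shows "\<exists>u. is_functor (EC {}) Q u \<and> fcomp C u (exp_incl C K \<psi> {}) = F \<and> smap (fob u) (new \<psi>) = \<psi>' \<and>
    (\<forall>(\<Phi>, f)\<in>set ps. fmor u (old \<Phi> @ new \<psi>) (ecls {} (old \<Phi> @ new \<psi>) (TGen (Til \<Phi> f))) = y \<Phi> f)"
proof -
  define h' where "h' = case_sum h (\<lambda>j. fst (\<psi>' ! j))"
  define tz where "tz \<Phi> x = (THE z. til \<Phi> x z)" for \<Phi> x
  \<comment> \<open>The pre-expansion has no generator \<open>Chi\<close>, so the value there is a
    dummy.\<close>
  define \<gamma> where "\<gamma> g = (case g of Mor \<Phi> f \<Rightarrow> fmor F \<Phi> f | Til \<Phi> f \<Rightarrow> tz \<Phi> f | Chi _ \<Rightarrow> undefined)" for g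
  have tz: "tz \<Phi> x = z" if "valid C (\<Phi> @ [K])" "til \<Phi> x z" for \<Phi> x z
    unfolding tz_def using that til_unique[OF that(1)] by blast
  have til_tz: "til \<Phi> x (tz \<Phi> x)" if "abstract_projection C K \<Phi> x" for \<Phi> x
    using that til_ex[of x \<Phi>] tz[OF lnl_valid[OF C]] by (auto simp: abstract_projection_def)
  have old: "smap h' (old \<Phi>) = smap h \<Phi>" for \<Phi> by (simp add: smap_smap h'_def)
  have new: "smap h' (new \<psi>) = \<psi>'"
    by (rule nth_equalityI) (auto simp: sh new_def smap_def h'_def map_prod_def split: prod.splits)
  have L: "map_prod h' id (map_prod Inl id L) = map_prod h id L" for L :: "'r signed"
    by (cases L) (simp add: h'_def)
  have len: "length \<psi> = length \<psi>'" using sh by simp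
  interpret pr: presentation "exp_Ob C \<psi>" "exp_cl C \<psi>" "exp_gen C K \<psi> {}" "exp_rel C K \<psi> {}" .
  have "\<exists>u. is_functor pr.P Q u \<and> (\<forall>R\<in>exp_Ob C \<psi>. fob u R = h' R) \<and>
      (\<forall>\<Phi> t. ewt {} \<Phi> t \<longrightarrow> fmor u \<Phi> (pr.cls \<Phi> t) = ev Q h' \<gamma> t)"
  proof (rule pr.presented_functor[OF Q])
    fix R assume "R \<in> exp_Ob C \<psi>"
    then consider r where "R = Inl r" "r \<in> Ob C" | j where "R = Inr j" "j < length \<psi>'"
      using len unfolding exp_Ob_def by auto
    then show "h' R \<in> Ob Q \<and> cl Q (h' R) = exp_cl C \<psi> R"
    proof cases
      case 1 then show ?thesis using functorD(1,2)[OF F] by (simp add: h'_def exp_cl_def)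
    next
      case 2
      then have "fst (\<psi>' ! j) \<in> fst ` set \<psi>'" by simp
      then show ?thesis using v 2 by (auto simp: valid_def h'_def exp_cl_def sh)
    qed
  next
    fix g \<Xi> assume "exp_gen C K \<psi> {} g \<Xi>"
    then consider \<Phi> f where "g = Mor \<Phi> f" "f \<in> Hom C \<Phi>" "\<Xi> = old \<Phi>"
      | \<Phi> f where "g = Til \<Phi> f" "abstract_projection C K \<Phi> f" "\<Xi> = old \<Phi> @ new \<psi>"
      unfolding exp_gen_def by (cases g) auto
    then show "\<gamma> g \<in> Hom Q (smap h' \<Xi>)"
    proof cases
      case 1 then show ?thesis using functor_hom[OF F] by (simp add: \<gamma>_def old)
    next
      case 2
      then show ?thesis using til_Hom[OF lnl_valid[OF C] til_tz] by (auto simp: \<gamma>_def old new abstract_projection_def)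
    qed
  next
    fix \<Xi> s t assume "exp_rel C K \<psi> {} \<Xi> s t"
    then show "ev Q h' \<gamma> s = ev Q h' \<gamma> t"
    proof cases
      case (incl_act \<Phi> \<sigma> x)
      then show ?thesis using functor_act[OF F] by (simp add: \<gamma>_def old)
    next
      case (incl_idn R)
      then show ?thesis using functor_idn[OF F] by (simp add: \<gamma>_def h'_def)
    next
      case (incl_cmp f \<Phi> L g \<Psi>)
      then show ?thesis using functor_cmp[OF F] by (simp add: \<gamma>_def old L)
    next
      case (til_trans L \<Phi> f g \<Theta>)
      then have f: "f \<in> Hom C (dual L # \<Phi> @ [K])" "fst K \<notin> fst ` set \<Phi>" by (auto simp: abstract_projection_def)
      have "valid C ((\<Theta> @ \<Phi>) @ [K])" using lnl_valid[OF C lnl_cmp[OF C til_trans(5) f(1)]] by simp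
      from tz[OF this cone_expn.til_trans[OF cone_expn_axioms Q F v y til_tz[OF til_trans(4)] f(1) til_trans(5,6) f(2)]]
      show ?thesis using til_trans by (simp add: \<gamma>_def old new L)
    next
      case (til_act \<Phi> \<sigma> f)
      have va: "valid C (pull \<Phi> \<sigma> @ [K])" using lnl_valid[OF C] til_act by (auto simp: abstract_projection_def)
      from tz[OF til_act(5) cone_expn.til_act[OF cone_expn_axioms Q F v y til_tz[OF til_act(4)] til_act(5,6) va]]
      show ?thesis using til_act by (simp add: \<gamma>_def old new len)
    next
      case (til_weak f \<Phi>)
      from tz[OF til_weak(6) cone_expn.til_weak[OF cone_expn_axioms Q F v y til_weak(4,7,5,6)]]
      show ?thesis using til_weak by (simp add: \<gamma>_def old new)
    qed simp
  qed
  then obtain u where u: "is_functor (EC {}) Q u" "\<And>R. R \<in> exp_Ob C \<psi> \<Longrightarrow> fob u R = h' R"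
    "\<And>\<Phi> t. ewt {} \<Phi> t \<Longrightarrow> fmor u \<Phi> (ecls {} \<Phi> t) = ev Q h' \<gamma> t"
    unfolding expansion_def exp_class_def by blast
  have "fcomp C u (exp_incl C K \<psi> {}) = F"
  proof (rule fcomp_eq_functorI[OF F])
    show "fob u (fob (exp_incl C K \<psi> {}) R) = fob F R" if "R \<in> Ob C" for R
      using that u(2) by (simp add: exp_incl_simps exp_Ob_def h'_def)
    show "fmor u (smap (fob (exp_incl C K \<psi> {})) \<Phi>) (fmor (exp_incl C K \<psi> {}) \<Phi> x) = fmor F \<Phi> x"
      if "x \<in> Hom C \<Phi>" for \<Phi> x
      using u(3)[OF wt_Mor[OF that]] exp_incl_simps(3)[OF lnl_valid[OF C that]] that
      by (simp add: exp_incl_simps(2) \<gamma>_def)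
  qed
  moreover have "smap (fob u) (new \<psi>) = \<psi>'"
    unfolding new[symmetric] by (rule smap_cong) (use u(2) in \<open>auto simp: new_simps exp_Ob_def\<close>)
  moreover have "fmor u (old \<Phi> @ new \<psi>) (ecls {} (old \<Phi> @ new \<psi>) (TGen (Til \<Phi> f))) = y \<Phi> f"
    if f: "(\<Phi>, f) \<in> set ps" for \<Phi> f
  proof -
    have ap: "abstract_projection C K \<Phi> f" using ps_proj[OF f] by (simp add: abstract_projection_def)
    have fH: "f \<in> Hom C (\<Phi> @ [K])" using ps_proj[OF f] by blast
    have "ext \<Phi> [0..<length \<Phi>] = [0..<length (smap h \<Phi> @ \<psi>')]"
      using upt_add_eq_append[of 0 "length \<Phi>" "length \<psi>'"] by simp
    then have "til \<Phi> f (y \<Phi> f)"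
      unfolding til_def using f structural_id[of "cl C" \<Phi>] lnl_act_id[OF C fH] lnl_act_id[OF Q y[OF f]]
      by (intro disjI1 exI[of _ f] exI[of _ "[0..<length \<Phi>]"]) simp
    then show ?thesis using u(3)[OF wt_Til[OF ap]] tz[OF lnl_valid[OF C fH]] by (simp add: \<gamma>_def)
  qed
  ultimately show ?thesis using u(1) by blast
qed

end

text \<open>By \<open>proj_nf\<close>, the relations \<open>til_act\<close> and
  \<open>til_weak\<close> of the expansion express every other tilde morphism through listed ones
  and included transitions.\<close>

lemma exp_generated_basis:
  assumes M: "op_closed (EC X) M"
    and mor: "\<And>\<Phi> f. f \<in> Hom C \<Phi> \<Longrightarrow> M (old \<Phi>) (ecls X (old \<Phi>) (TGen (Mor \<Phi> f)))"
    and til: "\<And>\<Phi> f. (\<Phi>, f) \<in> set ps \<Longrightarrow> M (old \<Phi> @ new \<psi>) (ecls X (old \<Phi> @ new \<psi>) (TGen (Til \<Phi> f)))"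
    and chi: "\<And>i. i \<in> X \<Longrightarrow> M (old [dual K] @ new \<psi>) (ecls X (old [dual K] @ new \<psi>) (TGen (Chi i)))"
    and x: "x \<in> Hom (EC X) \<Xi>"
  shows "M \<Xi> x"
proof (rule exp_generated[OF M mor _ chi x])
  interpret pr: presentation "exp_Ob C \<psi>" "exp_cl C \<psi>" "exp_gen C K \<psi> X" "exp_rel C K \<psi> X" .
  fix \<Phi> f assume f: "abstract_projection C K \<Phi> f"
  then have fH: "f \<in> Hom C (\<Phi> @ [K])" "fst K \<notin> fst ` set \<Phi>" by (auto simp: abstract_projection_def)
  note va = lnl_valid[OF C fH(1)]
  have vE: "valid (EC X) (old \<Phi> @ new \<psi>)"
    using wt_valid[OF wt_Til[OF f]] by (auto simp: valid_def exp_simps)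
  have sto: "structural (exp_cl C \<psi>) (old \<Phi>) \<sigma> = structural (cl C) \<Phi> \<sigma>" for \<sigma>
    by (rule structural_smap) (simp add: exp_cl_def)
  from fH show "M (old \<Phi> @ new \<psi>) (ecls X (old \<Phi> @ new \<psi>) (TGen (Til \<Phi> f)))"
  proof (cases rule: proj_nf)
    case (proj g \<sigma>)
    let ?\<sigma> = "\<sigma> @ [length \<Phi>..<length \<Phi> + length \<psi>]"
    have ap: "abstract_projection C K (pull \<Phi> \<sigma>) g" using ps_proj[OF proj(1)] by (simp add: abstract_projection_def)
    have lt: "\<forall>j\<in>set \<sigma>. j < length (old \<Phi>)" using structural_lt[OF proj(2)] by simp
    have st: "structural (cl (EC X)) (old \<Phi> @ new \<psi>) ?\<sigma>"
      using structural_append_iff[OF lt, of "exp_cl C \<psi>" "new \<psi>"] proj(2) sto by (simp add: exp_simps new_simps)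
    have pl: "pull (old \<Phi> @ new \<psi>) ?\<sigma> = old (pull \<Phi> \<sigma>) @ new \<psi>"
      using pull_append_left[OF lt] pull_smap_structural[OF proj(2)] pull_append_upt[of "old \<Phi>" "new \<psi>"]
      by (simp add: new_simps)
    have "ecls X (old \<Phi> @ new \<psi>) (TGen (Til \<Phi> f)) =
        ecls X (old \<Phi> @ new \<psi>) (TAct (old \<Phi> @ new \<psi>) ?\<sigma> (TGen (Til (pull \<Phi> \<sigma>) g)))"
      unfolding exp_class_def proj(3)
      by (rule pr.cls_eq, rule pr.eqv_rel, rule exp_rel.til_act[OF ap va proj(2) fH(2)])
    also have "\<dots> = act (EC X) (old \<Phi> @ new \<psi>) ?\<sigma> (ecls X (pull (old \<Phi> @ new \<psi>) ?\<sigma>) (TGen (Til (pull \<Phi> \<sigma>) g)))"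
      unfolding exp_class_def expansion_def
      by (rule pr.presented_act[symmetric]) (use wt_Til[OF ap] pl vE st in \<open>simp_all add: expansion_def exp_simps\<close>)
    also have "M (old \<Phi> @ new \<psi>) \<dots>"
      by (rule op_closed_act[OF M]) (use til[OF proj(1)] wt_Til[OF ap] pl vE st in \<open>auto simp: exp_simps\<close>)
    finally show ?thesis .
  next
    case (weak R \<sigma>)
    note v\<Phi> = valid_appendD(1)[OF va]
    define g where "g = act C \<Phi> \<sigma> (idn C R)"
    have gH: "g \<in> Hom C \<Phi>" unfolding g_def by (rule act_idn_Hom(1)[OF v\<Phi> weak(1,2)])
    have "R \<in> Ob C" by (rule act_idn_Hom(2)[OF v\<Phi> weak(1,2)])
    then have "f = act C (\<Phi> @ [K]) [0..<length \<Phi>] g"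
      unfolding weak(4) g_def
      using lnl_act_act[OF C, of "idn C R" "\<Phi> @ [K]" "[0..<length \<Phi>]" \<sigma>] lnl_idn[OF C] va weak
        structural_append_weak[of "[K]" "cl C" "[0..<length \<Phi>]" \<Phi>] structural_id[of "cl C" \<Phi>]
        pull_upt_left[of \<sigma>] structural_lt[OF weak(1)] by simp
    moreover have "exp_rel C K \<psi> X (old \<Phi> @ new \<psi>) (TGen (Til \<Phi> (act C (\<Phi> @ [K]) [0..<length \<Phi>] g)))
        (TAct (old \<Phi> @ new \<psi>) [0..<length \<Phi>] (TGen (Mor \<Phi> g)))"
      by (rule exp_rel.til_weak[OF gH weak(3) va fH(2)])
    ultimately have "ecls X (old \<Phi> @ new \<psi>) (TGen (Til \<Phi> f)) =
        ecls X (old \<Phi> @ new \<psi>) (TAct (old \<Phi> @ new \<psi>) [0..<length \<Phi>] (TGen (Mor \<Phi> g)))"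
      unfolding exp_class_def using pr.cls_eq[OF pr.eqv_rel] by simp
    moreover have "\<forall>L\<in>set (new \<psi>). neg_nonlinear (exp_cl C \<psi>) L"
      using neg_nonlinear_cut[of "exp_cl C \<psi>" "map_prod Inl id K" "new \<psi>"] adm weak(3)
      by (auto simp: dual_map_prod neg_nonlinear_def exp_cl_def)
    then have st: "structural (exp_cl C \<psi>) (old \<Phi> @ new \<psi>) [0..<length \<Phi>]"
      using structural_append_weak[of "new \<psi>" "exp_cl C \<psi>" "[0..<length \<Phi>]" "old \<Phi>"] sto structural_id by simp
    have pl: "pull (old \<Phi> @ new \<psi>) [0..<length \<Phi>] = old \<Phi>"
      using pull_append_id[of "old \<Phi>" "new \<psi>"] by simp
    have "act (EC X) (old \<Phi> @ new \<psi>) [0..<length \<Phi>] (ecls X (pull (old \<Phi> @ new \<psi>) [0..<length \<Phi>]) (TGen (Mor \<Phi> g))) =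
       ecls X (old \<Phi> @ new \<psi>) (TAct (old \<Phi> @ new \<psi>) [0..<length \<Phi>] (TGen (Mor \<Phi> g)))"
      unfolding exp_class_def expansion_def
      by (rule pr.presented_act) (use wt_Mor[OF gH] pl vE st in \<open>simp_all add: expansion_def exp_simps\<close>)
    moreover have "M (old \<Phi> @ new \<psi>) (act (EC X) (old \<Phi> @ new \<psi>) [0..<length \<Phi>]
        (ecls X (pull (old \<Phi> @ new \<psi>) [0..<length \<Phi>]) (TGen (Mor \<Phi> g))))"
      by (rule op_closed_act[OF M]) (use mor[OF gH] wt_Mor[OF gH] pl vE st in \<open>auto simp: exp_simps\<close>)
    ultimately show ?thesis by simp
  qed
qed

text \<open>The equalizer of the two functors is closed under the operations and contains the
  generators from \<open>exp_generated_basis\<close>.\<close>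

lemma exp_functor_unique:
  assumes u: "is_functor (EC {}) Q u" and u': "is_functor (EC {}) Q u'"
    and incl: "fcomp C u (exp_incl C K \<psi> {}) = fcomp C u' (exp_incl C K \<psi> {})"
    and new: "smap (fob u) (new \<psi>) = smap (fob u') (new \<psi>)"
    and til: "\<And>\<Phi> f. (\<Phi>, f) \<in> set ps \<Longrightarrow> fmor u (old \<Phi> @ new \<psi>) (ecls {} (old \<Phi> @ new \<psi>) (TGen (Til \<Phi> f))) =
       fmor u' (old \<Phi> @ new \<psi>) (ecls {} (old \<Phi> @ new \<psi>) (TGen (Til \<Phi> f)))"
  shows "u = u'"
proof -
  have ob: "fob u R = fob u' R" if "R \<in> Ob (EC {})" for R
  proof -
    from that consider r where "R = Inl r" "r \<in> Ob C" | j where "R = Inr j" "j < length \<psi>"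
      unfolding exp_simps exp_Ob_def by auto
    then show ?thesis
    proof cases
      case 1
      have "fob (fcomp C u (exp_incl C K \<psi> {})) r = fob (fcomp C u' (exp_incl C K \<psi> {})) r" using incl by simp
      then show ?thesis using 1 by (simp add: fcomp_simps exp_incl_simps)
    next
      case 2
      have "smap (fob u) (new \<psi>) ! j = smap (fob u') (new \<psi>) ! j" using new by simp
      then show ?thesis using 2 by (simp add: smap_nth new_simps) (simp add: new_def)
    qed
  qed
  have "fmor u \<Xi> x = fmor u' \<Xi> x" if "x \<in> Hom (EC {}) \<Xi>" for \<Xi> x
  proof (rule exp_generated_basis[where M = "\<lambda>\<Xi> x. fmor u \<Xi> x = fmor u' \<Xi> x", OF _ _ _ _ that])
    show "op_closed (EC {}) (\<lambda>\<Xi> x. fmor u \<Xi> x = fmor u' \<Xi> x)"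
      by (rule op_closed_equalizer[OF u u' ob exp_simps(4)])
    show "fmor u (old \<Phi>) (ecls {} (old \<Phi>) (TGen (Mor \<Phi> f))) = fmor u' (old \<Phi>) (ecls {} (old \<Phi>) (TGen (Mor \<Phi> f)))"
      if f: "f \<in> Hom C \<Phi>" for \<Phi> f
    proof -
      have "fmor (fcomp C u (exp_incl C K \<psi> {})) \<Phi> f = fmor (fcomp C u' (exp_incl C K \<psi> {})) \<Phi> f" using incl by simp
      then show ?thesis using f by (simp add: fcomp_simps exp_incl_simps(2) exp_incl_simps(3)[OF lnl_valid[OF C f]])
    qed
  qed (auto intro: til)
  then show ?thesis by (intro functor_eqI[OF u u' ob])
qed

end

section \<open>Objects, morphisms and proto-extremal lifts of colimits\<close>

context subterminal_doctrine
begin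

lemma subsketch_all:
  assumes "is_sketch D P"
  shows "subsketch D P (Ob (poly P)) (\<lambda>_ _. True) PE"
  using D assms by unfold_locales (auto simp: op_closed_def lands_def dest: sketch_pext functor_ob)

lemma subsketch_lands:
  assumes "is_sketch D P" "O' \<subseteq> Ob (poly P)" "op_closed (poly P) M"
  shows "subsketch D P O' M (\<lambda>c L. lands (cone D c) O' M L)"
  using D assms by unfold_locales auto

lemma lands_fcomp:
  assumes L: "carries C P L" and F: "lands P O' M F" and C: "lnl_ops C"
  shows "lands C O' M (fcomp C F L)"
  unfolding lands_def
proof (intro conjI ballI allI)
  show "fob (fcomp C F L) R \<in> O'" if "R \<in> Ob C" for R
    using that F carries_ob[OF L that] by (simp add: fcomp_simps lands_def)
  show "M (smap (fob (fcomp C F L)) \<Phi>) (fmor (fcomp C F L) \<Phi> x)" if "x \<in> Hom C \<Phi>" for \<Phi> x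
  proof -
    have "smap (fob (fcomp C F L)) \<Phi> = smap (fob F) (smap (fob L) \<Phi>)"
      unfolding smap_smap by (rule smap_fctr_cong[OF lnl_ops_valid[OF C that]]) (simp add: fcomp_simps)
    then show ?thesis using F carries_hom[OF L that] that by (simp add: fcomp_simps lands_def)
  qed
qed

lemma cone_ops: "c \<in> cones D \<Longrightarrow> lnl_ops (cone D c)"
  by (rule lnl_lnl_ops[OF cone_lnl])

context
  fixes I :: "'i set" and A :: "'i \<Rightarrow> ('a, 'a2, 'd, 'e, 'c, 'r, 'p) sketch" and B :: "'i \<Rightarrow> ('b, 'b2, 'd, 'e, 'c, 'r, 'p) sketch"
    and j a and S S' :: "('o, 'm, 'd, 'e, 'c, 'r, 'p) sketch" and inc att
  assumes po: "is_pushout D I A B j a S S' inc att" and S: "is_sketch D S"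
    and B: "\<And>i. i \<in> I \<Longrightarrow> lnl_ops (poly (B i))"
      "\<And>i c L. i \<in> I \<Longrightarrow> c \<in> cones D \<Longrightarrow> L \<in> pext (B i) c \<Longrightarrow> carries (cone D c) (poly (B i)) L"
begin

lemma pushout_generated_aux:
  assumes O': "O' \<subseteq> Ob (poly S')" and M: "op_closed (poly S') M"
    and inc: "lands (poly S) O' M inc" and att: "\<And>i. i \<in> I \<Longrightarrow> lands (poly (B i)) O' M (att i)"
  shows "Ob (poly S') \<subseteq> O'" "\<And>\<Phi> x. x \<in> Hom (poly S') \<Phi> \<Longrightarrow> M \<Phi> x"
proof -
  interpret s: subsketch D S' O' M "\<lambda>c L. lands (cone D c) O' M L"
    by (rule subsketch_lands[OF pushout_sketch[OF po] O' M])
  have *: "lands (cone D c) O' M (fcomp (cone D c) inc L)" if "c \<in> cones D" "L \<in> pext S c" for c L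
    by (rule lands_fcomp[OF functor_carries[OF sketch_pext[OF S that]] inc cone_ops[OF that(1)]])
  have **: "lands (cone D c) O' M (fcomp (cone D c) (att i) L)" if "i \<in> I" "c \<in> cones D" "L \<in> pext (B i) c" for i c L
    by (rule lands_fcomp[OF B(2)[OF that] att[OF that(1)] cone_ops[OF that(2)]])
  note full = s.pushout_sub[OF po lnl_lnl_ops[OF sketch_lnl[OF S]] B(1) inc att * **]
  show "Ob (poly S') \<subseteq> O'" by (rule full(1))
  show "\<And>\<Phi> x. x \<in> Hom (poly S') \<Phi> \<Longrightarrow> M \<Phi> x" by (rule full(2))
qed

text \<open>The images of the legs, with all morphisms between them, form a sub-sketch through which
  the legs factor.\<close>

lemma pushout_ob:
  assumes "R \<in> Ob (poly S')"
  shows "(\<exists>R0\<in>Ob (poly S). R = fob inc R0) \<or> (\<exists>i\<in>I. \<exists>r\<in>Ob (poly (B i)). R = fob (att i) r)"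
proof -
  let ?O = "fob inc ` Ob (poly S) \<union> (\<Union>i\<in>I. fob (att i) ` Ob (poly (B i)))"
  have "?O \<subseteq> Ob (poly S')"
    using functor_ob[OF sketch_mor_functor[OF pushout_inc[OF po]]]
      functor_ob[OF sketch_mor_functor[OF pushout_att[OF po]]] by auto
  then have "Ob (poly S') \<subseteq> ?O"
    by (rule pushout_generated_aux[where M = "\<lambda>_ _. True"]) (auto simp: op_closed_def lands_def)
  then show ?thesis using assms by blast
qed

lemma pushout_generated:
  assumes M: "op_closed (poly S') M"
    and "\<And>\<Phi> x. x \<in> Hom (poly S) \<Phi> \<Longrightarrow> M (smap (fob inc) \<Phi>) (fmor inc \<Phi> x)"
    and "\<And>i \<Phi> x. i \<in> I \<Longrightarrow> x \<in> Hom (poly (B i)) \<Phi> \<Longrightarrow> M (smap (fob (att i)) \<Phi>) (fmor (att i) \<Phi> x)"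
    and "x \<in> Hom (poly S') \<Phi>"
  shows "M \<Phi> x"
proof (rule pushout_generated_aux(2)[OF subset_refl M _ _ assms(4)])
  show "lands (poly S) (Ob (poly S')) M inc"
    using assms(2) functor_ob[OF sketch_mor_functor[OF pushout_inc[OF po]]] by (auto simp: lands_def)
  show "lands (poly (B i)) (Ob (poly S')) M (att i)" if "i \<in> I" for i
    using assms(3)[OF that] functor_ob[OF sketch_mor_functor[OF pushout_att[OF po that]]] by (auto simp: lands_def)
qed

text \<open>Here the sub-sketch keeps all objects and morphisms and restricts only the
  proto-extremal lifts.\<close>

lemma pushout_pext:
  assumes "c \<in> cones D" "L \<in> pext S' c"
  shows "(\<exists>L0\<in>pext S c. L = fcomp (cone D c) inc L0) \<or> (\<exists>i\<in>I. \<exists>L0\<in>pext (B i) c. L = fcomp (cone D c) (att i) L0)"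
proof -
  let ?PE = "\<lambda>c L. (\<exists>L0\<in>pext S c. L = fcomp (cone D c) inc L0) \<or> (\<exists>i\<in>I. \<exists>L0\<in>pext (B i) c. L = fcomp (cone D c) (att i) L0)"
  interpret s: subsketch D S' "Ob (poly S')" "\<lambda>_ _. True" ?PE
    by (rule subsketch_all[OF pushout_sketch[OF po]])
  show ?thesis
    by (rule s.pushout_sub(3)[OF po lnl_lnl_ops[OF sketch_lnl[OF S]] B(1) _ _ _ _ assms])
      (auto simp: lands_def functor_ob[OF sketch_mor_functor[OF pushout_inc[OF po]]]
        functor_ob[OF sketch_mor_functor[OF pushout_att[OF po]]])
qed

end

context
  fixes S :: "nat \<Rightarrow> ('o, 'm, 'd, 'e, 'c, 'r, 'p) sketch" and inc and S' :: "('o, 'm, 'd, 'e, 'c, 'r, 'p) sketch" and leg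
  assumes co: "is_seq_colimit D S inc S' leg" and S: "\<And>n. is_sketch D (S n)"
begin

lemma seq_colimit_generated_aux:
  assumes O': "O' \<subseteq> Ob (poly S')" and M: "op_closed (poly S') M"
    and leg: "\<And>n. lands (poly (S n)) O' M (leg n)"
  shows "Ob (poly S') \<subseteq> O'" "\<And>\<Phi> x. x \<in> Hom (poly S') \<Phi> \<Longrightarrow> M \<Phi> x"
proof -
  interpret s: subsketch D S' O' M "\<lambda>c L. lands (cone D c) O' M L"
    by (rule subsketch_lands[OF seq_colimit_sketch[OF co] O' M])
  have *: "lands (cone D c) O' M (fcomp (cone D c) (leg n) L)" if "c \<in> cones D" "L \<in> pext (S n) c" for n c L
    by (rule lands_fcomp[OF functor_carries[OF sketch_pext[OF S that]] leg cone_ops[OF that(1)]])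
  note full = s.seq_colimit_sub[OF co lnl_lnl_ops[OF sketch_lnl[OF S]] leg *]
  show "Ob (poly S') \<subseteq> O'" by (rule full(1))
  show "\<And>\<Phi> x. x \<in> Hom (poly S') \<Phi> \<Longrightarrow> M \<Phi> x" by (rule full(2))
qed

lemma leg_functor: "is_functor (poly (S n)) (poly S') (leg n)"
  by (rule sketch_mor_functor[OF seq_colimit_leg[OF co]])

lemma seq_colimit_ob:
  assumes "R \<in> Ob (poly S')"
  shows "\<exists>n. \<exists>R0\<in>Ob (poly (S n)). R = fob (leg n) R0"
proof -
  let ?O = "\<Union>n. fob (leg n) ` Ob (poly (S n))"
  have "?O \<subseteq> Ob (poly S')" using functor_ob[OF leg_functor] by auto
  then have "Ob (poly S') \<subseteq> ?O"
    by (rule seq_colimit_generated_aux[where M = "\<lambda>_ _. True"]) (auto simp: op_closed_def lands_def)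
  then show ?thesis using assms by blast
qed

lemma seq_colimit_generated:
  assumes M: "op_closed (poly S') M"
    and "\<And>n \<Phi> x. x \<in> Hom (poly (S n)) \<Phi> \<Longrightarrow> M (smap (fob (leg n)) \<Phi>) (fmor (leg n) \<Phi> x)"
    and "x \<in> Hom (poly S') \<Phi>"
  shows "M \<Phi> x"
  by (rule seq_colimit_generated_aux(2)[OF subset_refl M _ assms(3)])
    (use assms(2) functor_ob[OF leg_functor] in \<open>auto simp: lands_def\<close>)

lemma seq_colimit_pext:
  assumes "c \<in> cones D" "L \<in> pext S' c"
  shows "\<exists>n. \<exists>L0\<in>pext (S n) c. L = fcomp (cone D c) (leg n) L0"
proof -
  interpret s: subsketch D S' "Ob (poly S')" "\<lambda>_ _. True" "\<lambda>c L. \<exists>n. \<exists>L0\<in>pext (S n) c. L = fcomp (cone D c) (leg n) L0"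
    by (rule subsketch_all[OF seq_colimit_sketch[OF co]])
  show ?thesis
    by (rule s.seq_colimit_sub(3)[OF co lnl_lnl_ops[OF sketch_lnl[OF S]] _ _ assms])
      (auto simp: lands_def functor_ob[OF leg_functor])
qed

end

primrec obit :: "(nat \<Rightarrow> ('o, 'm, 'o, 'm) fctr) \<Rightarrow> nat \<Rightarrow> nat \<Rightarrow> 'o \<Rightarrow> 'o" where
  "obit inc n 0 R = R"
| "obit inc n (Suc k) R = fob (inc (n + k)) (obit inc n k R)"

lemma obit_shift: "obit inc (Suc n) k (fob (inc n) R) = obit inc n (Suc k) R"
  by (induction k) auto

text \<open>The predicate \<open>p\<close> says that an object and \<open>x\<close> have a common
  image at some later stage. It is compatible with the transition maps, so it descends to the
  colimit; if the legs identify \<open>x\<close> and \<open>y\<close>, these already agree after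
  finitely many transition maps, which are injective.\<close>

lemma seq_colimit_inj:
  fixes S :: "nat \<Rightarrow> ('o::infinite, 'm, 'd, 'e, 'c, 'r, 'p) sketch"
  assumes co: "is_seq_colimit D S inc S' leg" and S: "\<And>n. is_sketch D (S n)"
    and inc: "\<And>n. carries (poly (S n)) (poly (S (Suc n))) (inc n)"
    and inj: "\<And>n. inj_on (fob (inc n)) (Ob (poly (S n)))"
  shows "inj_on (fob (leg n)) (Ob (poly (S n)))"
proof (rule inj_onI)
  fix x y assume x: "x \<in> Ob (poly (S n))" and y: "y \<in> Ob (poly (S n))" and eq: "fob (leg n) x = fob (leg n) y"
  define p where "p m z \<longleftrightarrow> (\<exists>i j. m + j = n + i \<and> obit inc m j z = obit inc n i x)" for m z
  have "p (Suc m) (fob (inc m) z) \<longleftrightarrow> p m z" for m z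
  proof
    assume "p (Suc m) (fob (inc m) z)"
    then obtain i j where "Suc m + j = n + i" "obit inc (Suc m) j (fob (inc m) z) = obit inc n i x"
      unfolding p_def by blast
    then show "p m z" unfolding p_def obit_shift by (intro exI[of _ i] exI[of _ "Suc j"]) simp
  next
    assume "p m z"
    then obtain i j where ij: "m + j = n + i" "obit inc m j z = obit inc n i x"
      unfolding p_def by blast
    then have "obit inc (Suc m) j (fob (inc m) z) = obit inc n (Suc i) x"
      unfolding obit_shift by simp
    then show "p (Suc m) (fob (inc m) z)"
      unfolding p_def using ij by (intro exI[of _ "Suc i"] exI[of _ j]) simp
  qed
  then obtain Q where Q: "\<And>m z. z \<in> Ob (poly (S m)) \<Longrightarrow> Q (fob (leg m) z) \<longleftrightarrow> p m z"
    using seq_colimit_pred[OF co S inc, of p] by blast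
  have "p n x" unfolding p_def by blast
  then have "p n y" using Q[OF x] Q[OF y] eq by simp
  then obtain i where i: "obit inc n i y = obit inc n i x" unfolding p_def by auto
  have ob: "obit inc n i z \<in> Ob (poly (S (n + i)))" if "z \<in> Ob (poly (S n))" for z i
  proof (induction i)
    case (Suc i)
    then show ?case using carries_ob[OF inc[of "n + i"]] by (simp only: obit.simps add_Suc_right)
  qed (use that in simp)
  from i show "x = y"
  proof (induction i)
    case (Suc i)
    have "obit inc n i y = obit inc n i x"
      by (rule inj_onD[OF inj[of "n + i"] _ ob[OF y, of i] ob[OF x, of i]]) (use Suc.prems in \<open>simp only: obit.simps\<close>)
    then show ?case by (rule Suc.IH)
  qed simp
qed

lemma seq_colimit_shift:
  assumes "is_seq_colimit D S inc S' leg" "R \<in> Ob (poly (S n))"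
  shows "fob (leg (Suc n)) (fob (inc n) R) = fob (leg n) R"
proof -
  have "fob (fcomp (poly (S n)) (leg (Suc n)) (inc n)) R = fob (leg n) R"
    using seq_colimit_comm[OF assms(1)] by simp
  then show ?thesis using assms(2) by (simp add: fcomp_simps)
qed

lemma seq_colimit_shift_mor:
  assumes "is_seq_colimit D S inc S' leg" "x \<in> Hom (poly (S n)) \<Phi>"
  shows "fmor (leg (Suc n)) (smap (fob (inc n)) \<Phi>) (fmor (inc n) \<Phi> x) = fmor (leg n) \<Phi> x"
proof -
  have "fmor (fcomp (poly (S n)) (leg (Suc n)) (inc n)) \<Phi> x = fmor (leg n) \<Phi> x"
    using seq_colimit_comm[OF assms(1)] by simp
  then show ?thesis using assms(2) by (simp add: fcomp_simps)
qed

end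

section \<open>The cone with an isomorphic vertex\<close>

lemma iso_cone_simps [simp]:
  "Ob (iso_cone C K) = insert None (Some ` Ob C)" "cl (iso_cone C K) = cl C \<circ> collapse K"
  "Hom (iso_cone C K) \<Phi> = (if fst ` set \<Phi> \<subseteq> insert None (Some ` Ob C) then Hom C (smap (collapse K) \<Phi>) else {})"
  "act (iso_cone C K) \<Phi> = act C (smap (collapse K) \<Phi>)" "idn (iso_cone C K) R = idn C (collapse K R)"
  "cmp (iso_cone C K) \<Phi> L \<Psi> = cmp C (smap (collapse K) \<Phi>) (map_prod (collapse K) id L) (smap (collapse K) \<Psi>)"
  by (simp_all add: iso_cone_def Let_def)

text \<open>After collapsing \<open>None\<close> to the vertex, every hom-set and operation is one
  of \<open>C\<close>; closure is therefore inherited.\<close>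

lemma iso_cone_ops:
  assumes C: "lnl C" and K: "fst K \<in> Ob C"
  shows "lnl_ops (iso_cone C K)"
proof -
  let ?q = "collapse K"
  have q: "?q R \<in> Ob C" if "R \<in> insert None (Some ` Ob C)" for R
    using that K by (auto simp: collapse_def)
  have ad: "admissible (cl C \<circ> ?q) \<Phi> = admissible (cl C) (smap ?q \<Phi>)" for \<Phi>
    by (rule admissible_smap[symmetric]) simp
  have st: "structural (cl C \<circ> ?q) \<Phi> \<sigma> = structural (cl C) (smap ?q \<Phi>) \<sigma>" for \<Phi> \<sigma>
    by (rule structural_smap[symmetric]) simp
  show ?thesis
    unfolding lnl_ops_def
  proof (intro conjI allI ballI op_closedI)
    show "valid (iso_cone C K) \<Phi>" if "x \<in> Hom (iso_cone C K) \<Phi>" for \<Phi> x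
      using that lnl_valid[OF C, of x "smap ?q \<Phi>"] by (simp add: valid_def ad split: if_splits)
    show "idn (iso_cone C K) R \<in> Hom (iso_cone C K) [(R, Neg), (R, Pos)]" if "R \<in> Ob (iso_cone C K)" for R
      using that lnl_idn[OF C q[of R]] by simp
    show "act (iso_cone C K) \<Phi> \<sigma> x \<in> Hom (iso_cone C K) \<Phi>"
      if "x \<in> Hom (iso_cone C K) (pull \<Phi> \<sigma>)" "valid (iso_cone C K) \<Phi>" "structural (cl (iso_cone C K)) \<Phi> \<sigma>" for \<Phi> \<sigma> x
    proof -
      have "?q ` fst ` set \<Phi> \<subseteq> Ob C" using that(2) q by (auto simp: valid_def)
      then have "valid C (smap ?q \<Phi>)" using that(2) by (simp add: valid_def ad fst_set_smap)
      then show ?thesis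
        using that lnl_act[OF C, of x "smap ?q \<Phi>" \<sigma>] pull_smap_structural[of "cl (iso_cone C K)" \<Phi> \<sigma> ?q]
        by (auto simp: valid_def st split: if_splits)
    qed
    show "cmp (iso_cone C K) \<Phi> L \<Psi> g f \<in> Hom (iso_cone C K) (\<Phi> @ \<Psi>)"
      if "f \<in> Hom (iso_cone C K) (\<Phi> @ [L])" "g \<in> Hom (iso_cone C K) (dual L # \<Psi>)" for \<Phi> L \<Psi> f g
      using that lnl_cmp[OF C, of f "smap ?q \<Phi>" "map_prod ?q id L" g "smap ?q \<Psi>"]
      by (auto simp: dual_map_prod split: if_splits)
  qed
qed

lemma section_carries:
  assumes C: "lnl C" and K: "fst K \<in> Ob C" and L: "L \<in> {section1 C, section2 C K}"
  shows "carries C (iso_cone C K) L"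
proof -
  have ob: "fob L R \<in> insert None (Some ` Ob C)" "collapse K (fob L R) = R" if "R \<in> Ob C" for R
    using L that by (auto simp: section1_def section2_def mk_fctr_simps collapse_def split: if_splits)
  have mor: "fmor L \<Phi> x = x" if "x \<in> Hom C \<Phi>" for \<Phi> x
    using L that by (auto simp: section1_def section2_def mk_fctr_simps)
  show ?thesis
    unfolding carries_def
  proof (intro conjI ballI allI)
    fix \<Phi> x assume x: "x \<in> Hom C \<Phi>"
    note v = lnl_valid[OF C x]
    have "smap (collapse K) (smap (fob L) \<Phi>) = \<Phi>"
      unfolding smap_smap by (rule smap_idI) (use ob v in \<open>auto simp: valid_def\<close>)
    moreover have "fob L ` fst ` set \<Phi> \<subseteq> insert None (Some ` Ob C)"
      by (intro image_subsetI ob(1)) (use v in \<open>auto simp: valid_def\<close>)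
    ultimately show "fmor L \<Phi> x \<in> Hom (iso_cone C K) (smap (fob L) \<Phi>)"
      using x mor[OF x] by (simp add: fst_set_smap)
  qed (use ob in auto)
qed

section \<open>The stages of the construction\<close>

locale free_tower = subterminal_doctrine D
  for D :: "('d, 'e, 'c, 'r, 'p) doctrine" +
  fixes S :: "('o::infinite, 'm) lnl" and \<pi> :: "('o, 'm, 'd, 'e) fctr"
    and X :: "('o, 'm, 'd, 'e, 'c, 'r, 'p) tower"
    and ord :: "'c \<Rightarrow> 'r list" and prj :: "'c \<Rightarrow> ('r signed list \<times> 'p) list"
  assumes S: "lnl S" and \<pi>: "is_functor S (base D) \<pi>"
    and fc: "free_construction D (plain_sketch S \<pi>) X"
    and ord: "c \<in> cones D \<Longrightarrow> distinct (ord c) \<and> set (ord c) = Ob (cone_reduct D c)"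
    and prj: "c \<in> cones D \<Longrightarrow> projection_basis (cone D c) (vtx D c) (prj c)"
begin

lemma stg1_0: "stg1 X 0 = plain_sketch S \<pi>"
  and po1: "is_pushout D (cells1 D X n)
            (\<lambda>(c, u). reduct_sketch D c) (\<lambda>(c, u). cone_sketch D c)
            (\<lambda>(c, u). fincl (cone_reduct D c)) (\<lambda>(c, u). u)
            (stg1 X n) (stg1 X (Suc n)) (inc1 X n) (att1 X n)"
  and co1: "is_seq_colimit D (stg1 X) (inc1 X) (lim1 X) (leg1 X)"
  and stg2_0: "stg2 X 0 = lim1 X"
  and po2: "is_pushout D (cells2 D (stg2 X k))
            (\<lambda>(c, \<psi>, E, Y, u). exp_sketch D c \<psi> E Y) (\<lambda>(c, \<psi>, E, Y, u). exp_sketch D c \<psi> E {0})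
            (\<lambda>(c, \<psi>, E, Y, u). merge_chi (cone D c) (vtx D c) \<psi> Y) (\<lambda>(c, \<psi>, E, Y, u). u)
            (stg2 X k) (stg2 X (Suc k)) (inc2 X k) (att2 X k)"
  and co2: "is_seq_colimit D (stg2 X) (inc2 X) (lim2 X) (leg2 X)"
  and po3: "is_pushout D (cells3 D (lim2 X))
            (\<lambda>(c, u). iso_sketch' D c) (\<lambda>(c, u). iso_sketch D c)
            (\<lambda>(c, u). fincl (iso_cone (cone D c) (vtx D c))) (\<lambda>(c, u). u)
            (lim2 X) (fin X) (inc3 X) (att3 X)"
  using fc unfolding free_construction_def by blast+

abbreviation "S1 n \<equiv> poly (stg1 X n)"
abbreviation "T1 \<equiv> poly (lim1 X)"
abbreviation "S2 k \<equiv> poly (stg2 X k)"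
abbreviation "T2 \<equiv> poly (lim2 X)"
abbreviation "Z \<equiv> poly (fin X)"

lemma sk1: "is_sketch D (stg1 X n)"
proof (cases n)
  case 0
  then show ?thesis using S \<pi> unfolding 0 stg1_0 by (simp add: is_sketch_def plain_sketch_def)
next
  case (Suc m) then show ?thesis using pushout_sketch[OF po1] by simp
qed

lemma sk_lim1: "is_sketch D (lim1 X)"
  by (rule seq_colimit_sketch[OF co1])

lemma sk2: "is_sketch D (stg2 X k)"
proof (cases k)
  case 0 then show ?thesis using sk_lim1 stg2_0 by simp
next
  case (Suc m) then show ?thesis using pushout_sketch[OF po2] by simp
qed

lemma sk_lim2: "is_sketch D (lim2 X)"
  by (rule seq_colimit_sketch[OF co2])

lemma sk_fin: "is_sketch D (fin X)"
  by (rule pushout_sketch[OF po3])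

lemma vtx_Ob: "c \<in> cones D \<Longrightarrow> fst (vtx D c) \<in> Ob (cone D c)"
  using D by (simp add: lnl_doctrine_def abstract_cone_def)

lemma cone_basis: "c \<in> cones D \<Longrightarrow> cone_basis (cone D c) (vtx D c) (prj c)"
  by (simp add: cone_basis_def cone_lnl prj)

lemma inc1: "is_functor (S1 n) (S1 (Suc n)) (inc1 X n)"
  by (rule sketch_mor_functor[OF pushout_inc[OF po1]])

lemma leg1: "is_functor (S1 n) T1 (leg1 X n)"
  by (rule sketch_mor_functor[OF seq_colimit_leg[OF co1]])

lemma cells1D:
  assumes "(c, u) \<in> cells1 D X n"
  shows "c \<in> cones D" "is_functor (cone_reduct D c) (S1 n) u"
    "is_functor (cone D c) (S1 (Suc n)) (att1 X n (c, u))"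
proof -
  show "c \<in> cones D" "is_functor (cone_reduct D c) (S1 n) u"
    using assms sketch_mor_functor by (fastforce simp: cells1_def reduct_sketch_def plain_sketch_def)+
  show "is_functor (cone D c) (S1 (Suc n)) (att1 X n (c, u))"
    using sketch_mor_functor[OF pushout_att[OF po1 assms]] by (simp add: cone_sketch_def)
qed

lemma att1_reduct:
  assumes "(c, u) \<in> cells1 D X n" "r \<in> Ob (cone_reduct D c)"
  shows "fob (att1 X n (c, u)) r = fob (inc1 X n) (fob u r)"
proof -
  have "fcomp (cone_reduct D c) (att1 X n (c, u)) (fincl (cone_reduct D c)) = fcomp (cone_reduct D c) (inc1 X n) u"
    using pushout_comm[OF po1 assms(1)] by (simp add: reduct_sketch_def plain_sketch_def)
  then have "fob (fcomp (cone_reduct D c) (att1 X n (c, u)) (fincl (cone_reduct D c))) r = fob (fcomp (cone_reduct D c) (inc1 X n) u) r"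
    by simp
  then show ?thesis using assms(2) by (simp add: fcomp_simps fincl_simps)
qed

lemma cells1_B:
  assumes "i \<in> cells1 D X n"
  shows "lnl_ops (poly ((\<lambda>(c, u). cone_sketch D c) i))"
    "c \<in> cones D \<Longrightarrow> L \<in> pext ((\<lambda>(c, u). cone_sketch D c) i) c \<Longrightarrow>
       carries (cone D c) (poly ((\<lambda>(c, u). cone_sketch D c) i)) L"
proof -
  obtain c' u where i: "i = (c', u)" "c' \<in> cones D" using assms cells1D by (cases i) auto
  show "lnl_ops (poly ((\<lambda>(c, u). cone_sketch D c) i))" using cone_ops[OF i(2)] by (simp add: i cone_sketch_def)
  show "carries (cone D c) (poly ((\<lambda>(c, u). cone_sketch D c) i)) L"
    if "c \<in> cones D" "L \<in> pext ((\<lambda>(c, u). cone_sketch D c) i) c"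
    using that functor_carries[OF functor_fincl_self[OF cone_lnl[OF i(2)]]]
    by (auto simp: i cone_sketch_def split: if_splits)
qed

text \<open>\<open>pushout_pred\<close> for the first phase: the pieces need to agree only on the
  objects of the reducts, so the values at the new vertices can be chosen freely.\<close>

lemma pred1:
  assumes "\<And>c u r. (c, u) \<in> cells1 D X n \<Longrightarrow> r \<in> Ob (cone_reduct D c) \<Longrightarrow> pB (c, u) r \<longleftrightarrow> pS (fob u r)"
  shows "\<exists>Q. (\<forall>R\<in>Ob (S1 n). Q (fob (inc1 X n) R) \<longleftrightarrow> pS R) \<and>
    (\<forall>(c, u)\<in>cells1 D X n. \<forall>r\<in>Ob (cone D c). Q (fob (att1 X n (c, u)) r) \<longleftrightarrow> pB (c, u) r)"
proof -
  have "\<exists>Q. (\<forall>R\<in>Ob (S1 n). Q (fob (inc1 X n) R) \<longleftrightarrow> pS R) \<and>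
      (\<forall>i\<in>cells1 D X n. \<forall>r\<in>Ob (poly ((\<lambda>(c, u). cone_sketch D c) i)). Q (fob (att1 X n i) r) \<longleftrightarrow> pB i r)"
  proof (rule pushout_pred[OF po1 sk1 cells1_B])
    fix i assume "i \<in> cells1 D X n"
    then obtain c u where i: "i = (c, u)" "(c, u) \<in> cells1 D X n" by (cases i) auto
    show "carries (poly ((\<lambda>(c, u). reduct_sketch D c) i)) (poly ((\<lambda>(c, u). cone_sketch D c) i))
        ((\<lambda>(c, u). fincl (cone_reduct D c)) i)"
      using functor_carries[OF functor_fincl_reduct[OF cone_lnl[OF cells1D(1)[OF i(2)]]]] by (simp add: i reduct_sketch_def plain_sketch_def cone_sketch_def)
    show "carries (poly ((\<lambda>(c, u). reduct_sketch D c) i)) (S1 n) ((\<lambda>(c, u). u) i)"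
      using functor_carries[OF cells1D(2)[OF i(2)]] by (simp add: i reduct_sketch_def plain_sketch_def)
    show "pB i (fob ((\<lambda>(c, u). fincl (cone_reduct D c)) i) r) \<longleftrightarrow> pS (fob ((\<lambda>(c, u). u) i) r)"
      if "r \<in> Ob (poly ((\<lambda>(c, u). reduct_sketch D c) i))" for r
      using assms[OF i(2), of r] that by (simp add: i reduct_sketch_def plain_sketch_def fincl_simps)
  qed
  then obtain Q where Q: "\<forall>R\<in>Ob (S1 n). Q (fob (inc1 X n) R) \<longleftrightarrow> pS R"
    "\<forall>i\<in>cells1 D X n. \<forall>r\<in>Ob (poly ((\<lambda>(c, u). cone_sketch D c) i)). Q (fob (att1 X n i) r) \<longleftrightarrow> pB i r"
    by (elim exE conjE) (erule (1) that)
  have "\<forall>(c, u)\<in>cells1 D X n. \<forall>r\<in>Ob (cone D c). Q (fob (att1 X n (c, u)) r) \<longleftrightarrow> pB (c, u) r"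
  proof clarify
    fix c u r assume "(c, u) \<in> cells1 D X n" "r \<in> Ob (cone D c)"
    then show "Q (fob (att1 X n (c, u)) r) \<longleftrightarrow> pB (c, u) r"
      using Q(2)[rule_format, of "(c, u)" r] by (simp add: cone_sketch_def)
  qed
  with Q(1) show ?thesis by (intro exI[of _ Q] conjI)
qed

text \<open>The test predicate is equality with \<open>x\<close>, extended by falsity at all new
  vertices.\<close>

lemma inc1_inj: "inj_on (fob (inc1 X n)) (Ob (S1 n))"
proof (rule inj_onI)
  fix x y assume x: "x \<in> Ob (S1 n)" and y: "y \<in> Ob (S1 n)" and eq: "fob (inc1 X n) x = fob (inc1 X n) y"
  have "\<exists>Q. (\<forall>R\<in>Ob (S1 n). Q (fob (inc1 X n) R) \<longleftrightarrow> R = x) \<and>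
    (\<forall>(c, u)\<in>cells1 D X n. \<forall>r\<in>Ob (cone D c).
       Q (fob (att1 X n (c, u)) r) \<longleftrightarrow> (\<lambda>(c, u) r. r \<in> Ob (cone_reduct D c) \<and> fob u r = x) (c, u) r)"
    by (rule pred1[where pB = "\<lambda>(c, u) r. r \<in> Ob (cone_reduct D c) \<and> fob u r = x" and pS = "\<lambda>R. R = x"]) simp
  then obtain Q where Q: "\<forall>R\<in>Ob (S1 n). Q (fob (inc1 X n) R) \<longleftrightarrow> R = x"
    by (elim exE conjE) (erule that)
  have "Q (fob (inc1 X n) x)" using Q[THEN bspec, OF x] by (rule iffD2) (rule refl)
  then have "Q (fob (inc1 X n) y)" unfolding eq .
  with Q[THEN bspec, OF y] show "x = y" by (rule iffD1[THEN sym])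
qed

text \<open>The test predicate holds at the new vertices and at no old object; it is compatible
  because a reduct does not contain its vertex.\<close>

lemma att1_new:
  assumes "(c, u) \<in> cells1 D X n"
  shows "fob (att1 X n (c, u)) (fst (vtx D c)) \<notin> fob (inc1 X n) ` Ob (S1 n)"
proof -
  have "\<exists>Q. (\<forall>R\<in>Ob (S1 n). Q (fob (inc1 X n) R) \<longleftrightarrow> False) \<and>
    (\<forall>(c, u)\<in>cells1 D X n. \<forall>r\<in>Ob (cone D c). Q (fob (att1 X n (c, u)) r) \<longleftrightarrow> (\<lambda>(c, u) r. r = fst (vtx D c)) (c, u) r)"
    by (rule pred1[where pB = "\<lambda>(c, u) r. r = fst (vtx D c)" and pS = "\<lambda>_. False"]) simp
  then obtain Q where Q: "\<forall>R\<in>Ob (S1 n). Q (fob (inc1 X n) R) \<longleftrightarrow> False"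
    "\<forall>(c, u)\<in>cells1 D X n. \<forall>r\<in>Ob (cone D c). Q (fob (att1 X n (c, u)) r) \<longleftrightarrow> (\<lambda>(c, u) r. r = fst (vtx D c)) (c, u) r"
    by (elim exE conjE) (erule (1) that)
  have "Q (fob (att1 X n (c, u)) (fst (vtx D c)))"
    using Q(2)[rule_format, OF assms] vtx_Ob[OF cells1D(1)[OF assms]] by simp
  then show ?thesis using Q(1) by auto
qed

text \<open>The test predicate singles out the vertex attached by the cell
  \<open>(c, u)\<close>.\<close>

lemma att1_inj:
  assumes "(c, u) \<in> cells1 D X n" "(c', u') \<in> cells1 D X n"
    and "fob (att1 X n (c, u)) (fst (vtx D c)) = fob (att1 X n (c', u')) (fst (vtx D c'))"
  shows "c = c' \<and> u = u'"
proof -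
  have "\<exists>Q. (\<forall>R\<in>Ob (S1 n). Q (fob (inc1 X n) R) \<longleftrightarrow> False) \<and>
    (\<forall>(d, w)\<in>cells1 D X n. \<forall>r\<in>Ob (cone D d). Q (fob (att1 X n (d, w)) r) \<longleftrightarrow>
        (\<lambda>(d, w) r. (d, w) = (c, u) \<and> r = fst (vtx D d)) (d, w) r)"
    by (rule pred1[where pB = "\<lambda>(d, w) r. (d, w) = (c, u) \<and> r = fst (vtx D d)" and pS = "\<lambda>_. False"]) simp
  then obtain Q where Q: "\<forall>(d, w)\<in>cells1 D X n. \<forall>r\<in>Ob (cone D d). Q (fob (att1 X n (d, w)) r) \<longleftrightarrow>
        (\<lambda>(d, w) r. (d, w) = (c, u) \<and> r = fst (vtx D d)) (d, w) r"
    by (elim exE conjE) (erule that)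
  have "Q (fob (att1 X n (c, u)) (fst (vtx D c)))"
    using Q[THEN bspec, OF assms(1)] vtx_Ob[OF cells1D(1)[OF assms(1)]] by simp
  then have "Q (fob (att1 X n (c', u')) (fst (vtx D c')))" unfolding assms(3) .
  then show ?thesis
    using Q[THEN bspec, OF assms(2)] vtx_Ob[OF cells1D(1)[OF assms(2)]] by simp
qed

lemma S1_ob:
  assumes "R \<in> Ob (S1 (Suc n))"
  obtains (old) R0 where "R0 \<in> Ob (S1 n)" "R = fob (inc1 X n) R0"
  | (vtx) c u where "(c, u) \<in> cells1 D X n" "R = fob (att1 X n (c, u)) (fst (vtx D c))"
proof -
  consider (a) "\<exists>R0\<in>Ob (S1 n). R = fob (inc1 X n) R0"
    | (b) "\<exists>i\<in>cells1 D X n. \<exists>r\<in>Ob (poly ((\<lambda>(c, u). cone_sketch D c) i)). R = fob (att1 X n i) r"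
    by atomize_elim (rule pushout_ob[OF po1 sk1 cells1_B assms])
  then show thesis
  proof cases
    case b
    then obtain c u r where i: "(c, u) \<in> cells1 D X n" "r \<in> Ob (cone D c)" "R = fob (att1 X n (c, u)) r"
      by (auto simp: cone_sketch_def)
    show thesis
    proof (cases "r = fst (vtx D c)")
      case False
      then have "r \<in> Ob (cone_reduct D c)" using i(2) by simp
      then show ?thesis
        using old att1_reduct[OF i(1)] i(3) functor_ob[OF cells1D(2)[OF i(1)]] by metis
    qed (use vtx i in blast)
  qed (use old in blast)
qed

lemma S1_pext:
  assumes "c \<in> cones D" "L \<in> pext (stg1 X (Suc n)) c"
  obtains (old) L0 where "L0 \<in> pext (stg1 X n) c" "L = fcomp (cone D c) (inc1 X n) L0"
  | (vtx) u where "(c, u) \<in> cells1 D X n" "L = att1 X n (c, u)"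
proof -
  consider (a) "\<exists>L0\<in>pext (stg1 X n) c. L = fcomp (cone D c) (inc1 X n) L0"
    | (b) "\<exists>i\<in>cells1 D X n. \<exists>L0\<in>pext ((\<lambda>(c, u). cone_sketch D c) i) c. L = fcomp (cone D c) (att1 X n i) L0"
    by atomize_elim (rule pushout_pext[OF po1 sk1 cells1_B assms])
  then show thesis
  proof cases
    case b
    then obtain c' u L0 where i: "(c', u) \<in> cells1 D X n" "L0 \<in> pext (cone_sketch D c') c"
      "L = fcomp (cone D c) (att1 X n (c', u)) L0" by auto
    then have c: "c' = c" "L0 = fincl (cone D c)" by (auto simp: cone_sketch_def split: if_splits)
    have "L = att1 X n (c, u)"
      using fcomp_fincl[OF cells1D(3)[OF i(1)[unfolded c]] lnl_valid[OF cone_lnl[OF assms(1)]]] i(3) c by simp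
    then show ?thesis using vtx i(1) c by blast
  qed (use old in blast)
qed

lemma S1_generated:
  assumes M: "op_closed (S1 (Suc n)) M"
    and "\<And>\<Phi> x. x \<in> Hom (S1 n) \<Phi> \<Longrightarrow> M (smap (fob (inc1 X n)) \<Phi>) (fmor (inc1 X n) \<Phi> x)"
    and "\<And>c u \<Phi> x. (c, u) \<in> cells1 D X n \<Longrightarrow> x \<in> Hom (cone D c) \<Phi> \<Longrightarrow>
       M (smap (fob (att1 X n (c, u))) \<Phi>) (fmor (att1 X n (c, u)) \<Phi> x)"
    and "x \<in> Hom (S1 (Suc n)) \<Phi>"
  shows "M \<Phi> x"
proof (rule pushout_generated[OF po1 sk1 cells1_B M assms(2) _ assms(4)])
  fix i \<Phi> x assume "i \<in> cells1 D X n" "x \<in> Hom (poly ((\<lambda>(c, u). cone_sketch D c) i)) \<Phi>"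
  then show "M (smap (fob (att1 X n i)) \<Phi>) (fmor (att1 X n i) \<Phi> x)"
    using assms(3) by (cases i) (auto simp: cone_sketch_def)
qed

lemma leg1_inj: "inj_on (fob (leg1 X n)) (Ob (S1 n))"
  by (rule seq_colimit_inj[OF co1 sk1 functor_carries[OF inc1] inc1_inj])

section \<open>The second phase: adjoining universal morphisms\<close>

lemma cells2D:
  assumes "(c, \<psi>, E, Y, u) \<in> cells2 D (stg2 X k)"
  shows "c \<in> cones D" "expn (cone D c) (vtx D c) \<psi>" "Y = {} \<or> Y = {0, 1}"
    "is_functor (expansion (cone D c) (vtx D c) \<psi> Y) (S2 k) u"
    "fcomp (cone D c) u (exp_incl (cone D c) (vtx D c) \<psi> Y) \<in> pext (stg2 X k) c"
    "is_functor (expansion (cone D c) (vtx D c) \<psi> {0}) (S2 (Suc k)) (att2 X k (c, \<psi>, E, Y, u))"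
    "is_functor (expansion (cone D c) (vtx D c) \<psi> {0}) (base D) E"
proof -
  show c: "c \<in> cones D" and Y: "Y = {} \<or> Y = {0, 1}"
    and "is_functor (expansion (cone D c) (vtx D c) \<psi> {0}) (base D) E"
    using assms by (auto simp: cells2_def)
  show "expn (cone D c) (vtx D c) \<psi>"
    using assms cone_lnl[OF c] vtx_Ob[OF c] by (auto simp: cells2_def expn_def)
  have u: "sketch_mor D (exp_sketch D c \<psi> E Y) (stg2 X k) u" using assms by (auto simp: cells2_def)
  show "is_functor (expansion (cone D c) (vtx D c) \<psi> Y) (S2 k) u"
    using sketch_mor_functor[OF u] by (simp add: exp_sketch_def Let_def)
  show "fcomp (cone D c) u (exp_incl (cone D c) (vtx D c) \<psi> Y) \<in> pext (stg2 X k) c"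
    using sketch_mor_pext[OF u c, of "exp_incl (cone D c) (vtx D c) \<psi> Y"] by (simp add: exp_sketch_def Let_def)
  show "is_functor (expansion (cone D c) (vtx D c) \<psi> {0}) (S2 (Suc k)) (att2 X k (c, \<psi>, E, Y, u))"
    using sketch_mor_functor[OF pushout_att[OF po2 assms]] by (simp add: exp_sketch_def Let_def)
qed

lemma inc2: "is_functor (S2 k) (S2 (Suc k)) (inc2 X k)"
  by (rule sketch_mor_functor[OF pushout_inc[OF po2]])

lemma leg2: "is_functor (S2 k) T2 (leg2 X k)"
  by (rule sketch_mor_functor[OF seq_colimit_leg[OF co2]])

lemma inc3: "is_functor T2 Z (inc3 X)"
  by (rule sketch_mor_functor[OF pushout_inc[OF po3]])

abbreviation (input) "B2 \<equiv> \<lambda>(c, \<psi>, E, Y, u). exp_sketch D c \<psi> E {0}"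

lemma cells2_B:
  assumes "i \<in> cells2 D (stg2 X k)"
  shows "lnl_ops (poly (B2 i))" "c \<in> cones D \<Longrightarrow> L \<in> pext (B2 i) c \<Longrightarrow> carries (cone D c) (poly (B2 i)) L"
proof -
  obtain c' \<psi> E Y u where i: "i = (c', \<psi>, E, Y, u)" by (cases i) auto
  note i' = cells2D(1,2)[OF assms[unfolded i]]
  show "lnl_ops (poly (B2 i))" using expn.exp_simps(4)[OF i'(2)] by (simp add: i exp_sketch_def Let_def)
  show "carries (cone D c) (poly (B2 i)) L" if "c \<in> cones D" "L \<in> pext (B2 i) c"
    using that expn.exp_incl_carries[OF i'(2)] by (auto simp: i exp_sketch_def Let_def split: if_splits)
qed

text \<open>The pushout square read on objects and on representing terms. \<open>merge_chi\<close>
  fixes objects and renames the copies of chi, so the attached expansion extends \<open>u\<close> on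
  everything that comes from the domain of the cell.\<close>

lemma att2_comm:
  assumes i: "(c, \<psi>, E, Y, u) \<in> cells2 D (stg2 X k)" (is "?i \<in> _")
  shows "R \<in> exp_Ob (cone D c) \<psi> \<Longrightarrow> fob (att2 X k ?i) R = fob (inc2 X k) (fob u R)"
    "wt (exp_Ob (cone D c) \<psi>) (exp_cl (cone D c) \<psi>) (exp_gen (cone D c) (vtx D c) \<psi> Y) \<Xi> t \<Longrightarrow>
     fmor (att2 X k ?i) \<Xi> (exp_class (cone D c) (vtx D c) \<psi> {0} \<Xi> (map_tm id merge_gen t)) =
     fmor (inc2 X k) (smap (fob u) \<Xi>) (fmor u \<Xi> (exp_class (cone D c) (vtx D c) \<psi> Y \<Xi> t))"
proof -
  interpret expn "cone D c" "vtx D c" \<psi> by (rule cells2D(2)[OF i])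
  have eq: "fcomp (EC Y) (att2 X k ?i) (merge_chi (cone D c) (vtx D c) \<psi> Y) = fcomp (EC Y) (inc2 X k) u"
    using pushout_comm[OF po2 i] by (simp add: exp_sketch_def Let_def)
  have "fob (fcomp (EC Y) (att2 X k ?i) (merge_chi (cone D c) (vtx D c) \<psi> Y)) R = fob (fcomp (EC Y) (inc2 X k) u) R"
    using eq by simp
  then show "fob (att2 X k ?i) R = fob (inc2 X k) (fob u R)" if "R \<in> exp_Ob (cone D c) \<psi>"
    using that by (simp add: fcomp_simps exp_simps merge_ob)
  show "fmor (att2 X k ?i) \<Xi> (ecls {0} \<Xi> (map_tm id merge_gen t)) =
     fmor (inc2 X k) (smap (fob u) \<Xi>) (fmor u \<Xi> (ecls Y \<Xi> t))" if t: "ewt Y \<Xi> t"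
  proof -
    have x: "ecls Y \<Xi> t \<in> Hom (EC Y) \<Xi>" using t by (auto simp: exp_simps)
    have "fmor (fcomp (EC Y) (att2 X k ?i) (merge_chi (cone D c) (vtx D c) \<psi> Y)) \<Xi> (ecls Y \<Xi> t) =
        fmor (fcomp (EC Y) (inc2 X k) u) \<Xi> (ecls Y \<Xi> t)"
      using eq by simp
    then show ?thesis
      by (simp add: fcomp_simps(2)[OF x] merge_cls[OF t] merge_smap[OF lnl_ops_valid[OF exp_simps(4) x]])
  qed
qed

text \<open>An attached expansion has the same objects as the domain of its attaching map, for both
  kinds of cells. Hence equality with \<open>x\<close> extends to a test predicate through
  \<open>u\<close>, and no object is new.\<close>

lemma inc2_bij: "bij_betw (fob (inc2 X k)) (Ob (S2 k)) (Ob (S2 (Suc k)))"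
  unfolding bij_betw_def
proof
  show "inj_on (fob (inc2 X k)) (Ob (S2 k))"
  proof (rule inj_onI)
    fix x y assume x: "x \<in> Ob (S2 k)" and y: "y \<in> Ob (S2 k)" and eq: "fob (inc2 X k) x = fob (inc2 X k) y"
    have "\<exists>Q. (\<forall>R\<in>Ob (S2 k). Q (fob (inc2 X k) R) \<longleftrightarrow> R = x) \<and>
      (\<forall>i\<in>cells2 D (stg2 X k). \<forall>r\<in>Ob (poly (B2 i)). Q (fob (att2 X k i) r) \<longleftrightarrow> (\<lambda>(c, \<psi>, E, Y, u) r. fob u r = x) i r)"
    proof (rule pushout_pred[OF po2 sk2 cells2_B, where pS = "\<lambda>R. R = x" and pB = "\<lambda>(c, \<psi>, E, Y, u) r. fob u r = x"])
      fix i assume i: "i \<in> cells2 D (stg2 X k)"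
      then obtain c \<psi> E Y u where i': "i = (c, \<psi>, E, Y, u)" by (cases i) auto
      note i2 = cells2D[OF i[unfolded i']]
      interpret expn "cone D c" "vtx D c" \<psi> by (rule i2(2))
      show "carries (poly ((\<lambda>(c, \<psi>, E, Y, u). exp_sketch D c \<psi> E Y) i)) (poly (B2 i))
          ((\<lambda>(c, \<psi>, E, Y, u). merge_chi (cone D c) (vtx D c) \<psi> Y) i)"
        using merge_carries by (simp add: i' exp_sketch_def Let_def)
      show "carries (poly ((\<lambda>(c, \<psi>, E, Y, u). exp_sketch D c \<psi> E Y) i)) (S2 k) ((\<lambda>(c, \<psi>, E, Y, u). u) i)"
        using functor_carries[OF i2(4)] by (simp add: i' exp_sketch_def Let_def)
      show "(\<lambda>(c, \<psi>, E, Y, u) r. fob u r = x) i (fob ((\<lambda>(c, \<psi>, E, Y, u). merge_chi (cone D c) (vtx D c) \<psi> Y) i) r) \<longleftrightarrow>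
          fob ((\<lambda>(c, \<psi>, E, Y, u). u) i) r = x"
        if "r \<in> Ob (poly ((\<lambda>(c, \<psi>, E, Y, u). exp_sketch D c \<psi> E Y) i))" for r
        using that by (simp add: i' exp_sketch_def Let_def exp_simps merge_ob)
    qed
    then obtain Q where Q: "\<forall>R\<in>Ob (S2 k). Q (fob (inc2 X k) R) \<longleftrightarrow> R = x"
      by (elim exE conjE) (erule that)
    have "Q (fob (inc2 X k) x)" using Q[THEN bspec, OF x] by (rule iffD2) (rule refl)
  then have "Q (fob (inc2 X k) y)" unfolding eq .
  with Q[THEN bspec, OF y] show "x = y" by (rule iffD1[THEN sym])
  qed
  have "R \<in> fob (inc2 X k) ` Ob (S2 k)" if R: "R \<in> Ob (S2 (Suc k))" for R
  proof -
    consider "\<exists>R0\<in>Ob (S2 k). R = fob (inc2 X k) R0" | "\<exists>i\<in>cells2 D (stg2 X k). \<exists>r\<in>Ob (poly (B2 i)). R = fob (att2 X k i) r"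
      by atomize_elim (rule pushout_ob[OF po2 sk2 cells2_B R])
    then show ?thesis
    proof cases
      case 2
      then obtain c \<psi> E Y u r where i: "(c, \<psi>, E, Y, u) \<in> cells2 D (stg2 X k)" and
        r: "r \<in> Ob (expansion (cone D c) (vtx D c) \<psi> {0})" "R = fob (att2 X k (c, \<psi>, E, Y, u)) r"
        by (auto simp: exp_sketch_def Let_def)
      interpret expn "cone D c" "vtx D c" \<psi> by (rule cells2D(2)[OF i])
      show ?thesis using att2_comm(1)[OF i] r functor_ob[OF cells2D(4)[OF i]] by (auto simp: exp_simps)
    qed blast
  qed
  then show "fob (inc2 X k) ` Ob (S2 k) = Ob (S2 (Suc k))" using functor_ob[OF inc2] by blast
qed

text \<open>The only proto-extremal lift of an attached expansion is the inclusion of its cone,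
  which is already present in the domain of the attaching map.\<close>

lemma S2_pext:
  assumes c: "c \<in> cones D" "L \<in> pext (stg2 X (Suc k)) c"
  shows "\<exists>L0\<in>pext (stg2 X k) c. L = fcomp (cone D c) (inc2 X k) L0"
proof -
  consider "\<exists>L0\<in>pext (stg2 X k) c. L = fcomp (cone D c) (inc2 X k) L0"
    | "\<exists>i\<in>cells2 D (stg2 X k). \<exists>L0\<in>pext (B2 i) c. L = fcomp (cone D c) (att2 X k i) L0"
    by atomize_elim (rule pushout_pext[OF po2 sk2 cells2_B c])
  then show ?thesis
  proof cases
    case 2
    then obtain c' \<psi> E Y u L0 where i: "(c', \<psi>, E, Y, u) \<in> cells2 D (stg2 X k)"
      and L: "L0 \<in> pext (exp_sketch D c' \<psi> E {0}) c" "L = fcomp (cone D c) (att2 X k (c', \<psi>, E, Y, u)) L0"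
      by auto
    then have c': "c' = c" and L0: "L0 = exp_incl (cone D c) (vtx D c) \<psi> {0}"
      by (auto simp: exp_sketch_def Let_def split: if_splits)
    note i = i[unfolded c']
    interpret expn "cone D c" "vtx D c" \<psi> by (rule cells2D(2)[OF i])
    let ?C = "cone D c" and ?a = "att2 X k (c, \<psi>, E, Y, u)"
    have "L = fcomp ?C (inc2 X k) (fcomp ?C u (exp_incl ?C (vtx D c) \<psi> Y))"
      unfolding L(2) L0 c'
    proof (rule fcomp_eqI)
      show "fob ?a (fob (exp_incl ?C (vtx D c) \<psi> {0}) R) = fob (inc2 X k) (fob (fcomp ?C u (exp_incl ?C (vtx D c) \<psi> Y)) R)"
        if "R \<in> Ob ?C" for R
        using that att2_comm(1)[OF i, of "Inl R"] by (simp add: exp_incl_simps fcomp_simps exp_Ob_def)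
      show "fmor ?a (smap (fob (exp_incl ?C (vtx D c) \<psi> {0})) \<Phi>) (fmor (exp_incl ?C (vtx D c) \<psi> {0}) \<Phi> x) =
        fmor (inc2 X k) (smap (fob (fcomp ?C u (exp_incl ?C (vtx D c) \<psi> Y))) \<Phi>)
          (fmor (fcomp ?C u (exp_incl ?C (vtx D c) \<psi> Y)) \<Phi> x)" if x: "x \<in> Hom ?C \<Phi>" for \<Phi> x
      proof -
        note v = lnl_valid[OF C x]
        have "smap (fob (fcomp ?C u (exp_incl ?C (vtx D c) \<psi> Y))) \<Phi> = smap (fob u) (old \<Phi>)"
          unfolding smap_smap by (rule smap_fctr_cong[OF v]) (simp add: fcomp_simps exp_incl_simps)
        then show ?thesis
          using att2_comm(2)[OF i wt_Mor[OF x]] x exp_incl_simps(3)[OF v]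
          by (simp add: exp_incl_simps(2) fcomp_simps map_tm_id)
      qed
    qed
    then show ?thesis using cells2D(5)[OF i] by blast
  qed
qed

text \<open>Among the generators of an attached expansion only the chi of a pre-expansion cell is
  new. In a codiagonal cell, chi is the image of a copy in the domain and so comes from the previous
  stage.\<close>

lemma S2_generated:
  assumes M: "op_closed (S2 (Suc k)) M"
    and inc: "\<And>\<Phi> x. x \<in> Hom (S2 k) \<Phi> \<Longrightarrow> M (smap (fob (inc2 X k)) \<Phi>) (fmor (inc2 X k) \<Phi> x)"
    and chi: "\<And>c \<psi> E u. (c, \<psi>, E, {}, u) \<in> cells2 D (stg2 X k) \<Longrightarrow>
       M (smap (fob (att2 X k (c, \<psi>, E, {}, u))) (old [dual (vtx D c)] @ new \<psi>))
         (fmor (att2 X k (c, \<psi>, E, {}, u)) (old [dual (vtx D c)] @ new \<psi>)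
           (exp_class (cone D c) (vtx D c) \<psi> {0} (old [dual (vtx D c)] @ new \<psi>) (TGen (Chi 0))))"
    and "x \<in> Hom (S2 (Suc k)) \<Phi>"
  shows "M \<Phi> x"
proof (rule pushout_generated[OF po2 sk2 cells2_B M inc _ assms(4)])
  fix i \<Xi> x assume i: "i \<in> cells2 D (stg2 X k)" and x: "x \<in> Hom (poly (B2 i)) \<Xi>"
  obtain c \<psi> E Y u where i': "i = (c, \<psi>, E, Y, u)" by (cases i) auto
  note i = i[unfolded i'] and i2 = cells2D[OF i[unfolded i']]
  let ?a = "att2 X k (c, \<psi>, E, Y, u)"
  interpret expn "cone D c" "vtx D c" \<psi> by (rule i2(2))
  have x': "x \<in> Hom (EC {0}) \<Xi>" using x by (simp add: i' exp_sketch_def Let_def)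
  have Mt: "M (smap (fob ?a) \<Xi>) (fmor ?a \<Xi> (ecls {0} \<Xi> (map_tm id merge_gen t)))" if t: "ewt Y \<Xi> t" for \<Xi> t
  proof -
    have H: "ecls Y \<Xi> t \<in> Hom (EC Y) \<Xi>" using t by (auto simp: exp_simps)
    have "smap (fob ?a) \<Xi> = smap (fob (inc2 X k)) (smap (fob u) \<Xi>)"
      unfolding smap_smap by (rule smap_fctr_cong[OF lnl_ops_valid[OF exp_simps(4) H]])
        (use att2_comm(1)[OF i] in \<open>simp add: exp_simps\<close>)
    then show ?thesis using inc[OF functor_hom[OF i2(4) H]] att2_comm(2)[OF i t] by simp
  qed
  have "M (smap (fob ?a) \<Xi>) (fmor ?a \<Xi> x)"
  proof (rule exp_generated[OF op_closed_preimage[OF i2(6) M] _ _ _ x'])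
    show "M (smap (fob ?a) (old \<Phi>)) (fmor ?a (old \<Phi>) (ecls {0} (old \<Phi>) (TGen (Mor \<Phi> f))))"
      if "f \<in> Hom (cone D c) \<Phi>" for \<Phi> f
      using Mt[OF wt_Mor[OF that]] by (simp add: map_tm_id)
    show "M (smap (fob ?a) (old \<Phi> @ new \<psi>)) (fmor ?a (old \<Phi> @ new \<psi>) (ecls {0} (old \<Phi> @ new \<psi>) (TGen (Til \<Phi> f))))"
      if "abstract_projection (cone D c) (vtx D c) \<Phi> f" for \<Phi> f
      using Mt[OF wt_Til[OF that]] by (simp add: map_tm_id)
    show "M (smap (fob ?a) (old [dual (vtx D c)] @ new \<psi>)) (fmor ?a (old [dual (vtx D c)] @ new \<psi>)
        (ecls {0} (old [dual (vtx D c)] @ new \<psi>) (TGen (Chi j))))" if j: "j \<in> {0}" for j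
    proof (cases "Y = {}")
      case True
      then show ?thesis using chi i j by simp
    next
      case False
      then have "0 \<in> Y" using i2(3) by auto
      then show ?thesis using Mt[OF wt_Chi[of 0 Y]] j by (simp add: map_tm_id)
    qed
  qed
  then show "M (smap (fob (att2 X k i)) \<Xi>) (fmor (att2 X k i) \<Xi> x)" by (simp add: i')
qed

lemma leg2_inj: "inj_on (fob (leg2 X k)) (Ob (S2 k))"
  using seq_colimit_inj[OF co2 sk2 functor_carries[OF inc2]] inc2_bij by (auto simp: bij_betw_def)

lemma leg2_shift: "R \<in> Ob (S2 k) \<Longrightarrow> fob (leg2 X (Suc k)) (fob (inc2 X k) R) = fob (leg2 X k) R"
  by (rule seq_colimit_shift[OF co2])

lemma leg2_image: "fob (leg2 X k) ` Ob (S2 k) = fob (leg2 X 0) ` Ob (S2 0)"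
proof (induction k)
  case (Suc k)
  have "fob (leg2 X (Suc k)) ` Ob (S2 (Suc k)) = fob (leg2 X (Suc k)) ` fob (inc2 X k) ` Ob (S2 k)"
    using inc2_bij[of k] by (simp add: bij_betw_def)
  also have "\<dots> = fob (leg2 X k) ` Ob (S2 k)" using leg2_shift by (auto simp: image_iff)
  finally show ?case using Suc by simp
qed simp

lemma leg2_bij: "bij_betw (fob (leg2 X k)) (Ob (S2 k)) (Ob T2)"
  unfolding bij_betw_def
proof
  have "R \<in> fob (leg2 X k) ` Ob (S2 k)" if R: "R \<in> Ob T2" for R
  proof -
    obtain n where "R \<in> fob (leg2 X n) ` Ob (S2 n)" using seq_colimit_ob[OF co2 sk2 R] by blast
    then show ?thesis using leg2_image[of n] leg2_image[of k] by simp
  qed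
  then show "fob (leg2 X k) ` Ob (S2 k) = Ob T2" using functor_ob[OF leg2] by blast
qed (rule leg2_inj)

end

section \<open>Morphisms of the colimit of the second phase and of the last stage\<close>

lemma smap_inj_on:
  assumes "inj_on h A" "fst ` set \<Phi> \<subseteq> A" "fst ` set \<Psi> \<subseteq> A" "smap h \<Phi> = smap h \<Psi>"
  shows "\<Phi> = \<Psi>"
proof -
  have "inj_on (map_prod h id) (A \<times> UNIV)" using assms(1) by (auto simp: inj_on_def)
  moreover have "set \<Phi> \<union> set \<Psi> \<subseteq> A \<times> UNIV" using assms(2,3) by force
  ultimately have "inj_on (map_prod h id) (set \<Phi> \<union> set \<Psi>)" by (rule inj_on_subset)
  from inj_on_map_eq_map[OF this] show ?thesis using assms(4) by (simp add: smap_def)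
qed

lemma smap_surj:
  assumes "fst ` set \<Phi> \<subseteq> h ` A"
  shows "\<exists>\<Phi>0. fst ` set \<Phi>0 \<subseteq> A \<and> smap h \<Phi>0 = \<Phi>"
  using assms
proof (induction \<Phi>)
  case (Cons K \<Phi>)
  then obtain \<Phi>0 R where "fst ` set \<Phi>0 \<subseteq> A" "smap h \<Phi>0 = \<Phi>" "R \<in> A" "fst K = h R" by auto
  then show ?case by (intro exI[of _ "(R, snd K) # \<Phi>0"]) (cases K, auto)
qed (auto intro: exI[of _ "[]"])

text \<open>The image of a functor need not be closed under composition, since composable images may
  lift to lists that do not match. Bijectivity on objects makes the lifts match.\<close>

lemma op_closed_image:
  assumes F: "is_functor P Q F" and bij: "bij_betw (fob F) (Ob P) (Ob Q)" and P: "lnl P" and Q: "lnl Q"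
  shows "op_closed Q (\<lambda>\<Phi> x. \<exists>\<Phi>0. \<exists>x0\<in>Hom P \<Phi>0. \<Phi> = smap (fob F) \<Phi>0 \<and> x = fmor F \<Phi>0 x0)"
proof -
  let ?h = "fob F"
  have inj: "inj_on ?h (Ob P)" and surj: "?h ` Ob P = Ob Q" using bij by (auto simp: bij_betw_def)
  have v: "valid P \<Phi>" if "valid Q (smap ?h \<Phi>)" "fst ` set \<Phi> \<subseteq> Ob P" for \<Phi>
  proof -
    have "admissible (cl Q) (smap ?h \<Phi>) = admissible (cl P) \<Phi>"
      by (rule admissible_smap) (use that(2) functor_cl[OF F] in blast)
    then show ?thesis using that by (simp add: valid_def)
  qed
  show ?thesis
  proof (rule op_closedI)
    fix R assume "R \<in> Ob Q"
    then obtain R0 where R0: "R0 \<in> Ob P" "R = ?h R0" using surj by blast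
    show "\<exists>\<Phi>0. \<exists>x0\<in>Hom P \<Phi>0. [(R, Neg), (R, Pos)] = smap ?h \<Phi>0 \<and> idn Q R = fmor F \<Phi>0 x0"
      using lnl_idn[OF P R0(1)] functor_idn[OF F R0(1)] R0(2)
      by (intro exI[of _ "[(R0, Neg), (R0, Pos)]"] bexI[of _ "idn P R0"]) simp_all
  next
    fix \<Phi> \<sigma> x assume a: "\<exists>\<Phi>0. \<exists>x0\<in>Hom P \<Phi>0. pull \<Phi> \<sigma> = smap ?h \<Phi>0 \<and> x = fmor F \<Phi>0 x0"
      "valid Q \<Phi>" "structural (cl Q) \<Phi> \<sigma>"
    then obtain \<Phi>0 x0 where x0: "x0 \<in> Hom P \<Phi>0" "pull \<Phi> \<sigma> = smap ?h \<Phi>0" "x = fmor F \<Phi>0 x0" by blast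
    have "fst ` set \<Phi> \<subseteq> ?h ` Ob P" using a(2) surj by (simp add: valid_def)
    then obtain \<Phi>1 where \<Phi>1: "fst ` set \<Phi>1 \<subseteq> Ob P" "smap ?h \<Phi>1 = \<Phi>" using smap_surj by blast
    have v1: "valid P \<Phi>1" using v a(2) \<Phi>1 by simp
    have s1: "structural (cl P) \<Phi>1 \<sigma>" using functor_structural[OF F v1] a(3) \<Phi>1(2) by simp
    have "smap ?h (pull \<Phi>1 \<sigma>) = smap ?h \<Phi>0"
      using pull_smap_structural[OF s1, of ?h] x0(2) \<Phi>1(2) by simp
    then have eq: "\<Phi>0 = pull \<Phi>1 \<sigma>"
      using smap_inj_on[OF inj, of "pull \<Phi>1 \<sigma>" \<Phi>0] set_pull[OF s1] \<Phi>1(1) lnl_valid[OF P x0(1)]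
      by (fastforce simp: valid_def)
    show "\<exists>\<Phi>0. \<exists>x0\<in>Hom P \<Phi>0. \<Phi> = smap ?h \<Phi>0 \<and> act Q \<Phi> \<sigma> x = fmor F \<Phi>0 x0"
      using lnl_act[OF P x0(1)[unfolded eq] v1 s1] functor_act[OF F x0(1)[unfolded eq] v1 s1] \<Phi>1(2) x0(3) eq
      by (intro exI[of _ \<Phi>1] bexI[of _ "act P \<Phi>1 \<sigma> x0"]) simp_all
  next
    fix \<Phi> K \<Psi> f g
    assume "\<exists>\<Phi>0. \<exists>x0\<in>Hom P \<Phi>0. \<Phi> @ [K] = smap ?h \<Phi>0 \<and> f = fmor F \<Phi>0 x0"
      "\<exists>\<Phi>0. \<exists>x0\<in>Hom P \<Phi>0. dual K # \<Psi> = smap ?h \<Phi>0 \<and> g = fmor F \<Phi>0 x0"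
    then obtain \<Phi>0 f0 \<Psi>0 g0 where f0: "f0 \<in> Hom P \<Phi>0" "\<Phi> @ [K] = smap ?h \<Phi>0" "f = fmor F \<Phi>0 f0"
      and g0: "g0 \<in> Hom P \<Psi>0" "dual K # \<Psi> = smap ?h \<Psi>0" "g = fmor F \<Psi>0 g0" by blast
    from f0(2) obtain \<Phi>1 K1 where 1: "\<Phi>0 = \<Phi>1 @ [K1]" "\<Phi> = smap ?h \<Phi>1" "K = map_prod ?h id K1"
      by (cases \<Phi>0 rule: rev_cases) auto
    from g0(2) obtain K2 \<Psi>1 where 2: "\<Psi>0 = K2 # \<Psi>1" "\<Psi> = smap ?h \<Psi>1" "dual K = map_prod ?h id K2"
      by (cases \<Psi>0) auto
    have "fst K1 \<in> Ob P" "fst K2 \<in> Ob P"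
      using lnl_valid[OF P f0(1)] lnl_valid[OF P g0(1)] 1 2 by (auto simp: valid_def)
    moreover have "smap ?h [K2] = smap ?h [dual K1]" using 1(3) 2(3) by (simp add: dual_map_prod)
    ultimately have K2: "K2 = dual K1" using smap_inj_on[OF inj, of "[K2]" "[dual K1]"] by simp
    show "\<exists>\<Phi>0. \<exists>x0\<in>Hom P \<Phi>0. \<Phi> @ \<Psi> = smap ?h \<Phi>0 \<and> cmp Q \<Phi> K \<Psi> g f = fmor F \<Phi>0 x0"
      using f0 g0 1 2 K2 lnl_cmp[OF P, of f0 \<Phi>1 K1 g0 \<Psi>1] functor_cmp[OF F, of f0 \<Phi>1 K1 g0 \<Psi>1]
      by (intro exI[of _ "\<Phi>1 @ \<Psi>1"] bexI[of _ "cmp P \<Phi>1 K1 \<Psi>1 g0 f0"]) simp_all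
  qed
qed

context free_tower
begin

lemma cells3D:
  assumes "(c, u) \<in> cells3 D (lim2 X)"
  shows "c \<in> cones D" "is_functor (iso_cone (cone D c) (vtx D c)) T2 u"
    "is_functor (iso_cone (cone D c) (vtx D c)) Z (att3 X (c, u))"
    "r \<in> Ob (iso_cone (cone D c) (vtx D c)) \<Longrightarrow> fob (att3 X (c, u)) r = fob (inc3 X) (fob u r)"
    "x \<in> Hom (iso_cone (cone D c) (vtx D c)) \<Phi> \<Longrightarrow>
       fmor (att3 X (c, u)) \<Phi> x = fmor (inc3 X) (smap (fob u) \<Phi>) (fmor u \<Phi> x)"
proof -
  let ?I = "iso_cone (cone D c) (vtx D c)"
  have p: "poly (iso_sketch' D c) = ?I" "poly (iso_sketch D c) = ?I"
    by (simp_all add: iso_sketch'_def iso_sketch_def Let_def)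
  show c: "c \<in> cones D" using assms by (simp add: cells3_def)
  show "is_functor ?I T2 u" using assms sketch_mor_functor p by (fastforce simp: cells3_def)
  show "is_functor ?I Z (att3 X (c, u))" using sketch_mor_functor[OF pushout_att[OF po3 assms]] p by simp
  have eq: "fcomp ?I (att3 X (c, u)) (fincl ?I) = fcomp ?I (inc3 X) u"
    using pushout_comm[OF po3 assms] p by simp
  have "fob (fcomp ?I (att3 X (c, u)) (fincl ?I)) r = fob (fcomp ?I (inc3 X) u) r" for r using eq by simp
  then show "fob (att3 X (c, u)) r = fob (inc3 X) (fob u r)" if "r \<in> Ob ?I"
    using that by (metis fcomp_simps(1) fincl_simps(1))
  have i: "smap (fob (fincl ?I)) \<Phi> = \<Phi>" if "x \<in> Hom ?I \<Phi>" for x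
    by (rule smap_idI) (use that in \<open>auto simp: fincl_simps subset_iff split: if_splits\<close>)
  have "fmor (fcomp ?I (att3 X (c, u)) (fincl ?I)) \<Phi> x = fmor (fcomp ?I (inc3 X) u) \<Phi> x" using eq by simp
  then show "fmor (att3 X (c, u)) \<Phi> x = fmor (inc3 X) (smap (fob u) \<Phi>) (fmor u \<Phi> x)" if "x \<in> Hom ?I \<Phi>"
    using that i[OF that] by (simp only: fcomp_simps(2)[OF that] fincl_simps(2)[OF that])
qed

abbreviation (input) "B3 \<equiv> \<lambda>(c, u). iso_sketch D c"

lemma cells3_B:
  assumes "i \<in> cells3 D (lim2 X)"
  shows "lnl_ops (poly (B3 i))" "c \<in> cones D \<Longrightarrow> L \<in> pext (B3 i) c \<Longrightarrow> carries (cone D c) (poly (B3 i)) L"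
proof -
  obtain c' u where i: "i = (c', u)" by (cases i) auto
  note c' = cells3D(1)[OF assms[unfolded i]]
  show "lnl_ops (poly (B3 i))" using iso_cone_ops[OF cone_lnl[OF c'] vtx_Ob[OF c']]
    by (simp add: i iso_sketch_def Let_def)
  show "carries (cone D c) (poly (B3 i)) L" if "c \<in> cones D" "L \<in> pext (B3 i) c"
    using that section_carries[OF cone_lnl[OF c'] vtx_Ob[OF c']]
    by (auto simp: i iso_sketch_def Let_def split: if_splits)
qed

text \<open>In the last phase the domain and the codomain of an attaching map share their
  polycategory and differ only in the proto-extremal lifts. So the pushout acquires no object, and
  by the next lemma no morphism, outside the image of \<open>inc3 X\<close>.\<close>

lemma inc3_bij: "bij_betw (fob (inc3 X)) (Ob T2) (Ob Z)"
  unfolding bij_betw_def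
proof
  show "inj_on (fob (inc3 X)) (Ob T2)"
  proof (rule inj_onI)
    fix x y assume x: "x \<in> Ob T2" and y: "y \<in> Ob T2" and eq: "fob (inc3 X) x = fob (inc3 X) y"
    have "\<exists>Q. (\<forall>R\<in>Ob T2. Q (fob (inc3 X) R) \<longleftrightarrow> R = x) \<and>
      (\<forall>i\<in>cells3 D (lim2 X). \<forall>r\<in>Ob (poly (B3 i)). Q (fob (att3 X i) r) \<longleftrightarrow> (\<lambda>(c, u) r. fob u r = x) i r)"
    proof (rule pushout_pred[OF po3 sk_lim2 cells3_B, where pS = "\<lambda>R. R = x" and pB = "\<lambda>(c, u) r. fob u r = x"])
      fix i assume i: "i \<in> cells3 D (lim2 X)"
      then obtain c u where i': "i = (c, u)" by (cases i) auto
      note i3 = cells3D[OF i[unfolded i']]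
      let ?I = "iso_cone (cone D c) (vtx D c)"
      have p: "poly (iso_sketch' D c) = ?I" "poly (iso_sketch D c) = ?I"
        by (simp_all add: iso_sketch'_def iso_sketch_def Let_def)
      have "carries ?I ?I (fincl ?I)"
        unfolding carries_def
      proof (intro conjI ballI allI)
        fix \<Phi> x assume x: "x \<in> Hom ?I \<Phi>"
        have "smap (fob (fincl ?I)) \<Phi> = \<Phi>"
          by (rule smap_idI) (use x in \<open>auto simp: fincl_simps subset_iff split: if_splits\<close>)
        then show "fmor (fincl ?I) \<Phi> x \<in> Hom ?I (smap (fob (fincl ?I)) \<Phi>)"
          using x by (simp only: fincl_simps(2)[OF x])
      qed (simp_all add: fincl_simps)
      then show "carries (poly ((\<lambda>(c, u). iso_sketch' D c) i)) (poly (B3 i))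
          ((\<lambda>(c, u). fincl (iso_cone (cone D c) (vtx D c))) i)" by (simp add: i' p)
      show "carries (poly ((\<lambda>(c, u). iso_sketch' D c) i)) T2 ((\<lambda>(c, u). u) i)"
        using functor_carries[OF i3(2)] by (simp add: i' p)
      show "(\<lambda>(c, u) r. fob u r = x) i (fob ((\<lambda>(c, u). fincl (iso_cone (cone D c) (vtx D c))) i) r) \<longleftrightarrow>
          fob ((\<lambda>(c, u). u) i) r = x" if "r \<in> Ob (poly ((\<lambda>(c, u). iso_sketch' D c) i))" for r
        using that unfolding i' by (simp only: prod.case p fincl_simps(1))
    qed
    then obtain Q where Q: "\<forall>R\<in>Ob T2. Q (fob (inc3 X) R) \<longleftrightarrow> R = x"
      by (elim exE conjE) (erule that)
    have "Q (fob (inc3 X) x)" using Q[THEN bspec, OF x] by (rule iffD2) (rule refl)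
    then have "Q (fob (inc3 X) y)" unfolding eq .
    with Q[THEN bspec, OF y] show "x = y" by (rule iffD1[THEN sym])
  qed
  have "R \<in> fob (inc3 X) ` Ob T2" if R: "R \<in> Ob Z" for R
  proof -
    consider "\<exists>R0\<in>Ob T2. R = fob (inc3 X) R0" | "\<exists>i\<in>cells3 D (lim2 X). \<exists>r\<in>Ob (poly (B3 i)). R = fob (att3 X i) r"
      by atomize_elim (rule pushout_ob[OF po3 sk_lim2 cells3_B R])
    then show ?thesis
    proof cases
      case 2
      then obtain c u r where i: "(c, u) \<in> cells3 D (lim2 X)" and
        r: "r \<in> Ob (iso_cone (cone D c) (vtx D c))" "R = fob (att3 X (c, u)) r"
        by (auto simp: iso_sketch_def Let_def)
      then show ?thesis using cells3D(4)[OF i r(1)] functor_ob[OF cells3D(2)[OF i] r(1)] by blast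
    qed blast
  qed
  then show "fob (inc3 X) ` Ob T2 = Ob Z" using functor_ob[OF inc3] by blast
qed

lemma fin_hom:
  assumes "x \<in> Hom Z \<Phi>"
  shows "\<exists>\<Phi>0. \<exists>x0\<in>Hom T2 \<Phi>0. \<Phi> = smap (fob (inc3 X)) \<Phi>0 \<and> x = fmor (inc3 X) \<Phi>0 x0"
proof (rule pushout_generated[OF po3 sk_lim2 cells3_B
      op_closed_image[OF inc3 inc3_bij sketch_lnl[OF sk_lim2] sketch_lnl[OF sk_fin]] _ _ assms])
  show "\<exists>\<Phi>0. \<exists>x0\<in>Hom T2 \<Phi>0. smap (fob (inc3 X)) \<Phi> = smap (fob (inc3 X)) \<Phi>0 \<and> fmor (inc3 X) \<Phi> x = fmor (inc3 X) \<Phi>0 x0"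
    if "x \<in> Hom T2 \<Phi>" for \<Phi> x using that by blast
  fix i \<Phi> x assume i: "i \<in> cells3 D (lim2 X)" and x: "x \<in> Hom (poly (B3 i)) \<Phi>"
  obtain c u where i': "i = (c, u)" by (cases i) auto
  note i3 = cells3D[OF i[unfolded i']]
  let ?I = "iso_cone (cone D c) (vtx D c)"
  have x': "x \<in> Hom ?I \<Phi>" using x by (simp add: i' iso_sketch_def Let_def)
  have "smap (fob (att3 X (c, u))) \<Phi> = smap (fob (inc3 X)) (smap (fob u) \<Phi>)"
    unfolding smap_smap by (rule smap_fctr_cong[OF lnl_ops_valid[OF iso_cone_ops[OF cone_lnl[OF i3(1)] vtx_Ob[OF i3(1)]] x']])
      (rule i3(4))
  then show "\<exists>\<Phi>0. \<exists>x0\<in>Hom T2 \<Phi>0. smap (fob (att3 X i)) \<Phi> = smap (fob (inc3 X)) \<Phi>0 \<and> fmor (att3 X i) \<Phi> x = fmor (inc3 X) \<Phi>0 x0"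
    using i3(5)[OF x'] functor_hom[OF i3(2) x'] by (intro exI[of _ "smap (fob u) \<Phi>"] bexI[of _ "fmor u \<Phi> x"]) (simp_all add: i')
qed

text \<open>For each stage the morphisms coming from it form a closed predicate, and such morphisms
  also come from every later stage; two inputs of a composition can therefore be moved to a common
  stage.\<close>

lemma lim2_hom:
  assumes "x \<in> Hom T2 \<Phi>"
  shows "\<exists>k \<Phi>0. \<exists>x0\<in>Hom (S2 k) \<Phi>0. \<Phi> = smap (fob (leg2 X k)) \<Phi>0 \<and> x = fmor (leg2 X k) \<Phi>0 x0"
proof -
  define img where "img k \<Phi> x \<longleftrightarrow> (\<exists>\<Phi>0. \<exists>x0\<in>Hom (S2 k) \<Phi>0. \<Phi> = smap (fob (leg2 X k)) \<Phi>0 \<and> x = fmor (leg2 X k) \<Phi>0 x0)" for k \<Phi> x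
  have cl: "op_closed T2 (img k)" for k
    using op_closed_image[OF leg2 leg2_bij sketch_lnl[OF sk2] sketch_lnl[OF sk_lim2], of k] unfolding img_def .
  have Suc: "img (Suc k) \<Phi> x" if "img k \<Phi> x" for k \<Phi> x
  proof -
    from that obtain \<Phi>0 x0 where x0: "x0 \<in> Hom (S2 k) \<Phi>0" "\<Phi> = smap (fob (leg2 X k)) \<Phi>0" "x = fmor (leg2 X k) \<Phi>0 x0"
      unfolding img_def by blast
    have "smap (fob (leg2 X (Suc k))) (smap (fob (inc2 X k)) \<Phi>0) = smap (fob (leg2 X k)) \<Phi>0"
      unfolding smap_smap by (rule smap_fctr_cong[OF lnl_valid[OF sketch_lnl[OF sk2] x0(1)]]) (rule leg2_shift)
    then show ?thesis
      unfolding img_def using x0 seq_colimit_shift_mor[OF co2 x0(1)] functor_hom[OF inc2 x0(1)]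
      by (intro exI[of _ "smap (fob (inc2 X k)) \<Phi>0"] bexI[of _ "fmor (inc2 X k) \<Phi>0 x0"]) simp_all
  qed
  have mono: "img m \<Phi> x" if "img k \<Phi> x" "k \<le> m" for k m \<Phi> x
    using that(2,1) by (induction rule: dec_induct) (auto intro: Suc)
  have "\<exists>k. img k \<Phi> x"
  proof (rule seq_colimit_generated[OF co2 sk2 _ _ assms])
    show "op_closed T2 (\<lambda>\<Phi> x. \<exists>k. img k \<Phi> x)"
    proof (rule op_closedI)
      show "\<exists>k. img k [(R, Neg), (R, Pos)] (idn T2 R)" if "R \<in> Ob T2" for R
        using op_closed_idn[OF cl that] by blast
      show "\<exists>k. img k \<Phi> (act T2 \<Phi> \<sigma> x)"
        if "x \<in> Hom T2 (pull \<Phi> \<sigma>)" "\<exists>k. img k (pull \<Phi> \<sigma>) x" "valid T2 \<Phi>" "structural (cl T2) \<Phi> \<sigma>" for \<Phi> \<sigma> x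
        using that op_closed_act[OF cl that(1) _ that(3,4)] by blast
      show "\<exists>k. img k (\<Phi> @ \<Psi>) (cmp T2 \<Phi> K \<Psi> g f)"
        if a: "f \<in> Hom T2 (\<Phi> @ [K])" "g \<in> Hom T2 (dual K # \<Psi>)" "\<exists>k. img k (\<Phi> @ [K]) f" "\<exists>k. img k (dual K # \<Psi>) g"
        for \<Phi> K \<Psi> f g
      proof -
        from a obtain i j where "img i (\<Phi> @ [K]) f" "img j (dual K # \<Psi>) g" by blast
        then have "img (max i j) (\<Phi> @ [K]) f" "img (max i j) (dual K # \<Psi>) g"
          using mono[of _ _ _ "max i j"] by simp_all
        then show ?thesis using op_closed_cmp[OF cl a(1,2)] by blast
      qed
    qed
    show "\<exists>k. img k (smap (fob (leg2 X n)) \<Phi>) (fmor (leg2 X n) \<Phi> x)" if "x \<in> Hom (S2 n) \<Phi>" for n \<Phi> x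
      using that unfolding img_def by blast
  qed
  then show ?thesis unfolding img_def .
qed

end

section \<open>Types and objects\<close>

context free_tower
begin

text \<open>Objects of different stages of the second phase are compared through their final images,
  which is faithful because objects do not change any more.\<close>

definition e :: "nat \<Rightarrow> 'o \<Rightarrow> 'o" where
  "e k R = fob (inc3 X) (fob (leg2 X k) R)"

lemma e_bij: "bij_betw (e k) (Ob (S2 k)) (Ob Z)"
  using bij_betw_trans[OF leg2_bij inc3_bij, of k] by (simp add: e_def[abs_def] comp_def)

lemma e_cl: "R \<in> Ob (S2 k) \<Longrightarrow> cl Z (e k R) = cl (S2 k) R"
  unfolding e_def by (simp add: functor_cl[OF inc3 functor_ob[OF leg2]] functor_cl[OF leg2])

lemma e_shift: "R \<in> Ob (S2 k) \<Longrightarrow> e (Suc k) (fob (inc2 X k) R) = e k R"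
  by (simp add: e_def leg2_shift)

lemma S2_0: "S2 0 = T1"
  by (simp add: stg2_0)

abbreviation "tf \<equiv> to_fin X"

lemma tf_e: "tf n A = e 0 (fob (leg1 X n) A)"
  by (simp add: to_fin_def e_def)

lemma leg1_Ob: "A \<in> Ob (S1 n) \<Longrightarrow> fob (leg1 X n) A \<in> Ob (S2 0)"
  using functor_ob[OF leg1] by (simp add: S2_0)

lemma tf_Ob: "A \<in> Ob (S1 n) \<Longrightarrow> tf n A \<in> Ob Z"
  unfolding tf_e using e_bij[of 0] leg1_Ob by (auto simp: bij_betw_def)

lemma tf_cl: "A \<in> Ob (S1 n) \<Longrightarrow> cl Z (tf n A) = cl (S1 n) A"
  unfolding tf_e using e_cl[OF leg1_Ob] functor_cl[OF leg1] by (simp add: S2_0)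

lemma tf_inj: "A \<in> Ob (S1 n) \<Longrightarrow> B \<in> Ob (S1 n) \<Longrightarrow> tf n A = tf n B \<Longrightarrow> A = B"
  unfolding tf_e using e_bij[of 0] leg1_inj[of n] leg1_Ob by (meson bij_betw_def inj_onD)

lemma tf_Suc: "A \<in> Ob (S1 n) \<Longrightarrow> tf (Suc n) (fob (inc1 X n) A) = tf n A"
  unfolding tf_e by (simp add: seq_colimit_shift[OF co1])

lemma tf_surj: "R \<in> Ob Z \<Longrightarrow> \<exists>n. \<exists>A\<in>Ob (S1 n). R = tf n A"
proof -
  assume "R \<in> Ob Z"
  then obtain R0 where "R0 \<in> Ob T1" "R = e 0 R0" using e_bij[of 0] by (auto simp: bij_betw_def S2_0)
  then show ?thesis using seq_colimit_ob[OF co1 sk1] tf_e by metis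
qed

abbreviation "img n \<equiv> tf n ` Ob (S1 n)"

lemma img_Suc: "img n \<subseteq> img (Suc n)"
proof (rule image_subsetI)
  fix A assume "A \<in> Ob (S1 n)"
  then show "tf n A \<in> img (Suc n)" using tf_Suc[of A n] functor_ob[OF inc1, of A n] by (metis imageI)
qed

lemma img_mono: "n \<le> m \<Longrightarrow> img n \<subseteq> img m"
  by (rule lift_Suc_mono_le[of "\<lambda>n. img n", OF img_Suc])

lemma tf_vtx_new:
  assumes "(c, u) \<in> cells1 D X n"
  shows "tf (Suc n) (fob (att1 X n (c, u)) (fst (vtx D c))) \<notin> img n"
proof
  let ?v = "fob (att1 X n (c, u)) (fst (vtx D c))"
  assume "tf (Suc n) ?v \<in> img n"
  then obtain A where A: "A \<in> Ob (S1 n)" "tf (Suc n) ?v = tf (Suc n) (fob (inc1 X n) A)"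
    using tf_Suc by auto
  have "?v \<in> Ob (S1 (Suc n))" by (rule functor_ob[OF cells1D(3)[OF assms] vtx_Ob[OF cells1D(1)[OF assms]]])
  then have "?v = fob (inc1 X n) A" using tf_inj[OF _ functor_ob[OF inc1 A(1)] A(2)] by blast
  then show False using att1_new[OF assms] A(1) by blast
qed

text \<open>Freeness of the reduct gives the functor; lying over the base is automatic, since the
  base is subterminal.\<close>

lemma reduct_map_ex:
  assumes c: "c \<in> cones D" and h: "\<And>r. r \<in> Ob (cone_reduct D c) \<Longrightarrow> h r \<in> Ob (S1 n) \<and> cl (S1 n) (h r) = cl (cone D c) r"
  obtains w where "sketch_mor D (reduct_sketch D c) (stg1 X n) w" "\<And>r. r \<in> Ob (cone_reduct D c) \<Longrightarrow> fob w r = h r"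
proof -
  interpret cone_basis "cone D c" "vtx D c" "prj c" by (rule cone_basis[OF c])
  let ?R = "cone_reduct D c"
  obtain w where w: "is_functor ?R (S1 n) w" "\<And>r. r \<in> Ob ?R \<Longrightarrow> fob w r = h r"
    using reduct_functor[OF sketch_lnl[OF sk1], of h n] h by auto
  have R: "lnl_ops ?R" by (rule lnl_ops_reduct[OF C])
  have fi: "is_functor ?R (cone D c) (fincl ?R)" by (rule functor_fincl_reduct[OF C])
  have "fcomp ?R (over (stg1 X n)) w = fcomp ?R (cfun D c) (fincl ?R)"
    by (rule subterminal_functor_eq[OF sub functor_fcomp[OF w(1) sketch_over[OF sk1] R]
          functor_fcomp[OF fi cfun_functor[OF c] R] lnl_ops_valid[OF R]])
  then have "sketch_mor D (reduct_sketch D c) (stg1 X n) w"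
    using w(1) by (simp add: sketch_mor_def reduct_sketch_def plain_sketch_def)
  then show thesis using that w(2) by blast
qed

text \<open>If \<open>n\<close> were smaller than \<open>n'\<close>, all objects hit by
  \<open>u'\<close> would exist at the stage before \<open>n'\<close>. By freeness of the reduct
  \<open>u'\<close> would then factor through that stage, which \<open>cells1\<close>
  forbids.\<close>

lemma cell_unique_aux:
  assumes 1: "(c, u) \<in> cells1 D X n" and 2: "(c, u') \<in> cells1 D X n'" and le: "n \<le> n'"
    and eq: "\<And>r. r \<in> Ob (cone_reduct D c) \<Longrightarrow> tf n (fob u r) = tf n' (fob u' r)"
  shows "n = n' \<and> u = u'"
proof -
  interpret cone_basis "cone D c" "vtx D c" "prj c" by (rule cone_basis[OF cells1D(1)[OF 1]])
  note u = cells1D(2)[OF 1] and u' = cells1D(2)[OF 2]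
  have "n = n'"
  proof (rule ccontr)
    assume "n \<noteq> n'"
    then obtain m where m: "n' = Suc m" "n \<le> m" using le by (cases n') auto
    have "\<exists>B. B \<in> Ob (S1 m) \<and> tf m B = tf n' (fob u' r)" if "r \<in> Ob (cone_reduct D c)" for r
    proof -
      have "tf n (fob u r) \<in> img m" by (rule subsetD[OF img_mono[OF m(2)]], rule imageI, rule functor_ob[OF u that])
      then show ?thesis using eq[OF that] by auto
    qed
    then obtain h where h: "\<And>r. r \<in> Ob (cone_reduct D c) \<Longrightarrow> h r \<in> Ob (S1 m) \<and> tf m (h r) = tf n' (fob u' r)"
      using bchoice[of "Ob (cone_reduct D c)" "\<lambda>r B. B \<in> Ob (S1 m) \<and> tf m B = tf n' (fob u' r)"] by blast
    have "cl (S1 m) (h r) = cl (cone D c) r" if "r \<in> Ob (cone_reduct D c)" for r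
      using tf_cl[of "h r" m] h[OF that] tf_cl[OF functor_ob[OF u' that]] functor_cl[OF u' that] by simp
    then obtain w where w: "sketch_mor D (reduct_sketch D c) (stg1 X m) w" "\<And>r. r \<in> Ob (cone_reduct D c) \<Longrightarrow> fob w r = h r"
      using reduct_map_ex[OF cells1D(1)[OF 1], of h m] h by metis
    have w': "is_functor (cone_reduct D c) (S1 m) w"
      using sketch_mor_functor[OF w(1)] by (simp add: reduct_sketch_def plain_sketch_def)
    have "u' = fcomp (cone_reduct D c) (inc1 X m) w"
    proof (rule transition_functor_eq[OF u' functor_fcomp[OF w' _ lnl_ops_reduct[OF C]]])
      show "is_functor (S1 m) (S1 n') (inc1 X m)" using inc1 m by simp
      fix r assume r: "r \<in> Ob (cone_reduct D c)"
      have "tf n' (fob u' r) = tf n' (fob (inc1 X m) (h r))" using h[OF r] tf_Suc[of "h r" m] m by simp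
      then have "fob u' r = fob (inc1 X m) (h r)"
        using tf_inj[OF functor_ob[OF u' r], of "fob (inc1 X m) (h r)"] functor_ob[OF inc1, of "h r" m] h[OF r] m by simp
      then show "fob u' r = fob (fcomp (cone_reduct D c) (inc1 X m) w) r"
        using r w(2)[OF r] by (simp add: fcomp_simps)
    qed simp_all
    then show False using 2 w(1) m by (auto simp: cells1_def)
  qed
  moreover have "u = u'"
  proof (rule transition_functor_eq[OF u u'])
    show "fob u r = fob u' r" if "r \<in> Ob (cone_reduct D c)" for r
      using tf_inj[OF functor_ob[OF u that], of "fob u' r"] functor_ob[OF u' that] eq[OF that] \<open>n = n'\<close> by simp
  qed (simp_all add: \<open>n = n'\<close>)
  ultimately show ?thesis by simp
qed

lemma cell_unique:
  assumes "(c, u) \<in> cells1 D X n" "(c, u') \<in> cells1 D X n'"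
    and "\<And>r. r \<in> Ob (cone_reduct D c) \<Longrightarrow> tf n (fob u r) = tf n' (fob u' r)"
  shows "n = n' \<and> u = u'"
  using cell_unique_aux[OF assms(1,2) _ assms(3)] cell_unique_aux[OF assms(2,1) _ assms(3)[symmetric]]
  by (cases "n \<le> n'") auto

text \<open>Finitely many objects appear together at some stage. The least such stage is taken, so
  that the resulting map does not factor through the preceding one and is a cell.\<close>

lemma cell_exists:
  assumes c: "c \<in> cones D" and g: "\<And>r. r \<in> Ob (cone_reduct D c) \<Longrightarrow> g r \<in> Ob Z \<and> cl Z (g r) = cl (cone D c) r"
  shows "\<exists>n u. (c, u) \<in> cells1 D X n \<and> (\<forall>r\<in>Ob (cone_reduct D c). tf n (fob u r) = g r)"
proof -
  let ?R = "Ob (cone_reduct D c)"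
  have "finite ?R" using ord[OF c] by (metis List.finite_set)
  have "\<exists>n. \<forall>r\<in>F. g r \<in> img n" if "finite F" "F \<subseteq> ?R" for F
    using that
  proof (induction F rule: finite_induct)
    case (insert r F)
    then obtain n where n: "\<forall>r\<in>F. g r \<in> img n" by blast
    obtain m where "g r \<in> img m" using tf_surj g insert by blast
    then have "\<forall>r\<in>insert r F. g r \<in> img (max n m)"
      using n img_mono[of n "max n m"] img_mono[of m "max n m"] by auto
    then show ?case by blast
  qed simp
  then have ex: "\<exists>n. \<forall>r\<in>?R. g r \<in> img n" using \<open>finite ?R\<close> by blast
  define n where "n = (LEAST n. \<forall>r\<in>?R. g r \<in> img n)"
  have n: "\<forall>r\<in>?R. g r \<in> img n" unfolding n_def by (rule LeastI_ex[OF ex])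
  have "\<exists>A. \<forall>r\<in>?R. A r \<in> Ob (S1 n) \<and> tf n (A r) = g r"
  proof (intro bchoice ballI)
    fix r assume "r \<in> ?R"
    then have "g r \<in> img n" using n by blast
    then show "\<exists>A. A \<in> Ob (S1 n) \<and> tf n A = g r" by auto
  qed
  then obtain h where h: "\<And>r. r \<in> ?R \<Longrightarrow> h r \<in> Ob (S1 n) \<and> tf n (h r) = g r" by blast
  have "cl (S1 n) (h r) = cl (cone D c) r" if "r \<in> ?R" for r
    using tf_cl[of "h r" n] h[OF that] g[OF that] by simp
  then obtain u where u: "sketch_mor D (reduct_sketch D c) (stg1 X n) u" "\<And>r. r \<in> ?R \<Longrightarrow> fob u r = h r"
    using reduct_map_ex[OF c, of h n] h by metis
  have "\<not> (\<exists>w. sketch_mor D (reduct_sketch D c) (stg1 X (n - 1)) w \<and> u = fcomp (cone_reduct D c) (inc1 X (n - 1)) w)"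
    if "0 < n"
  proof
    assume "\<exists>w. sketch_mor D (reduct_sketch D c) (stg1 X (n - 1)) w \<and> u = fcomp (cone_reduct D c) (inc1 X (n - 1)) w"
    then obtain w where w: "sketch_mor D (reduct_sketch D c) (stg1 X (n - 1)) w" "u = fcomp (cone_reduct D c) (inc1 X (n - 1)) w"
      by blast
    have w': "is_functor (cone_reduct D c) (S1 (n - 1)) w"
      using sketch_mor_functor[OF w(1)] by (simp add: reduct_sketch_def plain_sketch_def)
    have "g r \<in> img (n - 1)" if "r \<in> ?R" for r
    proof -
      have "g r = tf n (fob (inc1 X (n - 1)) (fob w r))"
        using h[OF that] u(2)[OF that] w(2) that by (simp add: fcomp_simps)
      also have "\<dots> = tf (n - 1) (fob w r)" using tf_Suc[OF functor_ob[OF w' that]] \<open>0 < n\<close> by simp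
      finally show ?thesis using functor_ob[OF w' that] by blast
    qed
    then have "n \<le> n - 1" unfolding n_def by (intro Least_le) blast
    then show False using \<open>0 < n\<close> by simp
  qed
  then have "(c, u) \<in> cells1 D X n" using c u(1) by (simp add: cells1_def)
  then show ?thesis using u(2) h by (intro exI[of _ n] exI[of _ u]) simp
qed

section \<open>The correspondence between types and objects\<close>

abbreviation "tcl \<equiv> ty_class D S"
definition isty :: "('o, 'c) ty \<Rightarrow> bool" where "isty R \<longleftrightarrow> is_type D ord S R (tcl R)"

lemma is_type_tcl: "is_type D ord S R \<tau> \<Longrightarrow> \<tau> = tcl R"
  by (induction rule: is_type.induct) auto

lemma is_type_isty: "is_type D ord S R \<tau> \<Longrightarrow> isty R"
  using is_type_tcl unfolding isty_def by metis

lemma isty_Vtx: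
  "isty (Vtx c Rs) \<longleftrightarrow> c \<in> cones D \<and> length Rs = length (ord c) \<and>
     (\<forall>i<length Rs. isty (Rs ! i) \<and> tcl (Rs ! i) = cl (cone D c) (ord c ! i))"
proof
  assume "isty (Vtx c Rs)"
  then show "c \<in> cones D \<and> length Rs = length (ord c) \<and>
     (\<forall>i<length Rs. isty (Rs ! i) \<and> tcl (Rs ! i) = cl (cone D c) (ord c ! i))"
    unfolding isty_def by (cases rule: is_type.cases) (use is_type_tcl in \<open>metis\<close>)
next
  assume a: "c \<in> cones D \<and> length Rs = length (ord c) \<and>
     (\<forall>i<length Rs. isty (Rs ! i) \<and> tcl (Rs ! i) = cl (cone D c) (ord c ! i))"
  then have "is_type D ord S (Vtx c Rs) (cl (cone D c) (fst (vtx D c)))"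
    by (intro is_type.intros(2)) (auto simp: isty_def)
  then show "isty (Vtx c Rs)" by (rule is_type_isty)
qed

lemma isty_Base: "isty (Base A) \<longleftrightarrow> A \<in> Ob S"
  unfolding isty_def by (auto elim: is_type.cases intro: is_type.intros)

abbreviation "tob0 \<equiv> ty_obj D ord X"

lemma map_eq_ord:
  assumes "c \<in> cones D" "map f (ord c) = map g (ord c)" "r \<in> Ob (cone_reduct D c)"
  shows "f r = g r"
  using assms ord by auto

text \<open>The choice in \<open>ty_obj\<close> has only one candidate: by
  \<open>cell_unique\<close>, a cell is known from its cone and the final images of the objects it
  hits.\<close>

lemma ty_obj_VtxI:
  assumes cell: "(c, u) \<in> cells1 D X n" and eq: "map (\<lambda>r. tf n (fob u r)) (ord c) = map tob0 Rs"
  shows "tob0 (Vtx c Rs) = tf (Suc n) (fob (att1 X n (c, u)) (fst (vtx D c)))"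
proof -
  let ?P = "\<lambda>(n, u). (c, u) \<in> cells1 D X n \<and> map (\<lambda>r. tf n (fob u r)) (ord c) = map tob0 Rs"
  have "(SOME p. ?P p) = (n, u)"
  proof (rule some_equality)
    show "?P (n, u)" using assms by simp
    fix p assume "?P p"
    then obtain n' u' where p: "p = (n', u')" "(c, u') \<in> cells1 D X n'"
      "map (\<lambda>r. tf n' (fob u' r)) (ord c) = map (\<lambda>r. tf n (fob u r)) (ord c)" using eq by (cases p) auto
    then show "p = (n, u)"
      using cell_unique[OF p(2) cell map_eq_ord[OF cells1D(1)[OF cell] p(3)]] by simp
  qed
  then show ?thesis by simp
qed

lemma ty_obj_VtxE:
  assumes c: "c \<in> cones D" and len: "length Rs = length (ord c)"
    and Rs: "\<And>i. i < length Rs \<Longrightarrow> tob0 (Rs ! i) \<in> Ob Z \<and> cl Z (tob0 (Rs ! i)) = cl (cone D c) (ord c ! i)"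
  obtains n u where "(c, u) \<in> cells1 D X n" "map (\<lambda>r. tf n (fob u r)) (ord c) = map tob0 Rs"
    "tob0 (Vtx c Rs) = tf (Suc n) (fob (att1 X n (c, u)) (fst (vtx D c)))"
proof -
  define g where "g r = tob0 (the (map_of (zip (ord c) Rs) r))" for r
  have gi: "g (ord c ! i) = tob0 (Rs ! i)" if "i < length Rs" for i
    using that len ord[OF c] by (simp add: g_def map_of_zip_nth)
  have "g r \<in> Ob Z \<and> cl Z (g r) = cl (cone D c) r" if "r \<in> Ob (cone_reduct D c)" for r
  proof -
    have "r \<in> set (ord c)" using that ord[OF c] by simp
    then obtain i where "i < length Rs" "r = ord c ! i" using len by (auto simp: in_set_conv_nth)
    then show ?thesis using gi Rs by simp
  qed
  then obtain n u where u: "(c, u) \<in> cells1 D X n" "\<forall>r\<in>Ob (cone_reduct D c). tf n (fob u r) = g r"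
    using cell_exists[OF c] by blast
  have "map (\<lambda>r. tf n (fob u r)) (ord c) = map g (ord c)"
    using u(2) ord[OF c] by (intro map_cong refl) simp
  also have "\<dots> = map tob0 Rs" using gi len by (intro nth_equalityI) auto
  finally have m: "map (\<lambda>r. tf n (fob u r)) (ord c) = map tob0 Rs" .
  show thesis by (rule that[OF u(1) m ty_obj_VtxI[OF u(1) m]])
qed

lemma ty_obj_good: "is_type D ord S R \<tau> \<Longrightarrow> tob0 R \<in> Ob Z \<and> cl Z (tob0 R) = \<tau>"
proof (induction rule: is_type.induct)
  case (1 A)
  then show ?case using tf_Ob[of A 0] tf_cl[of A 0] by (simp add: stg1_0 plain_sketch_def)
next
  case (2 c Rs)
  obtain n u where u: "(c, u) \<in> cells1 D X n"
    "tob0 (Vtx c Rs) = tf (Suc n) (fob (att1 X n (c, u)) (fst (vtx D c)))"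
    using ty_obj_VtxE[OF 2(1,2,4)] by metis
  note a = cells1D(3)[OF u(1)] and v = vtx_Ob[OF 2(1)]
  show ?case unfolding u(2) using tf_Ob[OF functor_ob[OF a v]] tf_cl[OF functor_ob[OF a v]] functor_cl[OF a v] by simp
qed

lemma isty_Ob: "isty R \<Longrightarrow> tob0 R \<in> Ob Z" and isty_cl: "isty R \<Longrightarrow> cl Z (tob0 R) = tcl R"
  using ty_obj_good unfolding isty_def by blast+

lemma isty_VtxE:
  assumes "isty (Vtx c Rs)"
  obtains n u where "(c, u) \<in> cells1 D X n" "map (\<lambda>r. tf n (fob u r)) (ord c) = map tob0 Rs"
    "tob0 (Vtx c Rs) = tf (Suc n) (fob (att1 X n (c, u)) (fst (vtx D c)))"
proof -
  have a: "c \<in> cones D" "length Rs = length (ord c)"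
    "\<And>i. i < length Rs \<Longrightarrow> tob0 (Rs ! i) \<in> Ob Z \<and> cl Z (tob0 (Rs ! i)) = cl (cone D c) (ord c ! i)"
    using assms isty_Ob isty_cl unfolding isty_Vtx by auto
  show thesis by (rule ty_obj_VtxE[OF a]) (assumption, rule that)
qed

lemma cell_type:
  assumes cell: "(c, u) \<in> cells1 D X n"
    and surj: "\<And>A. A \<in> Ob (S1 n) \<Longrightarrow> \<exists>R. isty R \<and> tob0 R = tf n A"
  shows "\<exists>Rs. isty (Vtx c Rs) \<and> map (\<lambda>r. tf n (fob u r)) (ord c) = map tob0 Rs \<and>
    tob0 (Vtx c Rs) = tf (Suc n) (fob (att1 X n (c, u)) (fst (vtx D c)))"
proof -
  note c = cells1D(1)[OF cell] and u = cells1D(2)[OF cell]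
  have "\<exists>T. \<forall>r\<in>Ob (cone_reduct D c). isty (T r) \<and> tob0 (T r) = tf n (fob u r)"
    by (intro bchoice ballI surj functor_ob[OF u])
  then obtain T where T: "\<And>r. r \<in> Ob (cone_reduct D c) \<Longrightarrow> isty (T r) \<and> tob0 (T r) = tf n (fob u r)"
    by blast
  define Rs where "Rs = map T (ord c)"
  have m: "map (\<lambda>r. tf n (fob u r)) (ord c) = map tob0 Rs"
    unfolding Rs_def map_map comp_def by (rule map_cong[OF refl]) (use T ord[OF c] in simp)
  have "isty (Vtx c Rs)"
    unfolding isty_Vtx
  proof (intro conjI allI impI c)
    fix i assume i: "i < length Rs"
    then have r: "ord c ! i \<in> Ob (cone_reduct D c)" using ord[OF c] by (metis Rs_def length_map nth_mem)
    have "tcl (T (ord c ! i)) = cl (cone D c) (ord c ! i)"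
      using isty_cl[of "T (ord c ! i)"] T[OF r] tf_cl[OF functor_ob[OF u r]] functor_cl[OF u r] by simp
    then show "isty (Rs ! i)" "tcl (Rs ! i) = cl (cone D c) (ord c ! i)"
      using i T[OF r] by (simp_all add: Rs_def)
  qed (simp add: Rs_def)
  then show ?thesis using m ty_obj_VtxI[OF cell m] by blast
qed

lemma ty_obj_surj1: "A \<in> Ob (S1 n) \<Longrightarrow> \<exists>R. isty R \<and> tob0 R = tf n A"
proof (induction n arbitrary: A)
  case 0
  then have "A \<in> Ob S" by (simp add: stg1_0 plain_sketch_def)
  then show ?case by (intro exI[of _ "Base A"]) (simp add: isty_Base)
next
  case (Suc n)
  from Suc.prems show ?case
  proof (cases rule: S1_ob)
    case (old R0)
    then show ?thesis using Suc.IH[OF old(1)] tf_Suc[OF old(1)] by auto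
  next
    case (vtx c u)
    then show ?thesis using cell_type[OF vtx(1) Suc.IH] by auto
  qed
qed

lemma ty_obj_surj: "A \<in> Ob Z \<Longrightarrow> \<exists>R. isty R \<and> tob0 R = A"
  using tf_surj[of A] ty_obj_surj1 by blast

text \<open>A vertex is absent before the stage at which it is attached, which determines this
  stage; within a stage \<open>att1_inj\<close> separates the cells.\<close>

lemma vtx_unique:
  assumes u: "(c, u) \<in> cells1 D X n" and u': "(c', u') \<in> cells1 D X n'"
    and eq: "tf (Suc n) (fob (att1 X n (c, u)) (fst (vtx D c))) = tf (Suc n') (fob (att1 X n' (c', u')) (fst (vtx D c')))"
  shows "n = n'" "c = c'" "u = u'"
proof -
  have v: "fob (att1 X n (c, u)) (fst (vtx D c)) \<in> Ob (S1 (Suc n))" if "(c, u) \<in> cells1 D X n" for c u n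
    by (rule functor_ob[OF cells1D(3)[OF that] vtx_Ob[OF cells1D(1)[OF that]]])
  have "\<not> n < n'"
    using tf_vtx_new[OF u'] subsetD[OF img_mono[of "Suc n" n'] imageI[OF v[OF u]]] unfolding eq
    by (auto simp: Suc_le_eq)
  moreover have "\<not> n' < n"
    using tf_vtx_new[OF u] subsetD[OF img_mono[of "Suc n'" n] imageI[OF v[OF u']]] unfolding eq[symmetric]
    by (auto simp: Suc_le_eq)
  ultimately show n: "n = n'" by simp
  have "fob (att1 X n (c, u)) (fst (vtx D c)) = fob (att1 X n (c', u')) (fst (vtx D c'))"
    by (rule tf_inj[of _ "Suc n"]) (use eq n v[OF u] v[OF u'] in simp_all)
  then show "c = c'" "u = u'" using att1_inj[OF u, of c' u'] u' n by auto
qed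

text \<open>Unique readability: a base object exists at stage 0, whereas a vertex is new at its
  stage. A vertex determines its cell, hence the cone and the component objects, to which the
  induction hypothesis applies.\<close>

lemma ty_obj_inj: "isty R \<Longrightarrow> isty R' \<Longrightarrow> tob0 R = tob0 R' \<Longrightarrow> R = R'"
proof (induction R arbitrary: R')
  case (Base A)
  have A: "A \<in> Ob (S1 0)" using Base(1) by (simp add: isty_Base stg1_0 plain_sketch_def)
  show ?case
  proof (cases R')
    case (Base B)
    then have "B \<in> Ob (S1 0)" using Base.prems(2) by (simp add: isty_Base stg1_0 plain_sketch_def)
    then show ?thesis using tf_inj[OF A] Base.prems(3) Base by simp
  next
    case (Vtx c Rs)
    then obtain n u where u: "(c, u) \<in> cells1 D X n" "tob0 R' = tf (Suc n) (fob (att1 X n (c, u)) (fst (vtx D c)))"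
      using isty_VtxE Base.prems(2) by metis
    have "tf 0 A \<in> img n" by (rule subsetD[OF img_mono[of 0 n]]) (use A in simp_all)
    then show ?thesis using tf_vtx_new[OF u(1)] u(2) Base.prems(3) by simp
  qed
next
  case (Vtx c Rs)
  obtain n u where u: "(c, u) \<in> cells1 D X n" "map (\<lambda>r. tf n (fob u r)) (ord c) = map tob0 Rs"
    "tob0 (Vtx c Rs) = tf (Suc n) (fob (att1 X n (c, u)) (fst (vtx D c)))" by (rule isty_VtxE[OF Vtx.prems(1)])
  show ?case
  proof (cases R')
    case (Base B)
    then have "B \<in> Ob (S1 0)" using Vtx.prems(2) by (simp add: isty_Base stg1_0 plain_sketch_def)
    then have "tf 0 B \<in> img n" by (intro subsetD[OF img_mono[of 0 n]]) simp_all
    then show ?thesis using tf_vtx_new[OF u(1)] u(3) Vtx.prems(3) Base by simp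
  next
    case R': (Vtx c' Rs')
    obtain n' u' where u': "(c', u') \<in> cells1 D X n'" "map (\<lambda>r. tf n' (fob u' r)) (ord c') = map tob0 Rs'"
      "tob0 (Vtx c' Rs') = tf (Suc n') (fob (att1 X n' (c', u')) (fst (vtx D c')))"
      using isty_VtxE Vtx.prems(2) R' by metis
    have cu: "n = n'" "c = c'" "u = u'"
      using vtx_unique[OF u(1) u'(1)] u(3) u'(3) Vtx.prems(3) R' by simp_all
    then have m: "map tob0 Rs = map tob0 Rs'" using u(2) u'(2) cu by simp
    then have len: "length Rs = length Rs'" by (metis length_map)
    have "Rs = Rs'"
    proof (rule nth_equalityI[OF len])
      fix i assume i: "i < length Rs"
      show "Rs ! i = Rs' ! i"
      proof (rule Vtx.IH)
        show "Rs ! i \<in> set Rs" using i by simp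
        show "isty (Rs ! i)" using Vtx.prems(1) i by (simp add: isty_Vtx)
        show "isty (Rs' ! i)" using Vtx.prems(2) i len R' by (simp add: isty_Vtx)
        show "tob0 (Rs ! i) = tob0 (Rs' ! i)" using m i len by (metis nth_map)
      qed
    qed
    then show ?thesis using R' cu by simp
  qed
qed

end

declare ty_obj.simps(2) [simp del]

lemma carries_fcomp:
  assumes F: "carries P Q F" and G: "carries Q R G" and P: "lnl_ops P"
  shows "carries P R (fcomp P G F)"
  unfolding carries_def
proof (intro conjI ballI allI)
  fix \<Phi> x assume x: "x \<in> Hom P \<Phi>"
  have "smap (fob (fcomp P G F)) \<Phi> = smap (fob G) (smap (fob F) \<Phi>)"
    unfolding smap_smap by (rule smap_fctr_cong[OF lnl_ops_valid[OF P x]]) (simp add: fcomp_simps)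
  then show "fmor (fcomp P G F) \<Phi> x \<in> Hom R (smap (fob (fcomp P G F)) \<Phi>)"
    using carries_hom[OF G carries_hom[OF F x]] x by (simp add: fcomp_simps)
next
  fix S assume S: "S \<in> Ob P"
  show "fob (fcomp P G F) S \<in> Ob R" "cl R (fob (fcomp P G F) S) = cl P S"
    using carries_ob[OF G carries_ob[OF F S]] carries_cl[OF G carries_ob[OF F S]] carries_cl[OF F S] S
    by (simp_all add: fcomp_simps)
qed

section \<open>Types and proto-extremal lifts at each stage\<close>

context free_tower
begin

definition tob :: "nat \<Rightarrow> ('o, 'c) ty \<Rightarrow> 'o" where
  "tob k R = inv_into (Ob (S2 k)) (e k) (tob0 R)"

lemma e_inj: "A \<in> Ob (S2 k) \<Longrightarrow> B \<in> Ob (S2 k) \<Longrightarrow> e k A = e k B \<Longrightarrow> A = B"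
  using e_bij[of k] unfolding bij_betw_def by (blast dest: inj_onD)

lemma tob_Ob: "isty R \<Longrightarrow> tob k R \<in> Ob (S2 k)" and e_tob: "isty R \<Longrightarrow> e k (tob k R) = tob0 R"
proof -
  assume "isty R"
  then have "tob0 R \<in> e k ` Ob (S2 k)" using isty_Ob e_bij[of k] by (simp add: bij_betw_def)
  then show "tob k R \<in> Ob (S2 k)" "e k (tob k R) = tob0 R"
    unfolding tob_def by (rule inv_into_into, rule f_inv_into_f)
qed

lemma tobI: "isty R \<Longrightarrow> A \<in> Ob (S2 k) \<Longrightarrow> e k A = tob0 R \<Longrightarrow> tob k R = A"
  using e_inj[OF tob_Ob] e_tob by simp

lemma tob_cl: "isty R \<Longrightarrow> cl (S2 k) (tob k R) = tcl R"
  using e_cl[OF tob_Ob, of R k] isty_cl[of R] by (simp add: e_tob)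

lemma tob_Suc: "isty R \<Longrightarrow> fob (inc2 X k) (tob k R) = tob (Suc k) R"
  using e_shift[OF tob_Ob] e_tob functor_ob[OF inc2 tob_Ob] by (intro tobI[symmetric]) auto

lemma tob_inj: "inj_on (tob k) {R. isty R}"
  by (rule inj_onI) (metis e_tob mem_Collect_eq ty_obj_inj)

lemma tob_surj: "Ob (S2 k) = tob k ` {R. isty R}"
proof (intro set_eqI iffI)
  fix A assume A: "A \<in> Ob (S2 k)"
  then have "e k A \<in> Ob Z" using e_bij[of k] by (auto simp: bij_betw_def)
  then obtain R where "isty R" "tob0 R = e k A" using ty_obj_surj by blast
  then show "A \<in> tob k ` {R. isty R}" using tobI[OF _ A] by force
qed (use tob_Ob in blast)

lemma leg1_att:
  assumes "(c, u) \<in> cells1 D X n"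
  shows "e 0 (fob (fcomp (cone D c) (leg1 X (Suc n)) (att1 X n (c, u))) (fst (vtx D c))) =
      tf (Suc n) (fob (att1 X n (c, u)) (fst (vtx D c)))"
    "r \<in> Ob (cone_reduct D c) \<Longrightarrow>
      e 0 (fob (fcomp (cone D c) (leg1 X (Suc n)) (att1 X n (c, u))) r) = tf n (fob u r)"
    "fcomp (cone D c) (leg1 X (Suc n)) (att1 X n (c, u)) \<in> pext (lim1 X) c"
proof -
  note c = cells1D(1)[OF assms]
  show "e 0 (fob (fcomp (cone D c) (leg1 X (Suc n)) (att1 X n (c, u))) (fst (vtx D c))) =
      tf (Suc n) (fob (att1 X n (c, u)) (fst (vtx D c)))"
    using vtx_Ob[OF c] by (simp add: fcomp_simps tf_e)
  show "e 0 (fob (fcomp (cone D c) (leg1 X (Suc n)) (att1 X n (c, u))) r) = tf n (fob u r)"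
    if "r \<in> Ob (cone_reduct D c)"
    using that att1_reduct[OF assms that] tf_Suc[OF functor_ob[OF cells1D(2)[OF assms] that]]
    by (simp add: fcomp_simps tf_e)
  have "fcomp (cone D c) (att1 X n (c, u)) (fincl (cone D c)) \<in> pext (stg1 X (Suc n)) c"
    using sketch_mor_pext[OF pushout_att[OF po1 assms], of c] c by (simp add: cone_sketch_def)
  then have "att1 X n (c, u) \<in> pext (stg1 X (Suc n)) c"
    using fcomp_fincl[OF cells1D(3)[OF assms] lnl_valid[OF cone_lnl[OF c]]] by simp
  then show "fcomp (cone D c) (leg1 X (Suc n)) (att1 X n (c, u)) \<in> pext (lim1 X) c"
    by (rule sketch_mor_pext[OF seq_colimit_leg[OF co1] c])
qed

lemma pext1:
  assumes c: "c \<in> cones D"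
  shows "L \<in> pext (stg1 X n) c \<Longrightarrow>
    \<exists>m u. (c, u) \<in> cells1 D X m \<and> fcomp (cone D c) (leg1 X n) L = fcomp (cone D c) (leg1 X (Suc m)) (att1 X m (c, u))"
proof (induction n arbitrary: L)
  case 0 then show ?case by (simp add: stg1_0 plain_sketch_def)
next
  case (Suc n)
  from c Suc.prems show ?case
  proof (cases rule: S1_pext)
    case (old L0)
    have F: "is_functor (cone D c) (S1 n) L0" by (rule sketch_pext[OF sk1 c old(1)])
    have "fcomp (cone D c) (leg1 X (Suc n)) L = fcomp (cone D c) (leg1 X n) L0"
    proof (rule fcomp_eqI)
      show "fob (leg1 X (Suc n)) (fob L R) = fob (leg1 X n) (fob L0 R)" if "R \<in> Ob (cone D c)" for R
        using seq_colimit_shift[OF co1 functor_ob[OF F that]] that old(2) by (simp add: fcomp_simps)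
      show "fmor (leg1 X (Suc n)) (smap (fob L) \<Phi>) (fmor L \<Phi> x) = fmor (leg1 X n) (smap (fob L0) \<Phi>) (fmor L0 \<Phi> x)"
        if x: "x \<in> Hom (cone D c) \<Phi>" for \<Phi> x
      proof -
        have "smap (fob L) \<Phi> = smap (fob (inc1 X n)) (smap (fob L0) \<Phi>)"
          unfolding smap_smap old(2)
          by (rule smap_fctr_cong[OF lnl_valid[OF cone_lnl[OF c] x]]) (simp add: fcomp_simps)
        then show ?thesis using seq_colimit_shift_mor[OF co1 functor_hom[OF F x]] x old(2) by (simp add: fcomp_simps)
      qed
    qed
    then show ?thesis using Suc.IH[OF old(1)] by simp
  next
    case (vtx u)
    then show ?thesis by blast
  qed
qed

lemma pext_lim1:
  assumes c: "c \<in> cones D" and L: "L \<in> pext (lim1 X) c"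
  obtains m u where "(c, u) \<in> cells1 D X m" "L = fcomp (cone D c) (leg1 X (Suc m)) (att1 X m (c, u))"
  using seq_colimit_pext[OF co1 sk1 c L] pext1[OF c] by metis

lemma pext_Ob:
  assumes "c \<in> cones D" "L \<in> pext (stg2 X k) c" "r \<in> Ob (cone D c)"
  shows "fob L r \<in> Ob (S2 k)"
  by (rule functor_ob[OF sketch_pext[OF sk2 assms(1,2)] assms(3)])

lemma ord_Ob: "c \<in> cones D \<Longrightarrow> r \<in> set (ord c) \<longleftrightarrow> r \<in> Ob (cone D c) \<and> r \<noteq> fst (vtx D c)"
  using ord by simp

text \<open>The proto-extremal lifts at the start of the second phase come from the cells of the
  first, and that phase only pushes lifts forward. So the vertex of a lift is named by a compound
  type whose components name the other objects of the lift.\<close>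

lemma pext_type:
  assumes c: "c \<in> cones D"
  shows "L \<in> pext (stg2 X k) c \<Longrightarrow>
    \<exists>Rs. isty (Vtx c Rs) \<and> fob L (fst (vtx D c)) = tob k (Vtx c Rs) \<and> map (fob L) (ord c) = map (tob k) Rs"
proof (induction k arbitrary: L)
  case 0
  obtain m u where u: "(c, u) \<in> cells1 D X m" and L: "L = fcomp (cone D c) (leg1 X (Suc m)) (att1 X m (c, u))"
    using pext_lim1[OF c] 0 stg2_0 by metis
  obtain Rs where Rs: "isty (Vtx c Rs)" "map (\<lambda>r. tf m (fob u r)) (ord c) = map tob0 Rs"
    "tob0 (Vtx c Rs) = tf (Suc m) (fob (att1 X m (c, u)) (fst (vtx D c)))"
    using cell_type[OF u ty_obj_surj1] by blast
  have len: "length Rs = length (ord c)" using Rs(1) by (simp add: isty_Vtx)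
  have "tob 0 (Vtx c Rs) = fob L (fst (vtx D c))"
    by (rule tobI[OF Rs(1) pext_Ob[OF c 0 vtx_Ob[OF c]]]) (simp add: L leg1_att[OF u] Rs(3))
  moreover have "map (fob L) (ord c) = map (tob 0) Rs"
  proof (rule nth_equalityI)
    fix i assume "i < length (map (fob L) (ord c))"
    then have i: "i < length (ord c)" "i < length Rs" using len by simp_all
    then have r: "ord c ! i \<in> Ob (cone_reduct D c)" using ord_Ob[OF c, of "ord c ! i"] by simp
    have ty: "isty (Rs ! i)" using Rs(1) i by (simp add: isty_Vtx)
    have "tob0 (Rs ! i) = tf m (fob u (ord c ! i))" using Rs(2) i by (metis nth_map)
    then have "tob 0 (Rs ! i) = fob L (ord c ! i)"
      using r by (intro tobI[OF ty pext_Ob[OF c 0]]) (simp_all add: L leg1_att(2)[OF u r])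
    then show "map (fob L) (ord c) ! i = map (tob 0) Rs ! i" using i by simp
  qed (simp add: len)
  ultimately show ?case using Rs(1) by auto
next
  case (Suc k)
  obtain L0 where L0: "L0 \<in> pext (stg2 X k) c" "L = fcomp (cone D c) (inc2 X k) L0"
    using S2_pext[OF c Suc.prems] by blast
  obtain Rs where Rs: "isty (Vtx c Rs)" "fob L0 (fst (vtx D c)) = tob k (Vtx c Rs)" "map (fob L0) (ord c) = map (tob k) Rs"
    using Suc.IH[OF L0(1)] by blast
  have "map (fob L) (ord c) = map (fob (inc2 X k)) (map (fob L0) (ord c))"
    using L0(2) ord_Ob[OF c] by (simp add: fcomp_simps)
  also have "\<dots> = map (tob (Suc k)) Rs"
    unfolding Rs(3) map_map comp_def
    by (rule map_cong[OF refl]) (use Rs(1) in \<open>auto simp: isty_Vtx in_set_conv_nth intro: tob_Suc\<close>)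
  finally show ?case
    using Rs L0(2) vtx_Ob[OF c] tob_Suc[OF Rs(1)] by (intro exI[of _ Rs]) (simp add: fcomp_simps)
qed

text \<open>The vertex object identifies the cell by which the lift was attached, and the later
  inclusions are injective on objects. Hence a compound type names not just an object but a whole
  cone.\<close>

lemma pext_unique:
  assumes c: "c \<in> cones D"
  shows "L \<in> pext (stg2 X k) c \<Longrightarrow> L' \<in> pext (stg2 X k) c \<Longrightarrow> fob L (fst (vtx D c)) = fob L' (fst (vtx D c)) \<Longrightarrow> L = L'"
proof (induction k arbitrary: L L')
  case 0
  obtain m u where u: "(c, u) \<in> cells1 D X m" and L: "L = fcomp (cone D c) (leg1 X (Suc m)) (att1 X m (c, u))"
    using pext_lim1[OF c] 0 stg2_0 by metis
  obtain m' u' where u': "(c, u') \<in> cells1 D X m'" and L': "L' = fcomp (cone D c) (leg1 X (Suc m')) (att1 X m' (c, u'))"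
    using pext_lim1[OF c] 0 stg2_0 by metis
  have "tf (Suc m) (fob (att1 X m (c, u)) (fst (vtx D c))) = tf (Suc m') (fob (att1 X m' (c, u')) (fst (vtx D c)))"
    using 0(3) leg1_att(1)[OF u] leg1_att(1)[OF u'] L L' by simp
  from vtx_unique[OF u u' this] show ?case using L L' by simp
next
  case (Suc k)
  obtain L0 where L0: "L0 \<in> pext (stg2 X k) c" "L = fcomp (cone D c) (inc2 X k) L0"
    using S2_pext[OF c Suc.prems(1)] by blast
  obtain L1 where L1: "L1 \<in> pext (stg2 X k) c" "L' = fcomp (cone D c) (inc2 X k) L1"
    using S2_pext[OF c Suc.prems(2)] by blast
  have v: "fst (vtx D c) \<in> Ob (cone D c)" by (rule vtx_Ob[OF c])
  have "fob (inc2 X k) (fob L0 (fst (vtx D c))) = fob (inc2 X k) (fob L1 (fst (vtx D c)))"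
    using Suc.prems(3) L0(2) L1(2) v by (simp add: fcomp_simps)
  then have "fob L0 (fst (vtx D c)) = fob L1 (fst (vtx D c))"
    using inc2_bij[of k] pext_Ob[OF c L0(1) v] pext_Ob[OF c L1(1) v] unfolding bij_betw_def by (blast dest: inj_onD)
  then show ?case using Suc.IH[OF L0(1) L1(1)] L0(2) L1(2) by simp
qed

lemma pext_exists:
  assumes R: "isty (Vtx c Rs)"
  shows "\<exists>L\<in>pext (stg2 X k) c. fob L (fst (vtx D c)) = tob k (Vtx c Rs)"
proof (induction k)
  case 0
  obtain n u where u: "(c, u) \<in> cells1 D X n" "tob0 (Vtx c Rs) = tf (Suc n) (fob (att1 X n (c, u)) (fst (vtx D c)))"
    by (rule isty_VtxE[OF R])
  note c = cells1D(1)[OF u(1)]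
  let ?L = "fcomp (cone D c) (leg1 X (Suc n)) (att1 X n (c, u))"
  have L: "?L \<in> pext (stg2 X 0) c" using leg1_att(3)[OF u(1)] by (simp add: stg2_0)
  have "tob 0 (Vtx c Rs) = fob ?L (fst (vtx D c))"
    by (rule tobI[OF R pext_Ob[OF c L vtx_Ob[OF c]]]) (simp add: leg1_att(1)[OF u(1)] u(2))
  then show ?case using L by metis
next
  case (Suc k)
  have c: "c \<in> cones D" using R by (simp add: isty_Vtx)
  from Suc obtain L where L: "L \<in> pext (stg2 X k) c" "fob L (fst (vtx D c)) = tob k (Vtx c Rs)" by blast
  have "fcomp (cone D c) (inc2 X k) L \<in> pext (stg2 X (Suc k)) c"
    by (rule sketch_mor_pext[OF pushout_inc[OF po2] c L(1)])
  then show ?case using L(2) vtx_Ob[OF c] tob_Suc[OF R] by (intro bexI) (simp_all add: fcomp_simps)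
qed

lemma pext_ord:
  assumes R: "isty (Vtx c Rs)" and L: "L \<in> pext (stg2 X k) c" "fob L (fst (vtx D c)) = tob k (Vtx c Rs)"
  shows "map (fob L) (ord c) = map (tob k) Rs"
proof -
  have c: "c \<in> cones D" using R by (simp add: isty_Vtx)
  obtain Rs' where Rs': "isty (Vtx c Rs')" "fob L (fst (vtx D c)) = tob k (Vtx c Rs')" "map (fob L) (ord c) = map (tob k) Rs'"
    using pext_type[OF c L(1)] by blast
  have "Vtx c Rs = Vtx c Rs'" by (rule inj_onD[OF tob_inj[of k]]) (use R Rs'(1,2) L(2) in simp_all)
  then show ?thesis using Rs'(3) by simp
qed

abbreviation "sty \<equiv> signed_types D ord S"

lemma sty_iff: "sty \<Phi> \<longleftrightarrow> fst ` set \<Phi> \<subseteq> {R. isty R}"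
  unfolding signed_types_def isty_def by auto

lemma sty_simps [simp]: "sty []" "sty (K # \<Phi>) \<longleftrightarrow> isty (fst K) \<and> sty \<Phi>" "sty (\<Phi> @ \<Psi>) \<longleftrightarrow> sty \<Phi> \<and> sty \<Psi>"
  by (auto simp: sty_iff)

lemma stob_inj: "sty \<Phi> \<Longrightarrow> sty \<Psi> \<Longrightarrow> smap (tob k) \<Phi> = smap (tob k) \<Psi> \<Longrightarrow> \<Phi> = \<Psi>"
  by (rule smap_inj_on[OF tob_inj]) (simp_all add: sty_iff)

lemma stob_surj: "fst ` set \<Xi> \<subseteq> Ob (S2 k) \<Longrightarrow> \<exists>\<Phi>. sty \<Phi> \<and> smap (tob k) \<Phi> = \<Xi>"
  using smap_surj[of \<Xi> "tob k" "{R. isty R}"] by (simp add: sty_iff tob_surj[symmetric])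

lemma stob_Suc: "sty \<Phi> \<Longrightarrow> smap (fob (inc2 X k)) (smap (tob k) \<Phi>) = smap (tob (Suc k)) \<Phi>"
  unfolding smap_smap by (rule smap_cong) (auto simp: sty_iff intro: tob_Suc)

lemma stob_admissible: "sty \<Phi> \<Longrightarrow> admissible (cl (S2 k)) (smap (tob k) \<Phi>) = admissible tcl \<Phi>"
  by (rule admissible_smap) (auto simp: sty_iff tob_cl)

lemma stob_structural: "sty \<Phi> \<Longrightarrow> structural (cl (S2 k)) (smap (tob k) \<Phi>) \<sigma> = structural tcl \<Phi> \<sigma>"
  by (rule structural_smap) (auto simp: sty_iff tob_cl)

lemma stob_valid: "sty \<Phi> \<Longrightarrow> valid (S2 k) (smap (tob k) \<Phi>) \<longleftrightarrow> admissible tcl \<Phi>"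
  unfolding valid_def stob_admissible fst_set_smap by (auto simp: sty_iff tob_Ob)

lemma sequent_iff: "sequent D ord S \<Phi> \<longleftrightarrow> sty \<Phi> \<and> valid (S2 k) (smap (tob k) \<Phi>)"
  unfolding sequent_def using stob_valid by blast

text \<open>Used with \<open>h\<close> the object part of a proto-extremal lift and \<open>g\<close>
  the naming of objects by types: instantiating by types and then naming has the effect of applying
  the lift.\<close>

lemma inst_eq:
  assumes R: "isty (Vtx c Rs)" and L: "map h (ord c) = map g Rs"
    and \<Phi>: "fst ` set \<Phi> \<subseteq> Ob (cone_reduct D c)"
  shows "sty (inst ord c Rs \<Phi>)" "smap g (inst ord c Rs \<Phi>) = smap h \<Phi>"
proof -
  have c: "c \<in> cones D" and len: "length Rs = length (ord c)" using R by (simp_all add: isty_Vtx)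
  let ?m = "\<lambda>r. the (map_of (zip (ord c) Rs) r)"
  have m: "isty (?m r) \<and> g (?m r) = h r" if r: "r \<in> fst ` set \<Phi>" for r
  proof -
    have "r \<in> set (ord c)" using r \<Phi> ord[OF c] by blast
    then obtain i where i: "i < length (ord c)" "r = ord c ! i" by (auto simp: in_set_conv_nth)
    have "?m r = Rs ! i" using i len ord[OF c] by (simp add: map_of_zip_nth)
    moreover have "h r = g (Rs ! i)" using L i len by (metis nth_map)
    ultimately show ?thesis using R i len by (simp add: isty_Vtx)
  qed
  show "sty (inst ord c Rs \<Phi>)" unfolding sty_iff inst_def fst_set_smap using m by blast
  show "smap g (inst ord c Rs \<Phi>) = smap h \<Phi>"
    unfolding inst_def smap_smap by (rule smap_cong) (use m in blast)
qed

lemma prj_Ob: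
  assumes c: "c \<in> cones D" and "(\<Phi>, f) \<in> set (prj c)"
  shows "fst ` set \<Phi> \<subseteq> Ob (cone_reduct D c)" "f \<in> Hom (cone D c) (\<Phi> @ [vtx D c])"
    "abstract_projection (cone D c) (vtx D c) \<Phi> f"
proof -
  interpret cone_basis "cone D c" "vtx D c" "prj c" by (rule cone_basis[OF c])
  note p = ps_proj[OF assms(2)]
  show "f \<in> Hom (cone D c) (\<Phi> @ [vtx D c])" using p by blast
  show "fst ` set \<Phi> \<subseteq> Ob (cone_reduct D c)"
    using p lnl_valid[OF C, of f "\<Phi> @ [vtx D c]"] by (auto simp: valid_def subset_Diff_insert)
  show "abstract_projection (cone D c) (vtx D c) \<Phi> f" using p by (simp add: abstract_projection_def)
qed

end

section \<open>Every derivable sequent is inhabited\<close>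

context free_tower
begin

text \<open>The inhabited premises provide values at the listed projections, and
  \<open>exp_functor_ex\<close> turns these into a functor out of the pre-expansion. The side
  condition on the base allows the cone over the base to be extended to chi, as a cell
  requires.\<close>

lemma universal_cell:
  assumes R: "isty (Vtx c Rs)" and seq: "sequent D ord S ((Vtx c Rs, flip (snd (vtx D c))) # \<Psi>)"
    and base: "Hom (base D) (smap (\<lambda>R. base_obj D (tcl R)) ((Vtx c Rs, flip (snd (vtx D c))) # \<Psi>)) \<noteq> {}"
    and ne: "\<And>\<Phi> f. (\<Phi>, f) \<in> set (prj c) \<Longrightarrow> Hom (S2 k) (smap (tob k) (inst ord c Rs \<Phi> @ \<Psi>)) \<noteq> {}"
  shows "\<exists>E u. (c, map (map_prod tcl id) \<Psi>, E, {}, u) \<in> cells2 D (stg2 X k) \<and>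
    fob u (Inl (fst (vtx D c))) = tob k (Vtx c Rs) \<and>
    smap (fob u) (new (map (map_prod tcl id) \<Psi>)) = smap (tob k) \<Psi>"
proof -
  let ?C = "cone D c" and ?K = "vtx D c" and ?\<Gamma> = "(Vtx c Rs, flip (snd (vtx D c))) # \<Psi>"
  define \<psi> where "\<psi> = map (map_prod tcl id) \<Psi>"
  have c: "c \<in> cones D" using R by (simp add: isty_Vtx)
  have \<Psi>: "sty \<Psi>" and v\<Gamma>: "valid (S2 k) (smap (tob k) ?\<Gamma>)" using seq unfolding sequent_iff[of _ k] by simp_all
  obtain L where L: "L \<in> pext (stg2 X k) c" "fob L (fst ?K) = tob k (Vtx c Rs)"
    using pext_exists[OF R] by blast
  have LF: "is_functor ?C (S2 k) L" by (rule sketch_pext[OF sk2 c L(1)])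
  have dK: "dual (map_prod (fob L) id ?K) = (tob k (Vtx c Rs), flip (snd ?K))"
    using L(2) by (simp add: dual_def)
  have v: "valid (S2 k) (dual (map_prod (fob L) id ?K) # smap (tob k) \<Psi>)" using v\<Gamma> by (simp add: dK)
  have ty\<Psi>: "isty (fst (\<Psi> ! j))" if "j < length \<Psi>" for j
    using \<Psi> that nth_mem[OF that] unfolding sty_iff by blast
  define h' where "h' = case_sum (fob L) (\<lambda>j. tob k (fst (\<Psi> ! j)))"
  have new_h': "smap h' (new \<psi>) = smap (tob k) \<Psi>"
    by (rule nth_equalityI) (auto simp: \<psi>_def new_def smap_def h'_def map_prod_def split: prod.splits)
  have adm: "admissible (exp_cl ?C \<psi>) (old [dual ?K] @ new \<psi>)"
  proof -
    have "admissible (cl (S2 k)) (smap h' (old [dual ?K] @ new \<psi>)) = admissible (exp_cl ?C \<psi>) (old [dual ?K] @ new \<psi>)"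
      by (rule admissible_smap)
        (use functor_cl[OF LF vtx_Ob[OF c]] tob_cl ty\<Psi> in \<open>auto simp: h'_def exp_cl_def new_def \<psi>_def\<close>)
    moreover have "smap h' (old [dual ?K] @ new \<psi>) = smap (tob k) ?\<Gamma>"
      using new_h' L(2) by (simp add: h'_def dual_def)
    ultimately show ?thesis using v\<Gamma> by (simp add: valid_def)
  qed
  interpret cone_expn ?C ?K "prj c" \<psi>
    by (intro cone_expn.intro cone_basis[OF c] expn.intro cone_lnl[OF c] vtx_Ob[OF c] adm)
  \<comment> \<open>Arbitrary inhabitants will do: some cell is wanted, not a particular
    chi.\<close>
  define y where "y \<Phi> f = (SOME z. z \<in> Hom (S2 k) (smap (fob L) \<Phi> @ smap (tob k) \<Psi>))" for \<Phi> :: "'r signed list" and f :: 'p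
  have y': "y \<Phi> f \<in> Hom (S2 k) (smap (fob L) \<Phi> @ smap (tob k) \<Psi>)" if "(\<Phi>, f) \<in> set (prj c)" for \<Phi> f
    using ne[OF that] inst_eq(2)[OF R pext_ord[OF R L] prj_Ob(1)[OF c that]] by (simp add: y_def some_in_eq)
  have "\<psi> = map (map_prod (cl (S2 k)) id) (smap (tob k) \<Psi>)"
    unfolding \<psi>_def smap_def using \<Psi> tob_cl by (auto simp: sty_iff)
  note ex = exp_functor_ex[OF sketch_lnl[OF sk2] LF v _ this, of y]
  obtain u where u: "is_functor (EC {}) (S2 k) u" "fcomp ?C u (exp_incl ?C ?K \<psi> {}) = L" "smap (fob u) (new \<psi>) = smap (tob k) \<Psi>"
    using ex y' by blast
  define b where "b R = base_obj D (exp_cl ?C \<psi> R)" for R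
  have ou: "fob (over (stg2 X k)) (fob u R) = b R" "b R \<in> Ob (base D)" "cl (base D) (b R) = exp_cl ?C \<psi> R"
    if R: "R \<in> exp_Ob ?C \<psi>" for R
  proof -
    note o = sketch_over[OF sk2, of k]
    have uR: "fob u R \<in> Ob (S2 k)" "cl (S2 k) (fob u R) = exp_cl ?C \<psi> R"
      using functorD(1,2)[OF u(1), of R] R by (simp_all add: exp_simps)
    have "cl (base D) (fob (over (stg2 X k)) (fob u R)) = exp_cl ?C \<psi> R"
      using functor_cl[OF o uR(1)] uR(2) by simp
    then show "fob (over (stg2 X k)) (fob u R) = b R" "b R \<in> Ob (base D)" "cl (base D) (b R) = exp_cl ?C \<psi> R"
      using base_obj[OF functor_ob[OF o uR(1)]] functor_ob[OF o uR(1)] by (simp_all add: b_def)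
  qed
  have ne: "Hom (base D) (smap b \<Xi>) \<noteq> {}" if x: "x \<in> Hom (EC {}) \<Xi>" for x \<Xi>
  proof -
    have "smap (fob (over (stg2 X k))) (smap (fob u) \<Xi>) = smap b \<Xi>"
      unfolding smap_smap by (rule smap_fctr_cong[OF lnl_ops_valid[OF exp_simps(4) x]]) (use ou(1) in \<open>simp add: exp_simps\<close>)
    then show ?thesis using functor_hom[OF sketch_over[OF sk2] functor_hom[OF u(1) x]] by auto
  qed
  have vb: "valid (base D) (smap b \<Xi>) \<and> structural (cl (base D)) (smap b \<Xi>) \<sigma> = structural (exp_cl ?C \<psi>) \<Xi> \<sigma>"
    if "valid (EC {0}) \<Xi>" for \<Xi> \<sigma>
  proof -
    have R: "\<And>R. R \<in> fst ` set \<Xi> \<Longrightarrow> R \<in> exp_Ob ?C \<psi>" using that by (auto simp: valid_def exp_simps)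
    have "admissible (cl (base D)) (smap b \<Xi>) = admissible (exp_cl ?C \<psi>) \<Xi>"
      by (rule admissible_smap) (use R ou in blast)
    moreover have "structural (cl (base D)) (smap b \<Xi>) \<sigma> = structural (exp_cl ?C \<psi>) \<Xi> \<sigma>"
      by (rule structural_smap) (use R ou in blast)
    moreover have "b ` fst ` set \<Xi> \<subseteq> Ob (base D)" using R ou by blast
    ultimately show ?thesis using that by (simp add: valid_def fst_set_smap exp_simps)
  qed
  \<comment> \<open>Nonemptiness over the base is propagated from the generators: the side condition
    of the rule covers chi, and the functor \<open>u\<close> followed by the projection of the stage
    covers the others.\<close>
  have ne0: "Hom (base D) (smap b \<Xi>) \<noteq> {}" if x: "x \<in> Hom (EC {0}) \<Xi>" for x \<Xi>
  proof (rule exp_generated[where M = "\<lambda>\<Xi> _. Hom (base D) (smap b \<Xi>) \<noteq> {}", OF _ _ _ _ x])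
    show "op_closed (EC {0}) (\<lambda>\<Xi> _. Hom (base D) (smap b \<Xi>) \<noteq> {})"
    proof (rule op_closedI)
      show "Hom (base D) (smap b [(R, Neg), (R, Pos)]) \<noteq> {}" if "R \<in> Ob (EC {0})" for R
        using lnl_idn[OF base_lnl ou(2)] that by (auto simp: exp_simps)
      show "Hom (base D) (smap b \<Xi>) \<noteq> {}"
        if a: "Hom (base D) (smap b (pull \<Xi> \<sigma>)) \<noteq> {}" "valid (EC {0}) \<Xi>" "structural (cl (EC {0})) \<Xi> \<sigma>" for \<Xi> \<sigma>
      proof -
        from a(1) obtain z where "z \<in> Hom (base D) (pull (smap b \<Xi>) \<sigma>)"
          by (auto simp: pull_smap_structural[OF a(3)])
        from lnl_act[OF base_lnl this] show ?thesis using vb[OF a(2)] a(3) by (auto simp: exp_simps)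
      qed
      show "Hom (base D) (smap b (\<Xi> @ \<Theta>)) \<noteq> {}"
        if ne2: "Hom (base D) (smap b (\<Xi> @ [M])) \<noteq> {}" "Hom (base D) (smap b (dual M # \<Theta>)) \<noteq> {}" for \<Xi> M \<Theta>
      proof -
        from ne2 obtain z w where "z \<in> Hom (base D) (smap b \<Xi> @ [map_prod b id M])"
          "w \<in> Hom (base D) (dual (map_prod b id M) # smap b \<Theta>)" by (auto simp: dual_map_prod)
        from lnl_cmp[OF base_lnl this] show ?thesis by auto
      qed
    qed
    show "Hom (base D) (smap b (old \<Phi>)) \<noteq> {}" if "f \<in> Hom ?C \<Phi>" for \<Phi> f
      by (rule ne[of "ecls {} (old \<Phi>) (TGen (Mor \<Phi> f))"]) (use wt_Mor[OF that, of "{}"] in \<open>auto simp: exp_simps\<close>)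
    show "Hom (base D) (smap b (old \<Phi> @ new \<psi>)) \<noteq> {}" if "abstract_projection ?C ?K \<Phi> f" for \<Phi> f
      by (rule ne[of "ecls {} (old \<Phi> @ new \<psi>) (TGen (Til \<Phi> f))"]) (use wt_Til[OF that, of "{}"] in \<open>auto simp: exp_simps\<close>)
    have "smap b (new \<psi>) = smap (\<lambda>R. base_obj D (tcl R)) \<Psi>"
      by (rule nth_equalityI) (auto simp: \<psi>_def new_def smap_def b_def exp_cl_def map_prod_def split: prod.splits)
    then have "smap b (old [dual ?K] @ new \<psi>) = smap (\<lambda>R. base_obj D (tcl R)) ?\<Gamma>"
      by (simp add: b_def exp_cl_def dual_def)
    then show "Hom (base D) (smap b (old [dual ?K] @ new \<psi>)) \<noteq> {}" using base by simp
  qed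
  \<comment> \<open>All values are forced, as a hom-set of the base has at most one element.\<close>
  define E where "E = mk_fctr (EC {0}) b (\<lambda>\<Xi> _. SOME x. x \<in> Hom (base D) (smap b \<Xi>))"
  have Eob: "fob E R = b R" if "R \<in> exp_Ob ?C \<psi>" for R using that by (simp add: E_def mk_fctr_simps exp_simps)
  have Ecarries: "carries (EC {0}) (base D) E"
    unfolding carries_def
  proof (intro conjI ballI allI)
    fix \<Xi> x assume x: "x \<in> Hom (EC {0}) \<Xi>"
    have "smap (fob E) \<Xi> = smap b \<Xi>"
      by (rule smap_fctr_cong[OF lnl_ops_valid[OF exp_simps(4) x]]) (use Eob in \<open>simp add: exp_simps\<close>)
    moreover have "fmor E \<Xi> x = (SOME x. x \<in> Hom (base D) (smap b \<Xi>))" using x unfolding E_def by (rule mk_fctr_simps)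
    moreover have "(SOME x. x \<in> Hom (base D) (smap b \<Xi>)) \<in> Hom (base D) (smap b \<Xi>)"
      using ne0[OF x] by (simp add: some_in_eq)
    ultimately show "fmor E \<Xi> x \<in> Hom (base D) (smap (fob E) \<Xi>)" by simp
  qed (use Eob ou in \<open>simp_all add: exp_simps\<close>)
  note thin = functor_to_thin[OF _ _ lnl_lnl_ops[OF base_lnl] base_thin]
  have EF: "is_functor (EC {0}) (base D) E"
    by (rule thin[OF Ecarries exp_simps(4)]) (auto simp: E_def mk_fctr_def)
  have EI: "fcomp ?C E (exp_incl ?C ?K \<psi> {0}) = cfun D c"
  proof (rule subterminal_functor_eq[OF sub _ cfun_functor[OF c] lnl_valid[OF C]])
    show "is_functor ?C (base D) (fcomp ?C E (exp_incl ?C ?K \<psi> {0}))"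
      by (rule thin[OF carries_fcomp[OF exp_incl_carries Ecarries lnl_lnl_ops[OF C]] lnl_lnl_ops[OF C]])
        (auto simp: fcomp_def mk_fctr_def)
  qed
  have EM: "fcomp (EC {}) (over (stg2 X k)) u = fcomp (EC {}) E (merge_chi ?C ?K \<psi> {})"
  proof (rule subterminal_functor_eq[OF sub functor_fcomp[OF u(1) sketch_over[OF sk2] exp_simps(4)] _ lnl_ops_valid[OF exp_simps(4)]])
    show "is_functor (EC {}) (base D) (fcomp (EC {}) E (merge_chi ?C ?K \<psi> {}))"
      by (rule thin[OF carries_fcomp[OF merge_carries Ecarries exp_simps(4)] exp_simps(4)])
        (auto simp: fcomp_def mk_fctr_def)
  qed
  have "sketch_mor D (exp_sketch D c \<psi> E {}) (stg2 X k) u"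
    using u(1,2) L(1) EM by (auto simp: sketch_mor_def exp_sketch_def Let_def split: if_splits)
  then have "(c, \<psi>, E, {}, u) \<in> cells2 D (stg2 X k)"
    using c adm EF EI by (simp add: cells2_def)
  moreover have "fob u (Inl (fst ?K)) = tob k (Vtx c Rs)"
  proof -
    have "fob (fcomp ?C u (exp_incl ?C ?K \<psi> {})) (fst ?K) = tob k (Vtx c Rs)" using u(2) L(2) by simp
    then show ?thesis using vtx_Ob[OF c] by (simp add: fcomp_simps exp_incl_simps)
  qed
  ultimately show ?thesis using u(3) unfolding \<psi>_def by blast
qed

lemma cell_chi:
  assumes cell: "(c, \<psi>, E, {}, u) \<in> cells2 D (stg2 X k)" and R: "isty (Vtx c Rs)" "sty \<Psi>"
    and u: "fob u (Inl (fst (vtx D c))) = tob k (Vtx c Rs)" "smap (fob u) (new \<psi>) = smap (tob k) \<Psi>"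
  shows "fmor (att2 X k (c, \<psi>, E, {}, u)) (old [dual (vtx D c)] @ new \<psi>)
      (exp_class (cone D c) (vtx D c) \<psi> {0} (old [dual (vtx D c)] @ new \<psi>) (TGen (Chi 0)))
    \<in> Hom (S2 (Suc k)) (smap (tob (Suc k)) ((Vtx c Rs, flip (snd (vtx D c))) # \<Psi>))"
    "smap (fob (att2 X k (c, \<psi>, E, {}, u))) (old [dual (vtx D c)] @ new \<psi>) =
       smap (tob (Suc k)) ((Vtx c Rs, flip (snd (vtx D c))) # \<Psi>)"
proof -
  interpret expn "cone D c" "vtx D c" \<psi> by (rule cells2D(2)[OF cell])
  let ?\<Xi> = "old [dual (vtx D c)] @ new \<psi>" and ?a = "att2 X k (c, \<psi>, E, {}, u)"
  have w: "ewt {0} ?\<Xi> (TGen (Chi 0))" by (rule wt_Chi) simp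
  then have H: "ecls {0} ?\<Xi> (TGen (Chi 0)) \<in> Hom (EC {0}) ?\<Xi>" by (auto simp: exp_simps)
  have "smap (fob ?a) ?\<Xi> = smap (fob (inc2 X k)) (smap (fob u) ?\<Xi>)"
    unfolding smap_smap by (rule smap_fctr_cong[OF lnl_ops_valid[OF exp_simps(4) H]])
      (use att2_comm(1)[OF cell] in \<open>simp add: exp_simps\<close>)
  also have "smap (fob u) ?\<Xi> = smap (tob k) ((Vtx c Rs, flip (snd (vtx D c))) # \<Psi>)"
    using u by (simp add: dual_def)
  also have "smap (fob (inc2 X k)) \<dots> = smap (tob (Suc k)) ((Vtx c Rs, flip (snd (vtx D c))) # \<Psi>)"
    by (rule stob_Suc) (use R in simp)
  finally show eq: "smap (fob ?a) ?\<Xi> = smap (tob (Suc k)) ((Vtx c Rs, flip (snd (vtx D c))) # \<Psi>)" .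
  show "fmor ?a ?\<Xi> (ecls {0} ?\<Xi> (TGen (Chi 0))) \<in> Hom (S2 (Suc k)) (smap (tob (Suc k)) ((Vtx c Rs, flip (snd (vtx D c))) # \<Psi>))"
    using functor_hom[OF cells2D(6)[OF cell] H] unfolding eq .
qed

lemma inhabited_mono:
  assumes "sty \<Phi>" "Hom (S2 k) (smap (tob k) \<Phi>) \<noteq> {}" "k \<le> m"
  shows "Hom (S2 m) (smap (tob m) \<Phi>) \<noteq> {}"
  using assms(3)
proof (induction rule: dec_induct)
  case (step m)
  then obtain x where "x \<in> Hom (S2 m) (smap (tob m) \<Phi>)" by blast
  from functor_hom[OF inc2 this] show ?case using stob_Suc[OF assms(1)] by auto
qed (rule assms(2))

lemma tob_Base: "A \<in> Ob S \<Longrightarrow> tob 0 (Base A) = fob (leg1 X 0) A"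
  by (intro tobI) (auto simp: isty_Base tf_e stg1_0 plain_sketch_def intro: leg1_Ob)

text \<open>The stage is existential: for a cut or an invertible rule, the inhabitants of the
  premises are moved to a common stage. A chi is then adjoined one stage later.\<close>

lemma derives_inhabited: "derives D ord prj S d \<Phi> \<Longrightarrow> sty \<Phi> \<and> (\<exists>k. Hom (S2 k) (smap (tob k) \<Phi>) \<noteq> {})"
proof (induction rule: derives.induct)
  case (identity R \<tau>)
  then have R: "isty R" by (rule is_type_isty)
  then show ?case using lnl_idn[OF sketch_lnl[OF sk2] tob_Ob[OF R]] by auto
next
  case (cut d \<Phi> K d' \<Psi>)
  then obtain i j where "Hom (S2 i) (smap (tob i) (\<Phi> @ [K])) \<noteq> {}" "Hom (S2 j) (smap (tob j) (dual K # \<Psi>)) \<noteq> {}"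
    by blast
  from inhabited_mono[OF _ this(1), of "max i j"] inhabited_mono[OF _ this(2), of "max i j"]
  have "Hom (S2 (max i j)) (smap (tob (max i j)) (\<Phi> @ [K])) \<noteq> {}" "Hom (S2 (max i j)) (smap (tob (max i j)) (dual K # \<Psi>)) \<noteq> {}"
    using cut.IH by (auto simp del: smap_simps)
  then obtain x y where "x \<in> Hom (S2 (max i j)) (smap (tob (max i j)) \<Phi> @ [map_prod (tob (max i j)) id K])"
    "y \<in> Hom (S2 (max i j)) (dual (map_prod (tob (max i j)) id K) # smap (tob (max i j)) \<Psi>)"
    by (auto simp: dual_map_prod)
  from lnl_cmp[OF sketch_lnl[OF sk2] this] show ?case using cut.IH by auto
next
  case (structural d \<Phi> \<sigma>)
  then obtain k x where x: "x \<in> Hom (S2 k) (pull (smap (tob k) \<Phi>) \<sigma>)"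
    unfolding pull_smap_structural[OF structural(3)] by blast
  have s: "sty \<Phi>" "valid (S2 k) (smap (tob k) \<Phi>)" using structural(2) unfolding sequent_iff[of _ k] by simp_all
  from lnl_act[OF sketch_lnl[OF sk2] x s(2)] show ?case using s(1) stob_structural structural(3) by auto
next
  case (generator f \<Phi>)
  have v: "valid S \<Phi>" by (rule lnl_valid[OF S generator])
  have "smap (tob 0) (smap Base \<Phi>) = smap (fob (leg1 X 0)) \<Phi>"
    unfolding smap_smap by (rule smap_fctr_cong[OF v]) (rule tob_Base)
  moreover have "fmor (leg1 X 0) \<Phi> f \<in> Hom (S2 0) (smap (fob (leg1 X 0)) \<Phi>)"
    using functor_hom[OF leg1, of f 0 \<Phi>] generator by (simp add: stg1_0 plain_sketch_def S2_0)
  moreover have "sty (smap Base \<Phi>)" using v by (auto simp: sty_iff fst_set_smap valid_def isty_Base)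
  ultimately show ?case by (metis empty_iff)
next
  case (noninvertible c Rs \<tau> \<Phi> f)
  have R: "isty (Vtx c Rs)" by (rule is_type_isty[OF noninvertible(1)])
  have c: "c \<in> cones D" using R by (simp add: isty_Vtx)
  obtain L where L: "L \<in> pext (stg2 X 0) c" "fob L (fst (vtx D c)) = tob 0 (Vtx c Rs)"
    using pext_exists[OF R] by blast
  note p = prj_Ob[OF c noninvertible(2)]
  note i = inst_eq[OF R pext_ord[OF R L] p(1)]
  have "fmor L (\<Phi> @ [vtx D c]) f \<in> Hom (S2 0) (smap (tob 0) (inst ord c Rs \<Phi> @ [(Vtx c Rs, snd (vtx D c))]))"
    using functor_hom[OF sketch_pext[OF sk2 c L(1)] p(2)] i(2) L(2) by (cases "vtx D c") simp
  then show ?case using i(1) R by auto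
next
  case (invertible c Rs \<tau> \<Psi> ds)
  have R: "isty (Vtx c Rs)" by (rule is_type_isty[OF invertible(1)])
  let ?\<Gamma> = "\<lambda>i. inst ord c Rs (fst (prj c ! i)) @ \<Psi>"
  have ih: "sty (?\<Gamma> i)" "\<exists>k. Hom (S2 k) (smap (tob k) (?\<Gamma> i)) \<noteq> {}" if "i < length (prj c)" for i
    using invertible that by auto
  then obtain ki where ki: "\<And>i. i < length (prj c) \<Longrightarrow> Hom (S2 (ki i)) (smap (tob (ki i)) (?\<Gamma> i)) \<noteq> {}" by metis
  \<comment> \<open>A common stage for all premises; \<open>0\<close> keeps the set nonempty for a
    cone without projections.\<close>
  define k where "k = Max (insert 0 (ki ` {..<length (prj c)}))"
  have "Hom (S2 k) (smap (tob k) (?\<Gamma> i)) \<noteq> {}" if "i < length (prj c)" for i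
    by (rule inhabited_mono[OF ih(1)[OF that] ki[OF that]]) (use that in \<open>auto simp: k_def intro: Max_ge\<close>)
  then have ne: "Hom (S2 k) (smap (tob k) (inst ord c Rs \<Phi> @ \<Psi>)) \<noteq> {}" if "(\<Phi>, f) \<in> set (prj c)" for \<Phi> f
    using that by (metis fst_conv in_set_conv_nth)
  obtain E u where "(c, map (map_prod tcl id) \<Psi>, E, {}, u) \<in> cells2 D (stg2 X k)"
    "fob u (Inl (fst (vtx D c))) = tob k (Vtx c Rs)" "smap (fob u) (new (map (map_prod tcl id) \<Psi>)) = smap (tob k) \<Psi>"
    using universal_cell[OF R invertible(2,3), of k] ne by blast
  moreover have "sty ((Vtx c Rs, flip (snd (vtx D c))) # \<Psi>)" using invertible(2) by (simp add: sequent_def)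
  ultimately show ?case using cell_chi(1)[OF _ R, of _ E u k \<Psi>] by auto
qed

end

section \<open>The denotation of derivations\<close>

primrec delay :: "('o, 'c) ty signed list \<Rightarrow> nat \<Rightarrow> ('o, 'm, 'c, 'r, 'p) deriv \<Rightarrow> ('o, 'm, 'c, 'r, 'p) deriv" where
  "delay \<Phi> 0 d = d"
| "delay \<Phi> (Suc j) d = DStr \<Phi> [0..<length \<Phi>] (delay \<Phi> j d)"

text \<open>Recognises an invertible rule below any number of identity structural steps.
  \<open>den_raise\<close> excludes this shape, so that such a stack is read only as the code of an
  invertible rule.\<close>

fun delayed :: "('o, 'm, 'c, 'r, 'p) deriv \<Rightarrow> bool" where
  "delayed (DInv c Rs \<Psi> ds) \<longleftrightarrow> True"
| "delayed (DStr \<Phi> \<sigma> d) \<longleftrightarrow> \<sigma> = [0..<length \<Phi>] \<and> delayed d"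
| "delayed _ \<longleftrightarrow> False"

lemma delayed_delay [simp]: "delayed (delay \<Phi> j (DInv c Rs \<Psi> ds))"
  by (induction j) auto

lemma delay_neq [simp]:
  "delay \<Phi> j (DInv c Rs \<Psi> ds) \<noteq> DId R" "delay \<Phi> j (DInv c Rs \<Psi> ds) \<noteq> DCut \<Theta> K \<Xi> d d'"
  "delay \<Phi> j (DInv c Rs \<Psi> ds) \<noteq> DGen \<Theta>' f" "delay \<Phi> j (DInv c Rs \<Psi> ds) \<noteq> DNoninv c' Rs' \<Theta>'' f'"
  "DId R \<noteq> delay \<Phi> j (DInv c Rs \<Psi> ds)" "DCut \<Theta> K \<Xi> d d' \<noteq> delay \<Phi> j (DInv c Rs \<Psi> ds)"
  "DGen \<Theta>' f \<noteq> delay \<Phi> j (DInv c Rs \<Psi> ds)" "DNoninv c' Rs' \<Theta>'' f' \<noteq> delay \<Phi> j (DInv c Rs \<Psi> ds)"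
  by (cases j; simp)+

lemma delay_eq: "delay \<Phi> j (DInv c Rs \<Psi> ds) = delay \<Phi>' j' (DInv c' Rs' \<Psi>' ds') \<Longrightarrow>
   j = j' \<and> c = c' \<and> Rs = Rs' \<and> \<Psi> = \<Psi>' \<and> ds = ds'"
proof (induction j arbitrary: j')
  case 0 then show ?case by (cases j') auto
next
  case (Suc j) then show ?case by (cases j') auto
qed

lemma (in cone_basis) generated:
  assumes M: "op_closed C M" and ps: "\<And>\<Phi> f. (\<Phi>, f) \<in> set ps \<Longrightarrow> M (\<Phi> @ [K]) f" and x: "x \<in> Hom C \<Xi>"
  shows "M \<Xi> x"
proof -
  obtain \<Psi> g \<sigma> where n: "nf \<Xi> \<Psi> g \<sigma> x" using nf_ex1[OF x] by auto
  then have g: "g \<in> Hom C (pull \<Xi> \<sigma>) \<and> M (pull \<Xi> \<sigma>) g"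
    unfolding nf_def using lnl_idn[OF C] op_closed_idn[OF M] ps ps_proj by auto
  show ?thesis
    using op_closed_act[OF M _ _ lnl_valid[OF C x], of g \<sigma>] g n unfolding nf_def by auto
qed

context free_tower
begin

primrec rz :: "('o, 'c) ty signed list \<Rightarrow> nat \<Rightarrow> nat \<Rightarrow> 'm \<Rightarrow> 'm" where
  "rz \<Phi> k 0 y = y"
| "rz \<Phi> k (Suc i) y = fmor (inc2 X (k + i)) (smap (tob (k + i)) \<Phi>) (rz \<Phi> k i y)"

abbreviation "vty c Rs \<Psi> \<equiv> (Vtx c Rs, flip (snd (vtx D c))) # \<Psi>"
abbreviation "chi c \<psi> E u k \<equiv> fmor (att2 X k (c, \<psi>, E, {}, u)) (old [dual (vtx D c)] @ new \<psi>)
  (exp_class (cone D c) (vtx D c) \<psi> {0} (old [dual (vtx D c)] @ new \<psi>) (TGen (Chi 0)))"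
text \<open>The image under the attaching map of the tilde morphism of a projection, that is, what
  the corresponding premise has to denote.\<close>

abbreviation "tilm c \<psi> u p \<equiv> fmor u (old (fst p) @ new \<psi>)
  (exp_class (cone D c) (vtx D c) \<psi> {} (old (fst p) @ new \<psi>) (TGen (Til (fst p) (snd p))))"

text \<open>\<open>den \<Phi> d k y\<close>: the derivation \<open>d\<close> denotes the morphism \<open>y\<close> of stage \<open>k\<close>. Identity structural
  steps act trivially on morphisms, so they are free to carry information about stages: in general
  such a step moves a morphism to the next stage, but a sequence of them on top of an invertible
  rule encodes the stage at which the universal morphism is adjoined and the number of later
  stages to which it is moved. (For a cone without projections the premises do not determine this.)
  Nothing has to be known about equality in the colimit then.\<close>

inductive den :: "('o, 'c) ty signed list \<Rightarrow> ('o, 'm, 'c, 'r, 'p) deriv \<Rightarrow> nat \<Rightarrow> 'm \<Rightarrow> bool" where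
  den_id: "isty R \<Longrightarrow> den [(R, Neg), (R, Pos)] (DId R) 0 (idn (S2 0) (tob 0 R))"
| den_cut: "den (\<Phi> @ [K]) d k y \<Longrightarrow> den (dual K # \<Psi>) d' k y' \<Longrightarrow>
    den (\<Phi> @ \<Psi>) (DCut \<Phi> K \<Psi> d d') k (cmp (S2 k) (smap (tob k) \<Phi>) (map_prod (tob k) id K) (smap (tob k) \<Psi>) y' y)"
| den_raise: "den \<Phi> d k y \<Longrightarrow> \<not> delayed d \<Longrightarrow> den \<Phi> (DStr \<Phi> [0..<length \<Phi>] d) (Suc k) (fmor (inc2 X k) (smap (tob k) \<Phi>) y)"
| den_str: "den (pull \<Phi> \<sigma>) d k y \<Longrightarrow> \<sigma> \<noteq> [0..<length \<Phi>] \<Longrightarrow> sequent D ord S \<Phi> \<Longrightarrow> structural tcl \<Phi> \<sigma> \<Longrightarrow>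
    den \<Phi> (DStr \<Phi> \<sigma> d) k (act (S2 k) (smap (tob k) \<Phi>) \<sigma> y)"
| den_gen: "f \<in> Hom S \<Phi> \<Longrightarrow> den (smap Base \<Phi>) (DGen \<Phi> f) 0 (fmor (leg1 X 0) \<Phi> f)"
| den_noninv: "isty (Vtx c Rs) \<Longrightarrow> (\<Phi>, f) \<in> set (prj c) \<Longrightarrow> L \<in> pext (stg2 X 0) c \<Longrightarrow>
    fob L (fst (vtx D c)) = tob 0 (Vtx c Rs) \<Longrightarrow>
    den (inst ord c Rs \<Phi> @ [(Vtx c Rs, snd (vtx D c))]) (DNoninv c Rs \<Phi> f) 0 (fmor L (\<Phi> @ [vtx D c]) f)"
| den_inv: "isty (Vtx c Rs) \<Longrightarrow> sequent D ord S (vty c Rs \<Psi>) \<Longrightarrow> \<psi> = map (map_prod tcl id) \<Psi> \<Longrightarrow>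
    (c, \<psi>, E, {}, u) \<in> cells2 D (stg2 X k) \<Longrightarrow> fob u (Inl (fst (vtx D c))) = tob k (Vtx c Rs) \<Longrightarrow>
    smap (fob u) (new \<psi>) = smap (tob k) \<Psi> \<Longrightarrow> length ds = length (prj c) \<Longrightarrow>
    (\<And>i. i < length ds \<Longrightarrow> den (inst ord c Rs (fst (prj c ! i)) @ \<Psi>) (ds ! i) k (tilm c \<psi> u (prj c ! i))) \<Longrightarrow>
    den (vty c Rs \<Psi>) (delay (vty c Rs \<Psi>) (prod_encode (k, i)) (DInv c Rs \<Psi> ds)) (Suc k + i)
      (rz (vty c Rs \<Psi>) (Suc k) i (chi c \<psi> E u k))"

inductive_cases den_DIdE: "den \<Phi> (DId R) k y"
inductive_cases den_DCutE: "den \<Theta> (DCut \<Phi> K \<Psi> d d') k y"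
inductive_cases den_DGenE: "den \<Theta> (DGen \<Phi> f) k y"
inductive_cases den_DNoninvE: "den \<Theta> (DNoninv c Rs \<Phi> f) k y"
inductive_cases den_DStrE: "den \<Theta> (DStr \<Phi> \<sigma> d) k y"

text \<open>\<open>E\<close> is unique because the base is subterminal, the cone part of
  \<open>u\<close> because a proto-extremal lift is known from its vertex, and the remainder of
  \<open>u\<close> by \<open>exp_functor_unique\<close>.\<close>

lemma cell_unique2:
  assumes 1: "(c, \<psi>, E, {}, u) \<in> cells2 D (stg2 X k)" and 2: "(c, \<psi>, E', {}, u') \<in> cells2 D (stg2 X k)"
    and v: "fob u (Inl (fst (vtx D c))) = fob u' (Inl (fst (vtx D c)))"
    and n: "smap (fob u) (new \<psi>) = smap (fob u') (new \<psi>)"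
    and t: "\<And>p. p \<in> set (prj c) \<Longrightarrow> tilm c \<psi> u p = tilm c \<psi> u' p"
  shows "E = E' \<and> u = u'"
proof -
  note c1 = cells2D[OF 1] and c2 = cells2D[OF 2]
  interpret expn "cone D c" "vtx D c" \<psi> by (rule c1(2))
  interpret cone_expn "cone D c" "vtx D c" "prj c" \<psi>
    by (intro cone_expn.intro cone_basis[OF c1(1)] expn_axioms)
  have "E = E'" by (rule subterminal_functor_eq[OF sub c1(7) c2(7) lnl_ops_valid[OF exp_simps(4)]])
  moreover have "u = u'"
  proof (rule exp_functor_unique[OF c1(4) c2(4) _ n])
    show "fcomp (cone D c) u (exp_incl (cone D c) (vtx D c) \<psi> {}) = fcomp (cone D c) u' (exp_incl (cone D c) (vtx D c) \<psi> {})"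
      by (rule pext_unique[OF c1(1,5) c2(5)]) (use v vtx_Ob[OF c1(1)] in \<open>simp add: fcomp_simps exp_incl_simps\<close>)
  qed (use t in force)
  ultimately show ?thesis by simp
qed

text \<open>The second denotation is inverted rule by rule. For an invertible rule the length of the
  delay gives the stage, and then \<open>cell_unique2\<close> turns equal denotations of the
  premises into equal cells.\<close>

lemma den_functional: "den \<Phi> d k y \<Longrightarrow> den \<Phi>' d k' y' \<Longrightarrow> \<Phi>' = \<Phi> \<Longrightarrow> k' = k \<and> y' = y"
proof (induction arbitrary: \<Phi>' k' y' rule: den.induct)
  case (den_id R) from den_id.prems(1) show ?case by (rule den_DIdE) auto
next
  case (den_cut \<Phi> K d k y \<Psi> d' y1)
  from den_cut.prems(1) show ?case
  proof (rule den_DCutE)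
    fix z z' assume a: "y' = cmp (S2 k') (smap (tob k') \<Phi>) (map_prod (tob k') id K) (smap (tob k') \<Psi>) z' z"
      "den (\<Phi> @ [K]) d k' z" "den (dual K # \<Psi>) d' k' z'"
    show ?thesis using den_cut.IH(1)[OF a(2) refl] den_cut.IH(2)[OF a(3) refl] a(1) by simp
  qed
next
  case (den_raise \<Phi> d k y)
  from den_raise.prems(1) show ?case
  proof (rule den_DStrE)
    fix k1 y1 assume a: "k' = Suc k1" "\<Phi>' = \<Phi>" "y' = fmor (inc2 X k1) (smap (tob k1) \<Phi>) y1" "den \<Phi> d k1 y1"
    show ?thesis using den_raise.IH[OF a(4) refl] a by simp
  next
    fix c Rs \<Psi> ds \<Xi> j assume "DStr \<Phi> [0..<length \<Phi>] d = delay \<Xi> j (DInv c Rs \<Psi> ds)"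
    then have "delayed (DStr \<Phi> [0..<length \<Phi>] d)" by simp
    then show ?thesis using den_raise.hyps(2) by simp
  qed auto
next
  case (den_str \<Phi> \<sigma> d k y)
  note IH = den_str.IH and \<sigma> = den_str.hyps(2)
  from den_str.prems(1) show ?case
  proof (cases rule: den.cases)
    case den_inv
    from den_inv(2) have "delayed (DStr \<Phi> \<sigma> d)" by simp
    then show ?thesis using \<sigma> by simp
  qed (use IH \<sigma> in auto)
next
  case (den_gen f \<Phi>) from den_gen.prems(1) show ?case by (rule den_DGenE) auto
next
  case (den_noninv c Rs \<Phi> f L)
  have c: "c \<in> cones D" using den_noninv.hyps(1) by (simp add: isty_Vtx)
  from den_noninv.prems(1) show ?case
  proof (rule den_DNoninvE)
    fix L' assume a: "k' = 0" "y' = fmor L' (\<Phi> @ [vtx D c]) f" "L' \<in> pext (stg2 X 0) c"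
      "fob L' (fst (vtx D c)) = tob 0 (Vtx c Rs)"
    have "L' = L" by (rule pext_unique[OF c a(3) den_noninv.hyps(3)]) (use a(4) den_noninv.hyps(4) in simp)
    then show ?thesis using a by simp
  qed
next
  case (den_inv c Rs \<Psi> \<psi> E u k ds i)
  note H = den_inv.hyps and IH = den_inv.IH
  let ?d = "delay (vty c Rs \<Psi>) (prod_encode (k, i)) (DInv c Rs \<Psi> ds)"
  from den_inv.prems(1) show ?case
  proof (cases rule: den.cases)
    case (den_raise \<Phi>1 d1)
    then have "\<not> delayed ?d" by simp
    then show ?thesis by simp
  next
    case (den_str \<Phi>1 \<sigma>1 d1)
    then have "\<not> delayed ?d" by simp
    then show ?thesis by simp
  next
    case (den_inv c1 Rs1 \<Psi>1 \<psi>1 E1 u1 k1 ds1 i1)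
    \<comment> \<open>Injectivity of \<open>prod_encode\<close> recovers both the stage
      \<open>k\<close> of the cell and the number \<open>i\<close> of later steps from the length of
      the delay.\<close>
    have eq: "c1 = c" "Rs1 = Rs" "\<Psi>1 = \<Psi>" "ds1 = ds" "k1 = k" "i1 = i"
      using delay_eq[OF den_inv(2)] by simp_all
    note I = den_inv[unfolded eq]
    have \<psi>1: "\<psi>1 = \<psi>" using I(7) H(3) by simp
    note I = I[unfolded \<psi>1]
    have "E = E1 \<and> u = u1"
    proof (rule cell_unique2[OF H(4) I(8)])
      fix p assume "p \<in> set (prj c)"
      then obtain j where j: "j < length ds" "p = prj c ! j" using H(7) by (metis in_set_conv_nth)
      show "tilm c \<psi> u p = tilm c \<psi> u1 p"
        using IH[OF j(1) I(12)[OF j(1)] refl] j(2) by simp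
    qed (use H I in simp_all)
    then show ?thesis using I(3,4) by simp
  qed (use delay_neq in simp_all)
qed

lemma derives_delay:
  assumes "derives D ord prj S d \<Phi>" "sequent D ord S \<Phi>"
  shows "derives D ord prj S (delay \<Phi> j d) \<Phi>"
proof (induction j)
  case (Suc j)
  then show ?case using derives.structural[of D ord prj S _ \<Phi> "[0..<length \<Phi>]"] assms(2) structural_id[of "tcl" "\<Phi>"] by simp
qed (simp add: assms(1))

lemma rz_Hom:
  assumes "sty \<Phi>" "y \<in> Hom (S2 k) (smap (tob k) \<Phi>)"
  shows "rz \<Phi> k i y \<in> Hom (S2 (k + i)) (smap (tob (k + i)) \<Phi>)"
proof (induction i)
  case (Suc i)
  from functor_hom[OF inc2 this] show ?case using stob_Suc[OF assms(1)] by simp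
qed (simp add: assms(2))

lemma tilm_Hom:
  assumes cell: "(c, \<psi>, E, {}, u) \<in> cells2 D (stg2 X k)" and R: "isty (Vtx c Rs)"
    and u: "fob u (Inl (fst (vtx D c))) = tob k (Vtx c Rs)" "smap (fob u) (new \<psi>) = smap (tob k) \<Psi>"
    and p: "(\<Phi>, f) \<in> set (prj c)"
  shows "tilm c \<psi> u (\<Phi>, f) \<in> Hom (S2 k) (smap (tob k) (inst ord c Rs \<Phi> @ \<Psi>))"
proof -
  note c = cells2D[OF cell] and P = prj_Ob[OF cells2D(1)[OF cell] p]
  interpret expn "cone D c" "vtx D c" \<psi> by (rule c(2))
  let ?L = "fcomp (cone D c) u (exp_incl (cone D c) (vtx D c) \<psi> {})"
  have L: "fob ?L (fst (vtx D c)) = tob k (Vtx c Rs)"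
    using u(1) KC by (simp add: fcomp_simps exp_incl_simps)
  have "smap (tob k) (inst ord c Rs \<Phi>) = smap (fob ?L) \<Phi>"
    by (rule inst_eq(2)[OF R pext_ord[OF R c(5) L] P(1)])
  also have "\<dots> = smap (fob u) (old \<Phi>)"
    unfolding smap_smap by (rule smap_cong) (use P(1) in \<open>auto simp: fcomp_simps exp_incl_simps\<close>)
  finally have eq: "smap (tob k) (inst ord c Rs \<Phi> @ \<Psi>) = smap (fob u) (old \<Phi> @ new \<psi>)" using u(2) by simp
  have "ecls {} (old \<Phi> @ new \<psi>) (TGen (Til \<Phi> f)) \<in> Hom (EC {}) (old \<Phi> @ new \<psi>)"
    using wt_Til[OF P(3)] by (auto simp: exp_simps)
  from functor_hom[OF c(4) this] show ?thesis unfolding eq fst_conv snd_conv .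
qed

lemma den_derives: "den \<Phi> d k y \<Longrightarrow> derives D ord prj S d \<Phi> \<and> sty \<Phi> \<and> y \<in> Hom (S2 k) (smap (tob k) \<Phi>)"
proof (induction rule: den.induct)
  case (den_id R)
  then show ?case
    using derives.identity[of D ord S R "tcl R" prj] lnl_idn[OF sketch_lnl[OF sk2] tob_Ob[OF den_id]]
    by (simp add: isty_def)
next
  case (den_cut \<Phi> K d k y \<Psi> d' y')
  then have "y \<in> Hom (S2 k) (smap (tob k) \<Phi> @ [map_prod (tob k) id K])"
    "y' \<in> Hom (S2 k) (dual (map_prod (tob k) id K) # smap (tob k) \<Psi>)" by (simp_all add: dual_map_prod)
  from lnl_cmp[OF sketch_lnl[OF sk2] this] show ?case
    using den_cut.IH derives.cut[of D ord prj S d \<Phi> K d' \<Psi>] by simp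
next
  case (den_raise \<Phi> d k y)
  then have y: "y \<in> Hom (S2 k) (smap (tob k) \<Phi>)" and s: "sty \<Phi>" and d: "derives D ord prj S d \<Phi>" by simp_all
  have "sequent D ord S \<Phi>" using s lnl_valid[OF sketch_lnl[OF sk2] y] unfolding sequent_iff[of _ k] by simp
  from derives_delay[OF d this, of 1] rz_Hom[OF s y, of 1] s show ?case by simp
next
  case (den_str \<Phi> \<sigma> d k y)
  have s: "sty \<Phi>" "valid (S2 k) (smap (tob k) \<Phi>)" using den_str.hyps(3) unfolding sequent_iff[of _ k] by simp_all
  have "y \<in> Hom (S2 k) (pull (smap (tob k) \<Phi>) \<sigma>)"
    using den_str.IH pull_smap_structural[OF den_str.hyps(4), of "tob k"] by simp
  from lnl_act[OF sketch_lnl[OF sk2] this s(2)] show ?case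
    using s(1) stob_structural den_str derives.structural[of D ord prj S d \<Phi> \<sigma>] by simp
next
  case (den_gen f \<Phi>)
  have v: "valid S \<Phi>" by (rule lnl_valid[OF S den_gen])
  have "smap (tob 0) (smap Base \<Phi>) = smap (fob (leg1 X 0)) \<Phi>"
    unfolding smap_smap by (rule smap_fctr_cong[OF v]) (rule tob_Base)
  moreover have "fmor (leg1 X 0) \<Phi> f \<in> Hom (S2 0) (smap (fob (leg1 X 0)) \<Phi>)"
    using functor_hom[OF leg1, of f 0 \<Phi>] den_gen by (simp add: stg1_0 plain_sketch_def S2_0)
  moreover have "sty (smap Base \<Phi>)" using v by (auto simp: sty_iff fst_set_smap valid_def isty_Base)
  ultimately show ?case using derives.generator[OF den_gen] by simp
next
  case (den_noninv c Rs \<Phi> f L)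
  note R = den_noninv(1)
  have c: "c \<in> cones D" using R by (simp add: isty_Vtx)
  note p = prj_Ob[OF c den_noninv(2)]
  note i = inst_eq[OF R pext_ord[OF R den_noninv(3,4)] p(1)]
  have "fmor L (\<Phi> @ [vtx D c]) f \<in> Hom (S2 0) (smap (tob 0) (inst ord c Rs \<Phi> @ [(Vtx c Rs, snd (vtx D c))]))"
    using functor_hom[OF sketch_pext[OF sk2 c den_noninv(3)] p(2)] i(2) den_noninv(4) by (cases "vtx D c") simp
  moreover have "derives D ord prj S (DNoninv c Rs \<Phi> f) (inst ord c Rs \<Phi> @ [(Vtx c Rs, snd (vtx D c))])"
    using R den_noninv(2) unfolding isty_def by (rule derives.noninvertible)
  ultimately show ?case using i(1) R by simp
next
  case (den_inv c Rs \<Psi> \<psi> E u k ds i)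
  note H = den_inv.hyps and c = cells2D[OF den_inv.hyps(4)]
  have s: "sty (vty c Rs \<Psi>)" using H(2) by (simp add: sequent_def)
  interpret expn "cone D c" "vtx D c" \<psi> by (rule c(2))
  have "derives D ord prj S (DInv c Rs \<Psi> ds) (vty c Rs \<Psi>)"
  proof (rule derives.invertible[OF H(1)[unfolded isty_def] H(2)])
    \<comment> \<open>\<open>E\<close> sends chi to a morphism of the base, which witnesses the side
      condition of the invertible rule.\<close>
    have "ecls {0} (old [dual (vtx D c)] @ new \<psi>) (TGen (Chi 0)) \<in> Hom (EC {0}) (old [dual (vtx D c)] @ new \<psi>)"
      using wt_Chi[of 0 "{0}"] by (auto simp: exp_simps)
    from functor_hom[OF c(7) this]
    have "Hom (base D) (smap (fob E) (old [dual (vtx D c)] @ new \<psi>)) \<noteq> {}" by blast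
    moreover have "fob E R = base_obj D (exp_cl (cone D c) \<psi> R)" if "R \<in> exp_Ob (cone D c) \<psi>" for R
      using base_obj[OF functor_ob[OF c(7), of R]] functor_cl[OF c(7), of R] that by (simp add: exp_simps)
    then have "smap (fob E) (old [dual (vtx D c)] @ new \<psi>) = smap (\<lambda>R. base_obj D (exp_cl (cone D c) \<psi> R)) (old [dual (vtx D c)] @ new \<psi>)"
    proof (intro smap_cong)
      fix R assume "R \<in> fst ` set (old [dual (vtx D c)] @ new \<psi>)"
      then have "R \<in> exp_Ob (cone D c) \<psi>" using KC new_simps(2) unfolding exp_Ob_def set_append image_Un by auto
      then show "fob E R = base_obj D (exp_cl (cone D c) \<psi> R)" by fact
    qed
    moreover have "smap (\<lambda>R. base_obj D (exp_cl (cone D c) \<psi> R)) (new \<psi>) = smap (\<lambda>R. base_obj D (tcl R)) \<Psi>"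
      by (rule nth_equalityI) (auto simp: H(3) new_def smap_def exp_cl_def map_prod_def split: prod.splits)
    ultimately show "Hom (base D) (smap (\<lambda>R. base_obj D (tcl R)) (vty c Rs \<Psi>)) \<noteq> {}"
      by (simp add: dual_def exp_cl_def)
  qed (use H(7) den_inv.IH in blast)+
  from derives_delay[OF this H(2)] show ?case
    using rz_Hom[OF s cell_chi(1)[OF H(4) H(1) _ H(5,6)]] s by simp
qed

definition denotable :: "nat \<Rightarrow> 'o signed list \<Rightarrow> 'm \<Rightarrow> bool" where
  "denotable k \<Xi> y \<longleftrightarrow> (\<exists>\<Phi> d. smap (tob k) \<Phi> = \<Xi> \<and> den \<Phi> d k y)"

lemma denotableI: "den \<Phi> d k y \<Longrightarrow> smap (tob k) \<Phi> = \<Xi> \<Longrightarrow> denotable k \<Xi> y"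
  unfolding denotable_def by blast

lemma denotableE:
  assumes "denotable k (smap (tob k) \<Phi>) y" "sty \<Phi>"
  obtains d where "den \<Phi> d k y"
proof -
  obtain \<Phi>' d where d: "smap (tob k) \<Phi>' = smap (tob k) \<Phi>" "den \<Phi>' d k y" using assms(1) unfolding denotable_def by blast
  then have "\<Phi>' = \<Phi>" using stob_inj[OF _ assms(2)] den_derives by blast
  then show thesis using that d(2) by blast
qed

text \<open>A delayed derivation cannot be raised by one further step, since such steps are read as
  a code. Instead the code of \<open>(k0, i)\<close> is replaced by that of
  \<open>(k0, Suc i)\<close>.\<close>

lemma den_inc:
  assumes "den \<Phi> d k y"
  shows "\<exists>d'. den \<Phi> d' (Suc k) (fmor (inc2 X k) (smap (tob k) \<Phi>) y)"
proof (cases "delayed d")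
  case False
  then show ?thesis using den_raise[OF assms] by blast
next
  case True
  from assms show ?thesis
  proof (cases rule: den.cases)
    case (den_inv c Rs \<Psi> \<psi> E u k0 ds i)
    have "den (vty c Rs \<Psi>) (delay (vty c Rs \<Psi>) (prod_encode (k0, Suc i)) (DInv c Rs \<Psi> ds)) (Suc k0 + Suc i)
        (rz (vty c Rs \<Psi>) (Suc k0) (Suc i) (chi c \<psi> E u k0))"
      by (rule den.den_inv) (use den_inv in simp_all)
    then show ?thesis using den_inv(1,3,4) by auto
  qed (use True in auto)
qed

lemma denotable_inc:
  assumes "denotable k \<Xi> y"
  shows "denotable (Suc k) (smap (fob (inc2 X k)) \<Xi>) (fmor (inc2 X k) \<Xi> y)"
proof -
  obtain \<Phi> d where d: "smap (tob k) \<Phi> = \<Xi>" "den \<Phi> d k y" using assms unfolding denotable_def by blast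
  have "smap (fob (inc2 X k)) \<Xi> = smap (tob (Suc k)) \<Phi>" using stob_Suc den_derives[OF d(2)] d(1) by blast
  then show ?thesis using den_inc[OF d(2)] d(1) denotableI by metis
qed

text \<open>\<open>den_id\<close> speaks about stage 0 only; later identities are images of it,
  since the second phase adds no objects.\<close>

lemma denotable_idn: "A \<in> Ob (S2 k) \<Longrightarrow> denotable k [(A, Neg), (A, Pos)] (idn (S2 k) A)"
proof (induction k arbitrary: A)
  case 0
  then obtain R where R: "isty R" "A = tob 0 R" using tob_surj[of 0] by auto
  show ?case unfolding R(2) by (rule denotableI[OF den_id[OF R(1)]]) simp
next
  case (Suc k)
  then obtain B where B: "B \<in> Ob (S2 k)" "A = fob (inc2 X k) B" using inc2_bij[of k] by (auto simp: bij_betw_def)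
  from denotable_inc[OF Suc.IH[OF B(1)]] show ?case using functor_idn[OF inc2 B(1)] B(2) by simp
qed

lemma denotable_closed: "op_closed (S2 k) (denotable k)"
proof (rule op_closedI)
  show "denotable k [(R, Neg), (R, Pos)] (idn (S2 k) R)" if "R \<in> Ob (S2 k)" for R
    by (rule denotable_idn[OF that])
next
  fix \<Xi> \<sigma> x assume x: "x \<in> Hom (S2 k) (pull \<Xi> \<sigma>)" "denotable k (pull \<Xi> \<sigma>) x" and v: "valid (S2 k) \<Xi>" and \<sigma>: "structural (cl (S2 k)) \<Xi> \<sigma>"
  obtain \<Phi> where \<Phi>: "sty \<Phi>" "smap (tob k) \<Phi> = \<Xi>" using stob_surj[of \<Xi> k] v by (auto simp: valid_def)
  have st: "structural tcl \<Phi> \<sigma>" using \<sigma> stob_structural[OF \<Phi>(1), of k] \<Phi>(2) by simp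
  have pl: "pull \<Xi> \<sigma> = smap (tob k) (pull \<Phi> \<sigma>)" using pull_smap_structural[OF st, of "tob k"] \<Phi>(2) by simp
  have "sty (pull \<Phi> \<sigma>)" using \<Phi>(1) set_pull[OF st] by (auto simp: sty_iff)
  then obtain d where d: "den (pull \<Phi> \<sigma>) d k x" using denotableE x(2) pl by metis
  show "denotable k \<Xi> (act (S2 k) \<Xi> \<sigma> x)"
  \<comment> \<open>\<open>den_str\<close> excludes the identity map, because identity steps are
    reserved for changing stages; but this map acts trivially, so the given derivation still
    serves.\<close>
  proof (cases "\<sigma> = [0..<length \<Phi>]")
    case True
    have "length \<Phi> = length \<Xi>" using \<Phi>(2) by auto
    then have "act (S2 k) \<Xi> \<sigma> x = x" "pull \<Phi> \<sigma> = \<Phi>"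
      using lnl_act_id[OF sketch_lnl[OF sk2], of x k \<Xi>] x(1) pull_id[of \<Xi>] pull_id[of \<Phi>] unfolding True by simp_all
    then show ?thesis using d denotableI[OF _ \<Phi>(2)] by simp
  next
    case False
    have "sequent D ord S \<Phi>" using \<Phi> v unfolding sequent_iff[of _ k] by simp
    from den_str[OF d False this st] show ?thesis using denotableI[OF _ \<Phi>(2)] \<Phi>(2) by simp
  qed
next
  fix \<Xi> K \<Theta> f g assume f: "f \<in> Hom (S2 k) (\<Xi> @ [K])" "denotable k (\<Xi> @ [K]) f"
    and g: "g \<in> Hom (S2 k) (dual K # \<Theta>)" "denotable k (dual K # \<Theta>) g"
  note v = lnl_valid[OF sketch_lnl[OF sk2] f(1)] lnl_valid[OF sketch_lnl[OF sk2] g(1)]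
  obtain \<Phi> where \<Phi>: "sty \<Phi>" "smap (tob k) \<Phi> = \<Xi>" using stob_surj[of \<Xi> k] v by (auto simp: valid_def)
  obtain \<Psi> where \<Psi>: "sty \<Psi>" "smap (tob k) \<Psi> = \<Theta>" using stob_surj[of \<Theta> k] v by (auto simp: valid_def)
  have "fst K \<in> Ob (S2 k)" using v by (simp add: valid_def)
  then obtain R where R: "isty R" "tob k R = fst K" using tob_surj[of k] by auto
  define M where "M = (R, snd K)"
  have M: "isty (fst M)" "map_prod (tob k) id M = K" "map_prod (tob k) id (dual M) = dual K"
    using R by (simp_all add: M_def dual_def)
  have "denotable k (smap (tob k) (\<Phi> @ [M])) f" "sty (\<Phi> @ [M])"
    "denotable k (smap (tob k) (dual M # \<Psi>)) g" "sty (dual M # \<Psi>)"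
    using f(2) g(2) \<Phi> \<Psi> M by (simp_all add: sty_iff)
  then obtain d d' where d: "den (\<Phi> @ [M]) d k f" "den (dual M # \<Psi>) d' k g" by (meson denotableE)
  from den_cut[OF d] show "denotable k (\<Xi> @ \<Theta>) (cmp (S2 k) \<Xi> K \<Theta> g f)"
    using denotableI[of "\<Phi> @ \<Psi>"] \<Phi>(2) \<Psi>(2) M(2) by simp
qed

text \<open>By normal forms a cone is generated by its listed projections, whose images are denoted
  by the noninvertible rule.\<close>

lemma denotable_pext:
  assumes c: "c \<in> cones D" and L: "L \<in> pext (stg2 X 0) c" and x: "x \<in> Hom (cone D c) \<Xi>"
  shows "denotable 0 (smap (fob L) \<Xi>) (fmor L \<Xi> x)"
proof -
  interpret cone_basis "cone D c" "vtx D c" "prj c" by (rule cone_basis[OF c])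
  obtain Rs where R: "isty (Vtx c Rs)" "fob L (fst (vtx D c)) = tob 0 (Vtx c Rs)"
    using pext_type[OF c L] by blast
  show ?thesis
  proof (rule generated[OF op_closed_preimage[OF sketch_pext[OF sk2 c L] denotable_closed] _ x])
    fix \<Phi> f assume p: "(\<Phi>, f) \<in> set (prj c)"
    have "smap (tob 0) (inst ord c Rs \<Phi>) = smap (fob L) \<Phi>"
      by (rule inst_eq(2)[OF R(1) pext_ord[OF R(1) L R(2)] prj_Ob(1)[OF c p]])
    then show "denotable 0 (smap (fob L) (\<Phi> @ [vtx D c])) (fmor L (\<Phi> @ [vtx D c]) f)"
      using denotableI[OF den_noninv[OF R(1) p L R(2)]] R(2) by (cases "vtx D c") simp
  qed
qed

lemma denotable_stg1: "x \<in> Hom (S1 n) \<Xi> \<Longrightarrow> denotable 0 (smap (fob (leg1 X n)) \<Xi>) (fmor (leg1 X n) \<Xi> x)"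
proof (induction n arbitrary: \<Xi> x)
  case 0
  then have x: "x \<in> Hom S \<Xi>" by (simp add: stg1_0 plain_sketch_def)
  have "smap (tob 0) (smap Base \<Xi>) = smap (fob (leg1 X 0)) \<Xi>"
    unfolding smap_smap by (rule smap_fctr_cong[OF lnl_valid[OF S x]]) (rule tob_Base)
  then show ?case by (rule denotableI[OF den_gen[OF x]])
next
  case (Suc n)
  have cl: "op_closed T1 (denotable 0)" using denotable_closed[of 0] by (simp add: S2_0)
  show ?case
  proof (rule S1_generated[OF op_closed_preimage[OF leg1 cl] _ _ Suc.prems])
    fix \<Phi> x assume x: "x \<in> Hom (S1 n) \<Phi>"
    have "smap (fob (leg1 X (Suc n))) (smap (fob (inc1 X n)) \<Phi>) = smap (fob (leg1 X n)) \<Phi>"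
      unfolding smap_smap by (rule smap_fctr_cong[OF lnl_valid[OF sketch_lnl[OF sk1] x]]) (rule seq_colimit_shift[OF co1])
    then show "denotable 0 (smap (fob (leg1 X (Suc n))) (smap (fob (inc1 X n)) \<Phi>))
        (fmor (leg1 X (Suc n)) (smap (fob (inc1 X n)) \<Phi>) (fmor (inc1 X n) \<Phi> x))"
      using Suc.IH[OF x] seq_colimit_shift_mor[OF co1 x] by simp
  next
    fix c u \<Phi> x assume u: "(c, u) \<in> cells1 D X n" and x: "x \<in> Hom (cone D c) \<Phi>"
    note c = cells1D(1)[OF u]
    let ?L = "fcomp (cone D c) (leg1 X (Suc n)) (att1 X n (c, u))"
    have "smap (fob ?L) \<Phi> = smap (fob (leg1 X (Suc n))) (smap (fob (att1 X n (c, u))) \<Phi>)"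
      unfolding smap_smap by (rule smap_fctr_cong[OF lnl_valid[OF cone_lnl[OF c] x]]) (simp add: fcomp_simps)
    then show "denotable 0 (smap (fob (leg1 X (Suc n))) (smap (fob (att1 X n (c, u))) \<Phi>))
        (fmor (leg1 X (Suc n)) (smap (fob (att1 X n (c, u))) \<Phi>) (fmor (att1 X n (c, u)) \<Phi> x))"
      using denotable_pext[OF c _ x, of ?L] leg1_att(3)[OF u] x by (simp add: stg2_0 fcomp_simps)
  qed
qed

text \<open>At stage 0 the generators come from the stages of the first phase. At a successor stage
  they are images of earlier morphisms and the chi of cells; for a chi, the induction hypothesis
  applied to the images of the tilde morphisms supplies the premises.\<close>

lemma denotable_all: "x \<in> Hom (S2 k) \<Xi> \<Longrightarrow> denotable k \<Xi> x"
proof (induction k arbitrary: \<Xi> x)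
  case 0
  have cl: "op_closed T1 (denotable 0)" using denotable_closed[of 0] by (simp add: S2_0)
  show ?case by (rule seq_colimit_generated[OF co1 sk1 cl denotable_stg1]) (use 0 in \<open>simp_all add: S2_0\<close>)
next
  case (Suc k)
  show ?case
  proof (rule S2_generated[OF denotable_closed _ _ Suc.prems])
    show "denotable (Suc k) (smap (fob (inc2 X k)) \<Phi>) (fmor (inc2 X k) \<Phi> x)" if "x \<in> Hom (S2 k) \<Phi>" for \<Phi> x
      by (rule denotable_inc[OF Suc.IH[OF that]])
  next
    fix c \<psi> E u assume cell: "(c, \<psi>, E, {}, u) \<in> cells2 D (stg2 X k)"
    note c = cells2D[OF cell]
    interpret expn "cone D c" "vtx D c" \<psi> by (rule c(2))
    let ?L = "fcomp (cone D c) u (exp_incl (cone D c) (vtx D c) \<psi> {})"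
    obtain Rs where R: "isty (Vtx c Rs)" "fob ?L (fst (vtx D c)) = tob k (Vtx c Rs)"
      using pext_type[OF c(1,5)] by blast
    have uv: "fob u (Inl (fst (vtx D c))) = tob k (Vtx c Rs)"
      using R(2) KC by (simp add: fcomp_simps exp_incl_simps)
    have "fob u ` fst ` set (new \<psi>) \<subseteq> Ob (S2 k)"
      using functor_ob[OF c(4)] by (auto simp: new_simps exp_simps exp_Ob_def)
    then obtain \<Psi> where \<Psi>: "sty \<Psi>" "smap (tob k) \<Psi> = smap (fob u) (new \<psi>)"
      using stob_surj[of "smap (fob u) (new \<psi>)" k] by (auto simp: fst_set_smap)
    have len: "length \<Psi> = length \<psi>" using arg_cong[OF \<Psi>(2), of length] by (simp add: new_simps)
    \<comment> \<open>The shape of the cell is recovered from the objects to which \<open>u\<close>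
      sends its new objects, as \<open>den_inv\<close> expects it to be read off
      \<open>\<Psi>\<close>.\<close>
    have \<psi>: "\<psi> = map (map_prod tcl id) \<Psi>"
    proof (rule nth_equalityI)
      fix j assume "j < length \<psi>"
      then have j: "j < length \<psi>" "j < length \<Psi>" using len by simp_all
      have "map_prod (tob k) id (\<Psi> ! j) = (fob u (Inr j), snd (\<psi> ! j))"
        using arg_cong[OF \<Psi>(2), of "\<lambda>l. l ! j"] j by (simp add: smap_nth new_simps) (simp add: new_def)
      then have a: "tob k (fst (\<Psi> ! j)) = fob u (Inr j)" "snd (\<Psi> ! j) = snd (\<psi> ! j)" by (cases "\<Psi> ! j", simp)+
      have "isty (fst (\<Psi> ! j))" using \<Psi>(1) nth_mem[OF j(2)] unfolding sty_iff by blast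
      from tob_cl[OF this, of k] have "tcl (fst (\<Psi> ! j)) = fst (\<psi> ! j)"
        using functor_cl[OF c(4), of "Inr j"] j a by (simp add: exp_simps exp_Ob_def exp_cl_def)
      then show "\<psi> ! j = map (map_prod tcl id) \<Psi> ! j" using a(2) j by (cases "\<psi> ! j", cases "\<Psi> ! j") simp
    qed (simp add: len)
    have "admissible (cl (S2 k)) (smap (fob u) (old [dual (vtx D c)] @ new \<psi>))"
    proof (subst admissible_smap)
      fix r assume "r \<in> fst ` set (old [dual (vtx D c)] @ new \<psi>)"
      then have "r \<in> exp_Ob (cone D c) \<psi>" using KC new_simps by (auto simp: exp_Ob_def)
      then show "cl (S2 k) (fob u r) = exp_cl (cone D c) \<psi> r" using functor_cl[OF c(4)] by (simp add: exp_simps)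
    qed (rule adm)
    moreover have "smap (fob u) (old [dual (vtx D c)] @ new \<psi>) = smap (tob k) (vty c Rs \<Psi>)"
      using uv \<Psi>(2) by (simp add: dual_def)
    ultimately have seq: "sequent D ord S (vty c Rs \<Psi>)"
      using stob_admissible[of "vty c Rs \<Psi>" k] R(1) \<Psi>(1) by (simp add: sequent_def)
    have "\<exists>d. den (inst ord c Rs (fst p) @ \<Psi>) d k (tilm c \<psi> u p)" if p: "p \<in> set (prj c)" for p
    proof -
      obtain \<Phi> f where [simp]: "p = (\<Phi>, f)" by (cases p)
      have "denotable k (smap (tob k) (inst ord c Rs \<Phi> @ \<Psi>)) (tilm c \<psi> u (\<Phi>, f))"
        by (rule Suc.IH[OF tilm_Hom[OF cell R(1) uv \<Psi>(2)[symmetric]]]) (use p in simp)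
      moreover have "sty (inst ord c Rs \<Phi> @ \<Psi>)"
        using inst_eq(1)[OF R(1) pext_ord[OF R(1) c(5) R(2)] prj_Ob(1)[OF c(1), of \<Phi> f]] p \<Psi>(1) by simp
      ultimately show ?thesis using denotableE by (metis \<open>p = (\<Phi>, f)\<close> fst_conv)
    qed
    then obtain dd where dd: "\<And>p. p \<in> set (prj c) \<Longrightarrow> den (inst ord c Rs (fst p) @ \<Psi>) (dd p) k (tilm c \<psi> u p)" by metis
    \<comment> \<open>The universal morphism is wanted at the very stage at which it is adjoined,
      hence no later steps: the second component of the code is 0.\<close>
    have "den (vty c Rs \<Psi>) (delay (vty c Rs \<Psi>) (prod_encode (k, 0)) (DInv c Rs \<Psi> (map dd (prj c)))) (Suc k + 0)
      (rz (vty c Rs \<Psi>) (Suc k) 0 (chi c \<psi> E u k))"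
      by (rule den_inv[OF R(1) seq \<psi> cell uv \<Psi>(2)[symmetric]]) (use dd in simp_all)
    then show "denotable (Suc k) (smap (fob (att2 X k (c, \<psi>, E, {}, u))) (old [dual (vtx D c)] @ new \<psi>)) (chi c \<psi> E u k)"
      unfolding cell_chi(2)[OF cell R(1) \<Psi>(1) uv \<Psi>(2)[symmetric]] by (intro denotableI) auto
  qed
qed

lemma smap_e_tob: "sty \<Phi> \<Longrightarrow> smap (fob (inc3 X)) (smap (fob (leg2 X k)) (smap (tob k) \<Phi>)) = smap tob0 \<Phi>"
  unfolding smap_smap by (rule smap_cong) (auto simp: sty_iff e_tob e_def[symmetric])

theorem surjection:
  assumes seq: "sequent D ord S \<Phi>"
  shows "\<exists>h. h ` {d. derives D ord prj S d \<Phi>} = Hom Z (smap tob0 \<Phi>)"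
proof -
  let ?A = "{d. derives D ord prj S d \<Phi>}" and ?B = "Hom Z (smap tob0 \<Phi>)"
  have st: "sty \<Phi>" using seq by (simp add: sequent_def)
  define v where "v k y = fmor (inc3 X) (smap (fob (leg2 X k)) (smap (tob k) \<Phi>)) (fmor (leg2 X k) (smap (tob k) \<Phi>) y)" for k y
  have vB: "v k y \<in> ?B" if "y \<in> Hom (S2 k) (smap (tob k) \<Phi>)" for k y
    using functor_hom[OF inc3 functor_hom[OF leg2 that]] unfolding v_def smap_e_tob[OF st] .
  define h where "h d = (if \<exists>k y. den \<Phi> d k y then SOME x. \<exists>k y. den \<Phi> d k y \<and> x = v k y else SOME x. x \<in> ?B)" for d
  \<comment> \<open>The derivation determines both the stage and the morphism, so the choice in
    \<open>h\<close> has a single candidate.\<close>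
  have h: "h d = v k y" if "den \<Phi> d k y" for d k y
  proof -
    have "(SOME x. \<exists>k y. den \<Phi> d k y \<and> x = v k y) = v k y"
      by (rule some_equality) (use that den_functional[OF that _ refl] in blast)+
    then show ?thesis using that unfolding h_def by auto
  qed
  have "h d \<in> ?B" if d: "d \<in> ?A" for d
  proof (cases "\<exists>k y. den \<Phi> d k y")
    case True
    then show ?thesis using h vB den_derives by metis
  next
    case False
    have "?B \<noteq> {}" using derives_inhabited d vB by blast
    then show ?thesis using False by (simp add: h_def some_in_eq)
  qed
  moreover have "x \<in> h ` ?A" if x: "x \<in> ?B" for x
  proof -
    obtain \<Theta> x0 where x0: "x0 \<in> Hom T2 \<Theta>" "smap tob0 \<Phi> = smap (fob (inc3 X)) \<Theta>" "x = fmor (inc3 X) \<Theta> x0"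
      using fin_hom[OF x] by blast
    obtain k \<Xi> y where y: "y \<in> Hom (S2 k) \<Xi>" "\<Theta> = smap (fob (leg2 X k)) \<Xi>" "x0 = fmor (leg2 X k) \<Xi> y"
      using lim2_hom[OF x0(1)] by blast
    obtain \<Phi>' d where d: "smap (tob k) \<Phi>' = \<Xi>" "den \<Phi>' d k y" using denotable_all[OF y(1)] unfolding denotable_def by blast
    have d': "sty \<Phi>'" "derives D ord prj S d \<Phi>'" using den_derives[OF d(2)] by simp_all
    \<comment> \<open>Denotability yields some list of types naming the given objects; since types
      are determined by the objects they name, it is the given list.\<close>
    have "inj_on tob0 {R. isty R}" using ty_obj_inj by (auto intro: inj_onI)
    moreover have "smap tob0 \<Phi>' = smap tob0 \<Phi>" using smap_e_tob[OF d'(1), of k] d(1) y(2) x0(2) by simp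
    ultimately have "\<Phi>' = \<Phi>" using smap_inj_on d'(1) st unfolding sty_iff by blast
    then have "h d = x" using h d x0 y by (simp add: v_def)
    then show ?thesis using d'(2) \<open>\<Phi>' = \<Phi>\<close> by blast
  qed
  ultimately show ?thesis by blast
qed

end

theorem proposition8p3:
  fixes D :: "('d, 'e, 'c, 'r, 'p) doctrine"
    and S :: "('o::infinite, 'm::infinite) lnl"
    and \<pi> :: "('o, 'm, 'd, 'e) fctr"
    and X :: "('o, 'm, 'd, 'e, 'c, 'r, 'p) tower"
    and ord :: "'c \<Rightarrow> 'r list"
    and prj :: "'c \<Rightarrow> ('r signed list \<times> 'p) list"
  assumes "lnl_doctrine D"
    and "subterminal (base D)"
    and "\<forall>c\<in>cones D. discrete_cone (cone D c) (vtx D c) \<and> finite_cone (cone D c) (vtx D c)"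
    and "lnl S"
    and "is_functor S (base D) \<pi>"
    and "free_construction D (plain_sketch S \<pi>) X"
    and "\<forall>c\<in>cones D. distinct (ord c) \<and> set (ord c) = Ob (cone_reduct D c)"
    and "\<forall>c\<in>cones D. projection_basis (cone D c) (vtx D c) (prj c)"
  shows "\<forall>\<Phi>. sequent D ord S \<Phi> \<longrightarrow>
           (\<exists>h. h ` {d. derives D ord prj S d \<Phi>} = Hom (poly (fin X)) (smap (ty_obj D ord X) \<Phi>))"
proof -
  interpret free_tower D S \<pi> X ord prj
    using assms by unfold_locales auto
  show ?thesis using surjection by blast
qed

end
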